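(* Let $p\equiv 1\pmod 4$ be a prime. Let $1=a_1<a_2<\cdots<a_{(p-1)/2}\le p-1$ be all the quadratic residues modulo $p$ in $\{1,\dots,p-1\}$, and let $\sigma_{0,1}$ be the permutation relating the sequence $A_0:\ \overline{1^2},\overline{2^2},\ldots,\overline{((p-1)/2)^2}$ to the sequence $A_1:\ \overline{a_1},\overline{a_2},\ldots,\overline{a_{(p-1)/2}}$. Then $$\operatorname{sgn}(\sigma_{0,1})=\begin{cases}\overline{s_p\,u_p^{(p-1)/4}}\cdot(-1)^{((h(p)+2)(p-1)+2h(-4p))/8+r_p^*}&\text{if } p\equiv 1\pmod 8,\\[2mm] \overline{\tfrac12 s_p\,u_p^{(p+3)/4}}\cdot(-1)^{((h(p)+2)(p+3)+2h(-4p)-4)/8+r_p^*}&\text{if } p\equiv 5\pmod 8.\end{cases}$$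
   Context: For an odd prime $p$ and a $p$-adic integer $a$ (for instance a rational number with denominator prime to $p$), $\overline{a}$ denotes the unique integer $x$ with $-p/2<x<p/2$ and $x-a$ divisible by $p$. The sequences $A_0$ and $A_1$ list the same $(p-1)/2$ distinct integers in two orders. $\sigma_{0,1}$ is the permutation $\pi$ of $\{1,\dots,(p-1)/2\}$ such that the $i$-th term of $A_0$ is the $\pi(i)$-th term of $A_1$; $\operatorname{sgn}$ denotes the sign of a permutation (so replacing $\pi$ by its inverse makes no difference). For a prime $p\equiv1\pmod4$: $\varepsilon_p=(u_p+v_p\sqrt p)/2>1$ (with $u_p,v_p$ integers) is the fundamental unit of $\mathbb{Q}(\sqrt p)$; $h(p)$ is the class number of $\mathbb{Q}(\sqrt p)$; $h(-4p)$ is the class number of $\mathbb{Q}(\sqrt{-p})$. With $\left(\frac{\cdot}{p}\right)$ the Legendre symbol, $$s_p:=\prod_{\substack{1\le k\le (p-1)/2\\ \left(\frac{k}{p}\right)=-1}}k,$$ $$r_p^*:=\#\left\{(x,y)\in\mathbb{Z}^2:\ 1\le x,y\le \tfrac{p-1}{2},\ x+y\le \tfrac{p-1}{2},\ \left(\tfrac{x}{p}\right)=\left(\tfrac{y}{p}\right)=1\right\}.$$ *)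

theory Defs
  imports
    "HOL-Computational_Algebra.Polynomial"
    "HOL-Algebra.Ideal"
    "HOL-Number_Theory.Number_Theory"
    "HOL-Combinatorics.Permutations"
begin

text \<open>
  The residue of \<open>a\<close> modulo \<open>p\<close> of least absolute value. For rational \<open>a\<close>, ``\<open>x - a\<close> is divisible
  by \<open>p\<close>'' means that \<open>x - a\<close> lies in \<open>p\<close> times the ring of \<open>p\<close>-integral rationals. The value is
  unspecified if \<open>p\<close> divides the reduced denominator of \<open>a\<close>.
\<close>

definition bal_res :: "nat \<Rightarrow> rat \<Rightarrow> int" where
  "bal_res p a = (THE x::int. - (of_nat p / 2) < (of_int x :: rat) \<and> (of_int x :: rat) < of_nat p / 2 \<and>
     (\<exists>c d::int. \<not> int p dvd d \<and> of_int x - a = of_nat p * (of_int c / of_int d)))"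

text \<open>The sequences below are indexed from 1 to \<open>(p - 1) div 2\<close>.\<close>

definition quad_residues :: "nat \<Rightarrow> int set" where
  "quad_residues p = {a \<in> {1..int p - 1}. QuadRes (int p) a}"

definition seq_A0 :: "nat \<Rightarrow> nat \<Rightarrow> int" where
  "seq_A0 p i = bal_res p (of_nat (i\<^sup>2))"

definition seq_A1 :: "nat \<Rightarrow> nat \<Rightarrow> int" where
  "seq_A1 p i = bal_res p (of_int (sorted_list_of_set (quad_residues p) ! (i - 1)))"

definition sigma01 :: "nat \<Rightarrow> nat \<Rightarrow> nat" where
  "sigma01 p = (THE \<pi>. \<pi> permutes {1..(p - 1) div 2} \<and>
     (\<forall>i\<in>{1..(p - 1) div 2}. seq_A0 p i = seq_A1 p (\<pi> i)))"

definition s_prod :: "nat \<Rightarrow> int" where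
  "s_prod p = \<Prod>{k \<in> {1..(int p - 1) div 2}. Legendre k (int p) = -1}"

definition r_star :: "nat \<Rightarrow> nat" where
  "r_star p = card {(x, y).
     x \<in> {1..(int p - 1) div 2} \<and> y \<in> {1..(int p - 1) div 2} \<and> x + y \<le> (int p - 1) div 2 \<and>
     Legendre x (int p) = 1 \<and> Legendre y (int p) = 1}"

definition quad_field :: "int \<Rightarrow> complex set" where
  "quad_field d = {of_rat a + of_rat b * csqrt (of_int d) | a b. True}"

definition quad_integers :: "int \<Rightarrow> complex ring" where
  "quad_integers d = \<lparr>carrier = {x \<in> quad_field d. algebraic_int x},
     mult = (*), one = 1, zero = 0, add = (+)\<rparr>"

definition nonzero_ideals :: "int \<Rightarrow> complex set set" where
  "nonzero_ideals d = {I. ideal I (quad_integers d) \<and> I \<noteq> {0}}"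

definition ideal_equiv :: "int \<Rightarrow> (complex set \<times> complex set) set" where
  "ideal_equiv d = {(I, J). I \<in> nonzero_ideals d \<and> J \<in> nonzero_ideals d \<and>
     (\<exists>a \<in> carrier (quad_integers d) - {0}. \<exists>b \<in> carrier (quad_integers d) - {0}.
        (*) a ` I = (*) b ` J)}"

text \<open>
  The class number in the wide sense (no positivity condition on the generators). The argument is
  the squarefree radicand, not the discriminant: the class number \<open>h(-4p)\<close> of the field generated by
  the square root of \<open>-p\<close> is \<open>class_number (-p)\<close>.
\<close>

definition class_number :: "int \<Rightarrow> nat" where
  "class_number d = card (nonzero_ideals d // ideal_equiv d)"

definition fundamental_unit :: "int \<Rightarrow> real \<Rightarrow> bool" where
  "fundamental_unit d \<epsilon> \<longleftrightarrow>
     1 < \<epsilon> \<and> complex_of_real \<epsilon> \<in> Units (quad_integers d) \<and>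
     (\<forall>\<eta> \<in> Units (quad_integers d). \<exists>n::int.
        \<eta> = complex_of_real \<epsilon> powi n \<or> \<eta> = - (complex_of_real \<epsilon> powi n))"

end

theory Submission
  imports
    Defs
    "HOL-Analysis.Analysis"
    "HOL-Real_Asymp.Real_Asymp"
    "HOL-Computational_Algebra.Nth_Powers"
begin

text \<open>
  Write \<open>p = 4 q + 1\<close> and compare the Vandermonde products of the two sequences modulo \<open>p\<close>: the
  product over \<open>1\<^sup>2, \<dots>, (2 q)\<^sup>2\<close> is minus a factorial, and the product of the differences of quadratic
  residues is \<open>(-1) ^ r_star p * R ^ (q - 1) * S ^ q\<close>, where \<open>R\<close> and \<open>S\<close> are the products of the
  residues and of the nonresidues below \<open>p / 2\<close>. The second one needs only the
  number of pairs of residues with a given difference. Doubling a half system relates \<open>2 ^ q\<close>, \<open>R\<close>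
  and \<open>S\<close>, with a sign given by the number \<open>N4\<close> of nonresidues below \<open>p / 4\<close>. The class
  numbers and the unit enter through three facts.

  The fundamental unit has norm \<open>-1\<close>, since a unit of norm 1 would be a square up to sign; hence
  \<open>u\<^sup>2 = -4\<close> modulo \<open>p\<close>.

  The class number of the real field is odd: conjugation acts on the classes as an involution, and a
  class that is fixed contains an ideal equal to its conjugate, by Hilbert 90 and the existence of a
  unit of norm \<open>-1\<close>; such an ideal is principal.

  The class number of the imaginary field is \<open>2 q - 4 N4\<close>. To see this, count ideals of norm at most
  \<open>X\<close>. Each class contributes \<open>\<pi> X / (2 \<surd>p)\<close> asymptotically, by counting lattice points
  in an ellipse. In total there are \<open>X L(1, \<chi>)\<close>, because the number of ideals of norm \<open>n\<close> is
  the sum of \<open>\<chi>\<close> over the divisors of \<open>n\<close>. Finally \<open>L(1, \<chi>) = \<pi> (q - 2 N4) / \<surd>p\<close>, by expanding the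
  Legendre symbol as a sum of cosines with the quadratic Gauss sum and evaluating the Fourier
  series of a square wave.
\<close>

text \<open>A sign is determined by its class modulo \<open>p\<close>, so congruences suffice
  throughout. The obstacle is that the differences of the ordered residues are integers, not
  classes: the character sum evaluates only the total number of occurrences of \<open>d\<close> and
  \<open>p - d\<close>. Replacing a factor \<open>p - d\<close> by \<open>- d\<close> costs a sign,
  and \<open>r_star\<close> counts exactly these signs. The unit enters only through
  \<open>u\<^sup>2 = -4\<close>, so its exponent has to be even. This explains
  \<open>(p - 1) / 4\<close> for \<open>p = 1\<close> and \<open>(p + 3) / 4\<close> for
  \<open>p = 5\<close> modulo 8; in the second case a surplus factor 2 remains, which the
  \<open>1 / 2\<close> removes. The class number of the real field affects the sign only through its
  parity, while that of the imaginary field supplies the sign \<open>(-1) ^ N4\<close>. Ideals are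
  never multiplied with each other. Each is a lattice with basis \<open>k a\<close>,
  \<open>k (b + \<omega>)\<close>, its norm is a determinant, and classes are compared by scaling
  with elements.\<close>

lemmas cong_mod = unique_euclidean_semiring_class.cong_def

subsection \<open>Vandermonde products and permutations\<close>

definition vdm :: "nat \<Rightarrow> (nat \<Rightarrow> int) \<Rightarrow> int" where
  "vdm n y = (\<Prod>(i, j) \<in> {(i, j). 1 \<le> i \<and> i < j \<and> j \<le> n}. y j - y i)"

lemma finite_pairs: "finite {(i, j). 1 \<le> i \<and> i < j \<and> j \<le> (n::nat)}"
  by (rule finite_subset[of _ "{..n} \<times> {..n}"]) auto

text \<open>The transposition permutes the index pairs up to their order; \<open>s\<close> is the
  induced permutation of the ordered pairs. A factor changes sign exactly when its pair lies in the
  set \<open>I\<close> of inverted pairs, which has odd size.\<close>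

lemma vdm_transpose:
  assumes "a \<in> {1..n}" "b \<in> {1..n}" "a < b"
  shows "vdm n (y \<circ> Transposition.transpose a b) = - vdm n y"
proof -
  define P where "P = {(i, j). 1 \<le> i \<and> i < j \<and> j \<le> (n::nat)}"
  define t where "t = Transposition.transpose a b"
  define s where "s = (\<lambda>(i, j). (min (t i) (t j), max (t i) (t j)))"
  have tt: "t (t i) = i" for i by (simp add: t_def)
  have tinj: "t i = t j \<longleftrightarrow> i = j" for i j by (metis tt)
  have tr: "1 \<le> t i \<and> t i \<le> n \<longleftrightarrow> 1 \<le> i \<and> i \<le> n" for i
    using assms by (auto simp: t_def Transposition.transpose_def)
  have finP: "finite P" unfolding P_def by (rule finite_pairs)
  have sP: "s x \<in> P" if "x \<in> P" for x
  proof -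
    obtain i j where x: "x = (i, j)" "1 \<le> i" "i < j" "j \<le> n" using \<open>x \<in> P\<close> by (auto simp: P_def)
    show ?thesis using x tr[of i] tr[of j] tinj[of i j] by (auto simp: s_def P_def min_def max_def)
  qed
  have ss: "s (s x) = x" if "x \<in> P" for x
    using that tinj by (auto simp: s_def P_def min_def max_def tt)
  have bij: "bij_betw s P P"
    by (rule bij_betw_byWitness[where f' = s]) (use sP ss in auto)
  define D where "D = (\<lambda>(i, j). y j - y (i::nat))"
  define I where "I = {(i, j) \<in> P. t j < t i}"
  have "vdm n (y \<circ> t) = (\<Prod>x\<in>P. D (map_prod t t x))"
    by (simp add: vdm_def P_def D_def case_prod_beta)
  also have "\<dots> = (\<Prod>x\<in>P. (if x \<in> I then -1 else 1) * D (s x))"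
    by (rule prod.cong) (auto simp: I_def D_def s_def)
  also have "\<dots> = (\<Prod>x\<in>P. if x \<in> I then -1 else 1) * (\<Prod>x\<in>P. D (s x))"
    by (rule prod.distrib)
  also have "(\<Prod>x\<in>P. D (s x)) = (\<Prod>x\<in>P. D x)"
    by (rule prod.reindex_bij_betw[OF bij])
  also have "(\<Prod>x\<in>P. if x \<in> I then -1 else (1::int)) = (-1) ^ card I"
  proof -
    have "(\<Prod>x\<in>P. if x \<in> I then -1 else (1::int)) = (\<Prod>x\<in>P \<inter> I. -1)"
      using finP by (simp add: prod.If_cases)
    also have "P \<inter> I = I" by (auto simp: I_def)
    finally show ?thesis by simp
  qed
  \<comment> \<open>Inverted are \<open>(a, b)\<close> itself and, for each \<open>k\<close>
    strictly between, both \<open>(a, k)\<close> and \<open>(k, b)\<close>.\<close>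
  also have "I = insert (a, b) ((\<lambda>k. (a, k)) ` {a<..<b} \<union> (\<lambda>k. (k, b)) ` {a<..<b})"
    using assms by (auto simp: I_def P_def t_def Transposition.transpose_def image_iff split: if_splits)
  also have "card \<dots> = Suc (2 * card {a<..<b})"
  proof -
    have "card ((\<lambda>k. (a, k)) ` {a<..<b} \<union> (\<lambda>k. (k, b)) ` {a<..<b}) =
      card ((\<lambda>k. (a, k)) ` {a<..<b}) + card ((\<lambda>k. (k, b)) ` {a<..<b})"
      by (rule card_Un_disjoint) auto
    also have "\<dots> = 2 * card {a<..<b}"
      by (subst card_image, force simp: inj_on_def)+ simp
    finally show ?thesis by (subst card_insert_disjoint) auto
  qed
  also have "(\<Prod>x\<in>P. D x) = vdm n y"
    by (simp add: vdm_def P_def D_def case_prod_beta)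
  finally show ?thesis by (simp only: t_def power_mult power_Suc) simp
qed

lemma vdm_permutes:
  assumes "\<pi> permutes {1..n}"
  shows "vdm n (y \<circ> \<pi>) = sign \<pi> * vdm n y"
proof -
  have "\<forall>y. vdm n (y \<circ> \<pi>) = sign \<pi> * vdm n y"
    using assms finite_atLeastAtMost
  proof (induction \<pi> rule: permutes_induct)
    case id
    show ?case by simp
  next
    case (swap a b p)
    have tr: "vdm n (y \<circ> Transposition.transpose a b) = - vdm n y" for y
      using vdm_transpose[of a n b y] vdm_transpose[of b n a y] swap
      by (metis nat_neq_iff Transposition.transpose_commute)
    have perm: "permutation p" "permutation (Transposition.transpose a b)"
      by (use swap permutation_permutes in blast, rule permutation_swap_id)
    show ?case
    proof
      fix y
      have "vdm n (y \<circ> (Transposition.transpose a b \<circ> p)) = vdm n ((y \<circ> Transposition.transpose a b) \<circ> p)"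
        by (simp add: o_assoc)
      also have "\<dots> = sign p * - vdm n y" using swap.IH[rule_format, of "y \<circ> Transposition.transpose a b"] unfolding tr .
      finally show "vdm n (y \<circ> (Transposition.transpose a b \<circ> p)) = sign (Transposition.transpose a b \<circ> p) * vdm n y"
        using perm swap by (simp add: sign_compose sign_swap_id)
    qed
  qed
  thus ?thesis by blast
qed

subsection \<open>Quadratic residues\<close>

lemma Legendre_cong:
  assumes "[a = b] (mod p)"
  shows "Legendre a p = Legendre b p"
proof -
  have "[a = 0] (mod p) \<longleftrightarrow> [b = 0] (mod p)" using assms cong_sym cong_trans by blast
  moreover have "QuadRes p a \<longleftrightarrow> QuadRes p b"
    unfolding QuadRes_def using assms cong_sym cong_trans by blast
  ultimately show ?thesis by (simp add: Legendre_def)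
qed

lemma cong_small_imp_eq:
  fixes x y :: int
  assumes "[x = y] (mod m)" "\<bar>x - y\<bar> < m"
  shows "x = y"
  using assms dvd_imp_le_int[of "x - y" m] by (auto simp: cong_iff_dvd_diff)

lemma Legendre_values: "Legendre a p \<in> {-1, 0, 1}"
  by (simp add: Legendre_def)

text \<open>Euler's criterion makes both sides congruent modulo \<open>p\<close>, and integers
  between -1 and 1 that agree modulo \<open>p > 2\<close> are equal.\<close>

lemma Legendre_mult:
  assumes "prime p" "2 < (p::nat)"
  shows "Legendre (a * b) (int p) = Legendre a (int p) * Legendre b (int p)"
proof -
  have "[Legendre (a * b) p = (a * b) ^ ((p - 1) div 2)] (mod p)"
    by (rule euler_criterion[OF assms])
  moreover have "[Legendre a p * Legendre b p = a ^ ((p - 1) div 2) * b ^ ((p - 1) div 2)] (mod p)"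
    by (intro cong_mult euler_criterion assms)
  ultimately have "[Legendre (a * b) p = Legendre a p * Legendre b p] (mod int p)"
    by (metis cong_sym cong_trans power_mult_distrib)
  thus ?thesis
    by (rule cong_small_imp_eq)
      (use assms Legendre_values[of "a * b" p] Legendre_values[of a p] Legendre_values[of b p] in auto)
qed

text \<open>With \<open>p = 4 q + 1\<close> the sequences have length \<open>2 q\<close>, the
  positive integers up to \<open>q\<close> are those below \<open>p / 4\<close>, and the two cases
  of the theorem are \<open>q\<close> even and \<open>q\<close> odd.\<close>

locale prime_1_mod_4 =
  fixes p q :: nat
  assumes prime_p: "prime p" and p_eq: "p = 4 * q + 1"
begin

abbreviation L :: "int \<Rightarrow> int" where "L a \<equiv> Legendre a (int p)"

lemma q_pos: "q > 0"
  using prime_p p_eq by (cases q) auto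

lemma p_gt2: "p > 2" using q_pos p_eq by simp

lemma prime_int_p: "prime (int p)" using prime_p by simp

lemma L_mult: "L (a * b) = L a * L b"
  by (rule Legendre_mult[OF prime_p p_gt2])

lemma euler: "[L a = a ^ (2 * q)] (mod p)"
  using euler_criterion[OF prime_p p_gt2, of a] p_eq by simp

lemma L_minus_one: "L (-1) = 1"
proof -
  have "[L (-1) = 1] (mod p)" using euler[of "-1"] by simp
  thus ?thesis by (rule cong_small_imp_eq) (use p_gt2 Legendre_values[of "-1" p] in auto)
qed

lemma L_minus: "L (- a) = L a"
  using L_mult[of "-1" a] L_minus_one by simp

lemma L_p_minus: "L (int p - a) = L a"
proof -
  have "L (int p - a) = L (- a)" by (rule Legendre_cong) (simp add: cong_iff_dvd_diff)
  thus ?thesis by (simp add: L_minus)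
qed

lemma L_mod: "L (a mod int p) = L a"
  by (rule Legendre_cong) simp

lemma L_0_iff: "L a = 0 \<longleftrightarrow> int p dvd a"
  by (auto simp: Legendre_def cong_0_iff)

lemma L_1_iff: "L a = 1 \<longleftrightarrow> \<not> int p dvd a \<and> QuadRes (int p) a"
  by (auto simp: Legendre_def cong_0_iff)

lemma not_dvd_range: "x \<in> {1..int p - 1} \<Longrightarrow> \<not> int p dvd x"
  using zdvd_not_zless by auto

lemma quad_residues_alt: "quad_residues p = {a \<in> {1..int p - 1}. L a = 1}"
  unfolding quad_residues_def using L_1_iff not_dvd_range by blast

lemma finite_quad_residues: "finite (quad_residues p)"
  by (rule finite_subset[of _ "{1..int p - 1}"]) (auto simp: quad_residues_def)

lemma square_cong_imp_eq:
  fixes i j :: nat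
  assumes "i \<in> {1..2*q}" "j \<in> {1..2*q}" "[(int i)\<^sup>2 = (int j)\<^sup>2] (mod p)"
  shows "i = j"
proof -
  have "int p dvd (int i - int j) * (int i + int j)"
    using assms(3) by (simp add: cong_iff_dvd_diff power2_eq_square algebra_simps)
  hence "int p dvd int i - int j \<or> int p dvd int i + int j"
    using prime_int_p prime_dvd_mult_iff by blast
  moreover have "\<not> int p dvd int i + int j"
    by (rule not_dvd_range) (use assms p_eq in auto)
  ultimately have "[int i = int j] (mod p)" by (simp add: cong_iff_dvd_diff)
  thus ?thesis using cong_small_imp_eq[of "int i" "int j" p] assms p_eq by auto
qed

lemma bij_squares: "bij_betw (\<lambda>k. (int k)\<^sup>2 mod p) {1..2*q} (quad_residues p)"
proof (rule bij_betwI')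
  fix x y assume "x \<in> {1..2*q}" "y \<in> {1..2*q}"
  note xy = this
  have "x = y" if "(int x)\<^sup>2 mod p = (int y)\<^sup>2 mod p"
    by (rule square_cong_imp_eq[OF xy]) (use that in \<open>simp add: cong_mod\<close>)
  thus "((int x)\<^sup>2 mod p = (int y)\<^sup>2 mod p) = (x = y)" by blast
next
  fix x assume x: "x \<in> {1..2*q}"
  have "\<not> int p dvd int x" by (rule not_dvd_range) (use x p_eq in auto)
  hence nd: "\<not> int p dvd (int x)\<^sup>2" using prime_int_p prime_dvd_power by blast
  have "L ((int x)\<^sup>2) = 1" unfolding L_1_iff QuadRes_def by (intro conjI exI[of _ "int x"] nd cong_refl)
  moreover have "(int x)\<^sup>2 mod p \<in> {1..int p - 1}"
  proof -
    have "(int x)\<^sup>2 mod p \<noteq> 0" using nd by (simp add: dvd_eq_mod_eq_0)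
    moreover have "0 \<le> (int x)\<^sup>2 mod p" "(int x)\<^sup>2 mod p < p" using p_gt2 by auto
    ultimately show ?thesis by auto
  qed
  ultimately show "(int x)\<^sup>2 mod p \<in> quad_residues p" by (simp add: quad_residues_alt L_mod)
next
  fix a assume a: "a \<in> quad_residues p"
  then obtain y where y: "[y\<^sup>2 = a] (mod p)" and a1: "a \<in> {1..int p - 1}"
    by (auto simp: quad_residues_def QuadRes_def)
  define z where "z = y mod p"
  have z2: "[z\<^sup>2 = a] (mod p)" using y by (simp add: z_def cong_mod power_mod)
  have z: "0 \<le> z" "z < p" using p_gt2 by (auto simp: z_def)
  have z0: "z \<noteq> 0" using z2 a1 not_dvd_range[OF a1] by (auto simp: cong_mod dvd_eq_mod_eq_0)
  \<comment> \<open>Of the two square roots \<open>z\<close> and \<open>p - z\<close>, the one in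
    the lower half.\<close>
  define k where "k = nat (if z \<le> 2 * q then z else p - z)"
  have k: "k \<in> {1..2*q}" using z z0 p_eq by (auto simp: k_def)
  have "[(int k)\<^sup>2 = z\<^sup>2] (mod p)"
  proof (cases "z \<le> 2 * q")
    case True thus ?thesis using z by (simp add: k_def)
  next
    case False
    hence "(int k)\<^sup>2 - z\<^sup>2 = p * (p - 2 * z)" using z by (simp add: k_def power2_eq_square algebra_simps)
    thus ?thesis by (simp add: cong_iff_dvd_diff)
  qed
  hence "[(int k)\<^sup>2 = a] (mod p)" using z2 cong_trans by blast
  moreover have "a mod p = a" using a1 by simp
  ultimately have "a = (int k)\<^sup>2 mod p" by (simp add: cong_mod)
  thus "\<exists>x\<in>{1..2*q}. a = (int x)\<^sup>2 mod p" using k by blast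
qed

lemma card_quad_residues: "card (quad_residues p) = 2 * q"
  using bij_betw_same_card[OF bij_squares] by simp

lemma L_pm1: "x \<in> {1..int p - 1} \<Longrightarrow> L x = 1 \<or> L x = -1"
  using Legendre_values[of x p] L_0_iff not_dvd_range by auto

lemma sum_L: "(\<Sum>x\<in>{1..int p - 1}. L x) = 0"
proof -
  have "(\<Sum>x\<in>{1..int p - 1}. L x) = (\<Sum>x\<in>{1..int p - 1}. 2 * (if L x = 1 then 1 else 0) - 1)"
    by (rule sum.cong) (use L_pm1 in auto)
  also have "\<dots> = 2 * (\<Sum>x\<in>{1..int p - 1}. if L x = 1 then 1 else 0) - int (card {1..int p - 1})"
    by (simp only: sum_subtractf sum_distrib_left[symmetric] sum_constant mult_1_right)
  also have "(\<Sum>x\<in>{1..int p - 1}. if L x = 1 then 1 else 0) = int (card (quad_residues p))"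
    by (simp add: quad_residues_alt sum.If_cases Int_def conj_commute)
  finally show ?thesis using card_quad_residues p_eq by simp
qed

lemma cong_cancel:
  "\<lbrakk>[a * x = a * y] (mod int p); \<not> int p dvd a\<rbrakk> \<Longrightarrow> [x = y] (mod int p)"
  using cong_mult_lcancel[of a "int p" x y] prime_imp_coprime[OF prime_int_p, of a]
  by (simp add: coprime_commute)

text \<open>Supplies inverses modulo \<open>p\<close> as explicit powers: squaring Euler's criterion
  gives \<open>a ^ (p - 1) = 1\<close>, since a nonzero Legendre symbol squares to 1.\<close>

lemma mult_power_p_minus_2:
  assumes "\<not> int p dvd a"
  shows "[a * a ^ (p - 2) = 1] (mod int p)"
proof -
  have "L a \<noteq> 0" using assms by (simp add: L_0_iff)
  hence "L a = 1 \<or> L a = -1" using Legendre_values[of a p] by blast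
  hence "L a * L a = 1" by fastforce
  moreover have "[L a * L a = a ^ (2 * q) * a ^ (2 * q)] (mod int p)" by (intro cong_mult euler)
  moreover have "a ^ (2 * q) * a ^ (2 * q) = a ^ Suc (p - 2)"
  proof -
    have "2 * q + 2 * q = Suc (p - 2)" using p_eq q_pos by simp
    thus ?thesis by (simp only: power_add[symmetric])
  qed
  ultimately have "[1 = a ^ Suc (p - 2)] (mod int p)" by simp
  thus ?thesis unfolding power_Suc by (rule cong_sym)
qed

text \<open>Write \<open>x (x + d)\<close> as \<open>x\<^sup>2 (1 + d / x)\<close>. The square does
  not affect the symbol, and \<open>1 + d / x\<close> runs through all classes except 1 as
  \<open>x\<close> runs through the nonzero ones, so the full sum 0 loses the term at 1.\<close>

lemma sum_L_shift_product:
  assumes d: "\<not> int p dvd d"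
  shows "(\<Sum>x\<in>{1..int p - 1}. L (x * (x + d))) = -1"
proof -
  define iv where "iv = (\<lambda>a::int. a ^ (p - 2))"
  define f where "f = (\<lambda>a. (1 + d * iv a) mod p)"
  have iv: "[a * iv a = 1] (mod int p)" if "a \<in> {1..int p - 1}" for a
    unfolding iv_def by (rule mult_power_p_minus_2) (use that not_dvd_range in auto)
  have 1: "L (a * (a + d)) = L (f a)" if a: "a \<in> {1..int p - 1}" for a
  proof -
    have "[a * (a + d) = a * (a * 1) + a * d * 1] (mod int p)" by (simp add: algebra_simps)
    also have "[a * (a * 1) + a * d * 1 = a * (a * 1) + a * d * (a * iv a)] (mod int p)"
      by (intro cong_add cong_mult cong_refl cong_sym[OF iv[OF a]])
    also have "a * (a * 1) + a * d * (a * iv a) = (a * a) * (1 + d * iv a)" by (simp add: algebra_simps)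
    finally have "L (a * (a + d)) = L (a * a) * L (1 + d * iv a)"
      unfolding L_mult[of "a * a", symmetric] by (rule Legendre_cong)
    moreover have "L (a * a) = 1" using L_pm1[OF a] by (auto simp: L_mult)
    ultimately show ?thesis by (simp add: f_def L_mod)
  qed
  have inj: "inj_on f {1..int p - 1}"
  proof (rule inj_onI)
    fix a b assume ab: "a \<in> {1..int p - 1}" "b \<in> {1..int p - 1}" "f a = f b"
    have "[1 + d * iv a = 1 + d * iv b] (mod int p)" using ab(3) by (simp add: f_def cong_mod)
    hence "[d * iv a = d * iv b] (mod int p)" by (simp add: cong_add_lcancel)
    hence *: "[iv a = iv b] (mod int p)" using d cong_cancel by blast
    have "[a * b * iv b = a * b * iv a] (mod int p)" by (intro cong_mult cong_refl cong_sym[OF *])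
    moreover have "[a * (b * iv b) = a * 1] (mod int p)" "[b * (a * iv a) = b * 1] (mod int p)"
      by (intro cong_mult cong_refl iv ab)+
    moreover have "a * (b * iv b) = a * b * iv b" "b * (a * iv a) = a * b * iv a" by simp_all
    ultimately have "[a = b] (mod int p)" by (simp add: cong_mod)
    thus "a = b" by (rule cong_small_imp_eq) (use ab in auto)
  qed
  have sub: "f ` {1..int p - 1} \<subseteq> {0..int p - 1} - {1}"
  proof
    fix y assume "y \<in> f ` {1..int p - 1}"
    then obtain a where a: "a \<in> {1..int p - 1}" "y = f a" by auto
    have "y \<in> {0..int p - 1}" using p_gt2 by (simp add: a f_def)
    moreover have "y \<noteq> 1"
    proof
      assume "y = 1"
      hence "[1 + d * iv a = 1 + d * 0] (mod int p)" using p_gt2 by (simp add: a f_def cong_mod)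
      hence "[d * iv a = d * 0] (mod int p)" by (simp only: cong_add_lcancel)
      hence "[iv a = 0] (mod int p)" using d cong_cancel by blast
      hence "[a * iv a = a * 0] (mod int p)" by (intro cong_mult cong_refl)
      hence "[1 = 0] (mod int p)" using iv[OF a(1)] by (simp add: cong_mod)
      thus False using p_gt2 by (simp add: cong_mod)
    qed
    ultimately show "y \<in> {0..int p - 1} - {1}" by blast
  qed
  have "card (f ` {1..int p - 1}) = card ({0..int p - 1} - {1::int})"
    using inj p_gt2 by (subst card_image) auto
  hence img: "f ` {1..int p - 1} = {0..int p - 1} - {1}"
    using sub by (intro card_subset_eq) auto
  have "(\<Sum>x\<in>{1..int p - 1}. L (x * (x + d))) = (\<Sum>x\<in>{1..int p - 1}. L (f x))"
    by (rule sum.cong) (use 1 in auto)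
  also have "\<dots> = (\<Sum>y\<in>{0..int p - 1} - {1}. L y)"
    using inj by (simp add: sum.reindex flip: img)
  also have "\<dots> = (\<Sum>y\<in>{0..int p - 1}. L y) - L 1"
    using p_gt2 by (subst sum_diff1) auto
  also have "(\<Sum>y\<in>{0..int p - 1}. L y) = L 0 + (\<Sum>y\<in>{1..int p - 1}. L y)"
  proof -
    have "{0..int p - 1} = insert 0 {1..int p - 1}" using p_gt2 by auto
    thus ?thesis by simp
  qed
  also have "L 0 = 0" by (simp add: L_0_iff)
  also have "L 1 = 1" using L_mult[of "-1" "-1"] L_minus_one by simp
  finally show ?thesis using sum_L by simp
qed

lemma bij_shift: "bij_betw (\<lambda>x. (x + d) mod int p) {0..int p - 1} {0..int p - 1}"
proof (rule bij_betw_byWitness[where f' = "\<lambda>x. (x - d) mod int p"])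
  show "\<forall>a\<in>{0..int p - 1}. ((a + d) mod int p - d) mod int p = a"
    by (simp add: mod_simps)
  show "\<forall>a\<in>{0..int p - 1}. ((a - d) mod int p + d) mod int p = a"
    by (simp add: mod_simps)
qed (use p_gt2 in auto)

lemma range_insert: "{0..int p - 1} = insert 0 {1..int p - 1}"
  using p_gt2 by auto

text \<open>Sum \<open>(1 + L x) (1 + L (x + d))\<close> over all classes. Away from
  \<open>x = 0\<close> and \<open>x = p - d\<close> a term is 4 if both entries are residues and 0
  otherwise; the two exceptional classes contribute \<open>1 + L d\<close> each.\<close>

lemma card_consecutive_residues:
  assumes d: "d \<in> {1..int p - 1}"
  shows "4 * int (card {x \<in> quad_residues p. (x + d) mod p \<in> quad_residues p}) = int p - 3 - 2 * L d"
proof -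
  let ?J = "{x \<in> quad_residues p. (x + d) mod p \<in> quad_residues p}"
  let ?g = "\<lambda>x. (1 + L x) * (1 + L (x + d))"
  have L0: "L 0 = 0" by (simp add: L_0_iff)
  have "(\<Sum>x\<in>{0..int p - 1}. ?g x)
     = (\<Sum>x\<in>{0..int p - 1}. 1 + L x + L ((x + d) mod p) + L (x * (x + d)))"
    by (rule sum.cong) (simp_all only: L_mod L_mult, simp_all add: algebra_simps)
  also have "\<dots> = int p + (\<Sum>x\<in>{0..int p - 1}. L x) + (\<Sum>x\<in>{0..int p - 1}. L ((x + d) mod p))
      + (\<Sum>x\<in>{0..int p - 1}. L (x * (x + d)))"
    by (simp add: sum.distrib)
  also have "(\<Sum>x\<in>{0..int p - 1}. L ((x + d) mod p)) = (\<Sum>x\<in>{0..int p - 1}. L x)"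
    by (rule sum.reindex_bij_betw[OF bij_shift])
  also have "(\<Sum>x\<in>{0..int p - 1}. L x) = 0" using sum_L L0 by (simp add: range_insert)
  also have "(\<Sum>x\<in>{0..int p - 1}. L (x * (x + d))) = -1"
    using sum_L_shift_product[OF not_dvd_range[OF d]] L0 by (simp add: range_insert)
  finally have A: "(\<Sum>x\<in>{0..int p - 1}. ?g x) = int p - 1" by simp
  have Ld: "L (int p - d) = L d" by (rule L_p_minus)
  have dp: "int p - d \<in> {1..int p - 1}" using d by auto
  have split: "{0..int p - 1} = insert 0 (insert (int p - d) ({1..int p - 1} - {int p - d}))"
    using dp by (auto simp: range_insert)
  have "(\<Sum>x\<in>{0..int p - 1}. ?g x) = ?g 0 + (?g (int p - d) + (\<Sum>x\<in>{1..int p - 1} - {int p - d}. ?g x))"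
    using dp by (subst split, subst sum.insert, simp, force, subst sum.insert) auto
  also have "?g 0 = 1 + L d" using L0 by simp
  also have "?g (int p - d) = 1 + L d" using Ld by (simp add: L_0_iff)
  finally have B: "(\<Sum>x\<in>{1..int p - 1} - {int p - d}. ?g x) = int p - 3 - 2 * L d" using A by simp
  have C: "?g x = (if x \<in> ?J then 4 else 0)" if x: "x \<in> {1..int p - 1} - {int p - d}" for x
  proof -
    have "(x + d) mod p \<noteq> 0"
    proof
      assume "(x + d) mod p = 0"
      hence "int p dvd (x + d) - p" by (simp add: dvd_eq_mod_eq_0[symmetric])
      moreover have "\<bar>(x + d) - p\<bar> < p" using x d by auto
      ultimately have "(x + d) - p = 0" using dvd_imp_le_int[of "(x + d) - p" p] by auto
      thus False using x by auto
    qed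
    moreover have "0 \<le> (x + d) mod p" "(x + d) mod p < p" using p_gt2 by auto
    ultimately have r: "(x + d) mod p \<in> {1..int p - 1}" by auto
    have "L (x + d) = L ((x + d) mod p)" by (simp add: L_mod)
    thus ?thesis using L_pm1[OF r] L_pm1[of x] x r by (auto simp: quad_residues_alt)
  qed
  have sub: "?J \<subseteq> {1..int p - 1} - {int p - d}"
    by (auto simp: quad_residues_alt)
  have "(\<Sum>x\<in>{1..int p - 1} - {int p - d}. ?g x) = (\<Sum>x\<in>{1..int p - 1} - {int p - d}. if x \<in> ?J then 4 else 0)"
    by (rule sum.cong) (use C in auto)
  also have "\<dots> = (\<Sum>x\<in>({1..int p - 1} - {int p - d}) \<inter> ?J. 4)"
    by (subst sum.If_cases) auto
  also have "({1..int p - 1} - {int p - d}) \<inter> ?J = ?J" using sub by blast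
  finally show ?thesis using B by simp
qed

section \<open>Differences of the ordered residues\<close>

definition diff_count :: "int \<Rightarrow> nat" where
  "diff_count d = card {x \<in> quad_residues p. x + d \<in> quad_residues p}"

text \<open>\<open>diff_count\<close> takes differences as integers. A pair with difference
  \<open>d\<close> modulo \<open>p\<close> either does not wrap around and is counted by
  \<open>diff_count d\<close>, or it wraps and its reversal has difference \<open>p - d\<close>. So
  the sum is the cyclic count.\<close>

lemma diff_count_add:
  assumes d: "d \<in> {1..int p - 1}"
  shows "diff_count d + diff_count (int p - d) = (if L d = 1 then q - 1 else q)"
proof -
  let ?Q = "quad_residues p"
  let ?J = "{x \<in> ?Q. (x + d) mod p \<in> ?Q}"
  let ?A = "{x \<in> ?Q. x + d \<in> ?Q}" and ?B = "{x \<in> ?Q. x + d - p \<in> ?Q}"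
  have Qr: "x \<in> {1..int p - 1}" if "x \<in> ?Q" for x using that by (simp add: quad_residues_alt)
  have md: "(x + d) mod p = (if x + d < p then x + d else x + d - p)" if "x \<in> ?Q" for x
  proof (cases "x + d < p")
    case True thus ?thesis using d Qr[OF that] by simp
  next
    case False
    have "(x + d) mod p = (x + d - p) mod p" by simp
    also have "\<dots> = x + d - p" using False d Qr[OF that] by (intro mod_pos_pos_trivial) auto
    finally show ?thesis using False by simp
  qed
  have "?J = ?A \<union> ?B"
    using md Qr by (fastforce split: if_splits)
  moreover have "?A \<inter> ?B = {}"
  proof -
    have False if "x \<in> ?A" "x \<in> ?B" for x using Qr[of "x + d"] Qr[of "x + d - p"] that by auto
    thus ?thesis by blast
  qed
  moreover have fin: "finite ?A" "finite ?B" using finite_quad_residues by auto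
  ultimately have "card ?J = card ?A + card ?B" by (simp add: card_Un_disjoint)
  moreover have "card ?B = diff_count (int p - d)"
    unfolding diff_count_def
    by (rule bij_betw_same_card[where f = "\<lambda>x. x + d - p"], rule bij_betw_byWitness[where f' = "\<lambda>x. x - d + p"])
      (auto simp: algebra_simps)
  ultimately have "card ?J = diff_count d + diff_count (int p - d)" by (simp add: diff_count_def)
  thus ?thesis using card_consecutive_residues[OF d] p_eq q_pos L_pm1[OF d] by (auto simp: of_nat_diff)
qed

lemma half: "(p - 1) div 2 = 2 * q" "(int p - 1) div 2 = 2 * int q"
  using p_eq by auto

lemma bounds: "4 * int q < int p" "int p \<le> 4 * int q + 1"
  using p_eq by auto

definition r_prod :: int where "r_prod = \<Prod>{k \<in> {1..2 * int q}. L k = 1}"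

lemma s_prod_alt: "s_prod p = \<Prod>{k \<in> {1..2 * int q}. L k = -1}"
  by (simp add: s_prod_def half)

text \<open>Since \<open>-1\<close> is a residue, residues \<open>x\<close> and \<open>y\<close>
  with sum \<open>d\<close> correspond to the residues \<open>x\<close> and \<open>p - y\<close>,
  whose difference is \<open>p - d\<close>.\<close>

lemma r_star_alt: "r_star p = (\<Sum>d\<in>{1..2 * int q}. diff_count (int p - d))"
proof -
  let ?T = "{(x, y). x \<in> {1..2 * int q} \<and> y \<in> {1..2 * int q} \<and> x + y \<le> 2 * int q \<and> L x = 1 \<and> L y = 1}"
  let ?S = "SIGMA d:{1..2 * int q}. {x \<in> quad_residues p. x + (int p - d) \<in> quad_residues p}"
  have "(\<Sum>d\<in>{1..2 * int q}. diff_count (int p - d)) = card ?S"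
    unfolding diff_count_def using finite_quad_residues by (subst card_SigmaI) auto
  also have "card ?S = card ?T"
  proof (rule bij_betw_same_card[where f = "\<lambda>(d, x). (x, d - x)"],
      rule bij_betw_byWitness[where f' = "\<lambda>(x, y). (x + y, x)"])
    have e: "L (x + (int p - d)) = L (d - x)" for x d
      using L_p_minus[of "d - x"] by (simp add: algebra_simps)
    show "(\<lambda>(d, x). (x, d - x)) ` ?S \<subseteq> ?T"
    proof
      fix z assume "z \<in> (\<lambda>(d, x). (x, d - x)) ` ?S"
      then obtain d x where z: "z = (x, d - x)" "d \<in> {1..2 * int q}" "x \<in> quad_residues p"
        "x + (int p - d) \<in> quad_residues p" by auto
      thus "z \<in> ?T" using e[of x d] by (simp add: quad_residues_alt)
    qed
    have e2: "L (int p - y) = L y" for y by (rule L_p_minus)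
    show "(\<lambda>(x, y). (x + y, x)) ` ?T \<subseteq> ?S"
    proof
      fix z assume "z \<in> (\<lambda>(x, y). (x + y, x)) ` ?T"
      then obtain x y where z: "z = (x + y, x)" "x \<in> {1..2 * int q}" "y \<in> {1..2 * int q}"
        "x + y \<le> 2 * int q" "L x = 1" "L y = 1" by auto
      have "x + (int p - (x + y)) = int p - y" by simp
      thus "z \<in> ?S" using z e2[of y] bounds by (simp add: quad_residues_alt)
    qed
  qed auto
  finally show ?thesis by (simp add: r_star_def half)
qed

text \<open>Group the factors by their value, fold \<open>p - d\<close> onto \<open>d\<close> using
  \<open>p - d = - d\<close> modulo \<open>p\<close>, and read the total exponent of each
  \<open>d\<close> off \<open>diff_count_add\<close>: \<open>q - 1\<close> for residues,
  \<open>q\<close> for nonresidues. The number of folded factors is \<open>r_star p\<close>.\<close>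

lemma prod_differences_cong:
  "[(\<Prod>(x, y) \<in> {(x, y). x \<in> quad_residues p \<and> y \<in> quad_residues p \<and> x < y}. y - x) =
     (-1) ^ r_star p * r_prod ^ (q - 1) * s_prod p ^ q] (mod int p)"
proof -
  let ?Q = "quad_residues p"
  let ?P = "{(x, y). x \<in> ?Q \<and> y \<in> ?Q \<and> x < y}"
  let ?H = "{1..2 * int q}"
  have finP: "finite ?P" by (rule finite_subset[of _ "?Q \<times> ?Q"]) (use finite_quad_residues in auto)
  have inner: "(\<Prod>z\<in>{z \<in> ?P. snd z - fst z = d}. snd z - fst z) = d ^ diff_count d" if "d \<in> {1..int p - 1}" for d
  proof -
    have "(\<Prod>z\<in>{z \<in> ?P. snd z - fst z = d}. snd z - fst z) = d ^ card {z \<in> ?P. snd z - fst z = d}"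
      by simp
    also have "card {z \<in> ?P. snd z - fst z = d} = diff_count d"
      unfolding diff_count_def
      by (rule bij_betw_same_card[where f = fst], rule bij_betw_byWitness[where f' = "\<lambda>x. (x, x + d)"])
        (use that in \<open>auto simp: algebra_simps\<close>)
    finally show ?thesis .
  qed
  have "(\<Prod>(x, y)\<in>?P. y - x) = (\<Prod>z\<in>?P. snd z - fst z)" by (simp add: case_prod_beta)
  also have "\<dots> = (\<Prod>d\<in>{1..int p - 1}. \<Prod>z\<in>{z \<in> ?P. snd z - fst z = d}. snd z - fst z)"
    by (rule prod.group[symmetric]) (use finP in \<open>auto simp: quad_residues_alt\<close>)
  also have "\<dots> = (\<Prod>d\<in>{1..int p - 1}. d ^ diff_count d)"
    by (rule prod.cong) (use inner in auto)
  also have "{1..int p - 1} = ?H \<union> (\<lambda>d. int p - d) ` ?H"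
  proof (intro equalityI subsetI)
    fix x assume x: "x \<in> {1..int p - 1}"
    show "x \<in> ?H \<union> (\<lambda>d. int p - d) ` ?H"
    proof (cases "x \<le> 2 * int q")
      case False
      hence "x = int p - (int p - x)" "int p - x \<in> ?H" using x p_eq by auto
      thus ?thesis by blast
    qed (use x in auto)
  qed (use p_eq in auto)
  also have "(\<Prod>d\<in>?H \<union> (\<lambda>d. int p - d) ` ?H. d ^ diff_count d) =
      (\<Prod>d\<in>?H. d ^ diff_count d) * (\<Prod>d\<in>(\<lambda>d. int p - d) ` ?H. d ^ diff_count d)"
    by (rule prod.union_disjoint) (use p_eq in auto)
  also have "(\<Prod>d\<in>(\<lambda>d. int p - d) ` ?H. d ^ diff_count d) = (\<Prod>d\<in>?H. (int p - d) ^ diff_count (int p - d))"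
    by (subst prod.reindex) (auto simp: inj_on_def)
  also have "(\<Prod>d\<in>?H. d ^ diff_count d) * \<dots> = (\<Prod>d\<in>?H. d ^ diff_count d * (int p - d) ^ diff_count (int p - d))"
    by (rule prod.distrib[symmetric])
  also have "[\<dots> = (\<Prod>d\<in>?H. (-1) ^ diff_count (int p - d) * d ^ (if L d = 1 then q - 1 else q))] (mod int p)"
  proof (rule cong_prod)
    fix d assume d: "d \<in> ?H"
    have "[int p - d = - d] (mod int p)" by (simp add: cong_iff_dvd_diff)
    hence "[d ^ diff_count d * (int p - d) ^ diff_count (int p - d) =
        d ^ diff_count d * (- d) ^ diff_count (int p - d)] (mod int p)"
      by (intro cong_mult cong_refl cong_pow)
    also have "d ^ diff_count d * (- d) ^ diff_count (int p - d) =
        (-1) ^ diff_count (int p - d) * d ^ (diff_count d + diff_count (int p - d))"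
      by (subst power_minus) (simp add: power_add)
    also have "diff_count d + diff_count (int p - d) = (if L d = 1 then q - 1 else q)"
      by (rule diff_count_add) (use d p_eq in auto)
    finally show "[d ^ diff_count d * (int p - d) ^ diff_count (int p - d) =
      (-1) ^ diff_count (int p - d) * d ^ (if L d = 1 then q - 1 else q)] (mod int p)" .
  qed
  also have "(\<Prod>d\<in>?H. (-1) ^ diff_count (int p - d) * d ^ (if L d = 1 then q - 1 else q)) =
    (-1) ^ r_star p * (\<Prod>d\<in>?H. d ^ (if L d = 1 then q - 1 else q))"
    by (simp only: prod.distrib r_star_alt power_sum)
  also have "(\<Prod>d\<in>?H. d ^ (if L d = 1 then q - 1 else q)) = (\<Prod>d\<in>?H. if L d = 1 then d ^ (q - 1) else d ^ q)"
    by (rule prod.cong) auto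
  also have "\<dots> = (\<Prod>d\<in>?H \<inter> {d. L d = 1}. d ^ (q - 1)) * (\<Prod>d\<in>?H \<inter> - {d. L d = 1}. d ^ q)"
    by (rule prod.If_cases) auto
  also have "?H \<inter> {d. L d = 1} = {k \<in> ?H. L k = 1}" by auto
  also have "?H \<inter> - {d. L d = 1} = {k \<in> ?H. L k = -1}"
    using L_pm1 p_eq by (auto) fastforce
  also have "(\<Prod>d\<in>{k \<in> ?H. L k = 1}. d ^ (q - 1)) = r_prod ^ (q - 1)" by (simp add: r_prod_def prod_power_distrib)
  also have "(\<Prod>d\<in>{k \<in> ?H. L k = -1}. d ^ q) = s_prod p ^ q" by (simp add: s_prod_alt prod_power_distrib)
  finally show ?thesis by (simp add: mult.assoc)
qed

section \<open>Half systems and Wilson's theorem\<close>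

definition N4 :: nat where "N4 = card {k \<in> {1..int q}. L k = -1}"

abbreviation H :: "int set" where "H \<equiv> {1..2 * int q}"

lemma H_sub: "H \<subseteq> {1..int p - 1}" using bounds by auto

text \<open>As \<open>-1\<close> is a residue, \<open>k\<close> and \<open>p - k\<close> have the
  same symbol, so exactly half of the \<open>2 q\<close> residues lie in the lower half.\<close>

lemma card_half_residues: "card {k \<in> H. L k = 1} = q" "card {k \<in> H. L k = -1} = q"
proof -
  let ?A = "{k \<in> H. L k = 1}"
  have Q: "quad_residues p = ?A \<union> (\<lambda>k. int p - k) ` ?A"
  proof (intro equalityI subsetI)
    fix x assume x: "x \<in> quad_residues p"
    show "x \<in> ?A \<union> (\<lambda>k. int p - k) ` ?A"
    proof (cases "x \<le> 2 * int q")
      case True thus ?thesis using x by (simp add: quad_residues_alt)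
    next
      case False
      hence "x = int p - (int p - x)" "int p - x \<in> ?A"
        using x bounds by (auto simp: quad_residues_alt L_p_minus)
      thus ?thesis by blast
    qed
  next
    fix x assume "x \<in> ?A \<union> (\<lambda>k. int p - k) ` ?A"
    thus "x \<in> quad_residues p" using bounds by (auto simp: quad_residues_alt L_p_minus)
  qed
  have finA: "finite ?A" by (rule finite_subset[of _ H]) auto
  have "card (quad_residues p) = card ?A + card ((\<lambda>k. int p - k) ` ?A)"
    unfolding Q by (rule card_Un_disjoint) (use finA bounds in auto)
  also have "card ((\<lambda>k. int p - k) ` ?A) = card ?A"
    by (rule card_image) (simp add: inj_on_def)
  finally show 1: "card ?A = q" using card_quad_residues by simp
  have "H = ?A \<union> {k \<in> H. L k = -1}" using L_pm1 H_sub by blast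
  hence "card H = card (?A \<union> {k \<in> H. L k = -1})" by (rule arg_cong)
  also have "\<dots> = card ?A + card {k \<in> H. L k = -1}"
    by (rule card_Un_disjoint) ((rule finite_subset[of _ H], force, force)+, force)
  finally have "card H = card ?A + card {k \<in> H. L k = -1}" .
  thus "card {k \<in> H. L k = -1} = q" using 1 by simp
qed

text \<open>In the manner of Gauss's lemma: double the residues of the lower half and fold
  \<open>2 r\<close> to \<open>p - 2 r\<close> when it exceeds \<open>2 q\<close>. The result lists
  the elements of \<open>H\<close> with symbol \<open>L 2\<close>, and each fold costs a
  sign.\<close>

lemma half_system_times_two:
  "[\<Prod>{k \<in> H. L k = L 2} = (-1) ^ N4 * 2 ^ q * r_prod] (mod int p)"
proof -
  let ?A = "{k \<in> H. L k = 1}" and ?T = "{k \<in> H. L k = L 2}"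
  define f where "f = (\<lambda>r::int. if r \<le> int q then 2 * r else int p - 2 * r)"
  have L2: "L 2 = 1 \<or> L 2 = -1" by (rule L_pm1) (use p_gt2 in auto)
  have cT: "card ?T = q" using L2 card_half_residues by (elim disjE) (simp_all only:)
  have inj: "inj_on f ?A"
  proof (rule inj_onI)
    fix x y assume "f x = f y"
    moreover have "int p = 4 * int q + 1" using p_eq by simp
    ultimately show "x = y" unfolding f_def by (simp split: if_splits) presburger+
  qed
  have fT: "f r \<in> ?T" if "r \<in> ?A" for r
    using that bounds by (auto simp: f_def L_p_minus L_mult)
  have fin: "finite ?T" "finite ?A" by (rule finite_subset[of _ H], force, force)+
  have "f ` ?A = ?T"
    using fin fT inj cT card_half_residues(1) by (intro card_subset_eq) (auto simp: card_image)
  moreover have "\<Prod>(f ` ?A) = prod f ?A" by (subst prod.reindex[OF inj]) (simp add: o_def)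
  ultimately have PT: "\<Prod>?T = prod f ?A" by argo
  define A where "A = ?A"
  have finA: "finite A" unfolding A_def by (rule fin)
  have c1: "[prod f A = (\<Prod>r\<in>A. (if r \<le> int q then 1 else -1) * (2 * r))] (mod int p)"
    by (rule cong_prod) (simp add: f_def cong_iff_dvd_diff)
  have c2: "(\<Prod>r\<in>A. (if r \<le> int q then 1 else -1) * (2 * r)) =
     (\<Prod>r\<in>A. if r \<le> int q then 1 else -1) * (2 ^ card A * \<Prod>A)"
    by (simp add: prod.distrib)
  have c3: "(\<Prod>r\<in>A. if r \<le> int q then 1 else -1) = (-1::int) ^ card (A \<inter> - {r. r \<le> int q})"
    by (subst prod.If_cases[OF finA]) simp
  \<comment> \<open>The folded residues are those above \<open>q\<close>. As \<open>H\<close>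
    contains \<open>q\<close> residues, their number is \<open>q\<close> minus the number of
    residues up to \<open>q\<close>, which is the number of nonresidues up to
    \<open>q\<close>.\<close>
  have c4: "card (A \<inter> - {r. r \<le> int q}) = N4"
  proof -
    let ?R = "{k \<in> {1..int q}. L k = 1}" and ?N = "{k \<in> {1..int q}. L k = -1}"
    have f: "finite ?R" "finite ?N" by (rule finite_subset[of _ H], force, force)+
    have f': "finite (A \<inter> - {r. r \<le> int q})" using finA by simp
    have "{1..int q} = ?R \<union> ?N" using L_pm1 H_sub by fastforce
    hence "card {1..int q} = card (?R \<union> ?N)" by (rule arg_cong)
    also have "\<dots> = card ?R + card ?N" by (rule card_Un_disjoint[OF f]) auto
    finally have 1: "q = card ?R + N4" by (simp add: N4_def)
    have "A = ?R \<union> (A \<inter> - {r. r \<le> int q})" by (auto simp: A_def)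
    hence "card A = card (?R \<union> (A \<inter> - {r. r \<le> int q}))" by (rule arg_cong)
    also have "\<dots> = card ?R + card (A \<inter> - {r. r \<le> int q})" by (rule card_Un_disjoint[OF f(1) f']) auto
    finally show ?thesis using 1 card_half_residues(1) by (simp add: A_def)
  qed
  show ?thesis using c1 unfolding c2 c3 c4 PT
    using card_half_residues(1) by (simp add: r_prod_def mult.assoc A_def)
qed

lemma fact_eq_rs: "fact (2 * q) = r_prod * s_prod p"
proof -
  have "(fact (2 * q) :: int) = \<Prod>H"
  proof -
    have "(fact (2 * q) :: int) = (\<Prod>i\<in>{1..2*q}. int i)" by (simp add: fact_prod)
    also have "\<dots> = \<Prod>H"
      by (rule prod.reindex_bij_witness[where i = nat and j = int]) auto
    finally show ?thesis .
  qed
  also have "H = {k \<in> H. L k = 1} \<union> {k \<in> H. L k = -1}" using L_pm1 H_sub by blast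
  also have "\<Prod>\<dots> = r_prod * s_prod p"
    unfolding r_prod_def s_prod_alt
    by (rule prod.union_disjoint) ((rule finite_subset[of _ H], force, force)+, force)
  finally show ?thesis .
qed

text \<open>One induction step moves the factor \<open>p - 1 - k\<close>, congruent to
  \<open>- (k + 1)\<close>, from the second factorial to the first.\<close>

lemma wilson_split: "k \<le> p - 1 \<Longrightarrow> [fact k * fact (p - 1 - k) = (-1) ^ Suc k] (mod int p)"
proof (induction k)
  case 0
  have "[fact (p - 1) = - 1] (mod int p)" by (rule wilson_theorem[OF prime_p])
  thus ?case by simp
next
  case (Suc k)
  have e: "p - 1 - k = Suc (p - 1 - Suc k)" using Suc.prems by simp
  have "[int (p - 1 - k) = - int (Suc k)] (mod int p)"
    using Suc.prems p_gt2 by (simp add: cong_iff_dvd_diff of_nat_diff)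
  hence "[fact k * (- int (Suc k) * fact (p - 1 - Suc k)) = fact k * (int (p - 1 - k) * fact (p - 1 - Suc k))] (mod int p)"
    by (intro cong_mult cong_refl) (rule cong_sym)
  also have "int (p - 1 - k) * fact (p - 1 - Suc k) = fact (p - 1 - k)" unfolding e fact_Suc by simp
  also have "[fact k * fact (p - 1 - k) = (-1) ^ Suc k] (mod int p)" using Suc by simp
  finally have "[- 1 * (fact k * (- int (Suc k) * fact (p - 1 - Suc k))) = - 1 * (-1) ^ Suc k] (mod int p)"
    by (intro cong_mult cong_refl)
  thus ?case by (simp add: algebra_simps)
qed

lemma fact_square: "[(r_prod * s_prod p)\<^sup>2 = -1] (mod int p)"
proof -
  have "p - 1 - 2 * q = 2 * q" "2 * q \<le> p - 1" using p_eq by simp_all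
  thus ?thesis using wilson_split[of "2 * q"] by (simp add: fact_eq_rs[symmetric] power2_eq_square)
qed

lemma prod_residues_cong: "[\<Prod>(quad_residues p) = -1] (mod int p)"
proof -
  have "\<Prod>(quad_residues p) = (\<Prod>k\<in>{1..2*q}. (int k)\<^sup>2 mod p)"
    using prod.reindex_bij_betw[OF bij_squares, of "\<lambda>x. x"] by simp
  also have "[\<dots> = (\<Prod>k\<in>{1..2*q}. (int k)\<^sup>2)] (mod int p)" by (rule cong_prod) simp
  also have "(\<Prod>k\<in>{1..2*q}. (int k)\<^sup>2) = (fact (2 * q))\<^sup>2" by (simp add: fact_prod prod_power_distrib)
  also have "[\<dots> = -1] (mod int p)" using fact_square by (simp add: fact_eq_rs)
  finally show ?thesis .
qed

text \<open>Folding the upper half of the residues onto the lower one turns their product, which is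
  \<open>-1\<close>, into \<open>(-1) ^ q\<close> times the square of \<open>r_prod\<close>.\<close>

lemma r_prod_square: "[r_prod\<^sup>2 = - ((-1) ^ q)] (mod int p)"
proof -
  let ?A = "{k \<in> H. L k = 1}"
  have Q: "quad_residues p = ?A \<union> (\<lambda>k. int p - k) ` ?A"
  proof (intro equalityI subsetI)
    fix x assume x: "x \<in> quad_residues p"
    show "x \<in> ?A \<union> (\<lambda>k. int p - k) ` ?A"
    proof (cases "x \<le> 2 * int q")
      case True thus ?thesis using x by (simp add: quad_residues_alt)
    next
      case False
      hence "x = int p - (int p - x)" "int p - x \<in> ?A"
        using x bounds by (auto simp: quad_residues_alt L_p_minus)
      thus ?thesis by blast
    qed
  next
    fix x assume "x \<in> ?A \<union> (\<lambda>k. int p - k) ` ?A"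
    thus "x \<in> quad_residues p" using bounds by (auto simp: quad_residues_alt L_p_minus)
  qed
  have finA: "finite ?A" by (rule finite_subset[of _ H]) auto
  have "\<Prod>(quad_residues p) = \<Prod>?A * \<Prod>((\<lambda>k. int p - k) ` ?A)"
    unfolding Q by (rule prod.union_disjoint) (use finA bounds in auto)
  also have "\<Prod>((\<lambda>k. int p - k) ` ?A) = (\<Prod>k\<in>?A. int p - k)"
    by (subst prod.reindex) (auto simp: inj_on_def)
  finally have 1: "\<Prod>(quad_residues p) = \<Prod>?A * (\<Prod>k\<in>?A. int p - k)" .
  have 2: "[\<Prod>?A * (\<Prod>k\<in>?A. int p - k) = \<Prod>?A * (\<Prod>k\<in>?A. -1 * k)] (mod int p)"
    by (rule cong_mult[OF cong_refl], rule cong_prod) (simp add: cong_iff_dvd_diff)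
  have 3: "\<Prod>?A * (\<Prod>k\<in>?A. -1 * k) = (-1) ^ q * r_prod\<^sup>2"
    by (simp only: prod.distrib prod_constant card_half_residues r_prod_def power2_eq_square) (simp only: mult_ac)
  have "[(-1) ^ q * r_prod\<^sup>2 = \<Prod>(quad_residues p)] (mod int p)"
    using 2 unfolding 3 1 by (rule cong_sym)
  hence "[(-1) ^ q * r_prod\<^sup>2 = -1] (mod int p)" using prod_residues_cong by (rule cong_trans)
  hence "[(-1) ^ q * ((-1) ^ q * r_prod\<^sup>2) = (-1) ^ q * -1] (mod int p)" by (intro cong_mult cong_refl)
  thus ?thesis by (simp flip: mult.assoc power_add)
qed

lemma s_prod_square: "[(s_prod p)\<^sup>2 = (-1) ^ q] (mod int p)"
proof -
  have "[- ((-1) ^ q) * (s_prod p)\<^sup>2 = r_prod\<^sup>2 * (s_prod p)\<^sup>2] (mod int p)"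
    by (rule cong_mult[OF cong_sym[OF r_prod_square] cong_refl])
  also have "r_prod\<^sup>2 * (s_prod p)\<^sup>2 = (r_prod * s_prod p)\<^sup>2" by (simp add: power_mult_distrib)
  also have "[\<dots> = -1] (mod int p)" by (rule fact_square)
  finally have "[- ((-1) ^ q) * (- ((-1) ^ q) * (s_prod p)\<^sup>2) = - ((-1) ^ q) * -1] (mod int p)"
    by (intro cong_mult cong_refl)
  thus ?thesis by (simp flip: mult.assoc power_add)
qed

text \<open>Since \<open>j\<^sup>2 - i\<^sup>2 = (j - i) (j + i)\<close>, the factors with larger
  index \<open>j\<close>, together with one more factor \<open>j\<close>, multiply to
  \<open>(2 j - 1)!\<close>. The factorials for \<open>j\<close> and \<open>2 q + 1 - j\<close> are
  complementary in Wilson's theorem and multiply to 1. So \<open>(2 q)!\<close> times the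
  Vandermonde product is 1, while \<open>(2 q)!\<close> squares to \<open>-1\<close>.\<close>

lemma vdm_squares_cong: "[vdm (2 * q) (\<lambda>i. (int i)\<^sup>2) = - fact (2 * q)] (mod int p)"
proof -
  let ?n = "2 * q"
  have p_m1: "p - Suc 0 = 4 * q" using p_eq by simp
  have step: "int j * (\<Prod>i\<in>{1..<j}. (int j)\<^sup>2 - (int i)\<^sup>2) = fact (2 * j - 1)" if "j \<ge> 1" for j
  proof -
    have "(\<Prod>i\<in>{1..<j}. (int j)\<^sup>2 - (int i)\<^sup>2) = (\<Prod>i\<in>{1..<j}. int j - int i) * (\<Prod>i\<in>{1..<j}. int j + int i)"
      by (simp add: power2_eq_square algebra_simps flip: prod.distrib)
    also have "(\<Prod>i\<in>{1..<j}. int j - int i) = (\<Prod>i\<in>{1..<j}. int i)"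
      by (rule prod.reindex_bij_witness[where i = "\<lambda>i. j - i" and j = "\<lambda>i. j - i"]) (auto simp: of_nat_diff)
    also have "(\<Prod>i\<in>{1..<j}. int j + int i) = (\<Prod>i\<in>{Suc j..2 * j - 1}. int i)"
      by (rule prod.reindex_bij_witness[where i = "\<lambda>i. i - j" and j = "\<lambda>i. j + i"]) auto
    also have "int j * ((\<Prod>i\<in>{1..<j}. int i) * (\<Prod>i\<in>{Suc j..2 * j - 1}. int i)) =
        (\<Prod>i\<in>insert j {1..<j} \<union> {Suc j..2 * j - 1}. int i)"
      by (subst prod.union_disjoint) auto
    also have "insert j {1..<j} \<union> {Suc j..2 * j - 1} = {1..2 * j - 1}" using that by auto
    finally show ?thesis by (simp add: fact_prod)
  qed
  have "vdm ?n (\<lambda>i. (int i)\<^sup>2) = (\<Prod>j\<in>{1..?n}. \<Prod>i\<in>{1..<j}. (int j)\<^sup>2 - (int i)\<^sup>2)"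
    unfolding vdm_def
    by (subst prod.Sigma, simp, simp,
        rule prod.reindex_bij_witness[where i = "\<lambda>(j, i). (i, j)" and j = "\<lambda>(i, j). (j, i)"]) auto
  hence "fact ?n * vdm ?n (\<lambda>i. (int i)\<^sup>2) = (\<Prod>j\<in>{1..?n}. int j * (\<Prod>i\<in>{1..<j}. (int j)\<^sup>2 - (int i)\<^sup>2))"
    by (simp add: fact_prod prod.distrib)
  also have "\<dots> = (\<Prod>j\<in>{1..?n}. fact (2 * j - 1))" by (rule prod.cong) (use step in auto)
  also have "{1..?n} = {1..q} \<union> {q+1..?n}" by auto
  also have "(\<Prod>j\<in>\<dots>. (fact (2 * j - 1) :: int)) = (\<Prod>j\<in>{1..q}. fact (2 * j - 1)) * (\<Prod>j\<in>{q+1..?n}. fact (2 * j - 1))"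
    by (rule prod.union_disjoint) auto
  also have "(\<Prod>j\<in>{q+1..?n}. (fact (2 * j - 1) :: int)) = (\<Prod>j\<in>{1..q}. fact (p - 1 - (2 * j - 1)))"
    by (rule prod.reindex_bij_witness[where i = "\<lambda>j. ?n + 1 - j" and j = "\<lambda>j. ?n + 1 - j"]) (auto intro!: arg_cong[of _ _ fact] simp: p_m1)
  also have "(\<Prod>j\<in>{1..q}. fact (2 * j - 1)) * \<dots> = (\<Prod>j\<in>{1..q}. fact (2 * j - 1) * fact (p - 1 - (2 * j - 1)))"
    by (rule prod.distrib[symmetric])
  also have "[\<dots> = (\<Prod>j\<in>{1..q}. 1)] (mod int p)"
  proof (rule cong_prod)
    fix j assume j: "j \<in> {1..q}"
    hence "even (Suc (2 * j - 1))" "2 * j - 1 \<le> p - 1" using p_eq by auto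
    thus "[fact (2 * j - 1) * fact (p - 1 - (2 * j - 1)) = 1] (mod int p)"
      using wilson_split[of "2 * j - 1"] by (simp only: neg_one_even_power)
  qed
  finally have "[fact ?n * vdm ?n (\<lambda>i. (int i)\<^sup>2) = 1] (mod int p)" by simp
  hence "[- fact ?n * (fact ?n * vdm ?n (\<lambda>i. (int i)\<^sup>2)) = - fact ?n * 1] (mod int p)"
    by (intro cong_mult cong_refl)
  moreover have "[(- ((r_prod * s_prod p)\<^sup>2)) * vdm ?n (\<lambda>i. (int i)\<^sup>2) = - (- 1) * vdm ?n (\<lambda>i. (int i)\<^sup>2)] (mod int p)"
    by (rule cong_mult[OF _ cong_refl]) (use fact_square in \<open>simp only: cong_minus_minus_iff\<close>)
  ultimately show ?thesis
    by (simp add: fact_eq_rs power2_eq_square mult.assoc cong_mod)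
qed

end

subsection \<open>The sign of the permutation\<close>

text \<open>A denominator \<open>d\<close> is allowed because the case of \<open>1 / 2\<close>
  occurs below. For uniqueness, clearing denominators shows that \<open>p\<close> divides the
  difference of two candidates, which is smaller than \<open>p\<close> in absolute value.\<close>

lemma bal_res_eqI:
  assumes "prime p" "2 * \<bar>x\<bar> < int p" "\<not> int p dvd d"
    and "of_int x - a = of_nat p * (of_int c / of_int d)"
  shows "bal_res p a = x"
  unfolding bal_res_def
proof (rule the_equality)
  have "2 * (of_int \<bar>x\<bar> :: rat) < of_nat p"
    using assms(2) by (metis of_int_less_iff of_int_mult of_int_numeral of_int_of_nat_eq)
  hence "\<bar>of_int x :: rat\<bar> < of_nat p / 2" by simp
  hence "(of_int x :: rat) < of_nat p / 2" "- (of_int x :: rat) < of_nat p / 2"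
    by (simp_all only: abs_less_iff)
  thus "- (of_nat p / 2) < (of_int x :: rat) \<and> (of_int x :: rat) < of_nat p / 2 \<and>
    (\<exists>c d. \<not> int p dvd d \<and> of_int x - a = of_nat p * (of_int c / of_int d))"
    using assms(3,4) by (intro conjI exI[of _ c] exI[of _ d]) linarith+
next
  fix y :: int
  assume y: "- (of_nat p / 2) < (of_int y :: rat) \<and> (of_int y :: rat) < of_nat p / 2 \<and>
    (\<exists>c d. \<not> int p dvd d \<and> of_int y - a = of_nat p * (of_int c / of_int d))"
  then obtain c' d' where cd: "\<not> int p dvd d'" "of_int y - a = of_nat p * (of_int c' / of_int d')" by blast
  have d0: "d \<noteq> 0" "d' \<noteq> 0" using assms cd by auto
  have "(of_int (x - y) :: rat) = of_nat p * (of_int c / of_int d) - of_nat p * (of_int c' / of_int d')"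
    using cd(2) assms(4) by simp
  hence "(of_int (x - y) :: rat) * of_int (d * d') = of_nat p * of_int (c * d' - c' * d)"
    using d0 by (simp add: field_simps)
  hence "(of_int ((x - y) * (d * d')) :: rat) = of_int (int p * (c * d' - c' * d))" by simp
  hence "(x - y) * (d * d') = int p * (c * d' - c' * d)" by (simp only: of_int_eq_iff)
  hence "int p dvd (x - y) * (d * d')" by simp
  hence "int p dvd x - y" using assms(1,3) cd(1) by (simp add: prime_dvd_mult_iff)
  moreover have "2 * \<bar>y\<bar> < int p"
  proof -
    have "- (of_nat p :: rat) < 2 * of_int y" "2 * of_int y < (of_nat p :: rat)" using y by auto
    hence "(of_int (- int p) :: rat) < of_int (2 * y)" "(of_int (2 * y) :: rat) < of_int (int p)" by simp_all
    hence "- int p < 2 * y" "2 * y < int p" by (simp_all only: of_int_less_iff)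
    thus ?thesis by simp
  qed
  ultimately show "y = x"
    using assms(2) dvd_imp_le_int[of "x - y" "int p"] by force
qed

lemma bal_res_cong:
  assumes "prime p" "2 * \<bar>x\<bar> < int p" "[x = z] (mod int p)"
  shows "bal_res p (of_int z) = x"
proof -
  obtain k where "x - z = int p * k" using assms(3) by (auto simp: cong_iff_dvd_diff dvd_def)
  hence "(of_int (x - z) :: rat) = of_int (int p * k)" by simp
  thus ?thesis using assms prime_gt_1_nat[of p]
    by (intro bal_res_eqI[of p x 1 _ k]) auto
qed

context prime_1_mod_4
begin

lemma centred: "0 \<le> w \<Longrightarrow> w < int p \<Longrightarrow> 2 * \<bar>w - 2 * int q\<bar> < int p"
  using bounds by arith

lemma bal_res_cong_self: "[bal_res p (of_int z) = z] (mod int p)"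
proof -
  \<comment> \<open>Shifting by \<open>2 q = (p - 1) / 2\<close> around the reduction moves the
    representatives to the interval from \<open>- 2 q\<close> to \<open>2 q\<close>.\<close>
  define x where "x = (z + 2 * int q) mod int p - 2 * int q"
  have "[x = z + 2 * int q - 2 * int q] (mod int p)"
    unfolding x_def by (intro cong_diff cong_refl) simp
  hence xz: "[x = z] (mod int p)" by simp
  have "0 \<le> (z + 2 * int q) mod int p" "(z + 2 * int q) mod int p < int p" using p_gt2 by auto
  hence "2 * \<bar>x\<bar> < int p" unfolding x_def by (rule centred)
  thus ?thesis using bal_res_cong[OF prime_p _ xz] xz by simp
qed

lemma bal_res_eq_iff: "bal_res p (of_int y) = bal_res p (of_int z) \<longleftrightarrow> [y = z] (mod int p)"
proof
  assume "bal_res p (of_int y) = bal_res p (of_int z)"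
  thus "[y = z] (mod int p)" using bal_res_cong_self[of y] bal_res_cong_self[of z] by (simp add: cong_mod)
next
  assume yz: "[y = z] (mod int p)"
  define x where "x = (z + 2 * int q) mod int p - 2 * int q"
  have "[x = z + 2 * int q - 2 * int q] (mod int p)"
    unfolding x_def by (intro cong_diff cong_refl) simp
  hence xz: "[x = z] (mod int p)" by simp
  have "0 \<le> (z + 2 * int q) mod int p" "(z + 2 * int q) mod int p < int p" using p_gt2 by auto
  hence 1: "2 * \<bar>x\<bar> < int p" unfolding x_def by (rule centred)
  have xy: "[x = y] (mod int p)" using xz yz by (simp add: cong_mod)
  show "bal_res p (of_int y) = bal_res p (of_int z)"
    using bal_res_cong[OF prime_p 1 xz] bal_res_cong[OF prime_p 1 xy] by simp
qed

definition res_nth :: "nat \<Rightarrow> int" where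
  "res_nth i = sorted_list_of_set (quad_residues p) ! (i - 1)"

lemma res_nth_mono: "i \<in> {1..2*q} \<Longrightarrow> j \<in> {1..2*q} \<Longrightarrow> i < j \<Longrightarrow> res_nth i < res_nth j"
  using strict_sorted_list_of_set[of "quad_residues p"] card_quad_residues
  unfolding res_nth_def by (intro sorted_wrt_nth_less[of "(<)"]) auto

lemma bij_res_nth: "bij_betw res_nth {1..2*q} (quad_residues p)"
proof -
  have "bij_betw ((!) (sorted_list_of_set (quad_residues p))) {..<2*q} (quad_residues p)"
    using bij_betw_nth[of "sorted_list_of_set (quad_residues p)" "{..<2*q}" "quad_residues p"]
      card_quad_residues finite_quad_residues by simp
  moreover have "bij_betw (\<lambda>i. i - 1) {1..2*q} {..<2*q}"
    by (rule bij_betw_byWitness[where f' = Suc]) auto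
  ultimately have "bij_betw ((!) (sorted_list_of_set (quad_residues p)) \<circ> (\<lambda>i. i - 1)) {1..2*q} (quad_residues p)"
    by (rule bij_betw_trans[rotated])
  thus ?thesis by (simp add: res_nth_def[abs_def] o_def)
qed

lemma vdm_res_nth:
  "vdm (2*q) res_nth = (\<Prod>(x, y) \<in> {(x, y). x \<in> quad_residues p \<and> y \<in> quad_residues p \<and> x < y}. y - x)"
proof -
  let ?I = "{(i, j). 1 \<le> i \<and> i < j \<and> j \<le> 2 * q}"
  let ?P = "{(x, y). x \<in> quad_residues p \<and> y \<in> quad_residues p \<and> x < y}"
  let ?g = "\<lambda>(i, j). (res_nth i, res_nth j)"
  have mono_iff: "res_nth i < res_nth j \<longleftrightarrow> i < j" if "i \<in> {1..2*q}" "j \<in> {1..2*q}" for i j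
    using res_nth_mono[OF that] res_nth_mono[OF that(2,1)] by (cases i j rule: linorder_cases) auto
  have inj: "inj_on res_nth {1..2*q}" and img: "res_nth ` {1..2*q} = quad_residues p"
    using bij_res_nth unfolding bij_betw_def by blast+
  have "bij_betw ?g ?I ?P"
  proof (rule bij_betw_imageI)
    show "inj_on ?g ?I"
      by (rule inj_onI) (auto dest: inj_onD[OF inj])
    show "?g ` ?I = ?P"
    proof (intro equalityI subsetI)
      fix z assume "z \<in> ?g ` ?I"
      then obtain i j where ij: "z = (res_nth i, res_nth j)" "1 \<le> i" "i < j" "j \<le> 2 * q" by auto
      have "i \<in> {1..2*q}" "j \<in> {1..2*q}" using ij by auto
      thus "z \<in> ?P" using ij img res_nth_mono[of i j] by auto
    next
      fix z assume "z \<in> ?P"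
      then obtain x y where xy: "z = (x, y)" "x \<in> quad_residues p" "y \<in> quad_residues p" "x < y" by auto
      obtain i j where ij: "i \<in> {1..2*q}" "j \<in> {1..2*q}" "x = res_nth i" "y = res_nth j"
        using xy(2,3) unfolding img[symmetric] by blast
      have "i < j" using mono_iff[of i j] ij xy by simp
      hence "(i, j) \<in> ?I" using ij by auto
      moreover have "z = ?g (i, j)" using xy ij by simp
      ultimately show "z \<in> ?g ` ?I" by blast
    qed
  qed
  from prod.reindex_bij_betw[OF this, of "\<lambda>(x, y). y - x"] show ?thesis
    unfolding vdm_def by (simp add: case_prod_beta)
qed

text \<open>Balanced residues agree exactly for congruent integers, so the sequences may be compared
  through representatives in \<open>{1..int p - 1}\<close>. The permutation sends \<open>i\<close>
  to the position of \<open>i\<^sup>2 mod p\<close> among the sorted residues, and injectivity of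
  \<open>res_nth\<close> makes it unique.\<close>

lemma sigma01_spec:
  "sigma01 p permutes {1..2*q}"
  "i \<in> {1..2*q} \<Longrightarrow> res_nth (sigma01 p i) = (int i)\<^sup>2 mod int p"
proof -
  let ?I = "{1..2*q}"
  define sq where "sq = (\<lambda>i. (int i)\<^sup>2 mod int p)"
  define \<pi> where "\<pi> = (\<lambda>i. if i \<in> ?I then inv_into ?I res_nth (sq i) else i)"
  have sqQ: "sq i \<in> quad_residues p" if "i \<in> ?I" for i
    using bij_squares that unfolding sq_def bij_betw_def by blast
  have inj: "inj_on res_nth ?I" and img: "res_nth ` ?I = quad_residues p"
    using bij_res_nth unfolding bij_betw_def by blast+
  have \<pi>: "res_nth (\<pi> i) = sq i" "\<pi> i \<in> ?I" if "i \<in> ?I" for i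
    using f_inv_into_f[of "sq i" res_nth ?I] inv_into_into[of "sq i" res_nth ?I] sqQ[OF that] img that
    by (simp_all only: \<pi>_def if_True)
  have "bij_betw (inv_into ?I res_nth \<circ> sq) ?I ?I"
    using bij_squares bij_betw_inv_into[OF bij_res_nth] unfolding sq_def by (rule bij_betw_trans)
  hence "bij_betw \<pi> ?I ?I" by (rule iffD1[OF bij_betw_cong, rotated]) (simp add: \<pi>_def)
  hence perm: "\<pi> permutes ?I" by (rule bij_imp_permutes) (auto simp: \<pi>_def)
  have char: "seq_A0 p i = seq_A1 p j \<longleftrightarrow> res_nth j = sq i" if "i \<in> ?I" "j \<in> ?I" for i j
  proof -
    have "seq_A0 p i = bal_res p (of_int ((int i)\<^sup>2))" by (simp add: seq_A0_def)
    hence "seq_A0 p i = seq_A1 p j \<longleftrightarrow> [(int i)\<^sup>2 = res_nth j] (mod int p)"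
      by (simp only: seq_A1_def bal_res_eq_iff flip: res_nth_def)
    moreover have "res_nth j \<in> {1..int p - 1}" using img that quad_residues_alt by blast
    hence "res_nth j mod int p = res_nth j" by simp
    ultimately show ?thesis unfolding sq_def cong_mod by auto
  qed
  have "sigma01 p = \<pi>"
    unfolding sigma01_def half
  proof (rule the_equality)
    show "\<pi> permutes ?I \<and> (\<forall>i\<in>?I. seq_A0 p i = seq_A1 p (\<pi> i))" using perm char \<pi> by blast
  next
    fix \<rho> assume \<rho>: "\<rho> permutes ?I \<and> (\<forall>i\<in>?I. seq_A0 p i = seq_A1 p (\<rho> i))"
    show "\<rho> = \<pi>"
    proof
      fix i
      show "\<rho> i = \<pi> i"
      proof (cases "i \<in> ?I")
        case True
        hence ri: "\<rho> i \<in> ?I" using \<rho> permutes_in_image[of \<rho> ?I i] by blast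
        hence "res_nth (\<rho> i) = res_nth (\<pi> i)" using True \<rho> char[OF True ri] \<pi>(1)[OF True] by simp
        thus ?thesis using inj ri \<pi>(2)[OF True] by (simp only: inj_on_eq_iff)
      next
        case False
        thus ?thesis using \<rho> perm permutes_not_in[of \<rho> ?I i] permutes_not_in[of \<pi> ?I i] by simp
      qed
    qed
  qed
  thus "sigma01 p permutes ?I" "i \<in> ?I \<Longrightarrow> res_nth (sigma01 p i) = (int i)\<^sup>2 mod int p"
    using perm \<pi> by (simp_all add: sq_def)
qed

text \<open>The Vandermonde product of the squares is computed twice: through the sorted residues
  composed with \<open>sigma01 p\<close>, which brings in the sign, and directly through the
  factorial formula.\<close>

lemma sign_sigma01_cong:
  "[sign (sigma01 p) * ((-1) ^ r_star p * r_prod ^ (q - 1) * s_prod p ^ q) = - (r_prod * s_prod p)] (mod int p)"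
proof -
  have 1: "vdm (2*q) (res_nth \<circ> sigma01 p) = sign (sigma01 p) * vdm (2*q) res_nth"
    by (rule vdm_permutes[OF sigma01_spec(1)])
  have 2: "vdm (2*q) (res_nth \<circ> sigma01 p) = vdm (2*q) (\<lambda>i. (int i)\<^sup>2 mod int p)"
    unfolding vdm_def by (rule prod.cong) (auto simp: sigma01_spec(2))
  have 3: "[vdm (2*q) (\<lambda>i. (int i)\<^sup>2 mod int p) = vdm (2*q) (\<lambda>i. (int i)\<^sup>2)] (mod int p)"
    unfolding vdm_def by (rule cong_prod) (auto intro!: cong_diff)
  have 4: "[sign (sigma01 p) * vdm (2*q) res_nth = - (r_prod * s_prod p)] (mod int p)"
    using cong_trans[OF 3 vdm_squares_cong] unfolding 1[symmetric] 2 fact_eq_rs .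
  have 5: "[sign (sigma01 p) * vdm (2*q) res_nth =
      sign (sigma01 p) * ((-1) ^ r_star p * r_prod ^ (q - 1) * s_prod p ^ q)] (mod int p)"
    unfolding vdm_res_nth by (rule cong_mult[OF cong_refl prod_differences_cong])
  show ?thesis by (rule cong_trans[OF cong_sym[OF 5] 4])
qed

lemma not_dvd_rs: "\<not> int p dvd r_prod" "\<not> int p dvd s_prod p"
proof -
  have "\<not> int p dvd (r_prod * s_prod p)\<^sup>2"
  proof
    assume "int p dvd (r_prod * s_prod p)\<^sup>2"
    hence "[-1 = 0] (mod int p)" using fact_square by (simp add: cong_mod)
    thus False using p_gt2 by (simp add: cong_iff_dvd_diff)
  qed
  thus "\<not> int p dvd r_prod" "\<not> int p dvd s_prod p" by (auto simp: power2_eq_square)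
qed

text \<open>With \<open>I = (2 q)!\<close>, a square root of \<open>-1\<close>, one has
  \<open>(1 + I)\<^sup>2 = 2 I\<close>. Hence 2 and \<open>I\<close> have the same symbol, and
  Euler's criterion evaluates it as \<open>I ^ (2 q) = (-1) ^ q\<close>.\<close>

lemma L_2: "L 2 = (-1) ^ q"
proof -
  define I where "I = r_prod * s_prod p"
  have I2: "[I\<^sup>2 = -1] (mod int p)" unfolding I_def by (rule fact_square)
  have nd: "\<not> int p dvd I" using not_dvd_rs prime_int_p by (simp add: I_def prime_dvd_mult_iff)
  have n2: "\<not> int p dvd 2" by (rule not_dvd_range) (use p_gt2 in auto)
  have "[(1 + I) * (1 + I) = 2 * I] (mod int p)"
  proof -
    have "(1 + I) * (1 + I) - 2 * I = I\<^sup>2 - (-1)" by (simp add: power2_eq_square algebra_simps)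
    thus ?thesis using I2 by (simp only: cong_iff_dvd_diff)
  qed
  hence "L (1 + I) * L (1 + I) = L 2 * L I" unfolding L_mult[symmetric] by (rule Legendre_cong)
  moreover have "L 2 \<noteq> 0" "L I \<noteq> 0" using nd n2 by (simp_all add: L_0_iff)
  ultimately have e: "L 2 = L I"
    using Legendre_values[of "1 + I" p] Legendre_values[of 2 p] Legendre_values[of I p] by auto
  have "[L I = (I\<^sup>2) ^ q] (mod int p)" using euler[of I] by (simp add: power_mult)
  also have "[(I\<^sup>2) ^ q = (-1) ^ q] (mod int p)" by (rule cong_pow[OF I2])
  finally have "[L I = (-1) ^ q] (mod int p)" .
  hence "L I = (-1) ^ q"
    by (rule cong_small_imp_eq) (use p_gt2 Legendre_values[of I p] in \<open>cases "even q"; auto\<close>)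
  thus ?thesis using e by simp
qed

lemma cong_sign_cancel:
  assumes "[(-1) ^ k * a = b] (mod int p)"
  shows "[a = (-1) ^ k * b] (mod int p)"
proof -
  have "[(-1) ^ k * ((-1) ^ k * a) = (-1) ^ k * b] (mod int p)" by (rule cong_mult[OF cong_refl assms])
  thus ?thesis by (simp flip: mult.assoc power_add)
qed

lemma sign_abs: "2 * \<bar>sign \<pi> * (-1) ^ k\<bar> < int p"
  using p_gt2 by (simp add: abs_mult)

lemma four_power: "(-4) ^ k = (-1) ^ k * (2::int) ^ (2 * k)"
  by (simp add: power_mult flip: power_mult_distrib)

text \<open>Here \<open>R\<^sup>2 = -1\<close> and \<open>S\<^sup>2 = 1\<close>, so multiplying the
  sign relation by \<open>R\<close> makes the sign times \<open>(-1) ^ r_star p\<close> congruent to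
  \<open>(-1) ^ m * S\<close>. Doubling preserves residues because \<open>L 2 = 1\<close>, and
  cancelling \<open>R\<close> gives \<open>2 ^ q = (-1) ^ N4\<close>; thus \<open>u ^ q\<close>
  contributes \<open>(-1) ^ (m + N4)\<close>.\<close>

theorem sign_sigma01_1_mod_8:
  assumes q: "q = 2 * m" and u: "[u\<^sup>2 = -4] (mod int p)" and h: "odd h" and hm: "hm + 4 * N4 = 2 * q"
  shows "sign (sigma01 p) = bal_res p (of_int (s_prod p) * of_int u ^ q) *
      (-1) ^ (((h + 2) * (p - 1) + 2 * hm) div 8 + r_star p)"
proof -
  define R S sg where "R = r_prod" and "S = s_prod p" and "sg = sign (sigma01 p)"
  have m: "m > 0" using q q_pos by simp
  have R2: "[R\<^sup>2 = -1] (mod int p)" using r_prod_square by (simp add: R_def q)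
  have S2: "[S\<^sup>2 = 1] (mod int p)" using s_prod_square by (simp add: S_def q)
  have "[(R\<^sup>2) ^ m = (-1) ^ m] (mod int p)" by (rule cong_pow[OF R2])
  moreover have "(R\<^sup>2) ^ m = R * R ^ (q - 1)" using m q by (simp flip: power_mult power_Suc)
  ultimately have Rm: "[R * R ^ (q - 1) = (-1) ^ m] (mod int p)" by simp
  have "[(S\<^sup>2) ^ m = 1 ^ m] (mod int p)" by (rule cong_pow[OF S2])
  hence Sm: "[S ^ q = 1] (mod int p)" by (simp add: q power_mult)
  have "[sg * ((-1) ^ r_star p * R ^ (q - 1) * S ^ q) = - (R * S)] (mod int p)"
    unfolding R_def S_def sg_def by (rule sign_sigma01_cong)
  hence "[R * (sg * ((-1) ^ r_star p * R ^ (q - 1) * S ^ q)) = R * (- (R * S))] (mod int p)"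
    by (rule cong_mult[OF cong_refl])
  moreover have "R * (sg * ((-1) ^ r_star p * R ^ (q - 1) * S ^ q)) = sg * (-1) ^ r_star p * (R * R ^ (q - 1) * S ^ q)"
    by (simp only: mult_ac)
  moreover have "R * (- (R * S)) = R\<^sup>2 * - S" by (simp add: power2_eq_square)
  moreover have "[R\<^sup>2 * - S = -1 * - S] (mod int p)" by (rule cong_mult[OF R2 cong_refl])
  moreover have "[sg * (-1) ^ r_star p * (R * R ^ (q - 1) * S ^ q) = sg * (-1) ^ r_star p * ((-1) ^ m * 1)] (mod int p)"
    by (rule cong_mult[OF cong_refl cong_mult[OF Rm Sm]])
  ultimately have "[sg * (-1) ^ r_star p * ((-1) ^ m * 1) = -1 * - S] (mod int p)" by (simp only: cong_mod)
  hence "[(-1) ^ m * (sg * (-1) ^ r_star p) = S] (mod int p)" by (simp add: mult_ac)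
  hence A: "[sg * (-1) ^ r_star p = (-1) ^ m * S] (mod int p)" by (rule cong_sign_cancel)
  have L2: "L 2 = 1" by (simp add: L_2 q)
  have "[R = (-1) ^ N4 * 2 ^ q * R] (mod int p)"
    using half_system_times_two unfolding L2 r_prod_def[symmetric] R_def .
  hence "[R * 1 = R * ((-1) ^ N4 * 2 ^ q)] (mod int p)" by (simp add: mult_ac)
  hence "[1 = (-1) ^ N4 * 2 ^ q] (mod int p)" using not_dvd_rs(1) unfolding R_def by (rule cong_cancel)
  hence "[(-1) ^ N4 * 2 ^ q = 1] (mod int p)" by (rule cong_sym)
  hence "[2 ^ q = (-1) ^ N4 * 1] (mod int p)" by (rule cong_sign_cancel)
  hence T: "[2 ^ q = (-1) ^ N4] (mod int p)" by simp
  have "[(u\<^sup>2) ^ m = (-4) ^ m] (mod int p)" by (rule cong_pow[OF u])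
  hence U: "[u ^ q = (-1) ^ m * 2 ^ q] (mod int p)" by (simp add: q power_mult four_power[of m])
  have "[(-1) ^ N4 * (sg * (-1) ^ r_star p) = (-1) ^ N4 * ((-1) ^ m * S)] (mod int p)"
    by (rule cong_mult[OF cong_refl A])
  moreover have "[S * u ^ q = S * ((-1) ^ m * 2 ^ q)] (mod int p)" by (rule cong_mult[OF cong_refl U])
  moreover have "[S * ((-1) ^ m * 2 ^ q) = S * ((-1) ^ m * (-1) ^ N4)] (mod int p)"
    by (rule cong_mult[OF cong_refl cong_mult[OF cong_refl T]])
  moreover have "S * ((-1) ^ m * (-1) ^ N4) = (-1) ^ N4 * ((-1) ^ m * S)" by simp
  moreover have "(-1) ^ N4 * (sg * (-1) ^ r_star p) = sg * (-1) ^ (N4 + r_star p)" by (simp add: power_add)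
  ultimately have "[sg * (-1) ^ (N4 + r_star p) = S * u ^ q] (mod int p)" by (simp only: cong_mod)
  hence B: "bal_res p (of_int (S * u ^ q)) = sg * (-1) ^ (N4 + r_star p)"
    unfolding sg_def by (intro bal_res_cong[OF prime_p sign_abs])
  \<comment> \<open>Here \<open>p - 1 = 8 m\<close> and \<open>hm = 4 (m - N4)\<close>. As
    \<open>h\<close> is odd, \<open>(h + 2) m\<close> and \<open>m\<close> have the same parity, and
    only the parity of \<open>N4\<close> survives.\<close>
  have "((h + 2) * (p - 1) + 2 * hm) = 8 * ((h + 2) * m + (m - N4))"
    using hm by (simp add: p_eq q algebra_simps)
  hence E: "((h + 2) * (p - 1) + 2 * hm) div 8 = (h + 2) * m + (m - N4)" by simp
  have "N4 \<le> m" using hm q by simp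
  hence "even ((h + 2) * m + (m - N4)) \<longleftrightarrow> even N4" using h by auto
  hence "(-1 :: int) ^ (((h + 2) * (p - 1) + 2 * hm) div 8 + r_star p) = (-1) ^ (N4 + r_star p)"
    unfolding E by (simp add: minus_one_power_iff)
  thus ?thesis using B by (simp add: S_def sg_def mult.assoc flip: power_add)
qed

text \<open>Now \<open>R\<^sup>2 = 1\<close> and \<open>S\<^sup>2 = -1\<close>, and cancelling
  \<open>S\<close> in the sign relation leaves \<open>R\<close> on the right. Doubling sends
  residues to nonresidues because \<open>L 2 = -1\<close>, which gives
  \<open>2 ^ q = (-1) ^ N4 * (R * S)\<close> and converts \<open>R\<close> into \<open>S\<close>. As
  \<open>u ^ (q + 1) = (-4) ^ (m + 1)\<close>, it equals \<open>2 * 2 ^ q\<close> up to sign; this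
  is the 2 that the factor \<open>1 / 2\<close> removes.\<close>

theorem sign_sigma01_5_mod_8:
  assumes q: "q = 2 * m + 1" and u: "[u\<^sup>2 = -4] (mod int p)" and h: "odd h" and hm: "hm + 4 * N4 = 2 * q"
  shows "sign (sigma01 p) = bal_res p (1 / 2 * of_int (s_prod p) * of_int u ^ (q + 1)) *
      (-1) ^ (((h + 2) * (p + 3) + 2 * hm - 4) div 8 + r_star p)"
proof -
  define R S sg where "R = r_prod" and "S = s_prod p" and "sg = sign (sigma01 p)"
  have R2: "[R\<^sup>2 = 1] (mod int p)" using r_prod_square by (simp add: R_def q)
  have S2: "[S\<^sup>2 = -1] (mod int p)" using s_prod_square by (simp add: S_def q)
  have "[(R\<^sup>2) ^ m = 1 ^ m] (mod int p)" by (rule cong_pow[OF R2])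
  hence Rm: "[R ^ (q - 1) = 1] (mod int p)" by (simp add: q power_mult)
  have Sm: "[(S\<^sup>2) ^ m = (-1) ^ m] (mod int p)" by (rule cong_pow[OF S2])
  have "[sg * ((-1) ^ r_star p * R ^ (q - 1) * S ^ q) = - (R * S)] (mod int p)"
    unfolding R_def S_def sg_def by (rule sign_sigma01_cong)
  moreover have "sg * ((-1) ^ r_star p * R ^ (q - 1) * S ^ q) = S * (sg * (-1) ^ r_star p * (R ^ (q - 1) * (S\<^sup>2) ^ m))"
  proof -
    have "S ^ q = (S\<^sup>2) ^ m * S" unfolding q power_add power_mult power_one_right ..
    thus ?thesis by (simp only: mult_ac)
  qed
  moreover have "- (R * S) = S * - R" by simp
  ultimately have "[S * (sg * (-1) ^ r_star p * (R ^ (q - 1) * (S\<^sup>2) ^ m)) = S * - R] (mod int p)" by argo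
  hence "[sg * (-1) ^ r_star p * (R ^ (q - 1) * (S\<^sup>2) ^ m) = - R] (mod int p)"
    using not_dvd_rs(2) unfolding S_def by (rule cong_cancel)
  moreover have "[sg * (-1) ^ r_star p * (R ^ (q - 1) * (S\<^sup>2) ^ m) = sg * (-1) ^ r_star p * (1 * (-1) ^ m)] (mod int p)"
    by (rule cong_mult[OF cong_refl cong_mult[OF Rm Sm]])
  ultimately have "[sg * (-1) ^ r_star p * (1 * (-1) ^ m) = - R] (mod int p)" by (simp only: cong_mod)
  hence "[(-1) ^ m * (sg * (-1) ^ r_star p) = - R] (mod int p)" by (simp add: mult_ac)
  hence A: "[sg * (-1) ^ r_star p = (-1) ^ m * - R] (mod int p)" by (rule cong_sign_cancel)
  have L2: "L 2 = -1" by (simp add: L_2 q)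
  have "[S = (-1) ^ N4 * 2 ^ q * R] (mod int p)"
    using half_system_times_two unfolding L2 s_prod_alt[symmetric] R_def S_def .
  hence "[R * S = R * ((-1) ^ N4 * 2 ^ q * R)] (mod int p)" by (rule cong_mult[OF cong_refl])
  moreover have "R * ((-1) ^ N4 * 2 ^ q * R) = R\<^sup>2 * ((-1) ^ N4 * 2 ^ q)" by (simp add: power2_eq_square)
  moreover have "[R\<^sup>2 * ((-1) ^ N4 * 2 ^ q) = 1 * ((-1) ^ N4 * 2 ^ q)] (mod int p)" by (rule cong_mult[OF R2 cong_refl])
  ultimately have "[(-1) ^ N4 * 2 ^ q = R * S] (mod int p)" by (simp add: cong_mod)
  hence T: "[2 ^ q = (-1) ^ N4 * (R * S)] (mod int p)" by (rule cong_sign_cancel)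
  have "[(u\<^sup>2) ^ (m + 1) = (-4) ^ (m + 1)] (mod int p)" by (rule cong_pow[OF u])
  moreover have "(u\<^sup>2) ^ (m + 1) = u ^ (q + 1)" by (simp only: q power_mult[symmetric]) simp
  moreover have "(-4) ^ (m + 1) = (-1) ^ (m + 1) * (2 * (2::int) ^ q)"
    unfolding four_power by (simp add: q)
  ultimately have U: "[u ^ (q + 1) = (-1) ^ (m + 1) * (2 * 2 ^ q)] (mod int p)" by (simp only:)
  define x where "x = sg * (-1) ^ (N4 + 1 + r_star p)"
  have "[S * u ^ (q + 1) = S * ((-1) ^ (m + 1) * (2 * 2 ^ q))] (mod int p)" by (rule cong_mult[OF cong_refl U])
  moreover have "[S * ((-1) ^ (m + 1) * (2 * 2 ^ q)) = S * ((-1) ^ (m + 1) * (2 * ((-1) ^ N4 * (R * S))))] (mod int p)"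
    by (rule cong_mult[OF cong_refl cong_mult[OF cong_refl cong_mult[OF cong_refl T]]])
  moreover have "S * ((-1) ^ (m + 1) * (2 * ((-1) ^ N4 * (R * S)))) = S\<^sup>2 * ((-1) ^ (m + 1) * (2 * (-1) ^ N4 * R))"
    by (simp add: power2_eq_square)
  moreover have "[S\<^sup>2 * ((-1) ^ (m + 1) * (2 * (-1) ^ N4 * R)) = -1 * ((-1) ^ (m + 1) * (2 * (-1) ^ N4 * R))] (mod int p)"
    by (rule cong_mult[OF S2 cong_refl])
  moreover have "-1 * ((-1) ^ (m + 1) * (2 * (-1) ^ N4 * R)) = 2 * (-1) ^ (N4 + 1) * ((-1) ^ m * - R)" by simp
  moreover have "[2 * (-1) ^ (N4 + 1) * (sg * (-1) ^ r_star p) = 2 * (-1) ^ (N4 + 1) * ((-1) ^ m * - R)] (mod int p)"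
    by (rule cong_mult[OF cong_refl A])
  moreover have "2 * (-1) ^ (N4 + 1) * (sg * (-1) ^ r_star p) = 2 * x" unfolding x_def by (simp add: power_add)
  ultimately have "[2 * x = S * u ^ (q + 1)] (mod int p)" by (simp only: cong_mod)
  then obtain c where "2 * x - S * u ^ (q + 1) = int p * c" by (auto simp: cong_iff_dvd_diff dvd_def)
  hence "(of_int (2 * x - S * u ^ (q + 1)) :: rat) = of_int (int p * c)" by simp
  hence c: "(2 * of_int x - of_int S * of_int u ^ (q + 1) :: rat) = of_nat p * of_int c" by simp
  \<comment> \<open>The denominator 2, prime to \<open>p\<close>, certifies the balanced residue of
    a half-integer.\<close>
  have "(of_int x - 1 / 2 * of_int S * of_int u ^ (q + 1) :: rat) = of_nat p * (of_int c / of_int 2)"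
    using c by (simp add: field_simps)
  hence B: "bal_res p (1 / 2 * of_int S * of_int u ^ (q + 1)) = x"
    using prime_p sign_abs[of "sigma01 p"] not_dvd_range[of 2] p_gt2
    unfolding x_def sg_def by (intro bal_res_eqI[of p _ 2]) auto
  have Nm: "N4 \<le> m" using hm q by simp
  \<comment> \<open>The remainder 2 makes \<open>2 * hm - 4\<close> equal to
    \<open>8 (m - N4)\<close>, so the subtraction in the exponent does not truncate and the division
    by 8 is exact.\<close>
  have hm': "hm = 4 * (m - N4) + 2" using hm Nm q by simp
  have p3: "p + 3 = 8 * (m + 1)" by (simp add: p_eq q)
  have "((h + 2) * (p + 3) + 2 * hm - 4) = 8 * ((h + 2) * (m + 1) + (m - N4))"
    unfolding hm' p3 by (simp add: algebra_simps)
  hence E: "((h + 2) * (p + 3) + 2 * hm - 4) div 8 = (h + 2) * (m + 1) + (m - N4)" by simp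
  have "even ((h + 2) * (m + 1) + (m - N4)) \<longleftrightarrow> even (N4 + 1)" using h Nm by auto
  hence "(-1 :: int) ^ (((h + 2) * (p + 3) + 2 * hm - 4) div 8 + r_star p) = (-1) ^ (N4 + 1 + r_star p)"
    unfolding E by (simp add: minus_one_power_iff)
  thus ?thesis using B by (simp add: x_def S_def sg_def mult.assoc flip: power_add)
qed

end

subsection \<open>Quadratic orders and their ideals\<close>

lemma int_subgroup_generator:
  fixes S :: "int set"
  assumes sub: "\<And>x y. x \<in> S \<Longrightarrow> y \<in> S \<Longrightarrow> x - y \<in> S" and "x0 \<in> S" "x0 \<noteq> 0"
  shows "\<exists>g>0. \<forall>x. x \<in> S \<longleftrightarrow> g dvd x"
proof -
  have z: "0 \<in> S" using sub[OF \<open>x0 \<in> S\<close> \<open>x0 \<in> S\<close>] by simp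
  have neg: "- x \<in> S" if "x \<in> S" for x using sub[OF z that] by simp
  have add: "x + y \<in> S" if "x \<in> S" "y \<in> S" for x y using sub[OF that(1) neg[OF that(2)]] by simp
  have ex: "\<exists>n::nat. n > 0 \<and> int n \<in> S"
    using assms(2,3) neg[OF assms(2)] by (intro exI[of _ "nat \<bar>x0\<bar>"]) (auto simp: abs_if)
  define n where "n = (LEAST n::nat. n > 0 \<and> int n \<in> S)"
  have n: "n > 0" "int n \<in> S" using LeastI_ex[OF ex] by (auto simp: n_def)
  have nat_mult: "int n * int k \<in> S" for k
  proof (induction k)
    case (Suc k) thus ?case using add[OF Suc n(2)] by (simp add: algebra_simps)
  qed (use z in simp)
  have mult: "int n * k \<in> S" for k
  proof (cases "k \<ge> 0")
    case True thus ?thesis using nat_mult[of "nat k"] by simp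
  next
    case False thus ?thesis using neg[OF nat_mult[of "nat (- k)"]] by simp
  qed
  have "int n dvd x" if "x \<in> S" for x
  proof (rule ccontr)
    assume "\<not> int n dvd x"
    hence r: "x mod int n \<noteq> 0" by (simp add: dvd_eq_mod_eq_0)
    have "x mod int n = x - int n * (x div int n)" by (simp add: minus_mult_div_eq_mod)
    hence "x mod int n \<in> S" using sub[OF that mult] by simp
    moreover have "0 \<le> x mod int n" "x mod int n < int n" using n by auto
    ultimately have "nat (x mod int n) > 0 \<and> int (nat (x mod int n)) \<in> S" "nat (x mod int n) < n"
      using r by auto
    thus False using not_less_Least[of "nat (x mod int n)"] unfolding n_def by blast
  qed
  moreover have "x \<in> S" if "int n dvd x" for x using that mult by (auto elim!: dvdE)
  ultimately show ?thesis using n by (intro exI[of _ "int n"]) auto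
qed

text \<open>If \<open>r\<close> has reduced denominator \<open>b\<close>, every power of
  \<open>b\<close> divides \<open>D\<close>, which forces \<open>b = 1\<close>.\<close>

lemma bounded_denominator_imp_int:
  fixes r :: rat and D :: int
  assumes "D > 0" and "\<And>k. of_int D * r ^ k \<in> \<int>"
  shows "r \<in> \<int>"
proof -
  obtain a b where ab: "quotient_of r = (a, b)" by force
  have r: "r = of_int a / of_int b" and b: "b > 0" and cop: "coprime a b"
    using quotient_of_div[OF ab] quotient_of_denom_pos[OF ab] quotient_of_coprime[OF ab] by auto
  have "b ^ k dvd D" for k
  proof -
    obtain z where z: "of_int D * r ^ k = of_int z" using assms(2)[of k] by (auto elim: Ints_cases)
    hence "(of_int (D * a ^ k) :: rat) = of_int (z * b ^ k)"
      using b by (simp add: r field_simps)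
    hence "D * a ^ k = z * b ^ k" by (simp only: of_int_eq_iff)
    hence "b ^ k dvd D * a ^ k" by simp
    moreover have "coprime (b ^ k) (a ^ k)" using cop by (simp add: coprime_commute)
    ultimately show ?thesis by (simp add: coprime_dvd_mult_left_iff)
  qed
  hence le: "b ^ k \<le> D" for k using assms(1) zdvd_imp_le by blast
  have "b = 1"
  proof (rule ccontr)
    assume "b \<noteq> 1"
    hence "(2::int) ^ nat D \<le> b ^ nat D" using b by (intro power_mono) auto
    moreover have "int (nat D) < 2 ^ nat D" by (rule of_nat_less_two_power)
    ultimately show False using le[of "nat D"] assms(1) by simp
  qed
  thus ?thesis by (simp add: r)
qed

text \<open>This avoids minimal polynomials: integrality of \<open>x\<close> gives one denominator
  \<open>D\<close> such that all \<open>D x ^ k\<close> lie in the lattice spanned by 1 and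
  \<open>w\<close>. The norm is multiplicative, so its powers have a bounded denominator and it is
  an integer. The norm of \<open>x + 1\<close> is an integer for the same reason, and the difference
  yields the trace \<open>2 a\<close>.\<close>

lemma quadratic_algebraic_int:
  fixes d :: int and a b :: rat and w :: complex
  assumes w: "w * w = of_int d" and irr: "\<And>a b :: rat. of_rat a + of_rat b * w = 0 \<Longrightarrow> a = 0 \<and> b = 0"
    and "algebraic_int (of_rat a + of_rat b * w)"
  shows "2 * a \<in> \<int>" "a\<^sup>2 - of_int d * b\<^sup>2 \<in> \<int>"
proof -
  define el where "el = (\<lambda>u v. of_rat u + of_rat v * w :: complex)"
  define lat where "lat = {el (of_int u) (of_int v) | u v. True}"
  have el_inj: "el u v = el u' v' \<longleftrightarrow> u = u' \<and> v = v'" for u v u' v'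
    using irr[of "u - u'" "v - v'"] by (auto simp: el_def of_rat_diff algebra_simps)
  have el_mult: "el u v * el u' v' = el (u * u' + of_int d * v * v') (u * v' + v * u')" for u v u' v'
  proof -
    have "el u v * el u' v' = of_rat (u * u') + of_rat v * of_rat v' * (w * w) + of_rat (u * v' + v * u') * w"
      by (simp add: el_def of_rat_mult of_rat_add algebra_simps)
    thus ?thesis unfolding w by (simp add: el_def of_rat_mult of_rat_add algebra_simps)
  qed
  have el_add: "el u v + el u' v' = el (u + u') (v + v')" for u v u' v'
    by (simp add: el_def of_rat_add algebra_simps)
  have latI: "el (of_int u) (of_int v) \<in> lat" for u v by (auto simp: lat_def)
  have lat_add: "x + y \<in> lat" if xy: "x \<in> lat" "y \<in> lat" for x y
  proof -
    obtain u v u' v' where "x = el (of_int u) (of_int v)" "y = el (of_int u') (of_int v')"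
      using xy unfolding lat_def by blast
    hence "x + y = el (of_int (u + u')) (of_int (v + v'))" by (simp add: el_add)
    thus ?thesis using latI by metis
  qed
  have lat_mult: "x * y \<in> lat" if xy: "x \<in> lat" "y \<in> lat" for x y
  proof -
    obtain u v u' v' where "x = el (of_int u) (of_int v)" "y = el (of_int u') (of_int v')"
      using xy unfolding lat_def by blast
    hence "x * y = el (of_int (u * u' + d * v * v')) (of_int (u * v' + v * u'))" by (simp add: el_mult)
    thus ?thesis using latI by metis
  qed
  have lat_int: "of_int k \<in> lat" for k
    unfolding lat_def by (rule CollectI, rule exI[of _ k], rule exI[of _ 0]) (simp add: el_def)
  have lat_sum: "(\<Sum>i\<in>A. f i) \<in> lat" if "\<And>i. i \<in> A \<Longrightarrow> f i \<in> lat" for A :: "nat set" and f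
    using that by (induction A rule: infinite_finite_induct) (use lat_int[of 0] lat_add in auto)
  \<comment> \<open>\<open>D * D\<close> is a common denominator of all powers of the norm, because
    the norm of \<open>D z ^ k\<close> is an integer.\<close>
  have key: "N \<in> \<int>" if z: "z = el u v" and N: "N = u\<^sup>2 - of_int d * v\<^sup>2"
    and D: "D > 0" "\<And>k. of_int D * z ^ k \<in> lat" for z u v N D
  proof (rule bounded_denominator_imp_int[of "D * D"])
    show "D * D > 0" using D by simp
    fix k
    have pw: "\<exists>u' v'. z ^ k = el u' v' \<and> u'\<^sup>2 - of_int d * v'\<^sup>2 = N ^ k"
    proof (induction k)
      case 0
      have "(1::complex) = el 1 0" by (simp add: el_def)
      thus ?case by (intro exI[of _ 1] exI[of _ 0]) simp
    next
      case (Suc k)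
      then obtain u' v' where IH: "z ^ k = el u' v'" "u'\<^sup>2 - of_int d * v'\<^sup>2 = N ^ k" by blast
      have "z ^ Suc k = el (u * u' + of_int d * v * v') (u * v' + v * u')"
        using IH z by (simp add: el_mult)
      moreover have "(u * u' + of_int d * v * v')\<^sup>2 - of_int d * (u * v' + v * u')\<^sup>2 =
          (u\<^sup>2 - of_int d * v\<^sup>2) * (u'\<^sup>2 - of_int d * v'\<^sup>2)"
        by (simp add: power2_eq_square algebra_simps)
      ultimately show ?case using IH N by (metis power_Suc)
    qed
    then obtain u' v' where uv: "z ^ k = el u' v'" "u'\<^sup>2 - of_int d * v'\<^sup>2 = N ^ k" by blast
    obtain x y where xy: "of_int D * z ^ k = el (of_int x) (of_int y)" using D(2)[of k] by (auto simp: lat_def)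
    have "of_int D * z ^ k = el (of_int D * u') (of_int D * v')"
      unfolding uv by (simp add: el_def of_rat_mult algebra_simps)
    hence "of_int D * u' = of_int x" "of_int D * v' = of_int y" using xy el_inj by auto
    hence "(of_int D * u')\<^sup>2 - of_int d * (of_int D * v')\<^sup>2 = of_int (x\<^sup>2 - d * y\<^sup>2)" by simp
    moreover have "(of_int D * u')\<^sup>2 - of_int d * (of_int D * v')\<^sup>2 = of_int (D * D) * N ^ k"
      unfolding uv(2)[symmetric] by (simp add: power2_eq_square algebra_simps)
    ultimately show "of_int (D * D) * N ^ k \<in> \<int>" by (metis Ints_of_int)
  qed
  define x where "x = el a b"
  obtain P where P: "poly (map_poly of_int P) x = 0" "lead_coeff P = 1"
    using assms(3) unfolding algebraic_int_altdef_ipoly x_def el_def by blast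
  define n where "n = degree P"
  obtain a1 a2 where qa: "quotient_of a = (a1, a2)" by force
  obtain b1 b2 where qb: "quotient_of b = (b1, b2)" by force
  define e where "e = a2 * b2"
  have pos: "a2 > 0" "b2 > 0" using quotient_of_denom_pos qa qb by auto
  have ex: "of_int e * x \<in> lat"
  proof -
    have "of_int e * x = el (of_int e * a) (of_int e * b)" by (simp add: x_def el_def of_rat_mult algebra_simps)
    moreover have "of_int e * a = of_int (a1 * b2)" "of_int e * b = of_int (b1 * a2)"
      using quotient_of_div[OF qa] quotient_of_div[OF qb] pos by (auto simp: e_def field_simps)
    ultimately show ?thesis using latI[of "a1 * b2" "b1 * a2"] by (simp only:)
  qed
  define D where "D = e ^ n"
  have D0: "D > 0" using pos by (simp add: D_def e_def)
  have exk: "(of_int e * x) ^ k \<in> lat" for k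
    by (induction k) (use lat_int[of 1] lat_mult ex in auto)
  have Dx: "of_int D * x ^ k \<in> lat" for k
  proof (induction k rule: less_induct)
    case (less k)
    show ?case
    proof (cases "k \<le> n")
      case True
      hence "of_int D * x ^ k = of_int (e ^ (n - k)) * (of_int e * x) ^ k"
        by (simp add: D_def power_mult_distrib flip: power_add mult.assoc)
      thus ?thesis using lat_mult[OF lat_int[of "e ^ (n - k)"] exk[of k]] by (simp only:)
    next
      case False
      \<comment> \<open>The monic equation expresses \<open>x ^ n\<close> by lower powers, so
        \<open>x ^ k\<close> reduces to smaller exponents.\<close>
      have "poly (map_poly of_int P) x = (\<Sum>i\<le>n. of_int (poly.coeff P i) * x ^ i)"
        by (simp add: poly_altdef degree_map_poly coeff_map_poly n_def)
      also have "\<dots> = (\<Sum>i<n. of_int (poly.coeff P i) * x ^ i) + x ^ n"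
        using P(2) by (simp add: lessThan_Suc_atMost[symmetric] n_def)
      finally have "x ^ n = - (\<Sum>i<n. of_int (poly.coeff P i) * x ^ i)" using P(1) by (simp add: eq_neg_iff_add_eq_0 add.commute)
      hence "of_int D * x ^ k = of_int D * (x ^ (k - n) * - (\<Sum>i<n. of_int (poly.coeff P i) * x ^ i))"
        using False by (metis le_add_diff_inverse2 nat_le_linear power_add)
      also have "\<dots> = (\<Sum>i<n. of_int (- poly.coeff P i) * (of_int D * x ^ (k - n + i)))"
        by (simp add: sum_distrib_left sum_negf power_add algebra_simps)
      also have "\<dots> \<in> lat"
        by (rule lat_sum, rule lat_mult[OF lat_int], rule less) (use False in auto)
      finally show ?thesis .
    qed
  qed
  have nZ: "a\<^sup>2 - of_int d * b\<^sup>2 \<in> \<int>" by (rule key[OF x_def refl D0 Dx])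
  thus "a\<^sup>2 - of_int d * b\<^sup>2 \<in> \<int>" .
  have "(a + 1)\<^sup>2 - of_int d * b\<^sup>2 \<in> \<int>"
  proof (rule key[OF _ refl D0])
    show "x + 1 = el (a + 1) b" by (simp add: x_def el_def of_rat_add)
    fix k
    have "of_int D * (x + 1) ^ k = (\<Sum>i\<le>k. of_int (int (k choose i)) * (of_int D * x ^ i))"
      unfolding binomial_ring[of x 1 k] by (simp add: sum_distrib_left mult_ac)
    also have "\<dots> \<in> lat" by (rule lat_sum, rule lat_mult[OF lat_int Dx])
    finally show "of_int D * (x + 1) ^ k \<in> lat" .
  qed
  hence "((a + 1)\<^sup>2 - of_int d * b\<^sup>2) - (a\<^sup>2 - of_int d * b\<^sup>2) - 1 \<in> \<int>"
    by (rule Ints_diff[OF Ints_diff[OF _ nZ] Ints_1])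
  moreover have "((a + 1)\<^sup>2 - of_int d * b\<^sup>2) - (a\<^sup>2 - of_int d * b\<^sup>2) - 1 = 2 * a"
    by (simp add: power2_eq_square algebra_simps)
  ultimately show "2 * a \<in> \<int>" by (simp only:)
qed

text \<open>One setting for both fields: \<open>s\<close> and \<open>\<nu>\<close> are the trace and
  norm of \<open>\<omega>\<close>. They are 0 and \<open>p\<close> for the square root of
  \<open>-p\<close>, and 1 and \<open>- q\<close> for half of 1 plus the square root of
  \<open>p\<close>.\<close>

locale quad_order =
  fixes s \<nu> :: int and \<omega> :: complex
  assumes omega_sq: "\<omega> * \<omega> = of_int s * \<omega> - of_int \<nu>"
    and indep: "\<And>x y :: int. of_int x + of_int y * \<omega> = 0 \<Longrightarrow> x = 0 \<and> y = 0"
begin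

definition el :: "int \<Rightarrow> int \<Rightarrow> complex" where "el u v = of_int u + of_int v * \<omega>"

definition ints :: "complex set" where "ints = {el u v | u v. True}"

definition int_ring :: "complex ring" where
  "int_ring = \<lparr>carrier = ints, mult = (*), one = 1, zero = 0, add = (+)\<rparr>"

definition nrm :: "int \<Rightarrow> int \<Rightarrow> int" where "nrm u v = u\<^sup>2 + s * u * v + \<nu> * v\<^sup>2"

lemma el_eq_iff: "el u v = el u' v' \<longleftrightarrow> u = u' \<and> v = v'"
  using indep[of "u - u'" "v - v'"] by (auto simp: el_def algebra_simps)

lemma el_0_iff: "el u v = 0 \<longleftrightarrow> u = 0 \<and> v = 0"
  using indep[of u v] by (auto simp: el_def)

lemma el_add: "el u v + el u' v' = el (u + u') (v + v')"
  by (simp add: el_def algebra_simps)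

lemma el_diff: "el u v - el u' v' = el (u - u') (v - v')"
  by (simp add: el_def algebra_simps)

lemma el_minus: "- el u v = el (- u) (- v)"
  by (simp add: el_def)

lemma el_of_int: "el u 0 = of_int u"
  by (simp add: el_def)

lemma el_mult: "el u v * el u' v' = el (u * u' - \<nu> * v * v') (u * v' + v * u' + s * v * v')"
proof -
  have "el u v * el u' v' = of_int (u * u') + of_int (u * v' + v * u') * \<omega> + of_int (v * v') * (\<omega> * \<omega>)"
    by (simp add: el_def algebra_simps)
  thus ?thesis unfolding omega_sq by (simp add: el_def algebra_simps)
qed

lemma el_conj: "el u v * el (u + s * v) (- v) = of_int (nrm u v)"
  by (simp add: el_mult nrm_def power2_eq_square algebra_simps flip: el_of_int)

lemma el_in_ints [simp]: "el u v \<in> ints"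
  by (auto simp: ints_def)

lemma of_int_in_ints [simp]: "of_int u \<in> ints"
  using el_in_ints[of u 0] by (simp add: el_of_int)

lemma zero_in_ints [simp]: "0 \<in> ints" and one_in_ints [simp]: "1 \<in> ints"
  using of_int_in_ints[of 0] of_int_in_ints[of 1] by auto

lemma intsE: assumes "x \<in> ints" obtains u v where "x = el u v"
  using assms by (auto simp: ints_def)

lemma ints_closed:
  assumes "x \<in> ints" "y \<in> ints"
  shows "x + y \<in> ints" "x - y \<in> ints" "x * y \<in> ints" "- x \<in> ints"
  using assms by (auto elim!: intsE simp: el_add el_diff el_mult el_minus)

lemma nrm_0_iff: "nrm u v = 0 \<longleftrightarrow> u = 0 \<and> v = 0"
proof
  assume "nrm u v = 0"
  hence "el u v * el (u + s * v) (- v) = 0" by (simp add: el_conj)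
  thus "u = 0 \<and> v = 0" by (auto simp: el_0_iff)
qed (simp add: nrm_def)

lemma nrm_mult: "el u v * el u' v' = el x y \<Longrightarrow> nrm x y = nrm u v * nrm u' v'"
proof -
  assume "el u v * el u' v' = el x y"
  hence e: "x = u * u' - \<nu> * v * v'" "y = u * v' + v * u' + s * v * v'" by (auto simp: el_mult el_eq_iff)
  show ?thesis unfolding nrm_def e by (simp add: power2_eq_square algebra_simps)
qed

lemma cring_int_ring: "cring int_ring"
proof (rule cringI)
  show "abelian_group int_ring"
  proof (rule abelian_groupI)
    fix x assume "x \<in> carrier int_ring"
    thus "\<exists>y\<in>carrier int_ring. y \<oplus>\<^bsub>int_ring\<^esub> x = \<zero>\<^bsub>int_ring\<^esub>"
      by (intro bexI[of _ "- x"]) (auto simp: int_ring_def ints_closed(4))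
  qed (auto simp: int_ring_def ints_closed)
  show "Group.comm_monoid int_ring"
    by (rule comm_monoidI) (auto simp: int_ring_def ints_closed)
qed (auto simp: int_ring_def algebra_simps)

definition is_ideal :: "complex set \<Rightarrow> bool" where
  "is_ideal I \<longleftrightarrow> I \<subseteq> ints \<and> 0 \<in> I \<and> (\<forall>x\<in>I. \<forall>y\<in>I. x - y \<in> I) \<and> (\<forall>r\<in>ints. \<forall>x\<in>I. r * x \<in> I)"

lemma ideal_iff: "ideal I int_ring \<longleftrightarrow> is_ideal I"
proof -
  interpret R: cring int_ring by (rule cring_int_ring)
  have inv: "\<ominus>\<^bsub>int_ring\<^esub> x = - x" if "x \<in> ints" for x
    by (rule R.minus_equality) (use that ints_closed in \<open>auto simp: int_ring_def\<close>)
  show ?thesis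
  proof
    assume I: "ideal I int_ring"
    interpret I: ideal I int_ring by (rule I)
    have sub: "I \<subseteq> ints" using I.a_subset by (simp add: int_ring_def)
    have z: "0 \<in> I" using I.zero_closed by (simp add: int_ring_def)
    have d: "x - y \<in> I" if "x \<in> I" "y \<in> I" for x y
    proof -
      have "- y \<in> I" using I.a_inv_closed[OF that(2)] inv[of y] subsetD[OF sub that(2)] by simp
      thus ?thesis using I.a_closed[OF that(1), of "- y"] by (simp add: int_ring_def)
    qed
    have "r * x \<in> I" if "r \<in> ints" "x \<in> I" for r x
      using I.I_l_closed[of x r] that by (simp add: int_ring_def)
    thus "is_ideal I" using sub z d by (simp add: is_ideal_def)
  next
    assume I: "is_ideal I"
    have I': "I \<subseteq> ints" "0 \<in> I" "\<And>x y. x \<in> I \<Longrightarrow> y \<in> I \<Longrightarrow> x - y \<in> I"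
      using I by (simp_all add: is_ideal_def)
    have neg: "- x \<in> I" if "x \<in> I" for x using I'(3)[OF I'(2) that] by simp
    have add: "x + y \<in> I" if "x \<in> I" "y \<in> I" for x y using I'(3)[OF that(1) neg[OF that(2)]] by simp
    have sub: "subgroup I (add_monoid int_ring)"
    proof
      show "I \<subseteq> carrier (add_monoid int_ring)" using I by (simp add: is_ideal_def int_ring_def)
      show "x \<otimes>\<^bsub>add_monoid int_ring\<^esub> y \<in> I" if "x \<in> I" "y \<in> I" for x y
        using add that by (simp add: int_ring_def)
      show "\<one>\<^bsub>add_monoid int_ring\<^esub> \<in> I" using I by (simp add: is_ideal_def int_ring_def)
      show "inv\<^bsub>add_monoid int_ring\<^esub> x \<in> I" if "x \<in> I" for x
        using inv[of x] neg[OF that] subsetD[OF I'(1) that] by (simp add: a_inv_def)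
    qed
    have "x * a \<in> I" if "a \<in> I" "x \<in> ints" for a x using I that by (simp add: is_ideal_def)
    thus "ideal I int_ring"
      by (intro idealI[OF R.ring_axioms sub]) (simp_all add: int_ring_def mult.commute)
  qed
qed

text \<open>The normal form of an ideal: the lattice with basis \<open>k a\<close> and
  \<open>k (b + \<omega>)\<close>, written as divisibility conditions on the coordinates.\<close>

definition qid :: "int \<Rightarrow> int \<Rightarrow> int \<Rightarrow> complex set" where
  "qid k a b = {el u v | u v. k dvd v \<and> k * a dvd u - b * v}"

lemma qid_mem: "el u v \<in> qid k a b \<longleftrightarrow> k dvd v \<and> k * a dvd u - b * v"
  by (auto simp: qid_def el_eq_iff)

text \<open>This is the norm of \<open>b + \<omega>\<close>; when \<open>a\<close> divides it, the
  lattice \<open>qid k a b\<close> is closed under multiplication by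
  \<open>\<omega>\<close>.\<close>

definition poly_at :: "int \<Rightarrow> int" where "poly_at b = b\<^sup>2 + s * b + \<nu>"

lemma is_ideal_qid:
  assumes "a dvd poly_at b"
  shows "is_ideal (qid k a b)"
  unfolding is_ideal_def
proof (intro conjI ballI)
  show "qid k a b \<subseteq> ints" by (auto simp: qid_def)
  show "0 \<in> qid k a b" using qid_mem[of 0 0 k a b] by (simp add: el_def)
next
  fix x y assume xy: "x \<in> qid k a b" "y \<in> qid k a b"
  then obtain u v u' v' where e: "x = el u v" "y = el u' v'" by (auto simp: qid_def)
  hence "k dvd v" "k * a dvd u - b * v" "k dvd v'" "k * a dvd u' - b * v'"
    using xy by (simp_all add: qid_mem)
  hence "k dvd v - v'" "k * a dvd (u - b * v) - (u' - b * v')" by (blast intro: dvd_diff)+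
  moreover have "(u - b * v) - (u' - b * v') = (u - u') - b * (v - v')" by (simp add: algebra_simps)
  ultimately show "x - y \<in> qid k a b" by (simp add: e el_diff qid_mem)
next
  fix r x assume r: "r \<in> ints" and x: "x \<in> qid k a b"
  then obtain u v where e: "x = el u v" by (auto simp: qid_def)
  obtain c d where r: "r = el c d" using r by (rule intsE)
  have d1: "k dvd v" and d2: "k * a dvd u - b * v" using x by (simp_all add: e qid_mem)
  have ku: "k dvd u"
  proof -
    have "k dvd u - b * v" using d2 by (rule dvd_mult_left)
    hence "k dvd (u - b * v) + b * v" using d1 by (intro dvd_add) auto
    thus ?thesis by simp
  qed
  have "k dvd c * v + d * u + s * d * v" using d1 ku by auto
  moreover have "k * a dvd (c * u - \<nu> * d * v) - b * (c * v + d * u + s * d * v)"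
  proof -
    \<comment> \<open>Up to a multiple of \<open>u - b v\<close> only a multiple of \<open>v\<close>
      times the norm of \<open>b + \<omega>\<close> is left.\<close>
    have "(c * u - \<nu> * d * v) - b * (c * v + d * u + s * d * v) = (c - b * d) * (u - b * v) - d * (v * poly_at b)"
      by (simp add: poly_at_def power2_eq_square algebra_simps)
    moreover have "k * a dvd v * poly_at b" using d1 assms by (rule mult_dvd_mono)
    ultimately show ?thesis using d2 by auto
  qed
  ultimately show "r * x \<in> qid k a b" by (simp add: e r el_mult qid_mem)
qed

text \<open>Hermite reduction: \<open>k\<close> generates the group of
  \<open>\<omega>\<close>-coordinates of \<open>I\<close>, and \<open>A\<close> the group of
  rational integers in \<open>I\<close>. Multiplication by \<open>\<omega>\<close> shows that
  \<open>k\<close> divides \<open>A\<close> and also the other coordinate \<open>c\<close> of an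
  element with \<open>\<omega>\<close>-coordinate \<open>k\<close>.\<close>

lemma is_ideal_imp_qid:
  assumes I: "is_ideal I" "I \<noteq> {0}"
  shows "\<exists>k a b. k > 0 \<and> a > 0 \<and> a dvd poly_at b \<and> I = qid k a b"
proof -
  have sub: "I \<subseteq> ints" and diff: "\<And>x y. x \<in> I \<Longrightarrow> y \<in> I \<Longrightarrow> x - y \<in> I"
    and mult: "\<And>r x. r \<in> ints \<Longrightarrow> x \<in> I \<Longrightarrow> r * x \<in> I" and z: "0 \<in> I"
    using I(1) by (auto simp: is_ideal_def)
  obtain x0 where "x0 \<in> I" "x0 \<noteq> 0" using I z by blast
  then obtain u0 v0 where uv0: "el u0 v0 \<in> I" "el u0 v0 \<noteq> 0" using sub by (metis intsE subsetD)
  define N where "N = nrm u0 v0"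
  have N0: "N \<noteq> 0" using uv0 by (simp add: N_def nrm_0_iff el_0_iff)
  have NI: "el N 0 \<in> I"
    using mult[OF el_in_ints[of "u0 + s * v0" "- v0"] uv0(1)] el_conj[of u0 v0]
    by (simp add: N_def el_of_int mult.commute)
  have "\<exists>k>0. \<forall>v. v \<in> {v. \<exists>u. el u v \<in> I} \<longleftrightarrow> k dvd v"
  proof (rule int_subgroup_generator)
    show "N \<in> {v. \<exists>u. el u v \<in> I}"
      using mult[OF el_in_ints[of 0 1] NI] by (auto simp: el_mult)
    show "x - y \<in> {v. \<exists>u. el u v \<in> I}" if xy: "x \<in> {v. \<exists>u. el u v \<in> I}" "y \<in> {v. \<exists>u. el u v \<in> I}" for x y
    proof -
      obtain u u' where "el u x \<in> I" "el u' y \<in> I" using xy by blast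
      hence "el (u - u') (x - y) \<in> I" using diff by (fastforce simp flip: el_diff)
      thus ?thesis by auto
    qed
  qed (rule N0)
  then obtain k where k: "k > 0" "\<And>v. (\<exists>u. el u v \<in> I) \<longleftrightarrow> k dvd v" by auto
  have "\<exists>A>0. \<forall>u. u \<in> {u. el u 0 \<in> I} \<longleftrightarrow> A dvd u"
  proof (rule int_subgroup_generator)
    show "N \<in> {u. el u 0 \<in> I}" using NI by simp
    show "x - y \<in> {u. el u 0 \<in> I}" if "x \<in> {u. el u 0 \<in> I}" "y \<in> {u. el u 0 \<in> I}" for x y
      using diff[of "el x 0" "el y 0"] that by (simp add: el_diff)
  qed (rule N0)
  then obtain A where A: "A > 0" "\<And>u. el u 0 \<in> I \<longleftrightarrow> A dvd u" by auto
  have "el 0 A \<in> I" using mult[OF el_in_ints[of 0 1], of "el A 0"] A(2)[of A] by (simp add: el_mult)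
  hence "k dvd A" using k(2) by blast
  then obtain a where a: "A = k * a" by (auto simp: dvd_def)
  have apos: "a > 0" using A(1) k(1) a by (simp add: zero_less_mult_iff)
  obtain c where c: "el c k \<in> I" using k(2)[of k] by auto
  have "el (- \<nu> * k) (c + s * k) \<in> I" using mult[OF el_in_ints[of 0 1] c] by (simp add: el_mult)
  hence "k dvd c + s * k" using k(2) by blast
  hence "k dvd c" by (simp add: dvd_add_left_iff)
  then obtain b where b: "c = k * b" by (auto simp: dvd_def)
  have bm: "el (k * b * y) (k * y) \<in> I" for y
    using mult[OF el_in_ints[of y 0] c] by (simp add: el_mult b algebra_simps)
  have "I = qid k a b"
  proof (intro equalityI subsetI)
    fix x assume x: "x \<in> I"
    then obtain u v where e: "x = el u v" using sub by (metis intsE subsetD)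
    have kv: "k dvd v" using x k(2) e by blast
    then obtain y where y: "v = k * y" by (auto simp: dvd_def)
    have "el u v - el (k * b * y) (k * y) \<in> I" using diff x e bm by blast
    hence "el (u - b * v) 0 \<in> I" by (simp add: el_diff y algebra_simps)
    thus "x \<in> qid k a b" using kv A(2) by (simp add: e qid_mem a)
  next
    fix x assume x: "x \<in> qid k a b"
    then obtain u v where e: "x = el u v" by (auto simp: qid_def)
    have kv: "k dvd v" "k * a dvd u - b * v" using x by (simp_all add: e qid_mem)
    then obtain y where y: "v = k * y" by (auto simp: dvd_def)
    have "el (- (u - b * v)) 0 \<in> I" using A(2) kv(2) by (simp only: a[symmetric] dvd_minus_iff)
    hence "el (k * b * y) (k * y) - el (- (u - b * v)) 0 \<in> I" using diff bm by blast
    thus "x \<in> I" by (simp add: e el_diff y algebra_simps)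
  qed
  moreover have "a dvd poly_at b"
  proof -
    \<comment> \<open>The left factor is the conjugate of \<open>b + \<omega>\<close>, so the
      product is the rational integer \<open>k * poly_at b\<close>, and it lies in
      \<open>I\<close>.\<close>
    have "el (b + s) (- 1) * el c k \<in> I" by (rule mult[OF el_in_ints c])
    moreover have "el (b + s) (- 1) * el c k = el (k * poly_at b) 0"
      by (simp add: el_mult b poly_at_def power2_eq_square algebra_simps)
    ultimately have "k * a dvd k * poly_at b" using A(2) a by simp
    thus ?thesis using k(1) by simp
  qed
  ultimately show ?thesis using k(1) apos by blast
qed

text \<open>The parameters can be recovered: \<open>k\<close> from the
  \<open>\<omega>\<close>-coordinates, \<open>k a\<close> from the rational integers in the ideal,
  and \<open>b\<close> as an offset modulo \<open>a\<close>.\<close>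

lemma qid_eq_iff:
  assumes "k > 0" "a > 0" "k' > 0" "a' > 0"
  shows "qid k a b = qid k' a' b' \<longleftrightarrow> k = k' \<and> a = a' \<and> [b = b'] (mod a)"
proof
  assume eq: "qid k a b = qid k' a' b'"
  have "el (k * a) 0 \<in> qid k a b" "el (k' * a') 0 \<in> qid k' a' b'" by (simp_all add: qid_mem)
  hence "el (k * a) 0 \<in> qid k' a' b'" "el (k' * a') 0 \<in> qid k a b" using eq by blast+
  hence "k' * a' dvd k * a" "k * a dvd k' * a'" by (simp_all add: qid_mem)
  hence 1: "k * a = k' * a'" using assms by (intro zdvd_antisym_nonneg) auto
  have mem: "el (k * b) k \<in> qid k a b" "el (k' * b') k' \<in> qid k' a' b'" by (simp_all add: qid_mem mult.commute)
  hence "el (k * b) k \<in> qid k' a' b'" "el (k' * b') k' \<in> qid k a b" using eq by blast+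
  hence "k' dvd k" "k dvd k'" by (simp_all add: qid_mem)
  hence k: "k = k'" using assms by (intro zdvd_antisym_nonneg) auto
  hence a: "a = a'" using 1 assms by simp
  have "el (k * b) k \<in> qid k' a' b'" using mem(1) eq by blast
  hence "k' * a' dvd k * b - b' * k" by (simp add: qid_mem)
  hence "k * a dvd k * (b - b')" using k a by (simp add: algebra_simps)
  hence "a dvd b - b'" using assms by simp
  thus "k = k' \<and> a = a' \<and> [b = b'] (mod a)" using k a by (simp add: cong_iff_dvd_diff)
next
  assume h: "k = k' \<and> a = a' \<and> [b = b'] (mod a)"
  have *: "k dvd v \<and> k * a dvd u - b * v \<longleftrightarrow> k dvd v \<and> k * a dvd u - b' * v" for u v
  proof -
    have "k * a dvd u - b * v \<longleftrightarrow> k * a dvd u - b' * v" if kv: "k dvd v"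
    proof -
      have "k * a dvd v * (b - b')" using kv h by (intro mult_dvd_mono) (auto simp: cong_iff_dvd_diff)
      moreover have "u - b' * v = (u - b * v) + v * (b - b')" by (simp add: algebra_simps)
      ultimately show ?thesis by (metis dvd_add_left_iff)
    qed
    thus ?thesis by blast
  qed
  have "qid k a b = qid k a b'" unfolding qid_def by (simp only: *)
  thus "qid k a b = qid k' a' b'" using h by simp
qed

lemma qid_ne_0: "k > 0 \<Longrightarrow> a > 0 \<Longrightarrow> qid k a b \<noteq> {0}"
proof
  assume "k > 0" "a > 0" "qid k a b = {0}"
  moreover have "el (k * a) 0 \<in> qid k a b" by (simp add: qid_mem)
  ultimately show False by (auto simp: el_0_iff)
qed

definition nz_ideals :: "complex set set" where "nz_ideals = {I. is_ideal I \<and> I \<noteq> {0}}"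

definition class_rel :: "(complex set \<times> complex set) set" where
  "class_rel = {(I, J). I \<in> nz_ideals \<and> J \<in> nz_ideals \<and>
     (\<exists>a \<in> ints - {0}. \<exists>b \<in> ints - {0}. (*) a ` I = (*) b ` J)}"

lemma equiv_class_rel: "equiv nz_ideals class_rel"
proof (rule equivI)
  show "class_rel \<subseteq> nz_ideals \<times> nz_ideals" by (auto simp: class_rel_def)
  show "refl_on nz_ideals class_rel"
    by (rule refl_onI) (auto simp: class_rel_def intro!: bexI[of _ 1])
  show "sym class_rel"
  proof (rule symI)
    fix I J assume "(I, J) \<in> class_rel"
    then obtain a b where "I \<in> nz_ideals" "J \<in> nz_ideals" "a \<in> ints - {0}" "b \<in> ints - {0}" "(*) a ` I = (*) b ` J"
      unfolding class_rel_def by blast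
    note h = this
    have "\<exists>b\<in>ints - {0}. \<exists>a\<in>ints - {0}. (*) b ` J = (*) a ` I"
      using h(5) by (intro bexI[OF _ h(4)] bexI[OF _ h(3)]) (rule sym)
    thus "(J, I) \<in> class_rel" unfolding class_rel_def using h(1,2) by simp
  qed
  show "trans class_rel"
  proof (rule transI)
    fix I J K assume "(I, J) \<in> class_rel" "(J, K) \<in> class_rel"
    then obtain a b where ab: "I \<in> nz_ideals" "a \<in> ints - {0}" "b \<in> ints - {0}" "(*) a ` I = (*) b ` J"
      unfolding class_rel_def by blast
    obtain c d where cd: "K \<in> nz_ideals" "c \<in> ints - {0}" "d \<in> ints - {0}" "(*) c ` J = (*) d ` K"
      using \<open>(J, K) \<in> class_rel\<close> unfolding class_rel_def by blast
    have "(*) (c * a) ` I = (*) c ` (*) a ` I" by (simp add: image_image mult.assoc)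
    also have "\<dots> = (*) c ` (*) b ` J" by (simp only: ab(4))
    also have "\<dots> = (*) b ` (*) c ` J" by (simp add: image_image mult.left_commute)
    also have "\<dots> = (*) b ` (*) d ` K" by (simp only: cd(4))
    also have "\<dots> = (*) (b * d) ` K" by (simp add: image_image mult.assoc)
    finally have "(*) (c * a) ` I = (*) (b * d) ` K" .
    moreover have "c * a \<in> ints - {0}" "b * d \<in> ints - {0}" using ab cd ints_closed(3) by simp_all
    ultimately have "\<exists>b\<in>ints - {0}. \<exists>a\<in>ints - {0}. (*) b ` I = (*) a ` K"
      by (intro bexI[where x = "c * a"] bexI[where x = "b * d"])
    thus "(I, K) \<in> class_rel" unfolding class_rel_def using ab(1) cd(1) by simp
  qed
qed

lemma class_number_eq:
  assumes "carrier (quad_integers d) = ints"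
  shows "class_number d = card (nz_ideals // class_rel)"
proof -
  have eq: "quad_integers d = int_ring" using assms by (simp add: quad_integers_def int_ring_def)
  have "carrier int_ring = ints" by (simp add: int_ring_def)
  thus ?thesis
    unfolding class_number_def nonzero_ideals_def ideal_equiv_def class_rel_def nz_ideals_def eq ideal_iff
    by (simp only: mem_Collect_eq conj_assoc)
qed

end

lemma algebraic_int_quadratic:
  fixes z :: complex
  assumes "z * z = of_int t * z - of_int n"
  shows "algebraic_int z"
proof (rule algebraic_int.intros)
  let ?P = "[:of_int n, - of_int t, 1:] :: complex poly"
  show "lead_coeff ?P = 1" by simp
  show "\<forall>i. poly.coeff ?P i \<in> \<int>"
    by (auto simp: coeff_pCons split: nat.splits)
  show "poly ?P z = 0" using assms by (simp add: algebra_simps)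
qed

lemma (in quad_order) algebraic_int_el: "algebraic_int (el u v)"
proof (rule algebraic_int_quadratic)
  show "el u v * el u v = of_int (2 * u + s * v) * el u v - of_int (nrm u v)"
    unfolding el_of_int[symmetric] el_mult el_diff
    by (simp add: el_eq_iff nrm_def power2_eq_square algebra_simps)
qed

text \<open>Integral closedness, in the form applied later to a quotient of two elements that is
  shown to satisfy a monic quadratic equation.\<close>

lemma (in quad_order) algebraic_int_quadratic_in_ints:
  assumes "carrier (quad_integers d) = ints" "z \<in> quad_field d" "z * z = of_int t * z - of_int n"
  shows "z \<in> ints"
  using assms algebraic_int_quadratic[OF assms(3)] by (auto simp: quad_integers_def)

text \<open>The square of the reduced denominator of \<open>b\<close> divides \<open>p\<close>,
  which is squarefree.\<close>

lemma rat_times_square_int: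
  fixes b :: rat
  assumes "prime p" "of_nat p * b\<^sup>2 \<in> \<int>"
  shows "b \<in> \<int>"
proof -
  obtain m n where mn: "quotient_of b = (m, n)" by force
  have b: "b = of_int m / of_int n" and n: "n > 0" and cop: "coprime m n"
    using quotient_of_div[OF mn] quotient_of_denom_pos[OF mn] quotient_of_coprime[OF mn] by auto
  obtain z where z: "of_nat p * b\<^sup>2 = of_int z" using assms(2) by (auto elim: Ints_cases)
  hence "(of_int (int p * m\<^sup>2) :: rat) = of_int (z * n\<^sup>2)" using n by (simp add: b field_simps)
  hence e: "int p * m\<^sup>2 = z * n\<^sup>2" by (simp only: of_int_eq_iff)
  have "n\<^sup>2 dvd int p * m\<^sup>2" unfolding e by simp
  moreover have "coprime (n\<^sup>2) (m\<^sup>2)" using cop by (simp add: coprime_commute)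
  ultimately have "n\<^sup>2 dvd int p" by (simp add: coprime_dvd_mult_left_iff)
  hence np: "n * n dvd int p" by (simp add: power2_eq_square)
  have pp: "prime (int p)" using assms(1) by simp
  have "n = 1"
  proof (rule ccontr)
    assume n1: "n \<noteq> 1"
    have "n dvd int p" using np by (rule dvd_mult_left)
    hence "n = int p" using pp n n1 less_imp_le[OF n] unfolding prime_int_iff by blast
    hence "int p * int p dvd int p * 1" using np by simp
    hence "int p dvd 1" using pp by (simp only: dvd_mult_cancel_left) auto
    thus False using pp not_prime_unit by blast
  qed
  thus ?thesis by (simp add: b)
qed

lemma sqrt_prime_irrational:
  fixes a b :: rat
  assumes "prime p" "a\<^sup>2 = of_nat p * b\<^sup>2"
  shows "a = 0 \<and> b = 0"
proof (rule ccontr)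
  assume "\<not> (a = 0 \<and> b = 0)"
  have p0: "p > 0" using assms(1) by (simp add: prime_gt_0_nat)
  have b0: "b \<noteq> 0"
  proof
    assume "b = 0"
    hence "a\<^sup>2 = 0" using assms(2) by simp
    thus False using \<open>\<not> (a = 0 \<and> b = 0)\<close> \<open>b = 0\<close> by simp
  qed
  have ba: "of_nat p * (b / a)\<^sup>2 = 1"
    unfolding power_divide assms(2) using b0 p0 by simp
  have "b / a \<in> \<int>" by (rule rat_times_square_int[OF assms(1)]) (simp only: ba Ints_1)
  then obtain k where k: "b / a = of_int k" by (auto elim: Ints_cases)
  hence "(of_int (int p * k\<^sup>2) :: rat) = of_int 1" using ba by simp
  hence "int p * k\<^sup>2 = 1" by (simp only: of_int_eq_iff)
  hence "int p dvd 1" by (metis dvd_triv_left)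
  thus False using assms(1) by (simp add: not_prime_unit)
qed

section \<open>The rings of integers of the two quadratic fields\<close>

context prime_1_mod_4
begin

definition w_im :: complex where "w_im = csqrt (of_int (- int p))"
definition w_sqrt :: complex where "w_sqrt = csqrt (of_int (int p))"
definition w_re :: complex where "w_re = (1 + w_sqrt) / 2"

lemma w_im_sq: "w_im * w_im = of_int (- int p)" and w_sqrt_sq: "w_sqrt * w_sqrt = of_int (int p)"
  unfolding w_im_def w_sqrt_def by (metis power2_csqrt power2_eq_square)+

lemma indep_im:
  fixes a b :: rat
  assumes "of_rat a + of_rat b * w_im = 0"
  shows "a = 0 \<and> b = 0"
proof -
  have "of_rat a = - of_rat b * w_im" using assms by (simp add: eq_neg_iff_add_eq_0)
  hence "of_rat a * of_rat a = of_rat b * of_rat b * (w_im * w_im)" by (simp add: mult_ac)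
  also have "\<dots> = of_rat (b * b * (- of_nat p))" unfolding w_im_sq by (simp add: of_rat_mult of_rat_minus)
  finally have "(of_rat (a * a) :: complex) = of_rat (b * b * (- of_nat p))" by (simp add: of_rat_mult)
  hence "a * a + of_nat p * (b * b) = 0" by (simp only: of_rat_eq_iff) (simp add: algebra_simps)
  moreover have "a * a \<ge> 0" "of_nat p * (b * b) \<ge> (0 :: rat)" by auto
  ultimately have "a * a = 0" "of_nat p * (b * b) = (0 :: rat)" by linarith+
  thus ?thesis using p_gt2 by auto
qed

lemma indep_re:
  fixes a b :: rat
  assumes "of_rat a + of_rat b * w_sqrt = 0"
  shows "a = 0 \<and> b = 0"
proof -
  have "of_rat a = - of_rat b * w_sqrt" using assms by (simp add: eq_neg_iff_add_eq_0)
  hence "of_rat a * of_rat a = of_rat b * of_rat b * (w_sqrt * w_sqrt)" by (simp add: mult_ac)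
  also have "\<dots> = of_rat (b * b * of_nat p)" unfolding w_sqrt_sq by (simp add: of_rat_mult)
  finally have "(of_rat (a * a) :: complex) = of_rat (b * b * of_nat p)" by (simp add: of_rat_mult)
  hence "a\<^sup>2 = of_nat p * b\<^sup>2" by (simp only: of_rat_eq_iff) (simp add: algebra_simps power2_eq_square)
  thus ?thesis using sqrt_prime_irrational[OF prime_p] by blast
qed

lemma quad_order_im: "quad_order 0 (int p) w_im"
proof
  show "w_im * w_im = of_int 0 * w_im - of_int (int p)" using w_im_sq by simp
  fix x y :: int assume "of_int x + of_int y * w_im = 0"
  thus "x = 0 \<and> y = 0" using indep_im[of "of_int x" "of_int y"] by simp
qed

lemma quad_order_re: "quad_order 1 (- int q) w_re"
proof
  have "int p = 4 * int q + 1" using p_eq by simp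
  hence "w_sqrt * w_sqrt = 4 * of_int (int q) + 1" unfolding w_sqrt_sq by simp
  thus "w_re * w_re = of_int 1 * w_re - of_int (- int q)"
    unfolding w_re_def by (simp add: field_simps)
  fix x y :: int assume "of_int x + of_int y * w_re = 0"
  moreover have "of_rat (of_int x + of_int y / 2) + of_rat (of_int y / 2) * w_sqrt = of_int x + of_int y * w_re"
    unfolding w_re_def of_rat_add of_rat_divide of_rat_of_int_eq by (simp add: field_simps)
  ultimately have "of_rat (of_int x + of_int y / 2) + of_rat (of_int y / 2) * w_sqrt = 0" by simp
  thus "x = 0 \<and> y = 0" using indep_re by fastforce
qed

text \<open>Trace and norm are integers, hence so is \<open>d (2 b)\<^sup>2\<close>, and then
  \<open>2 b\<close> because \<open>d\<close> is a prime up to sign.\<close>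

lemma quad_coords_int:
  fixes a b :: rat and d :: int
  assumes d: "d = int p \<or> d = - int p"
    and irr: "\<And>a b :: rat. of_rat a + of_rat b * csqrt (of_int d) = 0 \<Longrightarrow> a = 0 \<and> b = 0"
    and "algebraic_int (of_rat a + of_rat b * csqrt (of_int d))"
  obtains A B n where "2 * a = of_int A" "2 * b = of_int B" "A\<^sup>2 - d * B\<^sup>2 = 4 * n"
proof -
  have w: "csqrt (of_int d) * csqrt (of_int d) = of_int d"
    by (metis power2_csqrt power2_eq_square)
  obtain A where A: "2 * a = of_int A"
    using quadratic_algebraic_int(1)[OF w irr assms(3)] by (auto elim: Ints_cases)
  obtain n where n: "a\<^sup>2 - of_int d * b\<^sup>2 = of_int n"
    using quadratic_algebraic_int(2)[OF w irr assms(3)] by (auto elim: Ints_cases)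
  have e: "of_int d * (2 * b)\<^sup>2 = of_int (A\<^sup>2 - 4 * n)"
    using n A[symmetric] by (simp add: power2_eq_square algebra_simps)
  have "of_nat p * (2 * b)\<^sup>2 \<in> \<int>"
    using d
  proof
    assume "d = int p"
    thus ?thesis using e by (metis Ints_of_int of_int_of_nat_eq)
  next
    assume "d = - int p"
    hence "of_nat p * (2 * b)\<^sup>2 = of_int (- (A\<^sup>2 - 4 * n))" using e by simp
    thus ?thesis by (metis Ints_of_int)
  qed
  hence "2 * b \<in> \<int>" by (rule rat_times_square_int[OF prime_p])
  then obtain B where B: "2 * b = of_int B" by (auto elim: Ints_cases)
  have "(of_int (d * B\<^sup>2) :: rat) = of_int (A\<^sup>2 - 4 * n)" using e B by simp
  hence "d * B\<^sup>2 = A\<^sup>2 - 4 * n" by (simp only: of_int_eq_iff)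
  thus ?thesis using that A B by simp
qed

text \<open>For an integral element with doubled coordinates \<open>A\<close> and \<open>B\<close>,
  the number \<open>A\<^sup>2 + p B\<^sup>2\<close> is divisible by 4. As \<open>p = 1\<close>
  modulo 4, both must be even, so halves do not occur.\<close>

lemma carrier_im: "carrier (quad_integers (- int p)) = quad_order.ints w_im"
proof -
  interpret Q: quad_order 0 "int p" w_im by (rule quad_order_im)
  show ?thesis
  proof (intro equalityI subsetI)
    fix x assume "x \<in> carrier (quad_integers (- int p))"
    then obtain a b where ab: "x = of_rat a + of_rat b * w_im" "algebraic_int x"
      by (auto simp: quad_integers_def quad_field_def w_im_def)
    then obtain A B n where h: "2 * a = of_int A" "2 * b = of_int B" "A\<^sup>2 - (- int p) * B\<^sup>2 = 4 * n"
      using quad_coords_int[of "- int p" a b, OF disjI2[OF refl] indep_im[unfolded w_im_def]]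
      unfolding w_im_def by metis
    have ip: "int p = 4 * int q + 1" using p_eq by simp
    have "A\<^sup>2 + B\<^sup>2 = 4 * (n - int q * B\<^sup>2)" using h(3) unfolding ip by (simp add: algebra_simps)
    hence m4: "(A\<^sup>2 + B\<^sup>2) mod 4 = 0" by simp
    have "even A \<and> even B"
    proof -
      have "z\<^sup>2 mod 4 = (if even z then 0 else 1)" for z :: int
      proof (cases "even z")
        case True
        then obtain k where "z = 2 * k" by (auto elim: evenE)
        thus ?thesis by (simp add: power2_eq_square)
      next
        case False
        then obtain k where "z = 2 * k + 1" by (auto elim: oddE)
        hence "z\<^sup>2 = 1 + 4 * (k\<^sup>2 + k)" by (simp add: power2_eq_square algebra_simps)
        moreover have "(1 + 4 * (k\<^sup>2 + k)) mod 4 = 1 mod 4" by (rule mod_mult_self2)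
        ultimately show ?thesis using False by simp
      qed
      moreover have "(A\<^sup>2 + B\<^sup>2) mod 4 = (A\<^sup>2 mod 4 + B\<^sup>2 mod 4) mod 4" by (simp add: mod_add_eq)
      ultimately show ?thesis using m4 by (auto split: if_splits)
    qed
    then obtain u v where "A = 2 * u" "B = 2 * v" by (auto elim!: evenE)
    hence "a = of_int u" "b = of_int v" using h by auto
    hence "x = Q.el u v" using ab by (simp add: Q.el_def)
    thus "x \<in> Q.ints" by simp
  next
    fix x assume "x \<in> Q.ints"
    then obtain u v where x: "x = Q.el u v" by (rule Q.intsE)
    have "x = of_rat (of_int u) + of_rat (of_int v) * w_im" by (simp add: x Q.el_def)
    hence "x \<in> quad_field (- int p)" unfolding quad_field_def w_im_def by blast
    thus "x \<in> carrier (quad_integers (- int p))"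
      using Q.algebraic_int_el[of u v] by (simp add: quad_integers_def x)
  qed
qed

text \<open>Here \<open>A\<^sup>2 - p B\<^sup>2\<close> is divisible by 4, which gives equal parity
  of \<open>A\<close> and \<open>B\<close>; such elements are exactly the integral combinations of 1
  and \<open>w_re\<close>.\<close>

lemma carrier_re: "carrier (quad_integers (int p)) = quad_order.ints w_re"
proof -
  interpret Q: quad_order 1 "- int q" w_re by (rule quad_order_re)
  show ?thesis
  proof (intro equalityI subsetI)
    fix x assume "x \<in> carrier (quad_integers (int p))"
    then obtain a b where ab: "x = of_rat a + of_rat b * w_sqrt" "algebraic_int x"
      by (auto simp: quad_integers_def quad_field_def w_sqrt_def)
    then obtain A B n where h: "2 * a = of_int A" "2 * b = of_int B" "A\<^sup>2 - int p * B\<^sup>2 = 4 * n"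
      using quad_coords_int[of "int p" a b, OF disjI1[OF refl] indep_re[unfolded w_sqrt_def]]
      unfolding w_sqrt_def by metis
    have ip: "int p = 4 * int q + 1" using p_eq by simp
    have "A\<^sup>2 - B\<^sup>2 = 4 * (n + int q * B\<^sup>2)" using h(3) unfolding ip by (simp add: algebra_simps)
    hence "even (A\<^sup>2 - B\<^sup>2)" by simp
    hence "even (A - B)" by simp
    then obtain u where "A - B = 2 * u" by (rule evenE)
    hence "A = 2 * u + B" by simp
    hence "a = of_int u + of_int B / 2" "b = of_int B / 2" using h by auto
    hence "x = of_rat (of_int u + of_int B / 2) + of_rat (of_int B / 2) * w_sqrt" using ab(1) by simp
    also have "\<dots> = of_int u + of_int B * w_re"
      unfolding w_re_def of_rat_add of_rat_divide of_rat_of_int_eq by (simp add: field_simps)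
    finally have "x = Q.el u B" by (simp add: Q.el_def)
    thus "x \<in> Q.ints" by simp
  next
    fix x assume "x \<in> Q.ints"
    then obtain u v where x: "x = Q.el u v" by (rule Q.intsE)
    have "of_rat (of_int u + of_int v / 2) + of_rat (of_int v / 2) * w_sqrt = of_int u + of_int v * w_re"
      unfolding w_re_def of_rat_add of_rat_divide of_rat_of_int_eq by (simp add: field_simps)
    hence "x = of_rat (of_int u + of_int v / 2) + of_rat (of_int v / 2) * w_sqrt"
      by (simp add: x Q.el_def)
    hence "x \<in> quad_field (int p)" unfolding quad_field_def w_sqrt_def by blast
    thus "x \<in> carrier (quad_integers (int p))"
      using Q.algebraic_int_el[of u v] by (simp add: quad_integers_def x)
  qed
qed

end

section \<open>Norms of ideals and ideal classes\<close>

context quad_order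
begin

definition cu :: "complex \<Rightarrow> int" where "cu z = (THE u. \<exists>v. z = el u v)"
definition cv :: "complex \<Rightarrow> int" where "cv z = (THE v. \<exists>u. z = el u v)"

lemma cu_el [simp]: "cu (el u v) = u" and cv_el [simp]: "cv (el u v) = v"
  unfolding cu_def cv_def by (rule the_equality; auto simp: el_eq_iff)+

definition Nm :: "complex \<Rightarrow> int" where "Nm z = nrm (cu z) (cv z)"

lemma Nm_el [simp]: "Nm (el u v) = nrm u v"
  by (simp add: Nm_def)

lemma Nm_mult: "x \<in> ints \<Longrightarrow> y \<in> ints \<Longrightarrow> Nm (x * y) = Nm x * Nm y"
  using nrm_mult by (metis Nm_el el_mult intsE)

lemma Nm_0_iff: "x \<in> ints \<Longrightarrow> Nm x = 0 \<longleftrightarrow> x = 0"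
  by (elim intsE) (simp add: nrm_0_iff el_0_iff)

lemma Nm_of_int: "Nm (of_int k) = k\<^sup>2"
  using Nm_el[of k 0] by (simp add: el_of_int nrm_def)

text \<open>The norm of an ideal is read off the determinants of pairs of its elements, which are its multiples.\<close>

definition dt :: "complex \<Rightarrow> complex \<Rightarrow> int" where "dt x y = cu x * cv y - cv x * cu y"

text \<open>Multiplication by \<open>z\<close> is a linear map of determinant
  \<open>Nm z\<close>.\<close>

lemma dt_mult:
  assumes "z \<in> ints" "x \<in> ints" "y \<in> ints"
  shows "dt (z * x) (z * y) = Nm z * dt x y"
proof -
  obtain a b where z: "z = el a b" using assms(1) by (rule intsE)
  obtain c d where x: "x = el c d" using assms(2) by (rule intsE)
  obtain e f where y: "y = el e f" using assms(3) by (rule intsE)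
  show ?thesis unfolding z x y el_mult dt_def cu_el cv_el Nm_el nrm_def
    by (simp add: power2_eq_square algebra_simps)
qed

definition dets :: "complex set \<Rightarrow> int set" where "dets I = {dt x y | x y. x \<in> I \<and> y \<in> I}"

lemma dets_scale:
  assumes "z \<in> ints" "I \<subseteq> ints"
  shows "dets ((*) z ` I) = (*) (Nm z) ` dets I"
proof (intro equalityI subsetI)
  fix w assume "w \<in> dets ((*) z ` I)"
  then obtain x y where "x \<in> I" "y \<in> I" "w = dt (z * x) (z * y)" by (auto simp: dets_def)
  moreover from this have "w = Nm z * dt x y" using dt_mult[OF assms(1)] assms(2) by blast
  ultimately show "w \<in> (*) (Nm z) ` dets I" unfolding dets_def by blast
next
  fix w assume "w \<in> (*) (Nm z) ` dets I"
  then obtain x y where xy: "x \<in> I" "y \<in> I" "w = Nm z * dt x y" by (auto simp: dets_def)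
  hence "w = dt (z * x) (z * y)" using dt_mult[OF assms(1)] assms(2) by (metis subsetD)
  thus "w \<in> dets ((*) z ` I)" using xy unfolding dets_def by blast
qed

lemma qid_sub_ints: "qid k a b \<subseteq> ints"
  by (auto simp: qid_def)

lemma qid_1_mem: "el u v \<in> qid 1 a b \<longleftrightarrow> (\<exists>x. u = a * x + b * v)"
  by (auto simp: qid_mem dvd_def algebra_simps)

text \<open>The basis \<open>k a\<close>, \<open>k (b + \<omega>)\<close> has determinant
  \<open>k\<^sup>2 a\<close>, which is thus the norm of the ideal.\<close>

lemma dets_qid: "dets (qid k a b) = {z. k * k * a dvd z}"
proof (intro equalityI subsetI)
  fix w assume "w \<in> dets (qid k a b)"
  then obtain X Y where XY: "X \<in> qid k a b" "Y \<in> qid k a b" "w = dt X Y" by (auto simp: dets_def)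
  then obtain u v u' v' where e: "X = el u v" "Y = el u' v'" by (auto simp: qid_def)
  have "k dvd v" "k * a dvd u - b * v" "k dvd v'" "k * a dvd u' - b * v'"
    using XY e by (simp_all add: qid_mem)
  then obtain x y x' y' where h: "v = k * y" "u - b * v = k * a * x" "v' = k * y'" "u' - b * v' = k * a * x'"
    unfolding dvd_def by blast
  have "u = b * v + k * a * x" "u' = b * v' + k * a * x'" using h by simp_all
  hence "w = k * k * a * (x * y' - y * x')" unfolding XY(3) e dt_def cu_el cv_el h(1,3)
    by (simp add: h(1,3) algebra_simps)
  thus "w \<in> {z. k * k * a dvd z}" by simp
next
  fix w assume "w \<in> {z. k * k * a dvd z}"
  then obtain y where y: "w = k * k * a * y" by (auto simp: dvd_def)
  have "el (k * a) 0 \<in> qid k a b" "el (k * b * y) (k * y) \<in> qid k a b" by (simp_all add: qid_mem)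
  moreover have "w = dt (el (k * a) 0) (el (k * b * y) (k * y))" by (simp add: y dt_def)
  ultimately show "w \<in> dets (qid k a b)" unfolding dets_def by blast
qed

text \<open>Compares ideal norms within a class: equal scaled ideals have equal determinant sets,
  whose generators therefore divide each other.\<close>

lemma scaled_norms:
  assumes "x \<in> ints" "y \<in> ints" "(*) x ` qid k a b = (*) y ` qid k' a' b'"
  shows "\<bar>Nm x * (k * k * a)\<bar> = \<bar>Nm y * (k' * k' * a')\<bar>"
proof -
  have e: "(*) (Nm x) ` {z. k * k * a dvd z} = (*) (Nm y) ` {z. k' * k' * a' dvd z}"
    using dets_scale[OF assms(1) qid_sub_ints, of k a b] dets_scale[OF assms(2) qid_sub_ints, of k' a' b'] assms(3)
    by (simp add: dets_qid)
  have "Nm x * (k * k * a) \<in> (*) (Nm x) ` {z. k * k * a dvd z}" by (rule imageI) simp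
  hence 1: "Nm y * (k' * k' * a') dvd Nm x * (k * k * a)" unfolding e by (auto intro: mult_dvd_mono)
  have "Nm y * (k' * k' * a') \<in> (*) (Nm y) ` {z. k' * k' * a' dvd z}" by (rule imageI) simp
  hence 2: "Nm x * (k * k * a) dvd Nm y * (k' * k' * a')" unfolding e[symmetric] by (auto intro: mult_dvd_mono)
  show ?thesis using zdvd_antisym_abs[OF 2 1] .
qed

lemma scale_qid: "(*) (of_int k) ` qid 1 a b = qid k a b"
proof (cases "k = 0")
  case False
  have m: "of_int k * el u v = el (k * u) (k * v)" for u v by (simp add: el_def algebra_simps)
  show ?thesis
  proof (intro equalityI subsetI)
    fix z assume "z \<in> (*) (of_int k) ` qid 1 a b"
    then obtain w where w: "w \<in> qid 1 a b" "z = of_int k * w" by blast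
    moreover obtain u v where "w = el u v" using w(1) qid_sub_ints by (meson intsE subsetD)
    ultimately have uv: "z = el (k * u) (k * v)" "el u v \<in> qid 1 a b" by (simp_all add: m)
    hence "a dvd u - b * v" by (simp add: qid_mem)
    hence "k * a dvd k * (u - b * v)" by simp
    thus "z \<in> qid k a b" unfolding uv(1) by (simp add: qid_mem algebra_simps)
  next
    fix z assume "z \<in> qid k a b"
    then obtain u v where uv: "z = el u v" "k dvd v" "k * a dvd u - b * v" by (auto simp: qid_def)
    then obtain y x where xy: "v = k * y" "u - b * v = k * a * x" by (auto simp: dvd_def)
    hence "u = k * (a * x + b * y)" by (simp add: algebra_simps)
    hence "z = of_int k * el (a * x + b * y) y" using xy uv by (simp add: m)
    moreover have "el (a * x + b * y) y \<in> qid 1 a b" by (simp add: qid_mem)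
    ultimately show "z \<in> (*) (of_int k) ` qid 1 a b" by blast
  qed
next
  case True
  have "el 0 0 \<in> qid 1 a b" by (simp add: qid_mem)
  moreover have "qid 0 a b = {0}" by (auto simp: qid_def el_def)
  ultimately show ?thesis using True by force
qed

lemma class_relI:
  assumes "I \<in> nz_ideals" "J \<in> nz_ideals" "x \<in> ints" "x \<noteq> 0" "y \<in> ints" "y \<noteq> 0" "(*) x ` I = (*) y ` J"
  shows "(I, J) \<in> class_rel"
proof -
  have "x \<in> ints - {0}" "y \<in> ints - {0}" using assms by auto
  hence "\<exists>a\<in>ints - {0}. \<exists>b\<in>ints - {0}. (*) a ` I = (*) b ` J" using assms(7) by (intro bexI[where x = x] bexI[where x = y])
  thus ?thesis using assms(1,2) unfolding class_rel_def by simp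
qed

lemma class_relE:
  assumes "(I, J) \<in> class_rel"
  obtains x y where "I \<in> nz_ideals" "J \<in> nz_ideals" "x \<in> ints" "x \<noteq> 0" "y \<in> ints" "y \<noteq> 0" "(*) x ` I = (*) y ` J"
proof -
  from assms have 1: "I \<in> nz_ideals" "J \<in> nz_ideals"
    and "\<exists>a\<in>ints - {0}. \<exists>b\<in>ints - {0}. (*) a ` I = (*) b ` J" unfolding class_rel_def by simp_all
  then obtain a b where "a \<in> ints - {0}" "b \<in> ints - {0}" "(*) a ` I = (*) b ` J" by blast
  hence 2: "a \<in> ints" "a \<noteq> 0" "b \<in> ints" "b \<noteq> 0" "(*) a ` I = (*) b ` J" by auto
  show ?thesis by (rule that[OF 1 2])
qed

lemma qid_in_nz: "k > 0 \<Longrightarrow> a > 0 \<Longrightarrow> a dvd poly_at b \<Longrightarrow> qid k a b \<in> nz_ideals"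
  by (simp add: nz_ideals_def is_ideal_qid qid_ne_0)

lemma nz_idealE:
  assumes "I \<in> nz_ideals"
  obtains k a b where "k > 0" "a > 0" "a dvd poly_at b" "I = qid k a b"
  using assms is_ideal_imp_qid[of I] by (auto simp: nz_ideals_def)

lemma qid_rel_qid_1:
  assumes "k > 0" "a > 0" "a dvd poly_at b"
  shows "(qid k a b, qid 1 a b) \<in> class_rel"
  by (rule class_relI[where x = 1 and y = "of_int k"])
    (use assms in \<open>auto simp: qid_in_nz scale_qid simp del: of_int_of_nat_eq\<close>)

lemma ints_eq_qid: "ints = qid 1 1 0"
  by (auto simp: ints_def qid_def)

lemma ints_in_nz: "ints \<in> nz_ideals"
  unfolding ints_eq_qid by (rule qid_in_nz) auto

lemma nz_ideal_scale:
  assumes "I \<in> nz_ideals" "z \<in> ints" "z \<noteq> 0"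
  shows "(*) z ` I \<in> nz_ideals"
proof -
  have I: "I \<subseteq> ints" "0 \<in> I" "\<And>x y. x \<in> I \<Longrightarrow> y \<in> I \<Longrightarrow> x - y \<in> I"
    "\<And>r x. r \<in> ints \<Longrightarrow> x \<in> I \<Longrightarrow> r * x \<in> I" "I \<noteq> {0}"
    using assms(1) by (auto simp: nz_ideals_def is_ideal_def)
  obtain x where x: "x \<in> I" "x \<noteq> 0" using I(2,5) by blast
  have "is_ideal ((*) z ` I)"
    unfolding is_ideal_def
  proof (intro conjI ballI)
    show "(*) z ` I \<subseteq> ints" using I(1) ints_closed(3)[OF assms(2)] by blast
    show "0 \<in> (*) z ` I" using I(2) by (intro image_eqI[of _ _ 0]) auto
  next
    fix a b assume "a \<in> (*) z ` I" "b \<in> (*) z ` I"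
    then obtain c d where "c \<in> I" "d \<in> I" "a = z * c" "b = z * d" by blast
    thus "a - b \<in> (*) z ` I" using I(3)[of c d] by (intro image_eqI[of _ _ "c - d"]) (auto simp: algebra_simps)
  next
    fix r a assume "r \<in> ints" "a \<in> (*) z ` I"
    then obtain c where "c \<in> I" "a = z * c" by blast
    thus "r * a \<in> (*) z ` I" using I(4)[OF \<open>r \<in> ints\<close>, of c] by (intro image_eqI[of _ _ "r * c"]) (auto simp: algebra_simps)
  qed
  moreover have "z * x \<in> (*) z ` I" "z * x \<noteq> 0" using x assms(3) by auto
  ultimately show ?thesis unfolding nz_ideals_def by blast
qed

end

subsection \<open>The quadratic Gauss sum and the L-series at 1\<close>

definition gauss_binomial :: "complex \<Rightarrow> nat \<Rightarrow> nat \<Rightarrow> complex" where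
  "gauss_binomial x m j = (\<Prod>i<j. (1 - x ^ (m - i)) / (1 - x ^ Suc i))"

lemma gauss_binomial_0: "gauss_binomial x m 0 = 1"
  by (simp add: gauss_binomial_def)

lemma gauss_binomial_Suc: "gauss_binomial x m (Suc j) = gauss_binomial x m j * ((1 - x ^ (m - j)) / (1 - x ^ Suc j))"
  by (simp add: gauss_binomial_def)

lemma gauss_binomial_eq_0: "gauss_binomial x m (Suc m) = 0"
  by (simp add: gauss_binomial_Suc)

lemma gauss_binomial_absorb:
  assumes "x ^ Suc j \<noteq> 1"
  shows "(1 - x ^ Suc j) * gauss_binomial x (Suc m) (Suc j) = (1 - x ^ Suc m) * gauss_binomial x m j"
proof -
  have "gauss_binomial x (Suc m) (Suc j) = (\<Prod>i<Suc j. 1 - x ^ (Suc m - i)) / (\<Prod>i<Suc j. 1 - x ^ Suc i)"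
    by (simp only: gauss_binomial_def prod_dividef)
  also have "(\<Prod>i<Suc j. 1 - x ^ (Suc m - i)) = (1 - x ^ Suc m) * (\<Prod>i<j. 1 - x ^ (m - i))"
    by (simp only: prod.lessThan_Suc_shift) simp
  also have "(\<Prod>i<Suc j. 1 - x ^ Suc i) = (\<Prod>i<j. 1 - x ^ Suc i) * (1 - x ^ Suc j)"
    by simp
  finally have "gauss_binomial x (Suc m) (Suc j) =
    (1 - x ^ Suc m) * (\<Prod>i<j. 1 - x ^ (m - i)) / ((\<Prod>i<j. 1 - x ^ Suc i) * (1 - x ^ Suc j))" .
  moreover have "gauss_binomial x m j = (\<Prod>i<j. 1 - x ^ (m - i)) / (\<Prod>i<j. 1 - x ^ Suc i)"
    by (simp only: gauss_binomial_def prod_dividef)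
  moreover have "1 - x ^ Suc j \<noteq> 0" using assms by simp
  ultimately show ?thesis by (simp del: power_Suc)
qed

lemma gauss_binomial_pascal:
  assumes "x ^ Suc j \<noteq> 1" "j \<le> m"
  shows "gauss_binomial x (Suc m) (Suc j) = gauss_binomial x m j + x ^ Suc j * gauss_binomial x m (Suc j)"
proof -
  have n0: "1 - x ^ Suc j \<noteq> 0" using assms by simp
  have "(1 - x ^ Suc j) * (gauss_binomial x m j + x ^ Suc j * gauss_binomial x m (Suc j)) =
     gauss_binomial x m j * ((1 - x ^ Suc j) + x ^ Suc j * (1 - x ^ (m - j)))"
    unfolding gauss_binomial_Suc using n0 by (simp add: field_simps del: power_Suc)
  also have "(1 - x ^ Suc j) + x ^ Suc j * (1 - x ^ (m - j)) = 1 - x ^ Suc m"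
    using assms(2) by (simp add: algebra_simps flip: power_add power_Suc)
  also have "gauss_binomial x m j * (1 - x ^ Suc m) = (1 - x ^ Suc j) * gauss_binomial x (Suc m) (Suc j)"
    using gauss_binomial_absorb[OF assms(1), of m] by (simp add: mult.commute)
  finally show ?thesis using n0 by (metis mult_left_cancel)
qed

definition gauss_alt_sum :: "complex \<Rightarrow> nat \<Rightarrow> complex" where
  "gauss_alt_sum x m = (\<Sum>j\<le>m. (-1) ^ j * gauss_binomial x m j)"

text \<open>Pascal's rule turns the sum for \<open>m + 2\<close> into a difference of two sums at
  \<open>m + 1\<close>, whose terms combine to a factor \<open>1 - x ^ j\<close>. Absorption
  replaces this factor by \<open>1 - x ^ (m + 1)\<close> and lowers both indices. The hypothesis
  keeps the denominators nonzero.\<close>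

lemma gauss_alt_sum_rec:
  fixes x :: complex
  assumes "\<And>i. 0 < i \<Longrightarrow> i \<le> Suc (Suc m) \<Longrightarrow> x ^ i \<noteq> 1"
  shows "gauss_alt_sum x (Suc (Suc m)) = (1 - x ^ Suc m) * gauss_alt_sum x m"
proof -
  let ?M = "Suc m"
  have "gauss_alt_sum x (Suc ?M) = 1 + (\<Sum>j\<le>?M. (-1) ^ Suc j * gauss_binomial x (Suc ?M) (Suc j))"
    by (simp add: gauss_alt_sum_def sum.atMost_Suc_shift gauss_binomial_0 del: sum.atMost_Suc)
  also have "(\<Sum>j\<le>?M. (-1) ^ Suc j * gauss_binomial x (Suc ?M) (Suc j)) =
     (\<Sum>j\<le>?M. - ((-1) ^ j * gauss_binomial x ?M j) + (-1) ^ Suc j * x ^ Suc j * gauss_binomial x ?M (Suc j))"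
  proof (rule sum.cong)
    fix j assume "j \<in> {..?M}"
    hence "x ^ Suc j \<noteq> 1" "j \<le> ?M" using assms[of "Suc j"] by (simp_all del: power_Suc)
    from gauss_binomial_pascal[OF this]
    show "(-1) ^ Suc j * gauss_binomial x (Suc ?M) (Suc j) =
      - ((-1) ^ j * gauss_binomial x ?M j) + (-1) ^ Suc j * x ^ Suc j * gauss_binomial x ?M (Suc j)"
      by (simp add: algebra_simps)
  qed simp
  also have "\<dots> = - gauss_alt_sum x ?M + (\<Sum>j\<le>?M. (-1) ^ Suc j * x ^ Suc j * gauss_binomial x ?M (Suc j))"
    by (simp only: sum.distrib sum_negf gauss_alt_sum_def)
  also have "(\<Sum>j\<le>?M. (-1) ^ Suc j * x ^ Suc j * gauss_binomial x ?M (Suc j)) =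
     (\<Sum>j\<le>?M. (-1) ^ j * x ^ j * gauss_binomial x ?M j) - 1"
  proof -
    have "(\<Sum>j\<le>Suc ?M. (-1) ^ j * x ^ j * gauss_binomial x ?M j) =
        1 + (\<Sum>j\<le>?M. (-1) ^ Suc j * x ^ Suc j * gauss_binomial x ?M (Suc j))"
      by (subst sum.atMost_Suc_shift) (simp add: gauss_binomial_0)
    thus ?thesis by (simp add: gauss_binomial_eq_0)
  qed
  finally have "gauss_alt_sum x (Suc ?M) =
      (\<Sum>j\<le>?M. (-1) ^ j * x ^ j * gauss_binomial x ?M j) - (\<Sum>j\<le>?M. (-1) ^ j * gauss_binomial x ?M j)"
    by (simp add: gauss_alt_sum_def)
  also have "\<dots> = (\<Sum>j\<le>?M. - ((-1) ^ j * ((1 - x ^ j) * gauss_binomial x ?M j)))"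
    by (simp only: sum_subtractf[symmetric]) (simp add: algebra_simps)
  also have "\<dots> = (\<Sum>j\<le>m. - ((-1) ^ Suc j * ((1 - x ^ Suc j) * gauss_binomial x ?M (Suc j))))"
    by (subst sum.atMost_Suc_shift) simp
  also have "\<dots> = (\<Sum>j\<le>m. (-1) ^ j * ((1 - x ^ Suc m) * gauss_binomial x m j))"
  proof (rule sum.cong)
    fix j assume "j \<in> {..m}"
    hence "x ^ Suc j \<noteq> 1" using assms[of "Suc j"] by (simp del: power_Suc)
    from gauss_binomial_absorb[OF this, of m]
    show "- ((-1) ^ Suc j * ((1 - x ^ Suc j) * gauss_binomial x ?M (Suc j))) =
        (-1) ^ j * ((1 - x ^ Suc m) * gauss_binomial x m j)" by simp
  qed simp
  also have "\<dots> = (1 - x ^ Suc m) * gauss_alt_sum x m"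
    by (simp add: gauss_alt_sum_def sum_distrib_left mult_ac)
  finally show ?thesis .
qed

lemma gauss_alt_sum_even:
  fixes x :: complex
  assumes "\<And>i. 0 < i \<Longrightarrow> i \<le> 2 * k \<Longrightarrow> x ^ i \<noteq> 1"
  shows "gauss_alt_sum x (2 * k) = (\<Prod>i<k. 1 - x ^ (2 * i + 1))"
  using assms
proof (induction k)
  case 0
  show ?case by (simp add: gauss_alt_sum_def gauss_binomial_0)
next
  case (Suc k)
  have "gauss_alt_sum x (2 * Suc k) = (1 - x ^ Suc (2 * k)) * gauss_alt_sum x (2 * k)"
    using gauss_alt_sum_rec[of "2 * k" x] Suc.prems by simp
  thus ?case using Suc by simp
qed

text \<open>From \<open>x ^ p = 1\<close> one gets \<open>x ^ (p - 1 - j) = y ^ (j + 1)\<close>, so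
  each factor of the product collapses to a negated power of \<open>y\<close>, and the exponents add
  up to a triangular number.\<close>

lemma gauss_binomial_root_of_unity:
  fixes x y :: complex
  assumes "x ^ p = 1" "y * x = 1" "\<And>i. 0 < i \<Longrightarrow> i < p \<Longrightarrow> x ^ i \<noteq> 1" "j < p"
  shows "gauss_binomial x (p - 1) j = (-1) ^ j * y ^ (j * (j + 1) div 2)"
  using assms(4)
proof (induction j)
  case (Suc j)
  have n0: "1 - x ^ Suc j \<noteq> 0" using assms(3)[of "Suc j"] Suc.prems by simp
  have yx: "y ^ k * x ^ k = 1" for k using assms(2) by (simp flip: power_mult_distrib)
  have "p - 1 - j + Suc j = p" using Suc.prems by simp
  hence "x ^ (p - 1 - j) * x ^ Suc j = 1" using assms(1) by (simp only: power_add[symmetric])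
  hence e: "x ^ (p - 1 - j) = y ^ Suc j" using yx[of "Suc j"]
    by (metis mult.assoc mult.commute mult.right_neutral)
  have "(1 - y ^ Suc j) = - (y ^ Suc j) * (1 - x ^ Suc j)"
    using yx[of "Suc j"] by (simp add: algebra_simps)
  hence r: "(1 - x ^ (p - 1 - j)) / (1 - x ^ Suc j) = - (y ^ Suc j)" unfolding e using n0 by simp
  have "gauss_binomial x (p - 1) (Suc j) = (-1) ^ j * y ^ (j * (j + 1) div 2) * - (y ^ Suc j)"
    unfolding gauss_binomial_Suc r using Suc by simp
  also have "\<dots> = (-1) ^ Suc j * y ^ (j * (j + 1) div 2 + Suc j)" by (simp add: power_add)
  also have "j * (j + 1) div 2 + Suc j = Suc j * (Suc j + 1) div 2"
  proof -
    have "Suc j * (Suc j + 1) = j * (j + 1) + 2 * Suc j" by simp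
    thus ?thesis by simp
  qed
  finally show ?case .
qed (simp add: gauss_binomial_0)

text \<open>The alternating signs cancel those of the binomial coefficients, so the product formula
  evaluates an exponential sum over triangular numbers. Completing the square will make it a
  quadratic Gauss sum.\<close>

lemma gauss_triangular_sum:
  fixes x y :: complex
  assumes "x ^ p = 1" "y * x = 1" "\<And>i. 0 < i \<Longrightarrow> i < p \<Longrightarrow> x ^ i \<noteq> 1" "p = 2 * k + 1"
  shows "(\<Sum>j<p. y ^ (j * (j + 1) div 2)) = (\<Prod>i<k. 1 - x ^ (2 * i + 1))"
proof -
  have "gauss_alt_sum x (2 * k) = (\<Sum>j\<le>2 * k. (-1) ^ j * gauss_binomial x (p - 1) j)"
    by (simp add: gauss_alt_sum_def assms(4))
  also have "\<dots> = (\<Sum>j\<le>2 * k. y ^ (j * (j + 1) div 2))"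
  proof (rule sum.cong)
    fix j assume "j \<in> {..2 * k}"
    hence "gauss_binomial x (p - 1) j = (-1) ^ j * y ^ (j * (j + 1) div 2)"
      by (intro gauss_binomial_root_of_unity assms(1-3)) (auto simp: assms(4))
    thus "(-1) ^ j * gauss_binomial x (p - 1) j = y ^ (j * (j + 1) div 2)"
      by (simp flip: mult.assoc power_add)
  qed simp
  also have "{..2 * k} = {..<p}" using assms(4) by auto
  finally show ?thesis using gauss_alt_sum_even[of k x] assms(3,4) by simp
qed

section \<open>The Fourier series of the square wave\<close>

lemma square_wave_aux:
  "2 * cos t * (\<Sum>j<N. (-1) ^ j * sin (real (2 * j + 1) * t)) = - ((-1) ^ N * sin (real (2 * N) * t))"
proof (induction N)
  case (Suc N)
  \<comment> \<open>Product-to-sum; with the alternating signs the sum telescopes.\<close>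
  have "2 * cos t * sin (real (2 * N + 1) * t) = sin (real (2 * N) * t) + sin (real (2 * Suc N) * t)"
  proof -
    have "sin (real (2 * N + 1) * t + t) = sin (real (2 * N + 1) * t) * cos t + cos (real (2 * N + 1) * t) * sin t"
      "sin (real (2 * N + 1) * t - t) = sin (real (2 * N + 1) * t) * cos t - cos (real (2 * N + 1) * t) * sin t"
      by (rule sin_add, rule sin_diff)
    moreover have "real (2 * N + 1) * t + t = real (2 * Suc N) * t" "real (2 * N + 1) * t - t = real (2 * N) * t"
      by (simp_all add: algebra_simps)
    ultimately show ?thesis by simp
  qed
  hence "2 * cos t * ((-1) ^ N * sin (real (2 * N + 1) * t)) =
      (-1) ^ N * (sin (real (2 * N) * t) + sin (real (2 * Suc N) * t))" by (simp add: mult_ac)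
  thus ?case using Suc.IH by (simp only: sum.lessThan_Suc distrib_left power_Suc)
qed simp

text \<open>A partial sum of the cosine series of the function that is \<open>pi / 4\<close> where
  the cosine is positive and \<open>- pi / 4\<close> where it is negative.\<close>

definition square_wave :: "nat \<Rightarrow> real \<Rightarrow> real" where
  "square_wave N t = (\<Sum>j<N. (-1) ^ j * cos (real (2 * j + 1) * t) / real (2 * j + 1))"

lemma square_wave_deriv:
  assumes "cos t \<noteq> 0"
  shows "(square_wave N has_real_derivative (-1) ^ N * sin (real (2 * N) * t) / (2 * cos t)) (at t)"
proof -
  have "(square_wave N has_real_derivative (\<Sum>j<N. - ((-1) ^ j * sin (real (2 * j + 1) * t)))) (at t)"
    unfolding square_wave_def[abs_def]
  proof (rule DERIV_sum)
    fix j
    have "((\<lambda>t. (-1) ^ j * cos (r * t) / r) has_real_derivative - ((-1) ^ j * sin (r * t))) (at t)"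
      if "r \<noteq> 0" for r :: real
      using that by (auto intro!: derivative_eq_intros)
    thus "((\<lambda>t. (-1) ^ j * cos (real (2 * j + 1) * t) / real (2 * j + 1)) has_real_derivative
        - ((-1) ^ j * sin (real (2 * j + 1) * t))) (at t)" by simp
  qed
  also have "(\<Sum>j<N. - ((-1) ^ j * sin (real (2 * j + 1) * t))) = (-1) ^ N * sin (real (2 * N) * t) / (2 * cos t)"
    using square_wave_aux[of t N] assms by (simp add: sum_negf field_simps)
  finally show ?thesis .
qed

text \<open>The derivative oscillates but does not become small. Adding \<open>g\<close>, which
  amounts to integrating by parts once, leaves a derivative of order \<open>1 / N\<close> as long as
  the cosine stays away from 0, and \<open>g\<close> itself is of order
  \<open>1 / N\<close>.\<close>

lemma square_wave_bound:
  assumes "\<bar>\<phi>\<bar> < pi / 2" "N > 0"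
  shows "\<bar>square_wave N \<phi> - square_wave N 0\<bar> \<le> (\<bar>\<phi>\<bar> / (cos \<phi>)\<^sup>2 + 2 / cos \<phi>) / (4 * real N)"
proof -
  define c where "c = cos \<phi>"
  define g where "g = (\<lambda>t. (-1) ^ N * cos (real (2 * N) * t) / (4 * real N * cos t))"
  define G where "G = (\<lambda>t. square_wave N t + g t)"
  have c0: "c > 0" unfolding c_def by (rule cos_gt_zero_pi) (use assms in auto)
  have cosge: "cos t \<ge> c" if "\<bar>t\<bar> \<le> \<bar>\<phi>\<bar>" for t
  proof -
    have "cos \<bar>\<phi>\<bar> \<le> cos \<bar>t\<bar>" by (rule cos_monotone_0_pi_le) (use that assms in auto)
    thus ?thesis by (simp add: c_def)
  qed
  have der: "(G has_real_derivative (-1) ^ N * cos (real (2 * N) * t) * sin t / (4 * real N * (cos t)\<^sup>2)) (at t)"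
    if t: "\<bar>t\<bar> \<le> \<bar>\<phi>\<bar>" for t
  proof -
    have c1: "cos t \<noteq> 0" using cosge[OF t] c0 by linarith
    have "(g has_real_derivative (-1) ^ N * (- sin (real (2 * N) * t) / (2 * cos t)) +
        (-1) ^ N * cos (real (2 * N) * t) * sin t / (4 * real N * (cos t)\<^sup>2)) (at t)"
      unfolding g_def using c1 assms(2)
      by (auto intro!: derivative_eq_intros simp: field_simps power2_eq_square)
    from DERIV_add[OF square_wave_deriv[OF c1, of N] this] show ?thesis
      unfolding G_def by (simp add: algebra_simps)
  qed
  have "norm (G \<phi> - G 0) \<le> 1 / (4 * real N * c\<^sup>2) * norm (\<phi> - 0)"
  proof (rule field_differentiable_bound[where S = "{- \<bar>\<phi>\<bar>..\<bar>\<phi>\<bar>}"])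
    show "convex {- \<bar>\<phi>\<bar>..\<bar>\<phi>\<bar>}" by simp
    fix t assume "t \<in> {- \<bar>\<phi>\<bar>..\<bar>\<phi>\<bar>}"
    hence t: "\<bar>t\<bar> \<le> \<bar>\<phi>\<bar>" by auto
    show "(G has_field_derivative (-1) ^ N * cos (real (2 * N) * t) * sin t / (4 * real N * (cos t)\<^sup>2))
        (at t within {- \<bar>\<phi>\<bar>..\<bar>\<phi>\<bar>})"
      by (rule has_field_derivative_at_within[OF der[OF t]])
    have "norm ((-1) ^ N * cos (real (2 * N) * t) * sin t / (4 * real N * (cos t)\<^sup>2)) =
        (\<bar>cos (real (2 * N) * t)\<bar> * \<bar>sin t\<bar>) / (4 * real N * (cos t)\<^sup>2)"
      by (simp add: abs_mult)
    also have "\<dots> \<le> 1 / (4 * real N * c\<^sup>2)"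
    proof (rule frac_le)
      show "\<bar>cos (real (2 * N) * t)\<bar> * \<bar>sin t\<bar> \<le> 1" by (intro mult_le_one abs_cos_le_one abs_sin_le_one) simp
      show "4 * real N * c\<^sup>2 \<le> 4 * real N * (cos t)\<^sup>2"
        using cosge[OF t] c0 by (intro mult_left_mono power_mono) auto
    qed (use c0 assms(2) in auto)
    finally show "norm ((-1) ^ N * cos (real (2 * N) * t) * sin t / (4 * real N * (cos t)\<^sup>2)) \<le> 1 / (4 * real N * c\<^sup>2)" .
  qed auto
  hence 1: "\<bar>G \<phi> - G 0\<bar> \<le> \<bar>\<phi>\<bar> / (4 * real N * c\<^sup>2)" by simp
  have gb: "\<bar>g t\<bar> \<le> 1 / (4 * real N * c)" if t: "\<bar>t\<bar> \<le> \<bar>\<phi>\<bar>" for t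
  proof -
    have "\<bar>g t\<bar> = \<bar>cos (real (2 * N) * t)\<bar> / (4 * real N * cos t)"
      using cosge[OF t] c0 by (simp add: g_def abs_mult)
    also have "\<dots> \<le> 1 / (4 * real N * c)"
      by (rule frac_le) (use cosge[OF t] c0 assms(2) in \<open>auto intro!: mult_left_mono\<close>)
    finally show ?thesis .
  qed
  have "\<bar>square_wave N \<phi> - square_wave N 0\<bar> \<le> \<bar>G \<phi> - G 0\<bar> + \<bar>g \<phi>\<bar> + \<bar>g 0\<bar>"
    unfolding G_def by linarith
  also have "\<dots> \<le> \<bar>\<phi>\<bar> / (4 * real N * c\<^sup>2) + 1 / (4 * real N * c) + 1 / (4 * real N * c)"
    using 1 gb[of \<phi>] gb[of 0] by (intro add_mono) auto
  also have "\<dots> = (\<bar>\<phi>\<bar> / c\<^sup>2 + 2 / c) / (4 * real N)"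
    using c0 assms(2) by (simp add: field_simps)
  finally show ?thesis by (simp add: c_def)
qed

text \<open>At 0 this is Leibniz's series for \<open>pi / 4\<close>, and the bound shows that the
  limit does not depend on the angle.\<close>

lemma square_wave_tendsto:
  assumes "\<bar>\<phi>\<bar> < pi / 2"
  shows "(\<lambda>N. square_wave N \<phi>) \<longlonglongrightarrow> pi / 4"
proof -
  have "(\<lambda>N. square_wave N 0) \<longlonglongrightarrow> pi / 4"
  proof -
    have "summable (\<lambda>k. (-1) ^ k * 1 / real (k * 2 + 1) :: real)"
      using summable_arctan_series[of 1] by simp
    hence "(\<lambda>N. \<Sum>k<N. (-1) ^ k * 1 / real (k * 2 + 1)) \<longlonglongrightarrow> pi / 4"
      unfolding pi_series by (rule summable_LIMSEQ)
    thus ?thesis by (simp add: square_wave_def mult.commute)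
  qed
  moreover have "(\<lambda>N. square_wave N \<phi> - square_wave N 0) \<longlonglongrightarrow> 0"
  proof (rule Lim_null_comparison)
    show "eventually (\<lambda>N. norm (square_wave N \<phi> - square_wave N 0) \<le>
        (\<bar>\<phi>\<bar> / (cos \<phi>)\<^sup>2 + 2 / cos \<phi>) / (4 * real N)) sequentially"
      using eventually_gt_at_top[of 0] by eventually_elim (use square_wave_bound[OF assms] in auto)
    show "(\<lambda>N. (\<bar>\<phi>\<bar> / (cos \<phi>)\<^sup>2 + 2 / cos \<phi>) / (4 * real N)) \<longlonglongrightarrow> 0"
      by real_asymp
  qed
  ultimately have "(\<lambda>N. square_wave N 0 + (square_wave N \<phi> - square_wave N 0)) \<longlonglongrightarrow> pi / 4 + 0"
    by (rule tendsto_add)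
  thus ?thesis by simp
qed

lemma square_wave_shift_pi: "square_wave N (t - pi) = - square_wave N t"
proof -
  have "cos (real (2 * j + 1) * (t - pi)) = - cos (real (2 * j + 1) * t)" for j
  proof -
    have "real (2 * j + 1) * (t - pi) = (real (2 * j + 1) * t - pi) - 2 * real j * pi" by (simp add: algebra_simps)
    moreover have "cos (x - 2 * real j * pi) = cos x" for x
      by (simp add: cos_diff)
    ultimately show ?thesis by (simp add: cos_diff)
  qed
  thus ?thesis by (simp add: square_wave_def sum_negf)
qed

section \<open>The sign of the Gauss sum and the value of the L-series\<close>

context prime_1_mod_4
begin

definition e :: "int \<Rightarrow> complex" where "e k = cis (2 * pi * of_int k / of_nat p)"

lemma e_0 [simp]: "e 0 = 1"
  by (simp add: e_def)

lemma e_add: "e (a + b) = e a * e b"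
  by (simp add: e_def cis_mult add_divide_distrib distrib_left)

lemma e_minus: "e (- a) * e a = 1"
  using e_add[of "- a" a] by simp

lemma e_power: "e a ^ n = e (int n * a)"
  by (induction n) (simp_all add: e_add algebra_simps)

lemma e_eq_1_iff: "e a = 1 \<longleftrightarrow> int p dvd a"
proof
  assume "int p dvd a"
  then obtain k where k: "a = int p * k" by (auto simp: dvd_def)
  have "2 * pi * of_int a / of_nat p = 2 * pi * of_int k" using p_gt2 by (simp add: k)
  thus "e a = 1" unfolding e_def by (simp add: cis_multiple_2pi)
next
  assume "e a = 1"
  hence "cos (2 * pi * of_int a / of_nat p) = 1" by (simp add: e_def complex_eq_iff)
  then obtain n :: int where "2 * pi * of_int a / of_nat p = of_int n * 2 * pi" by (auto simp: cos_one_2pi_int)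
  hence "real_of_int a = of_int (n * int p)" using p_gt2 by (simp add: field_simps)
  hence "a = n * int p" by (simp only: of_int_eq_iff)
  thus "int p dvd a" by simp
qed

lemma e_mod: "e (a mod int p) = e a"
proof -
  have "e a = e (int p * (a div int p) + a mod int p)" by simp
  also have "\<dots> = e (a mod int p)" unfolding e_add using e_eq_1_iff[of "int p * (a div int p)"] by simp
  finally show ?thesis by simp
qed

lemma e_cong: "[a = b] (mod int p) \<Longrightarrow> e a = e b"
  using e_mod[of a] e_mod[of b] by (simp add: cong_mod)

abbreviation Z :: "int set" where "Z \<equiv> {0..int p - 1}"

lemma sum_shift: "(\<Sum>x\<in>Z. f ((x + d) mod int p)) = (\<Sum>x\<in>Z. f x)"
  by (rule sum.reindex_bij_betw[OF bij_shift])

lemma bij_scale: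
  assumes "\<not> int p dvd a"
  shows "bij_betw (\<lambda>x. (a * x) mod int p) Z Z"
proof -
  have inj: "inj_on (\<lambda>x. (a * x) mod int p) Z"
  proof (rule inj_onI)
    fix x y assume h: "x \<in> Z" "y \<in> Z" "(a * x) mod int p = (a * y) mod int p"
    hence "[a * x = a * y] (mod int p)" by (simp add: cong_mod)
    hence "[x = y] (mod int p)" using assms by (rule cong_cancel)
    thus "x = y" by (rule cong_small_imp_eq) (use h in auto)
  qed
  moreover have "(\<lambda>x. (a * x) mod int p) ` Z \<subseteq> Z" using p_gt2 by auto
  ultimately have "(\<lambda>x. (a * x) mod int p) ` Z = Z" by (intro endo_inj_surj) auto
  thus ?thesis using inj by (simp add: bij_betw_def)
qed

lemma sum_scale: "\<not> int p dvd a \<Longrightarrow> (\<Sum>x\<in>Z. f ((a * x) mod int p)) = (\<Sum>x\<in>Z. f x)"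
  by (rule sum.reindex_bij_betw[OF bij_scale])

lemma sum_e: "(\<Sum>x\<in>Z. e (a * x)) = (if int p dvd a then of_nat p else 0)"
proof (cases "int p dvd a")
  case True
  hence "e (a * x) = 1" for x by (simp add: e_eq_1_iff)
  thus ?thesis using True p_gt2 by simp
next
  case False
  have "(\<Sum>x\<in>Z. e (a * x)) = (\<Sum>x\<in>Z. e ((a * x) mod int p))" by (simp add: e_mod)
  also have "\<dots> = (\<Sum>x\<in>Z. e x)" by (rule sum_scale[OF False])
  finally have 1: "(\<Sum>x\<in>Z. e (a * x)) = (\<Sum>x\<in>Z. e x)" .
  have "(\<Sum>x\<in>Z. e x) = (\<Sum>x\<in>Z. e ((x + 1) mod int p))" by (rule sum_shift[symmetric])
  also have "\<dots> = (\<Sum>x\<in>Z. e x) * e 1" by (simp add: e_mod e_add sum_distrib_right)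
  finally have "(\<Sum>x\<in>Z. e x) * (1 - e 1) = 0" by (simp add: algebra_simps)
  moreover have "e 1 \<noteq> 1" using p_gt2 by (simp add: e_eq_1_iff)
  ultimately show ?thesis using 1 False by simp
qed

definition G :: complex where "G = (\<Sum>x\<in>Z. e (x\<^sup>2))"

text \<open>What remains of the product of the \<open>1 - x ^ (2 i + 1)\<close> after a phase is
  taken out of each factor. Only its sign has to be read off; the absolute value of \<open>G\<close>
  is computed separately.\<close>

definition gauss_prod :: real where "gauss_prod = (\<Prod>i<2*q. 2 * sin (2 * pi * real (2 * i + 1) / real p))"

text \<open>With \<open>x = e (-2)\<close> the triangular exponents become \<open>j (j + 1)\<close>.
  Completing the square and extracting the phases from the product produce the same value of
  \<open>e\<close>, which cancels; the remaining factors \<open>\<i>\<close> give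
  \<open>\<i> ^ (2 q) = (-1) ^ q\<close>.\<close>

lemma G_eq_gauss_prod: "G = of_real ((-1) ^ q * gauss_prod)"
proof -
  define k where "k = 2 * q"
  have pk: "p = 2 * k + 1" using p_eq by (simp add: k_def)
  have ek: "(\<Sum>j<p. e 2 ^ (j * (j + 1) div 2)) = (\<Prod>i<k. 1 - e (-2) ^ (2 * i + 1))"
  proof (rule gauss_triangular_sum[where p = p])
    show "e (-2) ^ p = 1" by (simp add: e_power e_eq_1_iff)
    show "e 2 * e (-2) = 1" using e_minus[of 2] by (simp add: mult.commute)
    fix i assume i: "0 < i" "i < p"
    have "\<not> int p dvd - (int i * 2)"
    proof
      assume "int p dvd - (int i * 2)"
      hence "int p dvd int i * 2" by simp
      hence "int p dvd int i \<or> int p dvd 2" using prime_int_p prime_dvd_mult_iff by blast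
      thus False using i p_gt2 not_dvd_range[of 2] not_dvd_range[of "int i"] by auto
    qed
    thus "e (-2) ^ i \<noteq> 1" by (simp add: e_power e_eq_1_iff)
  qed (rule pk)
  have l: "e 2 ^ (j * (j + 1) div 2) = e (int j * (int j + 1))" for j
  proof -
    have "even (j * (j + 1))" by simp
    hence "int (j * (j + 1) div 2) * 2 = int (j * (j + 1))" by (metis dvd_div_mult_self of_nat_mult of_nat_numeral)
    thus ?thesis by (simp add: e_power algebra_simps)
  qed
  have "(\<Sum>j<p. e (int j * (int j + 1))) = (\<Sum>x\<in>Z. e (x * (x + 1)))"
    by (rule sum.reindex_bij_witness[where i = nat and j = int]) auto
  \<comment> \<open>Completing the square: \<open>k + 1\<close> is one half modulo
    \<open>p = 2 k + 1\<close>.\<close>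
  also have "\<dots> = (\<Sum>x\<in>Z. e (((x + (int k + 1)) mod int p)\<^sup>2) * e (- (int k + 1)\<^sup>2))"
  proof (rule sum.cong)
    fix x assume "x \<in> Z"
    have "[((x + (int k + 1)) mod int p)\<^sup>2 + - (int k + 1)\<^sup>2 = (x + (int k + 1))\<^sup>2 + - (int k + 1)\<^sup>2] (mod int p)"
      by (intro cong_add cong_pow cong_refl) simp
    also have "(x + (int k + 1))\<^sup>2 + - (int k + 1)\<^sup>2 = x * (x + 1) + int p * x"
      by (simp add: pk power2_eq_square algebra_simps)
    also have "[x * (x + 1) + int p * x = x * (x + 1)] (mod int p)" by (simp add: cong_iff_dvd_diff)
    finally show "e (x * (x + 1)) = e (((x + (int k + 1)) mod int p)\<^sup>2) * e (- (int k + 1)\<^sup>2)"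
      unfolding e_add[symmetric] by (rule e_cong[symmetric])
  qed simp
  also have "\<dots> = G * e (- (int k + 1)\<^sup>2)"
    unfolding sum_distrib_right[symmetric] G_def by (subst sum_shift) simp
  finally have A: "G * e (- (int k + 1)\<^sup>2) = (\<Prod>i<k. 1 - e (-2) ^ (2 * i + 1))"
    using ek unfolding l by simp
  have s: "(\<Prod>i<m. e (- int (2 * i + 1))) = e (- (int m)\<^sup>2)" for m
  proof (induction m)
    case (Suc m)
    have "(\<Prod>i<Suc m. e (- int (2 * i + 1))) = e (- (int m)\<^sup>2) * e (- int (2 * m + 1))"
      using Suc by (simp only: prod.lessThan_Suc)
    also have "\<dots> = e (- (int (Suc m))\<^sup>2)"
      unfolding e_add[symmetric] by (rule arg_cong[of _ _ e]) (simp add: power2_eq_square algebra_simps)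
    finally show ?case .
  qed simp
  have f: "1 - e (-2) ^ (2 * i + 1) = e (- int (2 * i + 1)) * (\<i> * of_real (2 * sin (2 * pi * real (2 * i + 1) / real p)))" for i
  proof -
    let ?n = "int (2 * i + 1)"
    let ?t = "2 * pi * real (2 * i + 1) / real p"
    have "e k - e (- k) = \<i> * of_real (2 * sin (2 * pi * of_int k / of_nat p))" for k
      by (simp add: e_def complex_eq_iff)
    from this[of ?n] have "e ?n - e (- ?n) = \<i> * of_real (2 * sin ?t)" by simp
    moreover have "e (- ?n) * (e ?n - e (- ?n)) = 1 - e (- ?n + - ?n)"
      unfolding right_diff_distrib e_minus by (simp only: e_add)
    moreover have "e (-2) ^ (2 * i + 1) = e (- ?n + - ?n)"
      unfolding e_power by (rule arg_cong[of _ _ e]) simp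
    ultimately show ?thesis by simp
  qed
  have "(\<Prod>i<k. 1 - e (-2) ^ (2 * i + 1)) = e (- (int k)\<^sup>2) * (\<i> ^ k * of_real gauss_prod)"
    unfolding f prod.distrib s by (simp add: gauss_prod_def k_def)
  also have "e (- (int k)\<^sup>2) = e (- (int k + 1)\<^sup>2)"
    by (rule e_cong) (simp add: cong_iff_dvd_diff pk power2_eq_square algebra_simps)
  finally have "G * e (- (int k + 1)\<^sup>2) = (\<i> ^ k * of_real gauss_prod) * e (- (int k + 1)\<^sup>2)"
    using A by (simp add: mult_ac)
  moreover have "e (- (int k + 1)\<^sup>2) \<noteq> 0" by (simp add: e_def)
  ultimately have "G = \<i> ^ k * of_real gauss_prod" by (simp only: mult_cancel_right) simp
  thus ?thesis by (simp add: k_def power_mult)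
qed

lemma angle_less: "2 * pi * x / real p < c * pi \<longleftrightarrow> 2 * x < c * real p"
proof -
  have "2 * pi * x / real p < c * pi \<longleftrightarrow> pi * (2 * x / real p) < pi * c" by (simp add: mult_ac)
  also have "\<dots> \<longleftrightarrow> 2 * x / real p < c" by (simp only: mult_less_cancel_left_pos[OF pi_gt_zero])
  also have "\<dots> \<longleftrightarrow> 2 * x < c * real p" using p_gt2 by (simp add: pos_divide_less_eq)
  finally show ?thesis .
qed

lemma less_angle: "c * pi < 2 * pi * x / real p \<longleftrightarrow> c * real p < 2 * x"
proof -
  have "c * pi < 2 * pi * x / real p \<longleftrightarrow> pi * c < pi * (2 * x / real p)" by (simp add: mult_ac)
  also have "\<dots> \<longleftrightarrow> c < 2 * x / real p" by (simp only: mult_less_cancel_left_pos[OF pi_gt_zero])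
  also have "\<dots> \<longleftrightarrow> c * real p < 2 * x" using p_gt2 by (simp add: pos_less_divide_eq)
  finally show ?thesis .
qed

text \<open>The angles lie in the upper half circle for the first \<open>q\<close> factors and in
  the lower one for the other \<open>q\<close>, so \<open>(-1) ^ q\<close> compensates the negative
  sines.\<close>

lemma gauss_prod_sign: "(-1) ^ q * gauss_prod > 0"
proof -
  let ?s = "\<lambda>i. 2 * sin (2 * pi * real (2 * i + 1) / real p)"
  have rp: "real p = 4 * real q + 1" using p_eq by simp
  have spl: "{..<2*q} = {..<q} \<union> {q..<2*q}" by auto
  define A where "A = (\<Prod>i<q. ?s i)"
  define B where "B = (\<Prod>i\<in>{q..<2*q}. - ?s i)"
  have "(\<Prod>i\<in>{q..<2*q}. ?s i) = (\<Prod>i\<in>{q..<2*q}. (-1) * (- ?s i))"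
    by (rule prod.cong) simp_all
  also have "\<dots> = (-1) ^ q * B"
    unfolding prod.distrib B_def by simp
  finally have "gauss_prod = A * ((-1) ^ q * B)"
    unfolding gauss_prod_def A_def by (subst spl, subst prod.union_disjoint) auto
  moreover have "(-1) ^ q * (A * ((-1) ^ q * B)) = A * B"
    by (cases "even q") simp_all
  ultimately have e: "(-1) ^ q * gauss_prod = A * B" by simp
  have "A > 0" unfolding A_def
  proof (rule prod_pos)
    fix i assume "i \<in> {..<q}"
    hence "real i + 1 \<le> real q" by simp
    hence "2 * real (2 * i + 1) < real p" using rp by simp
    hence "2 * pi * real (2 * i + 1) / real p < pi" using angle_less[of "real (2 * i + 1)" 1] by simp
    moreover have "0 < 2 * pi * real (2 * i + 1) / real p" using p_gt2 by simp
    ultimately show "?s i > 0" by (simp add: sin_gt_zero)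
  qed
  moreover have "B > 0" unfolding B_def
  proof (rule prod_pos)
    fix i assume "i \<in> {q..<2*q}"
    hence "real q \<le> real i" "real i + 1 \<le> 2 * real q" by auto
    hence "real p < 2 * real (2 * i + 1)" "real (2 * i + 1) < real p" using rp by simp_all
    hence "pi < 2 * pi * real (2 * i + 1) / real p" "2 * pi * real (2 * i + 1) / real p < 2 * pi"
      using less_angle[of 1 "real (2 * i + 1)"] angle_less[of "real (2 * i + 1)" 2] by simp_all
    thus "- ?s i > 0" using sin_lt_zero by simp
  qed
  ultimately show ?thesis using e by simp
qed

text \<open>After the substitution \<open>x = y + d\<close> the inner sum over \<open>y\<close> is a
  complete sum of a character with parameter \<open>2 d\<close>, which vanishes unless
  \<open>d = 0\<close>.\<close>

lemma G_norm: "G * cnj G = of_nat p"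
proof -
  have cnj_e: "cnj (e a) = e (- a)" for a by (simp add: e_def cis_cnj)
  have "G * cnj G = (\<Sum>y\<in>Z. \<Sum>x\<in>Z. e (x\<^sup>2) * e (- (y\<^sup>2)))"
    unfolding G_def cnj_sum cnj_e by (subst sum_product, subst sum.swap) simp
  also have "\<dots> = (\<Sum>y\<in>Z. \<Sum>d\<in>Z. e (d\<^sup>2) * e (2 * d * y))"
  proof (rule sum.cong)
    fix y assume "y \<in> Z"
    have "(\<Sum>x\<in>Z. e (x\<^sup>2) * e (- (y\<^sup>2))) = (\<Sum>d\<in>Z. e (((d + y) mod int p)\<^sup>2) * e (- (y\<^sup>2)))"
      by (rule sum_shift[symmetric])
    also have "\<dots> = (\<Sum>d\<in>Z. e (d\<^sup>2) * e (2 * d * y))"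
    proof (rule sum.cong)
      fix d assume "d \<in> Z"
      have "[((d + y) mod int p)\<^sup>2 + - (y\<^sup>2) = (d + y)\<^sup>2 + - (y\<^sup>2)] (mod int p)"
        by (intro cong_add cong_pow cong_refl) simp
      also have "(d + y)\<^sup>2 + - (y\<^sup>2) = d\<^sup>2 + 2 * d * y" by (simp add: power2_eq_square algebra_simps)
      finally show "e (((d + y) mod int p)\<^sup>2) * e (- (y\<^sup>2)) = e (d\<^sup>2) * e (2 * d * y)"
        unfolding e_add[symmetric] by (rule e_cong)
    qed simp
    finally show "(\<Sum>x\<in>Z. e (x\<^sup>2) * e (- (y\<^sup>2))) = (\<Sum>d\<in>Z. e (d\<^sup>2) * e (2 * d * y))" .
  qed simp
  also have "\<dots> = (\<Sum>d\<in>Z. e (d\<^sup>2) * (\<Sum>y\<in>Z. e (2 * d * y)))"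
    by (subst sum.swap) (simp add: sum_distrib_left)
  also have "\<dots> = (\<Sum>d\<in>Z. if d = 0 then of_nat p else 0)"
  proof (rule sum.cong)
    fix d assume d: "d \<in> Z"
    have "int p dvd 2 * d \<longleftrightarrow> d = 0"
    proof
      assume "int p dvd 2 * d"
      hence "int p dvd 2 \<or> int p dvd d" using prime_int_p prime_dvd_mult_iff by blast
      thus "d = 0" using d p_gt2 not_dvd_range[of 2] not_dvd_range[of d] by (cases "d = 0") auto
    qed simp
    thus "e (d\<^sup>2) * (\<Sum>y\<in>Z. e (2 * d * y)) = (if d = 0 then of_nat p else 0)"
      unfolding sum_e by simp
  qed simp
  also have "\<dots> = of_nat p" using p_gt2 by simp
  finally show ?thesis .
qed

lemma G_eq_sqrt: "G = of_real (sqrt (real p))"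
proof -
  define g where "g = (-1) ^ q * gauss_prod"
  have G: "G = of_real g" using G_eq_gauss_prod by (simp only: g_def)
  have "(of_real (g * g) :: complex) = of_real (real p)" using G_norm by (simp add: G)
  hence "g * g = real p" by (simp only: of_real_eq_iff)
  hence "g\<^sup>2 = real p" by (simp add: power2_eq_square)
  moreover have "g > 0" unfolding g_def by (rule gauss_prod_sign)
  ultimately have "g = sqrt (real p)" by (metis real_sqrt_abs abs_of_pos)
  thus ?thesis by (simp add: G)
qed

lemma sum_Z_split: "(\<Sum>x\<in>Z. f x) = f 0 + (\<Sum>x\<in>{1..int p - 1}. f x)"
  unfolding range_insert by simp

text \<open>Among the squares of all classes every residue occurs twice and 0 once, so
  \<open>G\<close> is 1 plus twice the sum over residues; the sum of \<open>e k\<close> over nonzero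
  \<open>k\<close> is \<open>-1\<close>.\<close>

lemma legendre_sum_e_1: "(\<Sum>k\<in>Z. of_int (L k) * e k) = G"
proof -
  let ?Q = "quad_residues p"
  have subQ: "?Q \<subseteq> {1..int p - 1}" by (auto simp: quad_residues_alt)
  have sq: "(\<Sum>x\<in>H. e (x\<^sup>2)) = (\<Sum>k\<in>?Q. e k)"
  proof -
    have "(\<Sum>k\<in>?Q. e k) = (\<Sum>k\<in>{1..2*q}. e ((int k)\<^sup>2 mod int p))"
      using sum.reindex_bij_betw[OF bij_squares, of e] by simp
    also have "\<dots> = (\<Sum>x\<in>H. e (x\<^sup>2))"
      by (rule sum.reindex_bij_witness[where i = nat and j = int]) (auto simp: e_mod)
    finally show ?thesis by simp
  qed
  have "{1..int p - 1} = H \<union> (\<lambda>x. int p - x) ` H"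
  proof (intro equalityI subsetI)
    fix x assume x: "x \<in> {1..int p - 1}"
    show "x \<in> H \<union> (\<lambda>x. int p - x) ` H"
    proof (cases "x \<le> 2 * int q")
      case False
      hence "x = int p - (int p - x)" "int p - x \<in> H" using x bounds by auto
      thus ?thesis by blast
    qed (use x in auto)
  qed (use bounds in auto)
  hence "(\<Sum>x\<in>{1..int p - 1}. e (x\<^sup>2)) = (\<Sum>x\<in>H. e (x\<^sup>2)) + (\<Sum>x\<in>(\<lambda>x. int p - x) ` H. e (x\<^sup>2))"
    by (simp only:) (rule sum.union_disjoint, use bounds in auto)
  also have "(\<Sum>x\<in>(\<lambda>x. int p - x) ` H. e (x\<^sup>2)) = (\<Sum>x\<in>H. e ((int p - x)\<^sup>2))"
    by (subst sum.reindex) (auto simp: inj_on_def)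
  also have "\<dots> = (\<Sum>x\<in>H. e (x\<^sup>2))"
  proof (rule sum.cong)
    fix x
    have "(int p - x)\<^sup>2 - x\<^sup>2 = int p * (int p - 2 * x)" by (simp add: power2_eq_square algebra_simps)
    thus "e ((int p - x)\<^sup>2) = e (x\<^sup>2)" by (intro e_cong) (simp add: cong_iff_dvd_diff)
  qed simp
  finally have 1: "G = 1 + 2 * (\<Sum>k\<in>?Q. e k)" unfolding G_def sum_Z_split sq by simp
  have "(\<Sum>k\<in>{1..int p - 1}. of_int (L k) * e k) = (\<Sum>k\<in>{1..int p - 1}. 2 * (if k \<in> ?Q then e k else 0) - e k)"
  proof (rule sum.cong)
    fix k assume "k \<in> {1..int p - 1}"
    thus "of_int (L k) * e k = 2 * (if k \<in> ?Q then e k else 0) - e k"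
      using L_pm1[of k] by (auto simp: quad_residues_alt)
  qed simp
  also have "\<dots> = 2 * (\<Sum>k\<in>{1..int p - 1}. if k \<in> ?Q then e k else 0) - (\<Sum>k\<in>{1..int p - 1}. e k)"
    by (simp only: sum_subtractf sum_distrib_left)
  also have "(\<Sum>k\<in>{1..int p - 1}. if k \<in> ?Q then e k else 0) = (\<Sum>k\<in>?Q. e k)"
    using subQ by (simp add: sum.inter_restrict[symmetric] Int_absorb1)
  also have "(\<Sum>k\<in>{1..int p - 1}. e k) = -1"
  proof -
    have "(\<Sum>x\<in>Z. e (1 * x)) = 0" unfolding sum_e using p_gt2 by simp
    thus ?thesis unfolding sum_Z_split by (simp add: add_eq_0_iff)
  qed
  finally have "(\<Sum>k\<in>{1..int p - 1}. of_int (L k) * e k) = G" using 1 by simp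
  thus ?thesis unfolding sum_Z_split by (simp add: L_0_iff)
qed

text \<open>Scaling the summation variable by \<open>n\<close> pulls out \<open>L n\<close>, which
  is its own inverse. For \<open>n\<close> divisible by \<open>p\<close> both sides vanish.\<close>

lemma legendre_sum_e: "(\<Sum>k\<in>Z. of_int (L k) * e (n * k)) = of_int (L n) * G"
proof (cases "int p dvd n")
  case True
  hence "e (n * k) = 1" for k by (simp add: e_eq_1_iff)
  hence "(\<Sum>k\<in>Z. of_int (L k) * e (n * k)) = of_int (\<Sum>k\<in>Z. L k)" by simp
  also have "(\<Sum>k\<in>Z. L k) = 0" unfolding sum_Z_split using sum_L by (simp add: L_0_iff)
  finally show ?thesis using True L_0_iff[of n] by simp
next
  case False
  have LL: "L n * L n = 1"
  proof -
    have "L n \<noteq> 0" using False by (simp add: L_0_iff)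
    hence "L n = 1 \<or> L n = -1" using Legendre_values[of n p] by blast
    thus ?thesis by fastforce
  qed
  have "G = (\<Sum>k\<in>Z. of_int (L ((n * k) mod int p)) * e ((n * k) mod int p))"
    unfolding legendre_sum_e_1[symmetric] by (rule sum_scale[OF False, symmetric])
  also have "\<dots> = of_int (L n) * (\<Sum>k\<in>Z. of_int (L k) * e (n * k))"
    by (simp add: L_mod L_mult e_mod sum_distrib_left mult.assoc)
  finally have "of_int (L n) * G = of_int (L n * L n) * (\<Sum>k\<in>Z. of_int (L k) * e (n * k))" by simp
  thus ?thesis unfolding LL by simp
qed

lemma legendre_sum_cos:
  "(\<Sum>k\<in>{1..int p - 1}. of_int (L k) * cos (of_int n * (2 * pi * of_int k / real p))) = of_int (L n) * sqrt (real p)"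
proof -
  have "Re (\<Sum>k\<in>Z. of_int (L k) * e (n * k)) = of_int (L n) * sqrt (real p)"
    unfolding legendre_sum_e G_eq_sqrt by simp
  moreover have "Re (\<Sum>k\<in>Z. of_int (L k) * e (n * k)) =
      (\<Sum>k\<in>Z. of_int (L k) * cos (of_int n * (2 * pi * of_int k / real p)))"
    unfolding Re_sum by (rule sum.cong) (simp_all add: e_def mult_ac)
  ultimately show ?thesis unfolding sum_Z_split by (simp add: L_0_iff)
qed

lemma square_wave_2pi: "square_wave N (t - 2 * pi) = square_wave N t"
  using square_wave_shift_pi[of N t] square_wave_shift_pi[of N "t - pi"] by (simp add: algebra_simps)

lemma sum_L_quarter: "(\<Sum>k\<in>{1..int q}. L k) = int q - 2 * int N4"
proof -
  have "(\<Sum>k\<in>{1..int q}. L k) = (\<Sum>k\<in>{1..int q}. 1 - 2 * (if L k = -1 then 1 else 0))"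
    by (rule sum.cong) (use L_pm1 H_sub in fastforce)+
  also have "\<dots> = int q - 2 * (\<Sum>k\<in>{1..int q}. if L k = -1 then 1 else 0)"
    by (simp add: sum_subtractf sum_distrib_left)
  also have "(\<Sum>k\<in>{1..int q}. if L k = -1 then 1 else 0) = int N4"
    by (simp add: N4_def sum.If_cases Int_def)
  finally show ?thesis .
qed

text \<open>The wave tends to \<open>pi / 4\<close> for \<open>k\<close> up to \<open>q\<close> and
  beyond \<open>3 q\<close>, and to \<open>- pi / 4\<close> in between. The symbols sum to 0 and are
  symmetric under replacing \<open>k\<close> by \<open>p - k\<close>, so the signed sum is four
  times the sum over the first quarter.\<close>

lemma square_wave_legendre:
  "(\<lambda>N. \<Sum>k\<in>{1..int p - 1}. of_int (L k) * square_wave N (2 * pi * of_int k / real p))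
     \<longlonglongrightarrow> pi * (real q - 2 * real N4)"
proof -
  define \<theta> where "\<theta> = (\<lambda>k. 2 * pi * real_of_int k / real p)"
  define sg where "sg = (\<lambda>k. if k \<in> {int q + 1..3 * int q} then -1 else (1::int))"
  have rp: "real p = 4 * real q + 1" using p_eq by simp
  have lim: "(\<lambda>N. square_wave N (\<theta> k)) \<longlonglongrightarrow> of_int (sg k) * (pi / 4)" if k: "k \<in> {1..int p - 1}" for k
  proof -
    consider "k \<le> int q" | "k \<in> {int q + 1..3 * int q}" | "k > 3 * int q" by force
    thus ?thesis
    proof cases
      case 1
      hence "4 * real_of_int k < real p" "real_of_int k > 0" using rp k by auto
      hence "\<bar>\<theta> k\<bar> < pi / 2"
        using angle_less[of "of_int k" "1 / 2"] less_angle[of 0 "of_int k"] unfolding \<theta>_def by auto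
      from square_wave_tendsto[OF this] show ?thesis using 1 by (simp add: sg_def)
    next
      case 2
      hence "4 * real_of_int k > real p" "4 * real_of_int k < 3 * real p" using rp by (auto simp: algebra_simps)
      hence "1 / 2 * pi < \<theta> k" "\<theta> k < 3 / 2 * pi"
        using less_angle[of "1 / 2" "of_int k"] angle_less[of "of_int k" "3 / 2"] unfolding \<theta>_def by auto
      hence "\<bar>\<theta> k - pi\<bar> < pi / 2" by (simp add: abs_if)
      from tendsto_minus[OF square_wave_tendsto[OF this]] show ?thesis
        using 2 by (simp add: sg_def square_wave_shift_pi)
    next
      case 3
      hence "4 * real_of_int k > 3 * real p" "real_of_int k < real p" using rp k by (auto simp: algebra_simps)
      hence "3 / 2 * pi < \<theta> k" "\<theta> k < 2 * pi"
        using less_angle[of "3 / 2" "of_int k"] angle_less[of "of_int k" 2] unfolding \<theta>_def by auto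
      hence "\<bar>\<theta> k - 2 * pi\<bar> < pi / 2" by (simp add: abs_if)
      from square_wave_tendsto[OF this] show ?thesis
        using 3 by (simp add: sg_def square_wave_2pi)
    qed
  qed
  have "(\<lambda>N. \<Sum>k\<in>{1..int p - 1}. of_int (L k) * square_wave N (\<theta> k))
      \<longlonglongrightarrow> (\<Sum>k\<in>{1..int p - 1}. of_int (L k) * (of_int (sg k) * (pi / 4)))"
    by (intro tendsto_sum tendsto_mult tendsto_const lim)
  also have "(\<Sum>k\<in>{1..int p - 1}. of_int (L k) * (of_int (sg k) * (pi / 4))) =
      of_int (\<Sum>k\<in>{1..int p - 1}. L k * sg k) * (pi / 4)"
    by (simp add: sum_distrib_right mult.assoc)
  also have "(\<Sum>k\<in>{1..int p - 1}. L k * sg k) = 4 * (int q - 2 * int N4)"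
  proof -
    let ?A = "{1..int q}" and ?B = "{int q + 1..3 * int q}" and ?C = "{3 * int q + 1..int p - 1}"
    have spl: "{1..int p - 1} = ?A \<union> (?B \<union> ?C)" using bounds q_pos by auto
    have s: "(\<Sum>k\<in>{1..int p - 1}. f k) = sum f ?A + (sum f ?B + sum f ?C)" for f :: "int \<Rightarrow> int"
      unfolding spl by (subst sum.union_disjoint, force, force, force, subst sum.union_disjoint) auto
    have C: "(\<Sum>k\<in>?C. L k) = (\<Sum>k\<in>?A. L k)"
      by (rule sum.reindex_bij_witness[where i = "\<lambda>k. int p - k" and j = "\<lambda>k. int p - k"])
        (use bounds in \<open>auto simp: L_p_minus\<close>)
    have "(\<Sum>k\<in>{1..int p - 1}. L k * sg k) = (\<Sum>k\<in>?A. L k) + (- (\<Sum>k\<in>?B. L k) + (\<Sum>k\<in>?C. L k))"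
    proof -
      have "(\<Sum>k\<in>?A. L k * sg k) = (\<Sum>k\<in>?A. L k)" "(\<Sum>k\<in>?C. L k * sg k) = (\<Sum>k\<in>?C. L k)"
        by (rule sum.cong; simp add: sg_def)+
      moreover have "(\<Sum>k\<in>?B. L k * sg k) = - (\<Sum>k\<in>?B. L k)"
        unfolding sum_negf[symmetric] by (rule sum.cong) (simp_all add: sg_def)
      ultimately show ?thesis unfolding s[of "\<lambda>k. L k * sg k"] by simp
    qed
    moreover have "0 = (\<Sum>k\<in>?A. L k) + ((\<Sum>k\<in>?B. L k) + (\<Sum>k\<in>?C. L k))" using sum_L s[of L] by simp
    moreover have "w = 4 * x" if "w = a + (- b + c)" "0 = a + (b + c)" "c = a" "a = x" for w a b c x :: int
      using that by linarith
    ultimately show ?thesis using C sum_L_quarter by blast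
  qed
  also have "real_of_int (4 * (int q - 2 * int N4)) * (pi / 4) = pi * (real q - 2 * real N4)"
    by (simp add: field_simps)
  finally show ?thesis unfolding \<theta>_def .
qed

text \<open>The quadratic character of the imaginary field, of period \<open>4 p\<close>. For odd
  \<open>n\<close> the exponent \<open>n div 2\<close> is \<open>(n - 1) / 2\<close>, so the first
  factor is the nontrivial character modulo 4.\<close>

definition chi :: "nat \<Rightarrow> int" where
  "chi n = (if even n then 0 else (-1) ^ (n div 2) * L (int n))"

text \<open>Only odd indices contribute, so a sum up to \<open>2 N\<close> has \<open>N\<close>
  terms. Expressing each \<open>L n\<close> by its cosine sum and exchanging the summations gives
  partial sums of the square wave.\<close>

lemma chi_series: "(\<lambda>N. \<Sum>n<2 * N. chi n / real n) \<longlonglongrightarrow> pi * (real q - 2 * real N4) / sqrt (real p)"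
proof -
  have odd: "(\<Sum>n<2 * N. chi n / real n) = (\<Sum>j<N. (-1) ^ j * of_int (L (int (2 * j + 1))) / real (2 * j + 1))" for N
    by (induction N) (simp_all add: chi_def)
  have "sqrt (real p) * (\<Sum>n<2 * N. chi n / real n) =
     (\<Sum>k\<in>{1..int p - 1}. of_int (L k) * square_wave N (2 * pi * of_int k / real p))" for N
  proof -
    have "sqrt (real p) * (\<Sum>n<2 * N. chi n / real n) =
      (\<Sum>j<N. (-1) ^ j / real (2 * j + 1) * (of_int (L (int (2 * j + 1))) * sqrt (real p)))"
      unfolding odd sum_distrib_left by (rule sum.cong) simp_all
    also have "\<dots> = (\<Sum>j<N. \<Sum>k\<in>{1..int p - 1}. of_int (L k) *
        ((-1) ^ j * cos (real (2 * j + 1) * (2 * pi * of_int k / real p)) / real (2 * j + 1)))"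
      unfolding legendre_sum_cos[symmetric] sum_distrib_left
      by (intro sum.cong refl) simp
    also have "\<dots> = (\<Sum>k\<in>{1..int p - 1}. of_int (L k) * square_wave N (2 * pi * of_int k / real p))"
      unfolding square_wave_def sum_distrib_left by (rule sum.swap)
    finally show ?thesis .
  qed
  hence "(\<lambda>N. sqrt (real p) * (\<Sum>n<2 * N. chi n / real n)) \<longlonglongrightarrow> pi * (real q - 2 * real N4)"
    using square_wave_legendre by simp
  hence "(\<lambda>N. sqrt (real p) * (\<Sum>n<2 * N. chi n / real n) / sqrt (real p)) \<longlonglongrightarrow>
      pi * (real q - 2 * real N4) / sqrt (real p)"
    by (intro tendsto_divide tendsto_const) (use p_gt2 in auto)
  thus ?thesis using p_gt2 by simp
qed

end

subsection \<open>Asymptotic counting\<close>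

text \<open>Summation by parts with the partial sums \<open>S'\<close> started at \<open>m\<close>;
  as \<open>f\<close> decreases, the bounds telescope to \<open>f m\<close>.\<close>

lemma abel_bound:
  fixes f c :: "nat \<Rightarrow> real"
  assumes S: "\<And>n. \<bar>\<Sum>d<n. c d\<bar> \<le> C" and f: "\<And>d. m \<le> d \<Longrightarrow> f (Suc d) \<le> f d" "\<And>d. f d \<ge> 0" and "m \<le> n"
  shows "\<bar>\<Sum>d\<in>{m..<n}. c d * f d\<bar> \<le> 2 * C * f m"
proof -
  define S' where "S' = (\<lambda>n. (\<Sum>d<n. c d) - (\<Sum>d<m. c d))"
  have S'b: "\<bar>S' n\<bar> \<le> 2 * C" for n using S[of n] S[of m] unfolding S'_def by linarith
  have C0: "C \<ge> 0" using S[of 0] by simp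
  have e: "(\<Sum>d\<in>{m..<n}. c d * f d) = S' n * f n + (\<Sum>d\<in>{m..<n}. S' (Suc d) * (f d - f (Suc d)))"
    using \<open>m \<le> n\<close>
  proof (induction n rule: dec_induct)
    case base
    show ?case by (simp add: S'_def)
  next
    case (step n)
    have "S' (Suc n) = S' n + c n" by (simp add: S'_def)
    thus ?case using step by (simp add: algebra_simps)
  qed
  have "\<bar>\<Sum>d\<in>{m..<n}. S' (Suc d) * (f d - f (Suc d))\<bar> \<le> (\<Sum>d\<in>{m..<n}. 2 * C * (f d - f (Suc d)))"
  proof (rule order_trans[OF sum_abs sum_mono])
    fix d assume "d \<in> {m..<n}"
    hence "0 \<le> f d - f (Suc d)" using f(1)[of d] by simp
    thus "\<bar>S' (Suc d) * (f d - f (Suc d))\<bar> \<le> 2 * C * (f d - f (Suc d))"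
      using S'b[of "Suc d"] by (simp add: abs_mult mult_right_mono)
  qed
  also have "\<dots> = 2 * C * (f m - f n)"
  proof -
    have "(\<Sum>d\<in>{m..<n}. f d - f (Suc d)) = f m - f n"
      using sum_Suc_diff'[of m n "\<lambda>d. - f d"] \<open>m \<le> n\<close> by simp
    thus ?thesis by (simp only: sum_distrib_left[symmetric])
  qed
  finally have "\<bar>\<Sum>d\<in>{m..<n}. S' (Suc d) * (f d - f (Suc d))\<bar> \<le> 2 * C * (f m - f n)" .
  moreover have "\<bar>S' n * f n\<bar> \<le> 2 * C * f n"
    using S'b[of n] f(2)[of n] by (simp add: abs_mult mult_right_mono)
  ultimately show ?thesis unfolding e by (simp add: algebra_simps)
qed

text \<open>Cut at \<open>D X\<close>, the integer part of the square root of \<open>X\<close>.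
  Below it, dropping the floor costs at most 1 per term. Above it, \<open>X div d\<close> is
  decreasing and at most \<open>sqrt (real X)\<close>, so the bounded sums of \<open>c\<close>
  control the tail. Both errors vanish after division by \<open>X\<close>.\<close>

lemma hyperbola_limit:
  fixes c :: "nat \<Rightarrow> real"
  assumes S: "\<And>n. \<bar>\<Sum>d<n. c d\<bar> \<le> C" and c1: "\<And>d. \<bar>c d\<bar> \<le> 1"
    and lim: "(\<lambda>N. \<Sum>n<N. c n / real n) \<longlonglongrightarrow> v"
  shows "(\<lambda>X. (\<Sum>d\<in>{1..X}. c d * real (X div d)) / real X) \<longlonglongrightarrow> v"
proof -
  define P where "P = (\<lambda>N. \<Sum>n<N. c n / real n)"
  define D where "D = (\<lambda>X. nat \<lfloor>sqrt (real X)\<rfloor>)"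
  define A where "A = (\<lambda>X. \<Sum>d\<in>{1..X}. c d * real (X div d))"
  have C0: "C \<ge> 0" using S[of 0] by simp
  have bound: "\<bar>A X / real X - P (Suc (D X))\<bar> \<le> (1 + 2 * C) / sqrt (real X)" if X: "X > 0" for X
  proof -
    let ?D = "D X"
    have D1: "real ?D \<le> sqrt (real X)" and D2: "sqrt (real X) < real ?D + 1"
      using X by (simp_all add: D_def)
    have sX: "sqrt (real X) \<ge> 1" using X by simp
    have "sqrt (real X) * 1 \<le> sqrt (real X) * sqrt (real X)" using sX by (intro mult_left_mono) auto
    hence "real ?D \<le> real X" using D1 by simp
    hence DX: "?D \<le> X" by simp
    have "{1..X} = {1..<Suc ?D} \<union> {Suc ?D..<Suc X}" using DX by auto
    hence spl: "A X = (\<Sum>d\<in>{1..<Suc ?D}. c d * real (X div d)) + (\<Sum>d\<in>{Suc ?D..<Suc X}. c d * real (X div d))"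
      unfolding A_def by (simp only:) (rule sum.union_disjoint, auto)
    have fl: "real (X div d) \<le> real X / real d" "real X / real d - 1 \<le> real (X div d)" for d
    proof -
      show "real (X div d) \<le> real X / real d" by (rule of_nat_div_le_of_nat)
      have "real X / real d < real (X div d) + 1"
      proof (cases "d = 0")
        case False
        have "X < (X div d + 1) * d" using False dividend_less_div_times[of d X] by (simp add: algebra_simps)
        hence "real X < (real (X div d) + 1) * real d" by (metis of_nat_less_iff of_nat_mult of_nat_1 of_nat_add)
        thus ?thesis using False by (simp add: pos_divide_less_eq)
      qed simp
      thus "real X / real d - 1 \<le> real (X div d)" by simp
    qed
    have "P (Suc ?D) = (\<Sum>d\<in>{1..<Suc ?D}. c d / real d)"
      unfolding P_def by (rule sum.mono_neutral_right) auto
    hence "(\<Sum>d\<in>{1..<Suc ?D}. c d * real (X div d)) - real X * P (Suc ?D) =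
        (\<Sum>d\<in>{1..<Suc ?D}. c d * (real (X div d) - real X / real d))"
      by (simp add: sum_distrib_left sum_subtractf[symmetric] algebra_simps del: sum.op_ivl_Suc)
    also have "\<bar>\<dots>\<bar> \<le> (\<Sum>d\<in>{1..<Suc ?D}. 1)"
    proof (rule order_trans[OF sum_abs sum_mono])
      fix d
      have "\<bar>real (X div d) - real X / real d\<bar> \<le> 1" using fl[of d] by linarith
      thus "\<bar>c d * (real (X div d) - real X / real d)\<bar> \<le> 1" using c1[of d] by (simp add: abs_mult mult_le_one)
    qed
    finally have 1: "\<bar>(\<Sum>d\<in>{1..<Suc ?D}. c d * real (X div d)) - real X * P (Suc ?D)\<bar> \<le> real ?D" by simp
    have 2: "\<bar>\<Sum>d\<in>{Suc ?D..<Suc X}. c d * real (X div d)\<bar> \<le> 2 * C * real (X div Suc ?D)"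
    proof (rule abel_bound[OF S])
      fix d assume "Suc ?D \<le> d"
      thus "real (X div Suc d) \<le> real (X div d)" by (simp add: div_le_mono2)
    qed (use DX in auto)
    have "real (X div Suc ?D) \<le> real X / (real ?D + 1)" using fl(1)[of "Suc ?D"] by (simp add: add.commute)
    also have "\<dots> \<le> real X / sqrt (real X)" using D2 sX by (intro divide_left_mono) auto
    also have "\<dots> = sqrt (real X)" by (rule real_div_sqrt) simp
    finally have "2 * C * real (X div Suc ?D) \<le> 2 * C * sqrt (real X)" using C0 by (intro mult_left_mono) auto
    hence 3: "\<bar>A X - real X * P (Suc ?D)\<bar> \<le> (1 + 2 * C) * sqrt (real X)"
      using 1 2 D1 unfolding spl by (simp add: algebra_simps)
    have "A X / real X - P (Suc ?D) = (A X - real X * P (Suc ?D)) / real X" using X by (simp add: field_simps)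
    hence "\<bar>A X / real X - P (Suc ?D)\<bar> = \<bar>A X - real X * P (Suc ?D)\<bar> / real X" by simp
    also have "\<dots> \<le> (1 + 2 * C) * sqrt (real X) / real X" using 3 X by (intro divide_right_mono) auto
    also have "\<dots> = (1 + 2 * C) / sqrt (real X)"
      using X by (metis real_div_sqrt divide_divide_eq_right of_nat_0_le_iff times_divide_eq_right mult.commute real_divide_square_eq real_sqrt_mult_self abs_of_nat sqrt_divide_self_eq divide_inverse inverse_eq_divide mult.assoc)
    finally show ?thesis .
  qed
  have Dinf: "filterlim D at_top at_top"
    unfolding D_def by real_asymp
  have "(\<lambda>X. P (Suc (D X))) \<longlonglongrightarrow> v"
    using filterlim_compose[OF lim[folded P_def] filterlim_compose[OF filterlim_Suc Dinf]] by (simp add: o_def)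
  moreover have "(\<lambda>X. A X / real X - P (Suc (D X))) \<longlonglongrightarrow> 0"
  proof (rule Lim_null_comparison)
    show "eventually (\<lambda>X. norm (A X / real X - P (Suc (D X))) \<le> (1 + 2 * C) / sqrt (real X)) sequentially"
      using eventually_gt_at_top[of 0] by eventually_elim (use bound in auto)
    show "(\<lambda>X. (1 + 2 * C) / sqrt (real X)) \<longlonglongrightarrow> 0" by real_asymp
  qed
  ultimately have "(\<lambda>X. P (Suc (D X)) + (A X / real X - P (Suc (D X)))) \<longlonglongrightarrow> v + 0"
    by (rule tendsto_add)
  thus ?thesis unfolding A_def by simp
qed

section \<open>Lattice points in an ellipse\<close>

lemma quarter_disc_sum:
  fixes Y :: real
  assumes Y: "Y \<ge> 1"
  shows "\<bar>(\<Sum>t\<in>{1..nat \<lfloor>Y\<rfloor>}. sqrt (Y\<^sup>2 - (real t)\<^sup>2)) - pi / 4 * Y\<^sup>2\<bar> \<le> 2 * Y"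
proof -
  define K where "K = nat \<lfloor>Y\<rfloor>"
  define g where "g = (\<lambda>x. sqrt (Y\<^sup>2 - x\<^sup>2))"
  \<comment> \<open>An antiderivative of \<open>g\<close> that vanishes at 0; \<open>F Y\<close> is
    the area of the quarter disc.\<close>
  define F where "F = (\<lambda>x. (x * sqrt (Y\<^sup>2 - x\<^sup>2) + Y\<^sup>2 * arcsin (x / Y)) / 2)"
  have K1: "real K \<le> Y" and K2: "Y < real K + 1" using Y by (simp_all add: K_def)
  have Fd: "(F has_real_derivative g x) (at x)" if "0 \<le> x" "x < Y" for x
  proof -
    have pos: "Y\<^sup>2 - x\<^sup>2 > 0" using that by (simp add: power_strict_mono)
    have xy: "-1 < x / Y" "x / Y < 1" using that Y by (auto simp: field_simps)
    have s: "sqrt (1 - (x / Y)\<^sup>2) = sqrt (Y\<^sup>2 - x\<^sup>2) / Y"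
    proof -
      have "1 - (x / Y)\<^sup>2 = (Y\<^sup>2 - x\<^sup>2) / Y\<^sup>2" using Y by (simp add: field_simps)
      thus ?thesis using Y by (simp add: real_sqrt_divide)
    qed
    define r where "r = sqrt (Y\<^sup>2 - x\<^sup>2)"
    have r: "r > 0" "r * r = Y\<^sup>2 - x\<^sup>2" using pos by (simp_all add: r_def)
    have d1: "((\<lambda>x. sqrt (Y\<^sup>2 - x\<^sup>2)) has_real_derivative (- x / r)) (at x)"
      using pos by (auto intro!: derivative_eq_intros simp: r_def field_simps)
    have d2: "((\<lambda>x. arcsin (x / Y)) has_real_derivative (1 / r)) (at x)"
    proof -
      have "((\<lambda>x. arcsin (x / Y)) has_real_derivative (inverse (sqrt (1 - (x / Y)\<^sup>2)) * (1 / Y))) (at x)"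
        using DERIV_chain2[OF DERIV_arcsin[OF xy] DERIV_cdivide[OF DERIV_ident, of Y]] .
      also have "inverse (sqrt (1 - (x / Y)\<^sup>2)) * (1 / Y) = 1 / r"
        unfolding s using Y r by (simp add: r_def field_simps)
      finally show ?thesis .
    qed
    have "(F has_real_derivative ((1 * sqrt (Y\<^sup>2 - x\<^sup>2) + (- x / r) * x) + Y\<^sup>2 * (1 / r)) / 2) (at x)"
      unfolding F_def by (rule DERIV_cdivide[OF DERIV_add[OF DERIV_mult[OF DERIV_ident d1] DERIV_cmult[OF d2]]])
    also have "((1 * sqrt (Y\<^sup>2 - x\<^sup>2) + (- x / r) * x) + Y\<^sup>2 * (1 / r)) / 2 = ((1 * r + x * (- x / r)) + Y\<^sup>2 * (1 / r)) / 2"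
      by (simp add: r_def)
    also have "((1 * r + x * (- x / r)) + Y\<^sup>2 * (1 / r)) / 2 = g x"
    proof -
      have "(1 * r + x * (- x / r)) + Y\<^sup>2 * (1 / r) = r + (Y\<^sup>2 - x\<^sup>2) / r"
        by (simp add: diff_divide_distrib power2_eq_square)
      also have "\<dots> = 2 * r" unfolding r(2)[symmetric] using r(1) by simp
      finally show ?thesis by (simp add: g_def r_def)
    qed
    finally show ?thesis .
  qed
  have cont: "continuous_on {0..Y} F"
    unfolding F_def using Y by (intro continuous_intros) (auto simp: field_simps)
  have mvt: "\<exists>z. x < z \<and> z < y \<and> F y - F x = (y - x) * g z" if "0 \<le> x" "x < y" "y \<le> Y" for x y
  proof -
    have "continuous_on {x..y} F" by (rule continuous_on_subset[OF cont]) (use that in auto)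
    moreover have "F differentiable (at z)" if "x < z" "z < y" for z
      using Fd[of z] that \<open>0 \<le> x\<close> \<open>y \<le> Y\<close> by (auto simp: real_differentiable_def)
    ultimately obtain l z where z: "x < z" "z < y" "DERIV F z :> l" "F y - F x = (y - x) * l"
      using MVT[OF \<open>x < y\<close>, of F] by blast
    have "l = g z" by (rule DERIV_unique[OF z(3) Fd]) (use z that in auto)
    thus ?thesis using z by blast
  qed
  have gmono: "g y \<le> g x" if "0 \<le> x" "x \<le> y" for x y
    using that by (simp add: g_def power_mono)
  have g0: "g x \<ge> 0" if "0 \<le> x" "x \<le> Y" for x using that by (simp add: g_def power_mono)
  have gY: "g x \<le> Y" if "0 \<le> x" for x using gmono[of 0 x] that Y by (simp add: g_def)
  \<comment> \<open>As \<open>g\<close> decreases, the increment of \<open>F\<close> over a unit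
    interval lies between the values of \<open>g\<close> at its ends.\<close>
  have ul: "(\<Sum>t\<in>{1..k}. g (real t)) \<le> F (real k) \<and> F (real k) \<le> (\<Sum>t\<in>{0..<k}. g (real t))" if "k \<le> K" for k
    using that
  proof (induction k)
    case 0
    show ?case by (simp add: F_def)
  next
    case (Suc k)
    have le: "real (Suc k) \<le> Y" using Suc.prems K1 by (meson of_nat_le_iff order_trans)
    obtain z where z: "real k < z" "z < real (Suc k)" "F (real (Suc k)) - F (real k) = (real (Suc k) - real k) * g z"
      using mvt[of "real k" "real (Suc k)"] le by auto
    have e: "F (real (Suc k)) = F (real k) + g z" using z(3) by simp
    have "g (real (Suc k)) \<le> g z" "g z \<le> g (real k)" using gmono[of z "real (Suc k)"] gmono[of "real k" z] z by simp_all
    thus ?case using Suc e by simp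
  qed
  note upper = conjunct1[OF ul] and lower = conjunct2[OF ul]
  have FY: "F Y = pi / 4 * Y\<^sup>2" using Y by (simp add: F_def)
  have FK: "F Y - Y \<le> F (real K)" "F (real K) \<le> F Y"
  proof -
    have "F Y - F (real K) \<le> Y \<and> F Y - F (real K) \<ge> 0"
    proof (cases "real K = Y")
      case False
      then obtain z where z: "real K < z" "z < Y" "F Y - F (real K) = (Y - real K) * g z"
        using mvt[of "real K" Y] K1 by auto
      have "(Y - real K) * g z \<le> 1 * Y" using K1 K2 z gY[of z] g0[of z] by (intro mult_mono) auto
      moreover have "(Y - real K) * g z \<ge> 0" using K1 z g0[of z] by auto
      ultimately show ?thesis using z by simp
    qed (use Y in simp)
    thus "F Y - Y \<le> F (real K)" "F (real K) \<le> F Y" by linarith+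
  qed
  \<comment> \<open>The term at 0 accounts for one \<open>Y\<close> of the error, the incomplete
    strip beyond \<open>K\<close> for the other.\<close>
  have "(\<Sum>t\<in>{0..<K}. g (real t)) \<le> Y + (\<Sum>t\<in>{1..K}. g (real t))"
  proof -
    have "(\<Sum>t\<in>{0..<K}. g (real t)) \<le> (\<Sum>t\<in>{0..K}. g (real t))"
      by (rule sum_mono2) (use K1 g0 in auto)
    also have "\<dots> = g 0 + (\<Sum>t\<in>{1..K}. g (real t))" by (simp add: sum.atLeast_Suc_atMost)
    finally show ?thesis using Y by (simp add: g_def)
  qed
  hence "F Y - 2 * Y \<le> (\<Sum>t\<in>{1..K}. g (real t))" using lower[of K] FK by simp
  moreover have "(\<Sum>t\<in>{1..K}. g (real t)) \<le> F Y" using upper[of K] FK by simp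
  ultimately show ?thesis using Y unfolding FY g_def K_def[symmetric] by (simp add: abs_le_iff)
qed

lemma card_interval:
  fixes a c :: int and r :: real
  assumes "a > 0" "r \<ge> 0"
  shows "finite {m. \<bar>real_of_int (a * m - c)\<bar> \<le> r}"
    "\<bar>real (card {m. \<bar>real_of_int (a * m - c)\<bar> \<le> r}) - 2 * r / of_int a\<bar> \<le> 1"
proof -
  define x where "x = (of_int c - r) / of_int a"
  define y where "y = (of_int c + r) / of_int a"
  have xy: "y - x = 2 * r / of_int a" using assms by (simp add: x_def y_def field_simps)
  have le: "x \<le> y" using assms by (simp add: x_def y_def divide_right_mono)
  have e: "{m. \<bar>real_of_int (a * m - c)\<bar> \<le> r} = {\<lceil>x\<rceil>..\<lfloor>y\<rfloor>}"
  proof (rule Set.set_eqI)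
    fix m
    have "\<bar>real_of_int (a * m - c)\<bar> \<le> r \<longleftrightarrow> of_int c - r \<le> of_int m * of_int a \<and> of_int m * of_int a \<le> of_int c + r"
      by (auto simp: abs_le_iff algebra_simps)
    also have "\<dots> \<longleftrightarrow> x \<le> of_int m \<and> of_int m \<le> y"
      unfolding x_def y_def using assms(1) by (simp add: pos_divide_le_eq pos_le_divide_eq)
    finally show "m \<in> {m. \<bar>real_of_int (a * m - c)\<bar> \<le> r} \<longleftrightarrow> m \<in> {\<lceil>x\<rceil>..\<lfloor>y\<rfloor>}"
      by (auto simp: ceiling_le_iff le_floor_iff)
  qed
  show "finite {m. \<bar>real_of_int (a * m - c)\<bar> \<le> r}" unfolding e by simp
  have "\<lfloor>y\<rfloor> - \<lceil>x\<rceil> + 1 \<ge> 0" using le by linarith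
  hence "real (card {\<lceil>x\<rceil>..\<lfloor>y\<rfloor>}) = of_int (\<lfloor>y\<rfloor> - \<lceil>x\<rceil> + 1)" by simp
  moreover have "of_int (\<lfloor>y\<rfloor> - \<lceil>x\<rceil> + 1) \<le> y - x + 1" "y - x - 1 \<le> of_int (\<lfloor>y\<rfloor> - \<lceil>x\<rceil> + 1)" by linarith+
  ultimately show "\<bar>real (card {m. \<bar>real_of_int (a * m - c)\<bar> \<le> r}) - 2 * r / of_int a\<bar> \<le> 1"
    unfolding e xy[symmetric] by linarith
qed

text \<open>With \<open>\<omega>\<^sup>2 = - D\<close>, the pair \<open>(m, t)\<close> stands for
  the lattice element \<open>a m + t (- b + \<omega>)\<close>, and the left-hand side is its
  norm.\<close>

definition ellipse_points :: "int \<Rightarrow> int \<Rightarrow> int \<Rightarrow> int \<Rightarrow> (int \<times> int) set" where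
  "ellipse_points a b D M = {(m, t). (a * m - b * t)\<^sup>2 + D * t\<^sup>2 \<le> M}"

text \<open>Slice by \<open>t\<close>: each slice is an interval whose number of points differs by
  at most 1 from its length divided by \<open>a\<close>. With \<open>Y\<close> the final square
  root, the \<open>2 K + 1\<close> slices cost \<open>3 Y\<close>. The slice \<open>t = 0\<close>
  and twice the error \<open>2 Y\<close> of the quarter disc give \<open>5 Y\<close>, times a factor
  at most \<open>2 * sqrt D\<close>.\<close>

lemma ellipse_count:
  fixes a b D M :: int
  assumes "a > 0" "D > 0" "M \<ge> D"
  shows "finite (ellipse_points a b D M)"
    "\<bar>real (card (ellipse_points a b D M)) - pi * of_int M / (of_int a * sqrt (of_int D))\<bar>
       \<le> (3 + 10 * sqrt (of_int D)) * sqrt (of_int M / of_int D)"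
proof -
  define Y where "Y = sqrt (real_of_int M / of_int D)"
  define K where "K = nat \<lfloor>Y\<rfloor>"
  define r where "r = (\<lambda>t. sqrt (of_int D) * sqrt (Y\<^sup>2 - (real_of_int t)\<^sup>2))"
  define B where "B = (\<lambda>t::int. {m. \<bar>real_of_int (a * m - b * t)\<bar> \<le> r t})"
  have Y1: "Y \<ge> 1" using assms by (simp add: Y_def)
  have Y2: "Y\<^sup>2 = of_int M / of_int D" using assms by (simp add: Y_def)
  have K1: "real K \<le> Y" and K2: "Y < real K + 1" using Y1 by (simp_all add: K_def)
  have r2: "(r t)\<^sup>2 = of_int (M - D * t\<^sup>2)" and r0: "r t \<ge> 0" if "t \<in> {- int K..int K}" for t
  proof -
    have "\<bar>real_of_int t\<bar> \<le> Y" using that K1 by auto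
    hence "(real_of_int t)\<^sup>2 \<le> Y\<^sup>2" using Y1 by (simp add: abs_le_square_iff[symmetric])
    hence nn: "Y\<^sup>2 - (real_of_int t)\<^sup>2 \<ge> 0" by simp
    hence "(r t)\<^sup>2 = of_int D * (Y\<^sup>2 - (real_of_int t)\<^sup>2)" using assms by (simp add: r_def power_mult_distrib)
    also have "\<dots> = of_int (M - D * t\<^sup>2)" unfolding Y2 using assms by (simp add: field_simps)
    finally show "(r t)\<^sup>2 = of_int (M - D * t\<^sup>2)" .
    show "r t \<ge> 0" using nn assms by (simp add: r_def)
  qed
  have Bt: "m \<in> B t \<longleftrightarrow> (a * m - b * t)\<^sup>2 + D * t\<^sup>2 \<le> M" if t: "t \<in> {- int K..int K}" for m t
  proof -
    have "m \<in> B t \<longleftrightarrow> (real_of_int (a * m - b * t))\<^sup>2 \<le> (r t)\<^sup>2"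
      unfolding B_def using abs_le_square_iff[of "real_of_int (a * m - b * t)" "r t"] r0[OF t] by simp
    also have "\<dots> \<longleftrightarrow> real_of_int ((a * m - b * t)\<^sup>2) \<le> of_int (M - D * t\<^sup>2)" unfolding r2[OF t] by simp
    also have "\<dots> \<longleftrightarrow> (a * m - b * t)\<^sup>2 \<le> M - D * t\<^sup>2" by (rule of_int_le_iff)
    finally show ?thesis by linarith
  qed
  have tK: "t \<in> {- int K..int K}" if "(a * m - b * t)\<^sup>2 + D * t\<^sup>2 \<le> M" for m t
  proof -
    have "D * t\<^sup>2 \<le> M" using that by (smt (verit) zero_le_power2)
    hence "real_of_int (D * t\<^sup>2) \<le> of_int M" by (simp only: of_int_le_iff)
    hence "(real_of_int t)\<^sup>2 \<le> Y\<^sup>2" unfolding Y2 using assms by (simp add: field_simps)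
    hence "\<bar>real_of_int t\<bar> \<le> Y" using Y1 by (simp add: abs_le_square_iff[symmetric])
    hence "real_of_int \<bar>t\<bar> < real_of_int (int K + 1)" using K2 by simp
    hence "\<bar>t\<bar> < int K + 1" by (simp only: of_int_less_iff)
    thus ?thesis by auto
  qed
  have E: "ellipse_points a b D M = (\<lambda>(t, m). (m, t)) ` (SIGMA t:{- int K..int K}. B t)"
    using Bt tK by (force simp: ellipse_points_def)
  have finB: "finite (B t)" and cB: "\<bar>real (card (B t)) - 2 * r t / of_int a\<bar> \<le> 1" if "t \<in> {- int K..int K}" for t
    unfolding B_def using card_interval[OF assms(1) r0[OF that], of "b * t"] by auto
  show "finite (ellipse_points a b D M)" unfolding E by (intro finite_imageI finite_SigmaI finB) auto
  have "card (ellipse_points a b D M) = card (SIGMA t:{- int K..int K}. B t)"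
    unfolding E by (rule card_image) (auto simp: inj_on_def)
  also have "\<dots> = (\<Sum>t\<in>{- int K..int K}. card (B t))" using finB by (subst card_SigmaI) auto
  finally have c: "real (card (ellipse_points a b D M)) = (\<Sum>t\<in>{- int K..int K}. real (card (B t)))" by simp
  have "\<bar>(\<Sum>t\<in>{- int K..int K}. real (card (B t))) - (\<Sum>t\<in>{- int K..int K}. 2 * r t / of_int a)\<bar>
      \<le> (\<Sum>t\<in>{- int K..int K}. 1)"
    unfolding sum_subtractf[symmetric] by (rule order_trans[OF sum_abs sum_mono]) (use cB in auto)
  also have "(\<Sum>t\<in>{- int K..int K}. 1) = 2 * real K + 1" by simp
  finally have 1: "\<bar>real (card (ellipse_points a b D M)) - (\<Sum>t\<in>{- int K..int K}. 2 * r t / of_int a)\<bar> \<le> 3 * Y"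
    unfolding c using K1 Y1 by linarith
  define s where "s = (\<Sum>t\<in>{1..K}. sqrt (Y\<^sup>2 - (real t)\<^sup>2))"
  have rs: "(\<Sum>t\<in>{- int K..int K}. r t) = sqrt (of_int D) * (Y + 2 * s)"
  proof -
    have spl: "{- int K..int K} = {0} \<union> ({1..int K} \<union> uminus ` {1..int K})"
    proof (intro equalityI subsetI)
      fix x assume x: "x \<in> {- int K..int K}"
      show "x \<in> {0} \<union> ({1..int K} \<union> uminus ` {1..int K})"
      proof (cases "x < 0")
        case True
        hence "x = - (- x)" "- x \<in> {1..int K}" using x by auto
        thus ?thesis by blast
      qed (use x in auto)
    qed auto
    have pos: "(\<Sum>t\<in>{1..int K}. r t) = sqrt (of_int D) * s"
    proof -
      have "(\<Sum>t\<in>{1..int K}. r t) = (\<Sum>t\<in>{1..K}. sqrt (of_int D) * sqrt (Y\<^sup>2 - (real t)\<^sup>2))"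
        unfolding r_def by (rule sum.reindex_bij_witness[where i = int and j = nat]) auto
      thus ?thesis by (simp add: s_def sum_distrib_left)
    qed
    have neg: "(\<Sum>t\<in>uminus ` {1..int K}. r t) = (\<Sum>t\<in>{1..int K}. r t)"
      by (subst sum.reindex) (auto simp: r_def)
    have "(\<Sum>t\<in>{- int K..int K}. r t) = r 0 + ((\<Sum>t\<in>{1..int K}. r t) + (\<Sum>t\<in>uminus ` {1..int K}. r t))"
      unfolding spl by (subst sum.union_disjoint, force, force, force, subst sum.union_disjoint) auto
    also have "r 0 = sqrt (of_int D) * Y" using Y1 by (simp add: r_def)
    finally show ?thesis unfolding neg pos by (simp add: algebra_simps)
  qed
  have qd: "\<bar>s - pi / 4 * Y\<^sup>2\<bar> \<le> 2 * Y" unfolding s_def K_def by (rule quarter_disc_sum[OF Y1])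
  have "(\<Sum>t\<in>{- int K..int K}. 2 * r t / of_int a) = 2 * sqrt (of_int D) / of_int a * (Y + 2 * s)"
    using rs by (simp add: sum_distrib_left[symmetric] sum_divide_distrib[symmetric])
  moreover have "pi * of_int M / (of_int a * sqrt (of_int D)) = 2 * sqrt (of_int D) / of_int a * (2 * (pi / 4 * Y\<^sup>2))"
  proof -
    have "sqrt (of_int D) * sqrt (of_int D) = real_of_int D" using assms by simp
    hence "of_int M / sqrt (of_int D) = sqrt (of_int D) * Y\<^sup>2"
      unfolding Y2 using assms by (simp add: field_simps)
    moreover have "pi * of_int M / (of_int a * sqrt (of_int D)) = pi / of_int a * (of_int M / sqrt (of_int D))" by simp
    ultimately show ?thesis by simp
  qed
  ultimately have "(\<Sum>t\<in>{- int K..int K}. 2 * r t / of_int a) - pi * of_int M / (of_int a * sqrt (of_int D)) =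
     2 * sqrt (of_int D) / of_int a * (Y + 2 * (s - pi / 4 * Y\<^sup>2))"
    by (simp add: algebra_simps)
  also have "\<bar>\<dots>\<bar> \<le> 2 * sqrt (of_int D) * (5 * Y)"
    unfolding abs_mult
  proof (rule mult_mono)
    have "2 * sqrt (real_of_int D) / real_of_int a \<le> 2 * sqrt (real_of_int D) / 1"
      using assms by (intro divide_left_mono) auto
    thus "\<bar>2 * sqrt (real_of_int D) / real_of_int a\<bar> \<le> 2 * sqrt (of_int D)" using assms by simp
    have "\<bar>Y + 2 * d\<bar> \<le> 5 * Y" if "\<bar>d\<bar> \<le> 2 * Y" for d using that Y1 by linarith
    thus "\<bar>Y + 2 * (s - pi / 4 * Y\<^sup>2)\<bar> \<le> 5 * Y" using qd by blast
  qed (use assms in auto)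
  finally have 2: "\<bar>(\<Sum>t\<in>{- int K..int K}. 2 * r t / of_int a) - pi * of_int M / (of_int a * sqrt (of_int D))\<bar>
      \<le> 10 * sqrt (of_int D) * Y" by simp
  have "(3 + 10 * sqrt (real_of_int D)) * Y = 3 * Y + 10 * sqrt (of_int D) * Y" by (simp add: algebra_simps)
  thus "\<bar>real (card (ellipse_points a b D M)) - pi * of_int M / (of_int a * sqrt (of_int D))\<bar>
       \<le> (3 + 10 * sqrt (of_int D)) * sqrt (of_int M / of_int D)"
    using 1 2 unfolding Y_def[symmetric] by linarith
qed

lemma ellipse_count_tendsto:
  fixes a b D :: int
  assumes "a > 0" "D > 0"
  shows "(\<lambda>X::nat. real (card (ellipse_points a b D (a * int X))) / real X) \<longlonglongrightarrow> pi / sqrt (of_int D)"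
proof -
  define W where "W = (3 + 10 * sqrt (real_of_int D)) * sqrt (of_int a / of_int D)"
  have "(\<lambda>X::nat. real (card (ellipse_points a b D (a * int X))) / real X - pi / sqrt (of_int D)) \<longlonglongrightarrow> 0"
  proof (rule Lim_null_comparison)
    show "eventually (\<lambda>X. norm (real (card (ellipse_points a b D (a * int X))) / real X - pi / sqrt (of_int D))
        \<le> W / sqrt (real X)) sequentially"
      using eventually_ge_at_top[of "nat D"]
    proof eventually_elim
      case (elim X)
      have X: "X > 0" and XD: "int X \<ge> D" using elim assms by auto
      have "1 * D \<le> a * int X" using XD assms by (intro mult_mono) auto
      from ellipse_count(2)[OF assms, of "a * int X" b] this
      have b: "\<bar>real (card (ellipse_points a b D (a * int X))) - pi * of_int (a * int X) / (of_int a * sqrt (of_int D))\<bar>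
        \<le> (3 + 10 * sqrt (of_int D)) * sqrt (of_int (a * int X) / of_int D)" by simp
      have e1: "pi * of_int (a * int X) / (of_int a * sqrt (of_int D)) = real X * (pi / sqrt (of_int D))"
        using assms by simp
      have e2: "(3 + 10 * sqrt (of_int D)) * sqrt (of_int (a * int X) / of_int D) = W * sqrt (real X)"
        unfolding W_def by (simp add: real_sqrt_mult real_sqrt_divide)
      have "norm (real (card (ellipse_points a b D (a * int X))) / real X - pi / sqrt (of_int D)) =
        \<bar>real (card (ellipse_points a b D (a * int X))) - real X * (pi / sqrt (of_int D))\<bar> / real X"
        using X by (simp add: field_simps abs_divide)
      also have "\<dots> \<le> W * sqrt (real X) / real X" using b unfolding e1 e2 by (intro divide_right_mono) auto
      also have "\<dots> = W / sqrt (real X)"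
        using real_div_sqrt[of "real X"] X by (simp add: field_simps)
      finally show ?case .
    qed
    show "(\<lambda>X. W / sqrt (real X)) \<longlonglongrightarrow> 0" by real_asymp
  qed
  thus ?thesis by (simp add: LIM_zero_iff)
qed

subsection \<open>The norm of the fundamental unit\<close>

lemma even_card_involution:
  assumes "finite Y" "\<And>x. x \<in> Y \<Longrightarrow> f x \<in> Y" "\<And>x. x \<in> Y \<Longrightarrow> f (f x) = x" "\<And>x. x \<in> Y \<Longrightarrow> f x \<noteq> x"
  shows "even (card Y)"
  using assms
proof (induction "card Y" arbitrary: Y rule: less_induct)
  case less
  show ?case
  proof (cases "Y = {}")
    case False
    then obtain x where x: "x \<in> Y" by blast
    let ?Y = "Y - {x, f x}"
    have 1: "Y = insert x (insert (f x) ?Y)" using x less.prems(2) by blast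
    have ne: "x \<notin> insert (f x) ?Y" "f x \<notin> ?Y" using less.prems(4)[OF x] by auto
    have c: "card Y = Suc (Suc (card ?Y))"
      using less.prems(1) ne by (subst 1) simp
    have "even (card ?Y)"
    proof (rule less.hyps)
      show "card ?Y < card Y" using c by simp
      show "finite ?Y" using less.prems(1) by simp
      fix y assume y: "y \<in> ?Y"
      show "f (f y) = y" "f y \<noteq> y" using y less.prems(3,4) by auto
      have "f y \<noteq> x" "f y \<noteq> f x" using y x less.prems(3)[of y] less.prems(3)[of x] by auto
      thus "f y \<in> ?Y" using y less.prems(2)[of y] by auto
    qed
    thus ?thesis using c by simp
  qed simp
qed

lemma odd_card_involution:
  assumes "finite X" "\<And>x. x \<in> X \<Longrightarrow> f x \<in> X" "\<And>x. x \<in> X \<Longrightarrow> f (f x) = x"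
    and "x0 \<in> X" "\<And>x. x \<in> X \<Longrightarrow> f x = x \<longleftrightarrow> x = x0"
  shows "odd (card X)"
proof -
  have "even (card (X - {x0}))"
  proof (rule even_card_involution)
    fix x assume x: "x \<in> X - {x0}"
    show "f (f x) = x" "f x \<noteq> x" using x assms(3,5) by auto
    have "f x \<noteq> x0"
    proof
      assume "f x = x0"
      hence "x = f x0" using assms(3)[of x] x by simp
      thus False using assms(4,5) x by auto
    qed
    thus "f x \<in> X - {x0}" using x assms(2) by auto
  qed (use assms(1) in simp)
  moreover have "card X = Suc (card (X - {x0}))" using assms(1,4) by (rule card.remove)
  ultimately show ?thesis by simp
qed

text \<open>The prime divides one of the two factors; after it is cancelled, coprime factors of a
  square are left.\<close>

lemma coprime_product_prime_times_square:
  fixes A B w p :: nat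
  assumes "prime p" "coprime A B" "A * B = p * w\<^sup>2"
  obtains x y where "A = x\<^sup>2" "B = p * y\<^sup>2" "x * y = w" | x y where "A = p * x\<^sup>2" "B = y\<^sup>2" "x * y = w"
proof -
  have aux: "\<exists>x y. A = p * x\<^sup>2 \<and> B = y\<^sup>2 \<and> x * y = w"
    if pA: "p dvd A" and cop: "coprime A B" and e: "A * B = p * w\<^sup>2" for A B :: nat
  proof -
    obtain A' where A': "A = p * A'" using pA by blast
    have p0: "p > 0" using assms(1) by (simp add: prime_gt_0_nat)
    have e': "A' * B = w\<^sup>2" using e p0 by (simp add: A' mult.assoc)
    have "coprime A' B" using cop by (simp add: A')
    moreover have "is_nth_power 2 (A' * B)" unfolding e' by simp
    ultimately have "is_nth_power 2 A'" "is_nth_power 2 B"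
      using is_nth_power_mult_coprime_nat_iff[of A' B 2] by auto
    then obtain x y where xy: "A' = x\<^sup>2" "B = y\<^sup>2" by (auto elim!: is_nth_powerE)
    have "(x * y)\<^sup>2 = w\<^sup>2" using e' xy by (simp add: power_mult_distrib)
    hence "x * y = w" by (simp add: power2_eq_iff_nonneg)
    thus ?thesis using xy A' by blast
  qed
  have "p dvd A * B" unfolding assms(3) by simp
  hence "p dvd A \<or> p dvd B" using assms(1) by (simp add: prime_dvd_mult_iff)
  thus ?thesis
  proof
    assume "p dvd A"
    from aux[OF this assms(2,3)] show ?thesis using that(2) by blast
  next
    assume "p dvd B"
    have "B * A = p * w\<^sup>2" "coprime B A" using assms by (simp_all add: mult.commute coprime_commute)
    from aux[OF \<open>p dvd B\<close> this(2,1)] show ?thesis using that(1) by (metis mult.commute)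
  qed
qed

context prime_1_mod_4
begin

text \<open>Here \<open>(X + Y \<surd>p) / 2\<close> is a square root of the element
  \<open>(u + v \<surd>p) / 2\<close> of norm 1. For odd \<open>u\<close> the factors of
  \<open>(u - 2) (u + 2) = p v\<^sup>2\<close> are coprime, hence a square and \<open>p\<close>
  times a square, and they add up to \<open>2 u\<close>. For even \<open>u\<close> the coprime
  factors are \<open>A\<close> and \<open>A + 1\<close>, where
  \<open>u = 2 (2 A + 1)\<close>.\<close>

lemma pell_descent:
  fixes u v :: int
  assumes "u\<^sup>2 - int p * v\<^sup>2 = 4" "u > 2" "v > 0"
  shows "\<exists>X Y :: int. X\<^sup>2 + int p * Y\<^sup>2 = 2 * u \<and> X * Y = v \<and> even (X - Y)"
proof -
  have oddp: "odd (int p)" using p_eq by simp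
  have main: "\<exists>x y :: int. (x\<^sup>2 + int p * y\<^sup>2 = A + B) \<and> x * y = w"
    if AB: "A * B = int p * w\<^sup>2" "coprime A B" "A > 0" "B > 0" "w > 0" for A B w :: int
  proof -
    have "int (nat A * nat B) = int (p * (nat w)\<^sup>2)" using AB by simp
    hence 1: "nat A * nat B = p * (nat w)\<^sup>2" by (simp only: of_nat_eq_iff)
    have "coprime (int (nat A)) (int (nat B))" using AB by simp
    hence 2: "coprime (nat A) (nat B)" by (simp only: coprime_int_iff)
    show ?thesis
    proof (rule coprime_product_prime_times_square[OF prime_p 2 1])
      fix x y assume h: "nat A = x\<^sup>2" "nat B = p * y\<^sup>2" "x * y = nat w"
      have "int (nat A) + int (nat B) = int x ^ 2 + int p * int y ^ 2" unfolding h by simp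
      moreover have "int x * int y = int (nat w)" unfolding h(3)[symmetric] by simp
      ultimately show ?thesis using AB by (intro exI[of _ "int x"] exI[of _ "int y"]) simp
    next
      fix x y assume h: "nat A = p * x\<^sup>2" "nat B = y\<^sup>2" "x * y = nat w"
      have "int (nat A) + int (nat B) = int y ^ 2 + int p * int x ^ 2" unfolding h by simp
      moreover have "int y * int x = int (nat w)" unfolding h(3)[symmetric] by simp
      ultimately show ?thesis using AB by (intro exI[of _ "int y"] exI[of _ "int x"]) simp
    qed
  qed
  have par: "even (X - Y)" if "X\<^sup>2 + int p * Y\<^sup>2 = 2 * u" for X Y :: int
  proof -
    have "even (X\<^sup>2 + int p * Y\<^sup>2)" unfolding that by simp
    thus ?thesis using oddp by auto
  qed
  show ?thesis
  proof (cases "even u")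
    case False
    have "coprime (u - 2) (u + 2)"
    proof (rule coprimeI)
      fix c assume c: "c dvd u - 2" "c dvd u + 2"
      hence "c dvd (u + 2) - (u - 2)" by (rule dvd_diff[rotated])
      hence c4: "c dvd 4" by simp
      have "odd c" using c(1) False by (auto dest: dvd_trans)
      hence "coprime c 2" by simp
      hence "coprime c (2 * 2)" by (simp only: coprime_mult_right_iff)
      hence "coprime c 4" by simp
      thus "is_unit c" using c4 by (metis coprime_absorb_left)
    qed
    moreover have "(u - 2) * (u + 2) = int p * v\<^sup>2" using assms(1) by (simp add: power2_eq_square algebra_simps)
    ultimately obtain x y where "x\<^sup>2 + int p * y\<^sup>2 = 2 * u" "x * y = v"
      using main[of "u - 2" "u + 2" v] assms by auto
    thus ?thesis using par by blast
  next
    case True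
    then obtain U where U: "u = 2 * U" by (auto elim: evenE)
    have "int p * v\<^sup>2 = 2 * (2 * U\<^sup>2 - 2)" using assms(1) by (simp add: U power_mult_distrib)
    hence "even (int p * v\<^sup>2)" by simp
    hence "even v" using oddp by simp
    then obtain V where V: "v = 2 * V" by (auto elim: evenE)
    have e1: "U\<^sup>2 - int p * V\<^sup>2 = 1" using assms(1) by (simp add: U V power_mult_distrib)
    have sq4: "z\<^sup>2 mod 4 = (if even z then 0 else 1)" for z :: int
    proof (cases "even z")
      case True
      then obtain k where "z = 2 * k" by (auto elim: evenE)
      thus ?thesis by (simp add: power2_eq_square)
    next
      case False
      then obtain k where "z = 2 * k + 1" by (auto elim: oddE)
      hence "z\<^sup>2 = 1 + 4 * (k\<^sup>2 + k)" by (simp add: power2_eq_square algebra_simps)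
      moreover have "(1 + 4 * (k\<^sup>2 + k)) mod 4 = 1 mod 4" by (rule mod_mult_self2)
      ultimately show ?thesis using False by simp
    qed
    have "U\<^sup>2 - V\<^sup>2 = 1 + 4 * (int q * V\<^sup>2)"
      using e1 p_eq by (simp add: algebra_simps)
    moreover have "(1 + 4 * (int q * V\<^sup>2)) mod 4 = 1 mod 4" by (rule mod_mult_self2)
    ultimately have "(U\<^sup>2 - V\<^sup>2) mod 4 = 1" by simp
    moreover have "(U\<^sup>2 - V\<^sup>2) mod 4 = (U\<^sup>2 mod 4 - V\<^sup>2 mod 4) mod 4" by (rule mod_diff_eq[symmetric])
    \<comment> \<open>Squares are 0 or 1 modulo 4, so a difference of 1 leaves only this parity;
      that the difference is 1 rests on \<open>p = 1\<close> modulo 4.\<close>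
    ultimately have "odd U \<and> even V" unfolding sq4 by (auto split: if_splits)
    then obtain A V1 where A: "U = 2 * A + 1" and V1: "V = 2 * V1" by (auto elim!: oddE evenE)
    have "A * (A + 1) = int p * V1\<^sup>2"
      using e1 by (simp add: A V1 power2_eq_square algebra_simps)
    moreover have "coprime A (A + 1)" by simp
    ultimately obtain x y where xy: "x\<^sup>2 + int p * y\<^sup>2 = A + (A + 1)" "x * y = V1"
      using main[of A "A + 1" V1] assms U V A V1 by auto
    have "(2 * x)\<^sup>2 + int p * (2 * y)\<^sup>2 = 4 * (x\<^sup>2 + int p * y\<^sup>2)" by (simp add: power_mult_distrib)
    also have "\<dots> = 2 * u" unfolding xy(1) U A by simp
    finally have "(2 * x)\<^sup>2 + int p * (2 * y)\<^sup>2 = 2 * u" .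
    moreover have "(2 * x) * (2 * y) = v" using xy(2) by (simp add: V V1)
    ultimately show ?thesis by (intro exI[of _ "2 * x"] exI[of _ "2 * y"]) simp
  qed
qed

lemma w_sqrt_eq: "w_sqrt = of_real (sqrt (real p))"
  by (simp add: w_sqrt_def)

text \<open>If the norm were 1, the descent would give a square root of the unit inside the ring.
  This root is again a unit, hence up to sign a power \<open>\<epsilon> powi n\<close>, and squaring
  yields \<open>2 * n = 1\<close>.\<close>

lemma fundamental_unit_norm:
  fixes u v :: int
  assumes "fundamental_unit (int p) ((of_int u + of_int v * sqrt (of_nat p)) / 2)"
  shows "u\<^sup>2 - int p * v\<^sup>2 = -4" "\<exists>x y. quad_order.nrm 1 (- int q) x y = -1"
proof -
  interpret Q: quad_order 1 "- int q" w_re by (rule quad_order_re)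
  define \<epsilon> where "\<epsilon> = (of_int u + of_int v * sqrt (real p)) / 2"
  define \<epsilon>c where "\<epsilon>c = complex_of_real \<epsilon>"
  have R: "quad_integers (int p) = Q.int_ring"
    using carrier_re by (simp add: quad_integers_def Q.int_ring_def)
  have f: "1 < \<epsilon>" "\<epsilon>c \<in> Units Q.int_ring"
    "\<And>\<eta>. \<eta> \<in> Units Q.int_ring \<Longrightarrow> \<exists>n::int. \<eta> = \<epsilon>c powi n \<or> \<eta> = - (\<epsilon>c powi n)"
    using assms unfolding fundamental_unit_def R \<epsilon>_def \<epsilon>c_def by auto
  have unit_iff: "z \<in> Units Q.int_ring \<longleftrightarrow> z \<in> Q.ints \<and> (\<exists>y\<in>Q.ints. y * z = 1)" for z
    by (auto simp: Units_def Q.int_ring_def mult.commute)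
  obtain x y where xy: "\<epsilon>c = Q.el x y" using f(2) unit_iff Q.intsE by blast
  have "of_rat (of_int u / 2 - of_int x - of_int y / 2) + of_rat (of_int v / 2 - of_int y / 2) * w_sqrt = 0"
  proof -
    have "\<epsilon>c = of_int u / 2 + of_int v / 2 * w_sqrt"
      by (simp add: \<epsilon>c_def \<epsilon>_def w_sqrt_eq add_divide_distrib)
    moreover have "\<epsilon>c = of_int x + of_int y / 2 + of_int y / 2 * w_sqrt"
      unfolding xy Q.el_def unfolding w_re_def by (simp add: field_simps)
    ultimately have "of_int u / 2 + of_int v / 2 * w_sqrt = of_int x + of_int y / 2 + of_int y / 2 * w_sqrt" by simp
    thus ?thesis by (simp add: of_rat_diff of_rat_add of_rat_divide algebra_simps)
  qed
  from indep_re[OF this] have "(of_int v :: rat) = of_int y" "(of_int u :: rat) = of_int (2 * x + y)" by simp_all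
  hence uv: "v = y" "u = 2 * x + y" by (simp_all only: of_int_eq_iff)
  have ip: "int p = 4 * int q + 1" using p_eq by simp
  have N4: "u\<^sup>2 - int p * v\<^sup>2 = 4 * Q.nrm x y"
    unfolding uv Q.nrm_def ip by (simp add: power2_eq_square algebra_simps)
  have "Q.nrm x y = 1 \<or> Q.nrm x y = -1"
  proof -
    obtain z where z: "z \<in> Q.ints" "z * \<epsilon>c = 1" using f(2) unit_iff by blast
    have "Q.Nm z * Q.Nm \<epsilon>c = Q.Nm (of_int 1)" using Q.Nm_mult[OF z(1), of \<epsilon>c] z(2) by (simp add: xy)
    hence "Q.Nm z * Q.nrm x y = 1" unfolding Q.Nm_of_int by (simp add: xy)
    hence "Q.nrm x y dvd 1" by (metis dvd_triv_right)
    thus ?thesis by (auto simp: zdvd1_eq abs_if split: if_splits)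
  qed
  moreover have "Q.nrm x y \<noteq> 1"
  proof
    assume n1: "Q.nrm x y = 1"
    hence e4: "u\<^sup>2 - int p * v\<^sup>2 = 4" using N4 by simp
    \<comment> \<open>The conjugate. From \<open>\<epsilon> * \<epsilon>' = 1\<close> it lies
      strictly between 0 and 1, which makes \<open>u\<close> and \<open>v\<close> positive, as the
      descent requires.\<close>
    define \<epsilon>' where "\<epsilon>' = (of_int u - of_int v * sqrt (real p)) / 2"
    have "\<epsilon> * \<epsilon>' = of_int (u\<^sup>2 - int p * v\<^sup>2) / 4"
      by (simp add: \<epsilon>_def \<epsilon>'_def power2_eq_square algebra_simps)
    hence ee: "\<epsilon> * \<epsilon>' = 1" unfolding e4 by simp
    have pos: "\<epsilon>' > 0" using ee f(1) by (smt (verit) mult_nonneg_nonpos)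
    have lt: "\<epsilon>' < 1" using ee f(1) pos by (smt (verit) mult_le_cancel_left1 mult_le_cancel_right2)
    have "\<epsilon> + \<epsilon>' = of_int u" "\<epsilon> - \<epsilon>' = of_int v * sqrt (real p)" by (simp_all add: \<epsilon>_def \<epsilon>'_def field_simps)
    hence "of_int u > (0::real)" "of_int v * sqrt (real p) > 0" using f(1) pos lt by linarith+
    hence u0: "u > 0" and v0: "v > 0" using p_gt2 by (simp_all add: zero_less_mult_iff)
    have "u > 2"
    proof (rule ccontr)
      assume "\<not> u > 2"
      hence "u * u \<le> 2 * 2" using u0 by (intro mult_mono) auto
      moreover have "int p * v\<^sup>2 > 0" using v0 p_gt2 by simp
      ultimately show False using e4 by (simp add: power2_eq_square)
    qed
    from pell_descent[OF e4 this v0] obtain X Y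
      where XY: "X\<^sup>2 + int p * Y\<^sup>2 = 2 * u" "X * Y = v" "even (X - Y)" by blast
    obtain Z where Z: "X - Y = 2 * Z" using XY(3) by (rule evenE)
    define \<eta> where "\<eta> = Q.el Z Y"
    define \<eta>r where "\<eta>r = (of_int X + of_int Y * sqrt (real p)) / 2"
    have "X = 2 * Z + Y" using Z by simp
    hence er: "\<eta> = of_real \<eta>r"
      unfolding \<eta>_def \<eta>r_def Q.el_def unfolding w_re_def w_sqrt_eq by (simp add: field_simps)
    have "\<eta>r * \<eta>r = (of_int (X\<^sup>2 + int p * Y\<^sup>2) + 2 * of_int (X * Y) * sqrt (real p)) / 4"
      by (simp add: \<eta>r_def power2_eq_square algebra_simps)
    also have "\<dots> = \<epsilon>" unfolding XY(1,2) \<epsilon>_def by simp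
    finally have sq: "\<eta>r * \<eta>r = \<epsilon>" .
    hence "\<eta> * \<eta> = \<epsilon>c" unfolding er \<epsilon>c_def by (simp flip: of_real_mult)
    moreover obtain z where z: "z \<in> Q.ints" "z * \<epsilon>c = 1" using f(2) unit_iff by blast
    ultimately have "(z * \<eta>) * \<eta> = 1" by (simp add: mult.assoc)
    moreover have "\<eta> \<in> Q.ints" "z * \<eta> \<in> Q.ints" using Q.ints_closed(3)[OF z(1)] by (simp_all add: \<eta>_def)
    ultimately have "\<eta> \<in> Units Q.int_ring" unfolding unit_iff by blast
    then obtain n where "\<eta> = \<epsilon>c powi n \<or> \<eta> = - (\<epsilon>c powi n)" using f(3) by blast
    hence "of_real \<eta>r = (of_real (\<epsilon> powi n) :: complex) \<or> of_real \<eta>r = (of_real (- (\<epsilon> powi n)) :: complex)"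
      unfolding er \<epsilon>c_def by (simp add: of_real_power_int)
    hence "\<eta>r = \<epsilon> powi n \<or> \<eta>r = - (\<epsilon> powi n)" by (simp only: of_real_eq_iff)
    hence "\<eta>r * \<eta>r = \<epsilon> powi n * \<epsilon> powi n" by (metis minus_mult_minus)
    hence "\<epsilon> = \<epsilon> powi n * \<epsilon> powi n" unfolding sq .
    \<comment> \<open>Real powers are injective in the exponent for a base above 1, so the exponents
      can be compared.\<close>
    hence "\<epsilon> powr 1 = \<epsilon> powr (of_int n) * \<epsilon> powr (of_int n)"
      using f(1) by (simp add: powr_real_of_int')
    hence "\<epsilon> powr 1 = \<epsilon> powr (of_int (2 * n))" by (simp flip: powr_add)
    hence "(1::real) = of_int (2 * n)" using f(1) powr_inj[of \<epsilon> 1 "of_int (2 * n)"] by simp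
    hence "(1::int) = 2 * n" by (metis of_int_1 of_int_eq_iff)
    thus False by presburger
  qed
  ultimately have nm: "Q.nrm x y = -1" by blast
  show "u\<^sup>2 - int p * v\<^sup>2 = -4" unfolding N4 nm by simp
  show "\<exists>x y. Q.nrm x y = -1" using nm by blast
qed

end

subsection \<open>The class number of the real field is odd\<close>

context prime_1_mod_4
begin

interpretation Q: quad_order 1 "- int q" w_re by (rule quad_order_re)

text \<open>Galois conjugation, sending \<open>\<omega>\<close> to \<open>1 - \<omega>\<close>.
  Complex conjugation would not do, since the field is real.\<close>

definition cj :: "complex \<Rightarrow> complex" where "cj z = Q.el (Q.cu z + Q.cv z) (- Q.cv z)"

lemma cj_el: "cj (Q.el u v) = Q.el (u + v) (- v)"
  by (simp add: cj_def)

lemma cj_ints: "z \<in> Q.ints \<Longrightarrow> cj z \<in> Q.ints"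
  by (simp add: cj_def)

lemma cj_cj: "z \<in> Q.ints \<Longrightarrow> cj (cj z) = z"
  by (elim Q.intsE) (simp add: cj_el)

lemma cj_mult: "x \<in> Q.ints \<Longrightarrow> y \<in> Q.ints \<Longrightarrow> cj (x * y) = cj x * cj y"
  by (elim Q.intsE) (simp add: cj_el Q.el_mult Q.el_eq_iff algebra_simps)

lemma cj_add: "x \<in> Q.ints \<Longrightarrow> y \<in> Q.ints \<Longrightarrow> cj (x + y) = cj x + cj y"
  by (elim Q.intsE) (simp add: cj_el Q.el_add Q.el_eq_iff)

lemma mult_cj: "x \<in> Q.ints \<Longrightarrow> x * cj x = of_int (Q.Nm x)"
  using Q.el_conj by (elim Q.intsE) (simp add: cj_el)

lemma cj_0_iff: "x \<in> Q.ints \<Longrightarrow> cj x = 0 \<longleftrightarrow> x = 0"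
  by (elim Q.intsE) (auto simp: cj_el Q.el_0_iff)

lemma cj_image_scale:
  assumes "z \<in> Q.ints" "I \<subseteq> Q.ints"
  shows "cj ` (*) z ` I = (*) (cj z) ` cj ` I"
proof -
  have "cj (z * x) = cj z * cj x" if "x \<in> I" for x using cj_mult assms that by blast
  thus ?thesis by (simp add: image_image)
qed

lemma cj_image_cj:
  assumes "I \<subseteq> Q.ints"
  shows "cj ` cj ` I = I"
proof -
  have "cj (cj x) = x" if "x \<in> I" for x using cj_cj assms that by blast
  thus ?thesis by (simp add: image_image)
qed

text \<open>The conjugate of \<open>b + \<omega>\<close> is the negative of
  \<open>(- b - 1) + \<omega>\<close>.\<close>

lemma cj_qid: "cj ` Q.qid k a b = Q.qid k a (- b - 1)"
proof -
  have sub: "cj ` Q.qid k a b \<subseteq> Q.qid k a (- b - 1)" for b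
  proof
    fix z assume "z \<in> cj ` Q.qid k a b"
    then obtain w where w: "w \<in> Q.qid k a b" "z = cj w" by blast
    obtain u v where uv: "w = Q.el u v" using w(1) Q.qid_sub_ints by (meson Q.intsE subsetD)
    have "k dvd v" "k * a dvd u - b * v" using w uv by (simp_all add: Q.qid_mem)
    moreover have eq: "(u + v) - (- b - 1) * (- v) = u - b * v" by (simp add: algebra_simps)
    ultimately show "z \<in> Q.qid k a (- b - 1)" unfolding w(2) uv cj_el Q.qid_mem eq by simp
  qed
  have "Q.qid k a (- b - 1) = cj ` cj ` Q.qid k a (- b - 1)" by (rule cj_image_cj[symmetric]) (rule Q.qid_sub_ints)
  also have "\<dots> \<subseteq> cj ` Q.qid k a (- (- b - 1) - 1)" by (rule image_mono[OF sub])
  also have "- (- b - 1) - 1 = b" by simp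
  finally show ?thesis using sub[of b] by blast
qed

lemma poly_at_cj: "Q.poly_at (- b - 1) = Q.poly_at b"
  by (simp add: Q.poly_at_def power2_eq_square algebra_simps)

lemma nz_sub: "I \<in> Q.nz_ideals \<Longrightarrow> I \<subseteq> Q.ints"
  by (simp add: Q.nz_ideals_def Q.is_ideal_def)

lemma cj_nz: "I \<in> Q.nz_ideals \<Longrightarrow> cj ` I \<in> Q.nz_ideals"
  by (elim Q.nz_idealE) (simp add: cj_qid Q.qid_in_nz poly_at_cj)

lemma cj_rel:
  assumes "(I, J) \<in> Q.class_rel"
  shows "(cj ` I, cj ` J) \<in> Q.class_rel"
proof -
  from assms obtain x y where h: "I \<in> Q.nz_ideals" "J \<in> Q.nz_ideals" "x \<in> Q.ints" "x \<noteq> 0" "y \<in> Q.ints" "y \<noteq> 0"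
    "(*) x ` I = (*) y ` J" by (rule Q.class_relE)
  have "(*) (cj x) ` cj ` I = cj ` (*) x ` I" by (rule cj_image_scale[symmetric, OF h(3) nz_sub[OF h(1)]])
  also have "\<dots> = (*) (cj y) ` cj ` J" unfolding h(7) by (rule cj_image_scale[OF h(5) nz_sub[OF h(2)]])
  finally show ?thesis
    by (intro Q.class_relI[where x = "cj x" and y = "cj y"]) (use h cj_nz cj_ints cj_0_iff in auto)
qed

text \<open>Equality with the conjugate forces \<open>- b - 1 = b\<close> modulo \<open>a\<close>.
  So \<open>a\<close> divides \<open>2 b + 1\<close> and, by
  \<open>p = (2 b + 1)\<^sup>2 - 4 poly_at b\<close>, also \<open>p\<close>. For
  \<open>a = 1\<close> the primitive ideal \<open>qid 1 a b\<close> is the whole ring, for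
  \<open>a = p\<close> it is generated by \<open>\<surd>p\<close>.\<close>

lemma ambiguous_principal:
  assumes "J \<in> Q.nz_ideals" "cj ` J = J"
  shows "(J, Q.ints) \<in> Q.class_rel"
proof -
  obtain k a b where h: "k > 0" "a > 0" "a dvd Q.poly_at b" "J = Q.qid k a b" using assms(1) by (rule Q.nz_idealE)
  have "Q.qid k a (- b - 1) = Q.qid k a b" using assms(2) by (simp add: h(4) cj_qid)
  hence "[- b - 1 = b] (mod a)" using Q.qid_eq_iff[OF h(1,2,1,2)] by simp
  hence "a dvd - (2 * b + 1)" by (simp add: cong_iff_dvd_diff algebra_simps)
  hence ab: "a dvd 2 * b + 1" by (simp only: dvd_minus_iff)
  have "int p = (2 * b + 1) * (2 * b + 1) - 4 * Q.poly_at b"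
    using p_eq by (simp add: Q.poly_at_def power2_eq_square algebra_simps)
  hence "a dvd int p" using ab h(3) by (metis dvd_diff dvd_mult)
  hence "a = 1 \<or> a = int p" using prime_int_p h(2) unfolding prime_int_iff by auto
  hence "(Q.qid 1 a b, Q.ints) \<in> Q.class_rel"
  proof
    assume "a = 1"
    moreover have "Q.qid 1 1 b = Q.ints" by (auto simp: Q.ints_def Q.qid_def)
    ultimately show ?thesis using Q.equiv_class_rel Q.ints_in_nz by (simp add: equiv_def refl_on_def)
  next
    assume ap: "a = int p"
    \<comment> \<open>The element \<open>Q.el (-1) 2\<close> is
      \<open>2 \<omega> - 1 = \<surd>p\<close>.\<close>
    have rt: "Q.el (-1) 2 * Q.el u v = Q.el (- u + 2 * int q * v) (2 * u + v)" for u v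
      by (simp add: Q.el_mult Q.el_eq_iff algebra_simps)
    have ip: "int p = 4 * int q + 1" using p_eq by simp
    have "Q.qid 1 (int p) b = (*) (Q.el (-1) 2) ` Q.ints"
    proof (intro equalityI subsetI)
      fix z assume z: "z \<in> Q.qid 1 (int p) b"
      then obtain U V where UV: "z = Q.el U V" using Q.qid_sub_ints by (meson Q.intsE subsetD)
      have d1: "int p dvd U - b * V" using z UV by (simp add: Q.qid_mem)
      have eq: "2 * U + V = 2 * (U - b * V) + V * (2 * b + 1)" by (simp add: algebra_simps)
      have d2: "int p dvd 2 * U + V" unfolding eq by (rule dvd_add[OF dvd_mult[OF d1] dvd_mult[OF ab[unfolded ap]]])
      have "2 * (- U + 2 * int q * V) = int p * V - (2 * U + V)" unfolding ip by (simp add: algebra_simps)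
      moreover have "int p dvd int p * V - (2 * U + V)" by (rule dvd_diff[OF dvd_triv_left d2])
      ultimately have "int p dvd 2 * (- U + 2 * int q * V)" by (simp only:)
      hence "int p dvd 2 \<or> int p dvd - U + 2 * int q * V" using prime_int_p prime_dvd_mult_iff by blast
      hence d3: "int p dvd - U + 2 * int q * V" using not_dvd_range[of 2] p_gt2 by auto
      \<comment> \<open>The product of \<open>z\<close> with \<open>\<surd>p\<close> is
        \<open>p\<close> times the element with coordinates \<open>u\<close>, \<open>v\<close>, so
        \<open>z\<close> is \<open>\<surd>p\<close> times that element.\<close>
      obtain u v where uv: "- U + 2 * int q * V = int p * u" "2 * U + V = int p * v" using d2 d3 by (auto simp: dvd_def)
      have "int p * (- u + 2 * int q * v) = - (int p * u) + 2 * int q * (int p * v)" by (simp add: algebra_simps)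
      also have "\<dots> = int p * U" unfolding uv[symmetric] by (simp add: ip algebra_simps)
      finally have "int p * U = int p * (- u + 2 * int q * v)" by (rule sym)
      moreover have "int p * V = int p * (2 * u + v)"
      proof -
        have "int p * (2 * u + v) = 2 * (int p * u) + int p * v" by (simp add: algebra_simps)
        also have "\<dots> = int p * V" unfolding uv[symmetric] by (simp add: ip algebra_simps)
        finally show ?thesis by (rule sym)
      qed
      ultimately have "U = - u + 2 * int q * v" "V = 2 * u + v" using p_gt2 by auto
      hence "z = Q.el (-1) 2 * Q.el u v" unfolding rt UV by simp
      thus "z \<in> (*) (Q.el (-1) 2) ` Q.ints" by (rule image_eqI) simp
    next
      fix z assume "z \<in> (*) (Q.el (-1) 2) ` Q.ints"
      then obtain x where x: "x \<in> Q.ints" "z = Q.el (-1) 2 * x" by blast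
      obtain u v where "x = Q.el u v" using x(1) by (rule Q.intsE)
      hence z: "z = Q.el (- u + 2 * int q * v) (2 * u + v)" by (simp only: x(2) rt)
      have "2 * ((- u + 2 * int q * v) - b * (2 * u + v)) = int p * v - (2 * b + 1) * (2 * u + v)"
        unfolding ip by (simp add: algebra_simps)
      moreover have "int p dvd int p * v - (2 * b + 1) * (2 * u + v)" using ab ap by (intro dvd_diff) auto
      ultimately have "int p dvd 2 * ((- u + 2 * int q * v) - b * (2 * u + v))" by simp
      hence "int p dvd 2 \<or> int p dvd (- u + 2 * int q * v) - b * (2 * u + v)" using prime_int_p prime_dvd_mult_iff by blast
      hence "int p dvd (- u + 2 * int q * v) - b * (2 * u + v)" using not_dvd_range[of 2] p_gt2 by auto
      thus "z \<in> Q.qid 1 (int p) b" unfolding z by (simp add: Q.qid_mem)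
    qed
    thus ?thesis
      by (intro Q.class_relI[where x = 1 and y = "Q.el (-1) 2"])
        (use h ap Q.qid_in_nz[of 1 a b] Q.ints_in_nz in \<open>auto simp: Q.el_0_iff\<close>)
  qed
  moreover have "(J, Q.qid 1 a b) \<in> Q.class_rel" unfolding h(4) by (rule Q.qid_rel_qid_1[OF h(1-3)])
  ultimately show ?thesis using Q.equiv_class_rel by (meson equivE transD)
qed

text \<open>Comparing norms gives \<open>Nm x = Nm y\<close> up to sign, and the unit of norm
  \<open>-1\<close> corrects the sign without changing the ideal. By Hilbert 90 the quotient
  \<open>y' / x\<close> of norm 1 has the form \<open>cj c / c\<close>, so the ideal scaled by
  \<open>c\<close> equals its conjugate.\<close>

lemma self_conjugate_principal:
  assumes rel: "(I, cj ` I) \<in> Q.class_rel" and unit: "Q.nrm ux uy = -1"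
  shows "(I, Q.ints) \<in> Q.class_rel"
proof -
  from rel obtain x y where h: "I \<in> Q.nz_ideals" "cj ` I \<in> Q.nz_ideals" "x \<in> Q.ints" "x \<noteq> 0" "y \<in> Q.ints" "y \<noteq> 0"
    "(*) x ` I = (*) y ` cj ` I" by (rule Q.class_relE)
  obtain k a b where I: "k > 0" "a > 0" "a dvd Q.poly_at b" "I = Q.qid k a b" using h(1) by (rule Q.nz_idealE)
  have Isub: "I \<subseteq> Q.ints" by (rule nz_sub[OF h(1)])
  have "\<bar>Q.Nm x * (k * k * a)\<bar> = \<bar>Q.Nm y * (k * k * a)\<bar>"
    using Q.scaled_norms[OF h(3,5)] h(7) unfolding I(4) cj_qid by blast
  hence abs: "\<bar>Q.Nm x\<bar> = \<bar>Q.Nm y\<bar>" using I(1,2) by (simp add: abs_mult)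
  obtain y' where y': "y' \<in> Q.ints" "y' \<noteq> 0" "(*) x ` I = (*) y' ` cj ` I" "Q.Nm x = Q.Nm y'"
  proof (cases "Q.Nm x = Q.Nm y")
    case True
    thus ?thesis using that h by blast
  next
    case False
    let ?e = "Q.el ux uy"
    have Ne: "Q.Nm (y * ?e) = - Q.Nm y" using Q.Nm_mult[OF h(5), of ?e] unit by simp
    have nzx: "Q.Nm y \<noteq> 0" using Q.Nm_0_iff h(5,6) by simp
    have e0: "y * ?e \<noteq> 0" using Ne nzx Q.Nm_0_iff[of "y * ?e"] Q.ints_closed(3)[OF h(5), of ?e] by auto
    have einv: "?e * - cj ?e = 1" using mult_cj[of ?e] unit by simp
    have eI: "(*) ?e ` cj ` I = cj ` I"
    proof -
      have idl: "\<And>r z. r \<in> Q.ints \<Longrightarrow> z \<in> cj ` I \<Longrightarrow> r * z \<in> cj ` I"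
        using h(2) by (auto simp: Q.nz_ideals_def Q.is_ideal_def)
      show ?thesis
      proof (intro equalityI subsetI)
        fix z assume "z \<in> (*) ?e ` cj ` I"
        thus "z \<in> cj ` I" using idl[of ?e] by auto
      next
        fix z assume z: "z \<in> cj ` I"
        have "- cj ?e \<in> Q.ints" using cj_ints[of ?e] Q.ints_closed(4) by simp
        hence "- cj ?e * z \<in> cj ` I" using idl z by blast
        moreover have "z = ?e * (- cj ?e * z)"
        proof -
          have "?e * (- cj ?e * z) = (?e * - cj ?e) * z" by (simp only: mult.assoc)
          thus ?thesis unfolding einv by simp
        qed
        ultimately show "z \<in> (*) ?e ` cj ` I" by blast
      qed
    qed
    have "(*) (y * ?e) ` cj ` I = (*) y ` (*) ?e ` cj ` I" by (simp add: image_image mult.assoc)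
    also have "\<dots> = (*) x ` I" unfolding eI h(7) ..
    finally have 1: "(*) x ` I = (*) (y * ?e) ` cj ` I" by simp
    have 2: "Q.Nm x = Q.Nm (y * ?e)" unfolding Ne using False abs by (auto simp: abs_if split: if_splits)
    have 3: "y * ?e \<in> Q.ints" using Q.ints_closed(3)[OF h(5), of ?e] by simp
    show ?thesis by (rule that[OF 3 e0 1 2])
  qed
  define t where "t = x + y'"
  have tO: "t \<in> Q.ints" unfolding t_def by (rule Q.ints_closed(1)[OF h(3) y'(1)])
  \<comment> \<open>The Hilbert 90 witness is \<open>x * cj t\<close> with
    \<open>t = x + y'\<close>. If \<open>t = 0\<close>, the two scaling factors differ only by sign,
    and \<open>I\<close> is already its own conjugate.\<close>
  obtain c where c: "c \<in> Q.ints" "c \<noteq> 0" "(*) c ` I = (*) (cj c) ` cj ` I"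
  proof (cases "t = 0")
    case True
    hence "y' = - x" by (simp add: t_def add_eq_0_iff)
    hence "(*) x ` I = (*) (- x) ` cj ` I" using y'(3) by simp
    hence "(*) x ` I = (*) x ` uminus ` cj ` I" by (simp add: image_image)
    moreover have "inj ((*) x)" using h(4) by (simp add: inj_on_def)
    ultimately have "I = uminus ` cj ` I" by (simp only: inj_image_eq_iff)
    also have "\<dots> = cj ` I"
    proof -
      have "0 \<in> cj ` I" "\<And>u v. u \<in> cj ` I \<Longrightarrow> v \<in> cj ` I \<Longrightarrow> u - v \<in> cj ` I"
        using h(2) by (simp_all only: Q.nz_ideals_def Q.is_ideal_def mem_Collect_eq)
      hence neg: "- z \<in> cj ` I" if "z \<in> cj ` I" for z using that by (metis diff_0)
      show ?thesis
      proof (intro equalityI subsetI)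
        fix z assume "z \<in> cj ` I"
        hence "- z \<in> cj ` I" "z = - (- z)" using neg by auto
        thus "z \<in> uminus ` cj ` I" by blast
      qed (use neg in auto)
    qed
    finally have "I = cj ` I" .
    moreover have "cj 1 = 1" using cj_el[of 1 0] by (simp add: Q.el_of_int)
    ultimately show ?thesis using that[of 1] by simp
  next
    case False
    let ?c = "x * cj t"
    have ct: "cj t \<in> Q.ints" "cj t \<noteq> 0" using cj_ints[OF tO] cj_0_iff[OF tO] False by auto
    have cc: "cj ?c = cj x * t" using cj_mult[OF h(3) ct(1)] cj_cj[OF tO] by simp
    have N: "x * cj x = y' * cj y'" using mult_cj[OF h(3)] mult_cj[OF y'(1)] y'(4) by simp
    have key: "y' * cj t = cj x * t"
    proof -
      have "y' * cj t = y' * cj x + y' * cj y'" unfolding t_def cj_add[OF h(3) y'(1)] by (simp add: algebra_simps)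
      also have "\<dots> = cj x * t" unfolding N[symmetric] t_def by (simp add: algebra_simps)
      finally show ?thesis .
    qed
    have "(*) ?c ` I = (*) (cj t) ` (*) x ` I" by (simp add: image_image mult_ac)
    also have "\<dots> = (*) (y' * cj t) ` cj ` I" unfolding y'(3) by (simp add: image_image mult_ac)
    also have "\<dots> = (*) (cj ?c) ` cj ` I" unfolding key cc ..
    finally have "(*) ?c ` I = (*) (cj ?c) ` cj ` I" .
    moreover have "?c \<in> Q.ints" by (rule Q.ints_closed(3)[OF h(3) ct(1)])
    moreover have "?c \<noteq> 0" using h(4) ct by simp
    ultimately show ?thesis using that by blast
  qed
  let ?J = "(*) c ` I"
  have J: "?J \<in> Q.nz_ideals" by (rule Q.nz_ideal_scale[OF h(1) c(1,2)])
  have "cj ` ?J = ?J" unfolding cj_image_scale[OF c(1) Isub] c(3)[symmetric] ..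
  from ambiguous_principal[OF J this] have "(?J, Q.ints) \<in> Q.class_rel" .
  moreover have "(I, ?J) \<in> Q.class_rel"
    by (rule Q.class_relI[where x = c and y = 1]) (use h(1) J c in auto)
  ultimately show ?thesis using Q.equiv_class_rel by (meson equivE transD)
qed

text \<open>Take the least \<open>a\<close> in the class and shift \<open>b\<close> so that
  \<open>2 b + 1\<close> lies between \<open>- a\<close> and \<open>a\<close>. With
  \<open>poly_at b = a c\<close>, multiplying by the conjugate of \<open>b + \<omega>\<close> leads
  to an equivalent ideal with \<open>\<bar>c\<bar>\<close> in place of \<open>a\<close>. So
  \<open>a \<le> \<bar>c\<bar>\<close>, hence
  \<open>4 a\<^sup>2 \<le> \<bar>(2 b + 1)\<^sup>2 - p\<bar>\<close>, and therefore
  \<open>a\<^sup>2 \<le> p\<close>.\<close>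

lemma reduced_representative:
  assumes "I \<in> Q.nz_ideals"
  shows "\<exists>a b. a \<in> {1..int p} \<and> b \<in> {0..int p} \<and> a dvd Q.poly_at b \<and> (I, Q.qid 1 a b) \<in> Q.class_rel"
proof -
  define P where "P = (\<lambda>n::nat. n > 0 \<and> (\<exists>b. int n dvd Q.poly_at b \<and> (I, Q.qid 1 (int n) b) \<in> Q.class_rel))"
  have ex: "\<exists>n. P n"
  proof -
    obtain k a b where h: "k > 0" "a > 0" "a dvd Q.poly_at b" "I = Q.qid k a b" using assms by (rule Q.nz_idealE)
    hence "P (nat a)" using Q.qid_rel_qid_1[OF h(1-3)] unfolding P_def by (intro conjI exI[of _ b]) auto
    thus ?thesis by blast
  qed
  define n where "n = (LEAST n. P n)"
  have Pn: "P n" unfolding n_def by (rule LeastI_ex[OF ex])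
  have least: "n \<le> m" if "P m" for m unfolding n_def using that by (rule Least_le)
  define a where "a = int n"
  obtain b0 where b0: "a dvd Q.poly_at b0" "(I, Q.qid 1 a b0) \<in> Q.class_rel" and a0: "a > 0"
    using Pn unfolding P_def a_def by auto
  have poly_cong: "a dvd Q.poly_at b" and qid_cong: "Q.qid 1 a b = Q.qid 1 a b0" if "[b = b0] (mod a)" for b
  proof -
    have "[Q.poly_at b = Q.poly_at b0] (mod a)" unfolding Q.poly_at_def
      by (intro cong_add cong_mult cong_pow cong_refl that)
    thus "a dvd Q.poly_at b" using b0(1) cong_dvd_iff by blast
    show "Q.qid 1 a b = Q.qid 1 a b0" using Q.qid_eq_iff[of 1 a 1 a b b0] a0 that by simp
  qed
  have ip: "int p = 4 * int q + 1" using p_eq by simp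
  have "a * a \<le> int p"
  proof -
    define m where "m = a div 2"
    define w where "w = (b0 + m) mod a"
    define b where "b = w - m"
    have "[b = b0 + m - m] (mod a)" unfolding b_def w_def by (intro cong_diff cong_refl) simp
    hence bc: "[b = b0] (mod a)" by simp
    have br: "- a \<le> 2 * b + 1" "2 * b + 1 \<le> a"
    proof -
      have "0 \<le> w" "w < a" using a0 by (auto simp: w_def)
      moreover have "2 * m \<le> a" "a - 1 \<le> 2 * m" unfolding m_def by presburger+
      moreover have "2 * b = 2 * w - 2 * m" by (simp add: b_def)
      ultimately show "- a \<le> 2 * b + 1" "2 * b + 1 \<le> a" by linarith+
    qed
    obtain c where c: "Q.poly_at b = a * c" using poly_cong[OF bc] by (auto simp: dvd_def)
    have fp: "4 * Q.poly_at b = (2 * b + 1)\<^sup>2 - int p" unfolding ip Q.poly_at_def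
      by (simp add: power2_eq_square algebra_simps)
    \<comment> \<open>Otherwise \<open>p\<close> would be the square of
      \<open>2 b + 1\<close>.\<close>
    have c0: "c \<noteq> 0"
    proof
      assume "c = 0"
      hence "int p = (2 * b + 1) * (2 * b + 1)" using fp c by (simp add: power2_eq_square)
      define M where "M = 2 * b + 1"
      have pM: "int p = M * M" unfolding M_def by fact
      have "int p dvd M * M" unfolding pM[symmetric] by (rule dvd_refl)
      hence "int p dvd M" using prime_int_p by (simp add: prime_dvd_mult_iff)
      hence "int p * int p dvd M * M" by (intro mult_dvd_mono)
      hence "int p * int p \<le> int p" unfolding pM[symmetric] using p_gt2 by (intro zdvd_imp_le) auto
      moreover have "int p * 2 < int p * int p" using p_gt2 by (intro mult_strict_left_mono) auto
      ultimately show False using p_gt2 by linarith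
    qed
    have img: "(*) (Q.el (b + 1) (-1)) ` Q.qid 1 a b = (*) (of_int a) ` Q.qid 1 \<bar>c\<bar> (- b - 1)"
    proof -
      have gen: "Q.qid 1 a b = {Q.el (a * x + b * y) y | x y. True}" for a b
      proof (intro equalityI subsetI)
        fix z assume z: "z \<in> Q.qid 1 a b"
        obtain u v where uv: "z = Q.el u v" using z Q.qid_sub_ints by (meson Q.intsE subsetD)
        then obtain x where "u = a * x + b * v" using z unfolding uv Q.qid_1_mem by blast
        thus "z \<in> {Q.el (a * x + b * y) y | x y. True}" using uv by blast
      next
        fix z assume "z \<in> {Q.el (a * x + b * y) y | x y. True}"
        then obtain x y where z: "z = Q.el (a * x + b * y) y" by blast
        show "z \<in> Q.qid 1 a b" unfolding z Q.qid_1_mem by blast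
      qed
      have img_gen: "(*) t ` {f x y | x y. True} = {t * f x y | x y. True}" for t :: complex and f :: "int \<Rightarrow> int \<Rightarrow> complex"
        by blast
      have p1: "Q.el (b + 1) (-1) * Q.el (a * x + b * y) y = of_int a * Q.el (c * y + (- b - 1) * (- x)) (- x)" for x y
      proof -
        have "b * b + b - int q = a * c" using c by (simp add: Q.poly_at_def power2_eq_square)
        hence q: "int q = b * b + b - a * c" by simp
        have "of_int a * Q.el (c * y + (- b - 1) * (- x)) (- x) = Q.el a 0 * Q.el (c * y + (- b - 1) * (- x)) (- x)"
          by (simp add: Q.el_of_int)
        thus ?thesis unfolding Q.el_mult Q.el_eq_iff q by (simp add: Q.el_mult Q.el_eq_iff algebra_simps)
      qed
      have "(*) (Q.el (b + 1) (-1)) ` Q.qid 1 a b = {of_int a * Q.el (c * y + (- b - 1) * (- x)) (- x) | x y. True}"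
        unfolding gen img_gen p1 ..
      \<comment> \<open>The norm form is indefinite, so \<open>c\<close> may be negative; its sign
        is absorbed into the free variable.\<close>
      also have "\<dots> = {of_int a * Q.el (\<bar>c\<bar> * x + (- b - 1) * y) y | x y. True}"
      proof (intro equalityI subsetI)
        fix z assume "z \<in> {of_int a * Q.el (c * y + (- b - 1) * (- x)) (- x) | x y. True}"
        then obtain x y where "z = of_int a * Q.el (c * y + (- b - 1) * (- x)) (- x)" by blast
        moreover have "c * y = \<bar>c\<bar> * (sgn c * y)" by (simp add: abs_mult_sgn mult.assoc[symmetric])
        ultimately have "z = of_int a * Q.el (\<bar>c\<bar> * (sgn c * y) + (- b - 1) * (- x)) (- x)" by (simp only:)
        thus "z \<in> {of_int a * Q.el (\<bar>c\<bar> * x + (- b - 1) * y) y | x y. True}" by blast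
      next
        fix z assume "z \<in> {of_int a * Q.el (\<bar>c\<bar> * x + (- b - 1) * y) y | x y. True}"
        then obtain x y where z: "z = of_int a * Q.el (\<bar>c\<bar> * x + (- b - 1) * y) y" by blast
        have cx: "\<bar>c\<bar> * x = c * (sgn c * x)" by (simp add: abs_sgn mult.assoc)
        have "z = of_int a * Q.el (c * (sgn c * x) + (- b - 1) * (- (- y))) (- (- y))"
          unfolding z cx minus_minus ..
        thus "z \<in> {of_int a * Q.el (c * y + (- b - 1) * (- x)) (- x) | x y. True}" by blast
      qed
      also have "\<dots> = (*) (of_int a) ` Q.qid 1 \<bar>c\<bar> (- b - 1)" unfolding gen img_gen ..
      finally show ?thesis .
    qed
    have cd: "\<bar>c\<bar> dvd Q.poly_at (- b - 1)" unfolding poly_at_cj c by simp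
    have "(Q.qid 1 a b, Q.qid 1 \<bar>c\<bar> (- b - 1)) \<in> Q.class_rel"
      by (rule Q.class_relI[OF _ _ _ _ _ _ img])
        (use a0 c0 cd poly_cong[OF bc] in \<open>auto simp: Q.qid_in_nz Q.el_0_iff\<close>)
    hence "(I, Q.qid 1 \<bar>c\<bar> (- b - 1)) \<in> Q.class_rel"
      using b0(2) Q.equiv_class_rel unfolding qid_cong[OF bc] by (meson equivE transD)
    hence "P (nat \<bar>c\<bar>)" unfolding P_def using c0 cd by (intro conjI exI[of _ "- b - 1"]) auto
    hence ac: "a \<le> \<bar>c\<bar>" using least[of "nat \<bar>c\<bar>"] unfolding a_def by simp
    have "a * a \<le> a * \<bar>c\<bar>" using ac a0 by simp
    also have "\<dots> = \<bar>Q.poly_at b\<bar>" unfolding c using a0 by (simp add: abs_mult)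
    finally have 1: "4 * (a * a) \<le> \<bar>(2 * b + 1)\<^sup>2 - int p\<bar>" using fp by linarith
    have "\<bar>2 * b + 1\<bar> \<le> \<bar>a\<bar>" using br by linarith
    hence "(2 * b + 1)\<^sup>2 \<le> a\<^sup>2" by (simp only: abs_le_square_iff)
    hence 2: "(2 * b + 1)\<^sup>2 \<le> a * a" by (simp add: power2_eq_square)
    have 3: "(2 * b + 1)\<^sup>2 \<ge> 0" "a * a > 0" using a0 by simp_all
    show ?thesis using 1 2 3 by linarith
  qed
  moreover have "a \<le> a * a" using a0 by (simp add: mult_le_cancel_left1)
  ultimately have ap: "a \<le> int p" by simp
  let ?b = "b0 mod a"
  have bc: "[?b = b0] (mod a)" by simp
  have bb: "0 \<le> ?b" "?b < a" using pos_mod_sign[of a b0] pos_mod_bound[of a b0] a0 by blast+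
  have "?b \<le> int p" using bb(2) ap by linarith
  hence "a \<in> {1..int p}" "?b \<in> {0..int p}" using a0 ap bb(1) by (simp_all only: atLeastAtMost_iff) auto
  moreover have "(I, Q.qid 1 a ?b) \<in> Q.class_rel" unfolding qid_cong[OF bc] by (rule b0(2))
  ultimately show ?thesis using poly_cong[OF bc] by blast
qed

lemma finite_classes: "finite (Q.nz_ideals // Q.class_rel)"
proof (rule finite_subset)
  show "Q.nz_ideals // Q.class_rel \<subseteq> (\<lambda>(a, b). Q.class_rel `` {Q.qid 1 a b}) ` ({1..int p} \<times> {0..int p})"
  proof
    fix C assume "C \<in> Q.nz_ideals // Q.class_rel"
    then obtain I where I: "I \<in> Q.nz_ideals" "C = Q.class_rel `` {I}" by (rule quotientE)
    obtain a b where ab: "a \<in> {1..int p}" "b \<in> {0..int p}" "(I, Q.qid 1 a b) \<in> Q.class_rel"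
      using reduced_representative[OF I(1)] by blast
    have "C = Q.class_rel `` {Q.qid 1 a b}" unfolding I(2) by (rule equiv_class_eq[OF Q.equiv_class_rel ab(3)])
    thus "C \<in> (\<lambda>(a, b). Q.class_rel `` {Q.qid 1 a b}) ` ({1..int p} \<times> {0..int p})"
      using ab(1,2) by (intro image_eqI[of _ _ "(a, b)"]) auto
  qed
qed simp

lemma odd_class_number:
  assumes "\<exists>x y. Q.nrm x y = -1"
  shows "odd (class_number (int p))"
proof -
  obtain ux uy where unit: "Q.nrm ux uy = -1" using assms by blast
  let ?r = Q.class_rel
  \<comment> \<open>Conjugates all ideals of the class and collects everything equivalent to one of
    them, so that no representative has to be chosen.\<close>
  define f where "f = (\<lambda>C. ?r `` ((`) cj ` C))"
  have eq: "equiv Q.nz_ideals ?r" by (rule Q.equiv_class_rel)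
  have f: "f (?r `` {I}) = ?r `` {cj ` I}" if I: "I \<in> Q.nz_ideals" for I
  proof (intro equalityI subsetI)
    fix K assume "K \<in> f (?r `` {I})"
    then obtain J where J: "(I, J) \<in> ?r" "(cj ` J, K) \<in> ?r" by (auto simp: f_def)
    have "(cj ` I, K) \<in> ?r" using cj_rel[OF J(1)] J(2) eq by (meson equivE transD)
    thus "K \<in> ?r `` {cj ` I}" by blast
  next
    fix K assume "K \<in> ?r `` {cj ` I}"
    moreover have "(I, I) \<in> ?r" using eq I by (simp add: equiv_def refl_on_def)
    ultimately show "K \<in> f (?r `` {I})" unfolding f_def by blast
  qed
  have eqc: "?r `` {I} = ?r `` {J} \<longleftrightarrow> (I, J) \<in> ?r" if "I \<in> Q.nz_ideals" "J \<in> Q.nz_ideals" for I J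
    using eq_equiv_class_iff[OF eq that] .
  have cjO: "cj ` Q.ints = Q.ints"
  proof -
    have "cj ` Q.qid 1 1 0 = Q.qid 1 1 (- 0 - 1)" by (rule cj_qid)
    also have "Q.qid 1 1 (- 0 - 1) = Q.ints" by (auto simp: Q.ints_def Q.qid_def)
    finally show ?thesis by (simp add: Q.ints_eq_qid[symmetric])
  qed
  have "odd (card (Q.nz_ideals // ?r))"
  proof (rule odd_card_involution[where f = f and ?x0.0 = "?r `` {Q.ints}"])
    show "finite (Q.nz_ideals // ?r)" by (rule finite_classes)
    show "?r `` {Q.ints} \<in> Q.nz_ideals // ?r" by (rule quotientI[OF Q.ints_in_nz])
    fix C assume "C \<in> Q.nz_ideals // ?r"
    then obtain I where I: "I \<in> Q.nz_ideals" "C = ?r `` {I}" by (rule quotientE)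
    show "f C \<in> Q.nz_ideals // ?r" unfolding I(2) f[OF I(1)] by (rule quotientI[OF cj_nz[OF I(1)]])
    show "f (f C) = C"
      unfolding I(2) f[OF I(1)] f[OF cj_nz[OF I(1)]] cj_image_cj[OF nz_sub[OF I(1)]] ..
    show "f C = C \<longleftrightarrow> C = ?r `` {Q.ints}"
    proof
      assume "f C = C"
      hence "?r `` {I} = ?r `` {cj ` I}" unfolding I(2) f[OF I(1)] by simp
      hence "(I, cj ` I) \<in> ?r" using eqc[OF I(1) cj_nz[OF I(1)]] by simp
      from self_conjugate_principal[OF this unit] show "C = ?r `` {Q.ints}"
        unfolding I(2) by (simp only: eqc[OF I(1) Q.ints_in_nz])
    next
      assume "C = ?r `` {Q.ints}"
      thus "f C = C" using f[OF Q.ints_in_nz] cjO by simp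
    qed
  qed
  thus ?thesis using Q.class_number_eq[OF carrier_re] by simp
qed

end

subsection \<open>The number of ideals of given norm\<close>

lemma sum_divisors_coprime:
  fixes F :: "nat \<Rightarrow> int"
  assumes "coprime m n" "m > 0" "n > 0"
  shows "(\<Sum>d | d dvd m * n. F d) = (\<Sum>d1 | d1 dvd m. \<Sum>d2 | d2 dvd n. F (d1 * d2))"
proof -
  have inj: "inj_on (\<lambda>(x, y). x * y) ({d. d dvd m} \<times> {d. d dvd n})"
  proof (rule inj_onI)
    fix z w assume h: "z \<in> {d. d dvd m} \<times> {d. d dvd n}" "w \<in> {d. d dvd m} \<times> {d. d dvd n}"
      "(case z of (x, y) \<Rightarrow> x * y) = (case w of (x, y) \<Rightarrow> x * y)"
    obtain x y x' y' where e: "z = (x, y)" "w = (x', y')" by force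
    have d: "x dvd m" "y dvd n" "x' dvd m" "y' dvd n" "x * y = x' * y'" using h e by auto
    have g: "gcd (x * y) m = x" if "x dvd m" "y dvd n" for x y
    proof -
      have "coprime m y" using coprime_divisors[OF dvd_refl that(2) assms(1)] .
      hence "gcd (x * y) m = gcd x m" by (rule gcd_mult_left_right_cancel)
      thus ?thesis using that(1) by (simp add: gcd_nat.absorb1)
    qed
    have "x = x'" using g[OF d(1,2)] g[OF d(3,4)] d(5) by simp
    moreover have "x > 0" using d(1) assms(2) by (simp add: dvd_pos_nat)
    ultimately show "z = w" using d(5) e by simp
  qed
  have img: "(\<lambda>(x, y). x * y) ` ({d. d dvd m} \<times> {d. d dvd n}) = {d. d dvd m * n}"
  proof (intro equalityI subsetI)
    fix d assume "d \<in> {d. d dvd m * n}"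
    then obtain x y where "d = x * y" "x dvd m" "y dvd n" using division_decomp by blast
    thus "d \<in> (\<lambda>(x, y). x * y) ` ({d. d dvd m} \<times> {d. d dvd n})" by force
  qed (auto intro: mult_dvd_mono)
  have "(\<Sum>d | d dvd m * n. F d) = (\<Sum>z\<in>{d. d dvd m} \<times> {d. d dvd n}. F (case z of (x, y) \<Rightarrow> x * y))"
    unfolding img[symmetric] by (subst sum.reindex[OF inj]) (simp add: o_def)
  also have "\<dots> = (\<Sum>d1 | d1 dvd m. \<Sum>d2 | d2 dvd n. F (d1 * d2))"
    by (subst sum.cartesian_product) (simp add: case_prod_beta)
  finally show ?thesis .
qed

definition convol :: "(nat \<Rightarrow> int) \<Rightarrow> (nat \<Rightarrow> int) \<Rightarrow> nat \<Rightarrow> int" where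
  "convol f g n = (\<Sum>d | d dvd n. f d * g (n div d))"

definition multiplicative_fn :: "(nat \<Rightarrow> int) \<Rightarrow> bool" where
  "multiplicative_fn f \<longleftrightarrow> f 1 = 1 \<and> (\<forall>m n. m > 0 \<longrightarrow> n > 0 \<longrightarrow> coprime m n \<longrightarrow> f (m * n) = f m * f n)"

lemma multiplicative_fnD:
  "multiplicative_fn f \<Longrightarrow> m > 0 \<Longrightarrow> n > 0 \<Longrightarrow> coprime m n \<Longrightarrow> f (m * n) = f m * f n"
  by (simp add: multiplicative_fn_def)

lemma multiplicative_convol:
  assumes f: "multiplicative_fn f" and g: "multiplicative_fn g"
  shows "multiplicative_fn (convol f g)"
  unfolding multiplicative_fn_def
proof (intro conjI allI impI)
  show "convol f g 1 = 1" using f g by (simp add: convol_def multiplicative_fn_def)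
  fix m n :: nat assume mn: "m > 0" "n > 0" "coprime m n"
  have "convol f g (m * n) = (\<Sum>d1 | d1 dvd m. \<Sum>d2 | d2 dvd n. f (d1 * d2) * g (m * n div (d1 * d2)))"
    unfolding convol_def by (rule sum_divisors_coprime[OF mn(3,1,2)])
  also have "\<dots> = (\<Sum>d1 | d1 dvd m. \<Sum>d2 | d2 dvd n. (f d1 * g (m div d1)) * (f d2 * g (n div d2)))"
  proof (intro sum.cong refl)
    fix d1 d2 assume "d1 \<in> {d. d dvd m}" "d2 \<in> {d. d dvd n}"
    hence d: "d1 dvd m" "d2 dvd n" by auto
    then obtain e1 e2 where e: "m = d1 * e1" "n = d2 * e2" by (auto elim!: dvdE)
    have pos: "d1 > 0" "d2 > 0" "e1 > 0" "e2 > 0" using mn e by auto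
    have c: "coprime d1 d2" "coprime e1 e2" using mn(3) e by auto
    have "m * n div (d1 * d2) = e1 * e2" using pos by (simp add: e mult.assoc mult.left_commute[of e1])
    thus "f (d1 * d2) * g (m * n div (d1 * d2)) = f d1 * g (m div d1) * (f d2 * g (n div d2))"
      using multiplicative_fnD[OF f pos(1,2) c(1)] multiplicative_fnD[OF g pos(3,4) c(2)] pos by (simp add: e)
  qed
  also have "\<dots> = convol f g m * convol f g n"
    by (simp add: convol_def sum_product)
  finally show "convol f g (m * n) = convol f g m * convol f g n" .
qed

lemma multiplicative_eqI:
  assumes f: "multiplicative_fn f" and g: "multiplicative_fn g"
    and pp: "\<And>l e. prime l \<Longrightarrow> f (l ^ e) = g (l ^ e)" and "n > 0"
  shows "f n = g n"
  using \<open>n > 0\<close>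
proof (induction n rule: less_induct)
  case (less n)
  show ?case
  proof (cases "n = 1")
    case True thus ?thesis using f g by (simp add: multiplicative_fn_def)
  next
    case False
    then obtain l where l: "prime l" "l dvd n" using prime_factor_nat by blast
    have nz: "n \<noteq> 0" "\<not> is_unit l" using less.prems l(1) by auto
    obtain m where m: "n = l ^ multiplicity l n * m" "\<not> l dvd m"
      using multiplicity_decompose'[OF nz] by metis
    have e: "multiplicity l n > 0" using l nz by (simp add: prime_multiplicity_gt_zero_iff)
    have m0: "m > 0" using m less.prems by (cases m) auto
    have cop: "coprime (l ^ multiplicity l n) m" using prime_imp_coprime[OF l(1) m(2)] by simp
    have "l ^ multiplicity l n > 1" using e prime_gt_1_nat[OF l(1)] by (intro one_less_power)
    hence "m < n" using m0 by (subst m(1)) simp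
    hence IH: "f m = g m" using less.IH m0 by blast
    have lp: "l ^ multiplicity l n > 0" using l(1) by (simp add: prime_gt_0_nat)
    show ?thesis
      using multiplicative_fnD[OF f lp m0 cop] multiplicative_fnD[OF g lp m0 cop] pp[OF l(1)] IH
      by (subst (1 2) m(1)) simp
  qed
qed

lemma sum_divisors_prime_power:
  fixes F :: "nat \<Rightarrow> int"
  assumes "prime (l::nat)"
  shows "(\<Sum>d | d dvd l ^ e. F d) = (\<Sum>i\<le>e. F (l ^ i))"
proof -
  have "{d. d dvd l ^ e} = (\<lambda>i. l ^ i) ` {..e}"
    using divides_primepow_nat[OF assms] by (auto simp: image_iff)
  moreover have "inj_on (\<lambda>i. l ^ i) {..e}"
    using prime_gt_1_nat[OF assms] by (intro inj_onI) (simp add: power_inject_exp)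
  ultimately show ?thesis by (simp add: sum.reindex)
qed

definition sq_ind :: "nat \<Rightarrow> int" where "sq_ind n = (if \<exists>k. n = k\<^sup>2 then 1 else 0)"

lemma multiplicative_sq_ind: "multiplicative_fn sq_ind"
  unfolding multiplicative_fn_def
proof (intro conjI allI impI)
  have "(1::nat) = 1\<^sup>2" by simp
  thus "sq_ind 1 = 1" unfolding sq_ind_def by metis
  fix m n :: nat assume "m > 0" "n > 0" "coprime m n"
  have e: "(\<exists>k. x = k\<^sup>2) \<longleftrightarrow> is_nth_power 2 x" for x :: nat by (auto simp: is_nth_power_def)
  have "is_nth_power 2 (m * n) \<longleftrightarrow> is_nth_power 2 m \<and> is_nth_power 2 n"
    by (rule is_nth_power_mult_coprime_nat_iff) (fact \<open>coprime m n\<close>)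
  thus "sq_ind (m * n) = sq_ind m * sq_ind n" unfolding sq_ind_def e by simp
qed

lemma sq_ind_prime_power:
  assumes "prime (l::nat)"
  shows "sq_ind (l ^ i) = (if even i then 1 else 0)"
proof -
  have "(\<exists>k. l ^ i = k\<^sup>2) \<longleftrightarrow> is_nth_power 2 (l ^ i)" by (auto simp: is_nth_power_def)
  also have "\<dots> \<longleftrightarrow> even i" by (rule is_nth_power_prime_power_nat_iff[OF assms])
  finally show ?thesis by (simp add: sq_ind_def)
qed

section \<open>Square roots of \<open>-p\<close> modulo \<open>n\<close>\<close>

context prime_1_mod_4
begin

text \<open>Indexes the ideals of norm \<open>n\<close> with \<open>k = 1\<close>, through the
  parameter \<open>b\<close> of their normal form with \<open>a = n\<close>.\<close>

definition rho_set :: "nat \<Rightarrow> nat set" where "rho_set n = {b. b < n \<and> n dvd b\<^sup>2 + p}"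
definition rho :: "nat \<Rightarrow> int" where "rho n = int (card (rho_set n))"

lemma finite_rho_set: "finite (rho_set n)"
  by (rule finite_subset[of _ "{..<n}"]) (auto simp: rho_set_def)

lemma rho_1: "rho 1 = 1"
proof -
  have "rho_set 1 = {0}" by (auto simp: rho_set_def)
  thus ?thesis by (simp add: rho_def)
qed

lemma multiplicative_rho: "multiplicative_fn rho"
  unfolding multiplicative_fn_def
proof (intro conjI allI impI)
  show "rho 1 = 1" by (rule rho_1)
  fix m n :: nat assume mn: "m > 0" "n > 0" "coprime m n"
  have cg: "k dvd b\<^sup>2 + p \<longleftrightarrow> k dvd b'\<^sup>2 + p" if "[b = b'] (mod k)" for k b b' :: nat
  proof -
    have "[b\<^sup>2 + p = b'\<^sup>2 + p] (mod k)" by (intro cong_add cong_pow cong_refl that)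
    thus ?thesis by (rule cong_dvd_iff)
  qed
  have "bij_betw (\<lambda>b. (b mod m, b mod n)) (rho_set (m * n)) (rho_set m \<times> rho_set n)"
  proof (rule bij_betwI')
    fix x y assume h: "x \<in> rho_set (m * n)" "y \<in> rho_set (m * n)"
    have "x = y" if "x mod m = y mod m" "x mod n = y mod n"
    proof -
      have "[x = y] (mod m)" "[x = y] (mod n)" using that by (simp_all add: cong_mod)
      hence "[x = y] (mod m * n)" using mn(3) by (rule coprime_cong_mult_nat)
      thus ?thesis using h by (simp add: rho_set_def cong_mod)
    qed
    thus "((x mod m, x mod n) = (y mod m, y mod n)) = (x = y)" by auto
  next
    fix x assume "x \<in> rho_set (m * n)"
    hence "m dvd x\<^sup>2 + p" "n dvd x\<^sup>2 + p" by (auto simp: rho_set_def intro: dvd_mult_left dvd_mult_right)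
    moreover have "[x mod m = x] (mod m)" "[x mod n = x] (mod n)" by simp_all
    ultimately have "m dvd (x mod m)\<^sup>2 + p" "n dvd (x mod n)\<^sup>2 + p" using cg by blast+
    thus "(x mod m, x mod n) \<in> rho_set m \<times> rho_set n" using mn by (simp add: rho_set_def)
  next
    fix z assume "z \<in> rho_set m \<times> rho_set n"
    then obtain u v where z: "z = (u, v)" "u < m" "v < n" "m dvd u\<^sup>2 + p" "n dvd v\<^sup>2 + p"
      by (auto simp: rho_set_def)
    obtain x where x: "x < m * n" "[x = u] (mod m)" "[x = v] (mod n)"
      using binary_chinese_remainder_unique_nat[OF mn(3), of u v] mn by auto
    have "m dvd x\<^sup>2 + p" "n dvd x\<^sup>2 + p" using cg[OF x(2)] cg[OF x(3)] z by simp_all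
    hence "m * n dvd x\<^sup>2 + p" using mn(3) by (simp add: divides_mult)
    moreover have "z = (x mod m, x mod n)" using x z by (simp add: cong_mod)
    ultimately show "\<exists>x\<in>rho_set (m * n). z = (x mod m, x mod n)" using x(1) by (auto simp: rho_set_def)
  qed
  from bij_betw_same_card[OF this] show "rho (m * n) = rho m * rho n"
    by (simp add: rho_def card_cartesian_product)
qed

lemma chi_mult: "chi (m * n) = chi m * chi n"
proof (cases "even m \<or> even n")
  case False
  then obtain i j where ij: "m = 2 * i + 1" "n = 2 * j + 1" by (auto elim!: oddE)
  have "m * n = 2 * (2 * i * j + i + j) + 1" unfolding ij by (simp add: algebra_simps)
  hence "odd (m * n)" "m * n div 2 = 2 * i * j + i + j" by simp_all
  moreover have "m div 2 = i" "n div 2 = j" using ij by simp_all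
  ultimately have "chi (m * n) = (-1) ^ (2 * i * j + i + j) * L (int (m * n))"
    "chi m = (-1) ^ i * L (int m)" "chi n = (-1) ^ j * L (int n)"
    using False by (simp_all only: chi_def if_False) auto
  thus ?thesis by (simp add: L_mult power_add power_mult)
qed (auto simp: chi_def)

lemma chi_1: "chi 1 = 1"
proof -
  have "L 1 = 1" using L_mult[of "-1" "-1"] L_minus_one by simp
  thus ?thesis by (simp add: chi_def)
qed

lemma chi_power: "chi (n ^ i) = chi n ^ i"
  by (induction i) (simp_all add: chi_1[simplified] chi_mult)

lemma multiplicative_chi: "multiplicative_fn chi"
  by (simp add: multiplicative_fn_def chi_mult chi_1[simplified])

text \<open>Squares are 0 or 1 modulo 4 and \<open>p\<close> is 1, so \<open>b\<^sup>2 + p\<close>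
  is never divisible by 4.\<close>

lemma rho_two_power: "rho (2 ^ Suc (Suc j)) = 0" "rho 2 = 1" "chi 2 = 0"
proof -
  have "\<not> 4 dvd b\<^sup>2 + p" for b
  proof
    assume "4 dvd b\<^sup>2 + p"
    hence "(b\<^sup>2 + 1) mod 4 = 0" unfolding p_eq by (metis add.assoc add.commute dvd_add_left_iff dvd_eq_mod_eq_0 dvd_triv_left)
    moreover have "b\<^sup>2 mod 4 = (if even b then 0 else 1)"
    proof (cases "even b")
      case True
      then obtain k where "b = 2 * k" by (auto elim: evenE)
      thus ?thesis by (simp add: power2_eq_square)
    next
      case False
      then obtain k where "b = 2 * k + 1" by (auto elim: oddE)
      hence "b\<^sup>2 = 1 + 4 * (k\<^sup>2 + k)" by (simp add: power2_eq_square algebra_simps)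
      moreover have "(1 + 4 * (k\<^sup>2 + k)) mod 4 = 1 mod 4" by (rule mod_mult_self2)
      ultimately show ?thesis using False by simp
    qed
    ultimately show False by (auto simp: mod_Suc split: if_splits)
  qed
  moreover have "4 dvd (2::nat) ^ Suc (Suc j)" by simp
  ultimately have "\<not> 2 ^ Suc (Suc j) dvd b\<^sup>2 + p" for b by (meson dvd_trans)
  hence "rho_set (2 ^ Suc (Suc j)) = {}" unfolding rho_set_def by blast
  thus "rho (2 ^ Suc (Suc j)) = 0" by (simp add: rho_def)
  have op: "odd p" using p_eq by simp
  have "b < 2 \<and> 2 dvd b\<^sup>2 + p \<longleftrightarrow> b = 1" for b
  proof -
    have "b < 2 \<longleftrightarrow> b = 0 \<or> b = 1" by auto
    thus ?thesis using op by auto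
  qed
  hence "rho_set 2 = {1}" by (simp add: rho_set_def)
  thus "rho 2 = 1" by (simp add: rho_def)
  show "chi 2 = 0" by (simp add: chi_def)
qed

text \<open>A root modulo \<open>p\<close> is divisible by \<open>p\<close>, and then
  \<open>b\<^sup>2 + p\<close> contains the factor \<open>p\<close> exactly once.\<close>

lemma rho_p_power: "rho (p ^ Suc (Suc j)) = 0" "rho p = 1" "chi p = 0"
proof -
  have "\<not> p * p dvd b\<^sup>2 + p" for b
  proof
    assume h: "p * p dvd b\<^sup>2 + p"
    hence "p dvd b\<^sup>2 + p" by (rule dvd_mult_left)
    hence "p dvd b\<^sup>2" by (simp add: dvd_add_left_iff)
    hence pb: "p dvd b" using prime_p prime_dvd_power by blast
    hence "p * p dvd b\<^sup>2" by (simp add: power2_eq_square mult_dvd_mono)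
    hence "p * p dvd p" using h by (simp add: dvd_add_right_iff)
    hence "p * p \<le> p * 1" using p_gt2 by (intro dvd_imp_le) auto
    thus False using p_gt2 by simp
  qed
  moreover have "p * p dvd p ^ Suc (Suc j)" by (simp add: mult.assoc[symmetric])
  ultimately have "\<not> p ^ Suc (Suc j) dvd b\<^sup>2 + p" for b by (meson dvd_trans)
  hence "rho_set (p ^ Suc (Suc j)) = {}" unfolding rho_set_def by blast
  thus "rho (p ^ Suc (Suc j)) = 0" by (simp add: rho_def)
  have "rho_set p = {0}"
  proof (intro equalityI subsetI)
    fix b assume "b \<in> rho_set p"
    hence b: "b < p" "p dvd b\<^sup>2" by (simp_all add: rho_set_def dvd_add_left_iff)
    have "p dvd b" using b(2) prime_p prime_dvd_power by blast
    thus "b \<in> {0}" using b(1) by (auto dest: dvd_imp_le)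
  qed (use p_gt2 in \<open>auto simp: rho_set_def\<close>)
  thus "rho p = 1" by (simp add: rho_def)
  have "L (int p) = 0" by (simp add: L_0_iff)
  thus "chi p = 0" by (simp add: chi_def)
qed

text \<open>Quadratic reciprocity carries no sign because \<open>p = 1\<close> modulo 4; the factor
  \<open>(-1) ^ (l div 2)\<close> of \<open>chi\<close> is the symbol of \<open>-1\<close> modulo
  \<open>l\<close>.\<close>

lemma chi_prime:
  assumes l: "prime l" "l \<noteq> 2" "l \<noteq> p"
  shows "chi l = Legendre (- int p) (int l)"
proof -
  have l2: "l > 2" using prime_ge_2_nat[OF l(1)] l(2) by simp
  have odd: "odd l" using l l2 by (simp add: prime_odd_nat)
  have ld: "(l - 1) div 2 = l div 2" using odd by (auto elim: oddE)
  have "[Legendre (-1) (int l) = (-1) ^ ((l - 1) div 2)] (mod int l)" by (rule euler_criterion[OF l(1) l2])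
  hence m1: "Legendre (-1) (int l) = (-1) ^ (l div 2)" unfolding ld
    by (rule cong_small_imp_eq) (use l2 Legendre_values[of "-1" "int l"] in \<open>cases "even (l div 2)"; auto\<close>)
  have "Legendre (int p) (int l) * Legendre (int l) (int p) = (-1) ^ ((p - 1) div 2 * ((l - 1) div 2))"
    by (rule Quadratic_Reciprocity[OF prime_p p_gt2 l(1) l2]) (use l in auto)
  also have "\<dots> = 1" unfolding half(1) by (simp add: power_mult)
  finally have "Legendre (int p) (int l) * L (int l) = 1" .
  hence rc: "Legendre (int p) (int l) = L (int l)"
    using Legendre_values[of "int p" "int l"] Legendre_values[of "int l" "int p"] by auto
  have "Legendre (- int p) (int l) = Legendre (-1) (int l) * Legendre (int p) (int l)"
    using Legendre_mult[OF l(1) l2, of "-1" "int p"] by simp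
  thus ?thesis unfolding m1 rc using odd by (simp add: chi_def)
qed

text \<open>Hensel lifting: \<open>2 * b\<close> is invertible modulo \<open>l\<close>, since
  \<open>l\<close> is odd and would divide \<open>p\<close> if it divided \<open>b\<close>.\<close>

lemma root_lift:
  assumes l: "prime l" "l \<noteq> 2" "l \<noteq> p" and "Legendre (- int p) (int l) = 1"
  shows "\<exists>b::int. int l ^ Suc j dvd b\<^sup>2 + int p"
proof (induction j)
  case 0
  have "QuadRes (int l) (- int p)" using assms(4) by (auto simp: Legendre_def split: if_splits)
  then obtain y where "[y\<^sup>2 = - int p] (mod int l)" by (auto simp: QuadRes_def)
  thus ?case by (intro exI[of _ y]) (simp add: cong_iff_dvd_diff)
next
  case (Suc j)
  then obtain b where b: "int l ^ Suc j dvd b\<^sup>2 + int p" by blast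
  then obtain c where c: "b\<^sup>2 + int p = int l ^ Suc j * c" by (auto simp: dvd_def)
  have pl: "prime (int l)" using l(1) by simp
  have "\<not> int l dvd 2 * b"
  proof
    assume "int l dvd 2 * b"
    hence "int l dvd 2 \<or> int l dvd b" using pl prime_dvd_mult_iff by blast
    moreover have "\<not> int l dvd 2"
      using l by (metis int_dvd_int_iff of_nat_numeral primes_dvd_imp_eq two_is_prime_nat)
    ultimately have "int l dvd b" by blast
    hence "int l dvd b\<^sup>2" by (simp add: power2_eq_square)
    moreover have "int l dvd b\<^sup>2 + int p" using b by (simp add: dvd_mult_left)
    ultimately have "int l dvd int p" by (simp add: dvd_add_right_iff)
    thus False using l prime_p by (simp add: primes_dvd_imp_eq)
  qed
  hence "coprime (int l) (2 * b)" by (rule prime_imp_coprime[OF pl])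
  hence "coprime (2 * b) (int l)" by (simp only: coprime_commute)
  \<comment> \<open>The correction \<open>t1 = - c t0\<close> makes \<open>c + 2 b t1\<close>
    divisible by \<open>l\<close>; the quadratic term is a multiple of \<open>l ^ (j + 2)\<close>
    for every choice.\<close>
  then obtain t0 where "[2 * b * t0 = 1] (mod int l)" using cong_solve_coprime_int by blast
  hence "[(2 * b * t0) * - c = 1 * - c] (mod int l)" by (rule cong_mult[OF _ cong_refl])
  hence t: "int l dvd c + 2 * b * (t0 * - c)" by (simp add: cong_iff_dvd_diff algebra_simps)
  define t1 where "t1 = t0 * - c"
  have "(b + t1 * int l ^ Suc j)\<^sup>2 + int p = int l ^ Suc j * (c + 2 * b * t1) + t1\<^sup>2 * (int l ^ Suc j * int l ^ Suc j)"
    using c by (simp add: power2_eq_square algebra_simps)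
  moreover have "int l ^ Suc (Suc j) dvd int l ^ Suc j * (c + 2 * b * t1)"
    using t unfolding t1_def[symmetric] by (simp only: power_Suc2) (rule mult_dvd_mono, simp_all)
  moreover have "int l ^ Suc (Suc j) dvd t1\<^sup>2 * (int l ^ Suc j * int l ^ Suc j)"
  proof -
    have "int l ^ Suc j * int l ^ Suc j = int l ^ Suc (Suc j) * int l ^ j" by simp
    thus ?thesis by simp
  qed
  ultimately have "int l ^ Suc (Suc j) dvd (b + t1 * int l ^ Suc j)\<^sup>2 + int p" by (simp only: dvd_add)
  thus ?case by blast
qed

text \<open>Modulo \<open>N = l ^ Suc j\<close> a lifted root \<open>b\<close> and its negative
  \<open>N - b\<close> are the only roots: for a root \<open>x\<close> the prime cannot divide both
  \<open>x - b\<close> and \<open>x + b\<close>, so all of \<open>N\<close> divides one of them. The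
  two are distinct because \<open>N\<close> is odd.\<close>

lemma rho_prime_power:
  assumes l: "prime l" "l \<noteq> 2" "l \<noteq> p"
  shows "rho (l ^ Suc j) = 1 + chi l"
proof -
  have pl: "prime (int l)" using l(1) by simp
  have nlp: "\<not> int l dvd int p" using l prime_p by (auto dest: primes_dvd_imp_eq)
  have L01: "Legendre (- int p) (int l) = 1 \<or> Legendre (- int p) (int l) = -1"
    using nlp by (auto simp: Legendre_def cong_0_iff)
  have l2: "l > 2" using prime_ge_2_nat[OF l(1)] l(2) by simp
  have oddN: "odd (l ^ Suc j)" using l l2 by (simp add: prime_odd_nat)
  let ?N = "l ^ Suc j"
  show ?thesis
  proof (cases "Legendre (- int p) (int l) = 1")
    case False
    hence m: "Legendre (- int p) (int l) = -1" using L01 by blast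
    have "rho_set ?N = {}"
    proof (rule ccontr)
      assume "rho_set ?N \<noteq> {}"
      then obtain b where "?N dvd b\<^sup>2 + p" by (auto simp: rho_set_def)
      hence "l dvd b\<^sup>2 + p" by (simp add: dvd_mult_left)
      hence "int l dvd (int b)\<^sup>2 + int p" by (metis int_dvd_int_iff of_nat_add of_nat_power)
      hence "[(int b)\<^sup>2 = - int p] (mod int l)" by (simp add: cong_iff_dvd_diff)
      hence "QuadRes (int l) (- int p)" unfolding QuadRes_def by blast
      thus False using m by (auto simp: Legendre_def split: if_splits)
    qed
    thus ?thesis using chi_prime[OF l] m by (simp add: rho_def)
  next
    case True
    obtain b0 where b0: "int l ^ Suc j dvd b0\<^sup>2 + int p" using root_lift[OF l True] by blast
    define b where "b = nat (b0 mod int ?N)"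
    have N0: "?N > 0" using l2 by simp
    have bi: "int b = b0 mod int ?N" unfolding b_def using N0 by (simp del: power_Suc of_nat_power)
    have bN: "b < ?N"
    proof -
      have "int b < int ?N" unfolding bi using N0 by (intro pos_mod_bound) (simp only: of_nat_0_less_iff)
      thus ?thesis by (simp only: of_nat_less_iff)
    qed
    have "[int b = b0] (mod int ?N)" unfolding bi by simp
    hence "[(int b)\<^sup>2 + int p = b0\<^sup>2 + int p] (mod int ?N)" by (intro cong_add cong_pow cong_refl)
    hence "int ?N dvd (int b)\<^sup>2 + int p" using b0 cong_dvd_iff by (metis of_nat_power)
    hence "int ?N dvd int (b\<^sup>2 + p)" by simp
    hence bd: "?N dvd b\<^sup>2 + p" by (simp only: int_dvd_int_iff)
    have nlb: "\<not> int l dvd int x" if "?N dvd x\<^sup>2 + p" for x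
    proof
      assume "int l dvd int x"
      hence lx: "l dvd x" by (simp only: int_dvd_int_iff)
      have "l dvd x\<^sup>2 + p" using that by (simp add: dvd_mult_left)
      moreover have "l dvd x\<^sup>2" using lx by (simp add: power2_eq_square)
      ultimately have "l dvd p" by (simp add: dvd_add_right_iff)
      thus False using nlp by (simp add: int_dvd_int_iff)
    qed
    have b1: "b > 0" using nlb[OF bd] by (cases b) auto
    have "rho_set ?N = {b, ?N - b}"
    proof (intro equalityI subsetI)
      fix x assume "x \<in> rho_set ?N"
      hence x: "x < ?N" "?N dvd x\<^sup>2 + p" by (simp_all add: rho_set_def)
      have "int ?N dvd int (x\<^sup>2 + p) - int (b\<^sup>2 + p)" using x(2) bd by (intro dvd_diff) (simp_all only: int_dvd_int_iff)
      moreover have "int (x\<^sup>2 + p) - int (b\<^sup>2 + p) = (int x - int b) * (int x + int b)"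
        by (simp add: power2_eq_square algebra_simps)
      ultimately have D: "int ?N dvd (int x - int b) * (int x + int b)" by simp
      have "\<not> (int l dvd int x - int b \<and> int l dvd int x + int b)"
      proof
        assume h: "int l dvd int x - int b \<and> int l dvd int x + int b"
        have "2 * int x = (int x - int b) + (int x + int b)" by simp
        hence "int l dvd 2 * int x" using h by (simp only: dvd_add)
        hence "int l dvd 2 \<or> int l dvd int x" using pl prime_dvd_mult_iff by blast
        moreover have "\<not> int l dvd 2" using l2 zdvd_not_zless[of 2 "int l"] by simp
        ultimately show False using nlb[OF x(2)] by blast
      qed
      hence "coprime (int l) (int x - int b) \<or> coprime (int l) (int x + int b)"
        using prime_imp_coprime[OF pl] by blast
      hence "coprime (int ?N) (int x - int b) \<or> coprime (int ?N) (int x + int b)" by auto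
      hence "int ?N dvd int x + int b \<or> int ?N dvd int x - int b"
        using D coprime_dvd_mult_right_iff coprime_dvd_mult_left_iff by blast
      thus "x \<in> {b, ?N - b}"
      proof
        assume "int ?N dvd int x - int b"
        moreover have "\<bar>int x - int b\<bar> < int ?N" using x(1) bN by linarith
        ultimately have "int x = int b" by (intro cong_small_imp_eq) (simp_all only: cong_iff_dvd_diff)
        thus ?thesis by simp
      next
        assume "int ?N dvd int x + int b"
        hence "?N dvd x + b" by (simp only: of_nat_add[symmetric] int_dvd_int_iff)
        then obtain c where c: "x + b = ?N * c" by (auto simp: dvd_def)
        have "0 < ?N * c" "?N * c < ?N * 2" using x(1) bN b1 unfolding c[symmetric] by linarith+
        hence "c = 1" by (simp only: mult_less_cancel1 nat_0_less_mult_iff) linarith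
        hence "x + b = ?N" using c by simp
        hence "x = ?N - b" by (rule add_implies_diff)
        thus ?thesis by blast
      qed
    next
      fix x assume "x \<in> {b, ?N - b}"
      moreover have "?N - b \<in> rho_set ?N"
      proof -
        have "int ((?N - b)\<^sup>2 + p) = int ?N * (int ?N - 2 * int b) + int (b\<^sup>2 + p)"
        proof -
          have d: "int (?N - b) = int ?N - int b" using bN by (intro of_nat_diff) simp
          have "int ((?N - b)\<^sup>2 + p) = (int (?N - b))\<^sup>2 + int p" by (simp only: of_nat_add of_nat_power)
          also have "\<dots> = int ?N * (int ?N - 2 * int b) + ((int b)\<^sup>2 + int p)"
            unfolding d by (simp only: power2_eq_square) (simp only: algebra_simps)
          also have "(int b)\<^sup>2 + int p = int (b\<^sup>2 + p)" by (simp only: of_nat_add of_nat_power)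
          finally show ?thesis .
        qed
        also have "int ?N dvd \<dots>" using bd by (intro dvd_add dvd_triv_left) (simp only: int_dvd_int_iff)
        finally have "?N dvd (?N - b)\<^sup>2 + p" by (simp only: int_dvd_int_iff)
        thus ?thesis using b1 N0 by (simp add: rho_set_def del: power_Suc)
      qed
      ultimately show "x \<in> rho_set ?N" using bd bN by (auto simp: rho_set_def simp del: power_Suc)
    qed
    moreover have "b \<noteq> ?N - b" using oddN bN by presburger
    ultimately show ?thesis using chi_prime[OF l] True by (simp add: rho_def del: power_Suc)
  qed
qed

text \<open>Both sides are multiplicative, and at prime powers both satisfy
  \<open>F (e + 2) = F e + chi l ^ (e + 1) + chi l ^ (e + 2)\<close>. The primes 2 and
  \<open>p\<close>, where \<open>chi\<close> vanishes and \<open>rho l = 1\<close>, fit the same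
  recursion.\<close>

lemma convol_sq_rho: "n > 0 \<Longrightarrow> convol sq_ind rho n = (\<Sum>d | d dvd n. chi d)"
proof -
  assume n: "n > 0"
  have "multiplicative_fn (\<lambda>n. if n > 0 then 1 else 0)" by (auto simp: multiplicative_fn_def)
  hence M: "multiplicative_fn (convol chi (\<lambda>n. if n > 0 then 1 else 0))"
    by (rule multiplicative_convol[OF multiplicative_chi])
  have pp: "convol sq_ind rho (l ^ e) = convol chi (\<lambda>n. if n > 0 then 1 else 0) (l ^ e)" if l: "prime l" for l e
  proof -
    have l0: "l > 0" using l by (simp add: prime_gt_0_nat)
    have div: "l ^ e div l ^ i = l ^ (e - i)" if "i \<le> e" for e i using that l0 by (simp add: power_diff)
    define A where "A = (\<lambda>e. \<Sum>i\<le>e. (if even i then 1 else 0) * rho (l ^ (e - i)))"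
    define B where "B = (\<lambda>e. \<Sum>i\<le>e. chi l ^ i)"
    have A: "convol sq_ind rho (l ^ e) = A e" for e
      unfolding convol_def sum_divisors_prime_power[OF l] A_def
      by (rule sum.cong) (simp_all add: sq_ind_prime_power[OF l] div)
    have B: "convol chi (\<lambda>n. if n > 0 then 1 else 0) (l ^ e) = B e" for e
      unfolding convol_def sum_divisors_prime_power[OF l] B_def
      by (rule sum.cong) (simp_all add: chi_power div l0)
    have r1: "rho l = 1 + chi l" and r2: "rho (l ^ Suc (Suc e)) = chi l ^ Suc e + chi l ^ Suc (Suc e)" for e
    proof -
      consider "l = 2" | "l = p" | "l \<noteq> 2" "l \<noteq> p" by blast
      hence "rho l = 1 + chi l \<and> rho (l ^ Suc (Suc e)) = chi l ^ Suc e + chi l ^ Suc (Suc e)"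
      proof cases
        case 1 thus ?thesis using rho_two_power by simp
      next
        case 2 thus ?thesis using rho_p_power by simp
      next
        case 3
        have "chi l = 1 \<or> chi l = -1"
          unfolding chi_prime[OF l 3] using l 3 prime_p
          by (auto simp: Legendre_def cong_0_iff dest: primes_dvd_imp_eq)
        hence "1 + chi l = chi l ^ Suc e + chi l ^ Suc (Suc e)" by auto
        thus ?thesis using rho_prime_power[OF l 3, of 0] rho_prime_power[OF l 3, of "Suc e"] by simp
      qed
      thus "rho l = 1 + chi l" "rho (l ^ Suc (Suc e)) = chi l ^ Suc e + chi l ^ Suc (Suc e)" by blast+
    qed
    have "A e = B e"
    proof (induction e rule: induct_nat_012)
      case 0 show ?case using rho_1 by (simp add: A_def B_def)
    next
      case 1 show ?case using r1 by (simp add: A_def B_def)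
    next
      case (ge2 e)
      have "A (Suc (Suc e)) = rho (l ^ Suc (Suc e)) + A e"
        unfolding A_def by (simp add: sum.atMost_Suc_shift del: sum.atMost_Suc power_Suc)
      moreover have "B (Suc (Suc e)) = B e + (chi l ^ Suc e + chi l ^ Suc (Suc e))" by (simp add: B_def)
      ultimately show ?case using ge2 r2[of e] by simp
    qed
    thus ?thesis unfolding A B .
  qed
  have "convol sq_ind rho n = convol chi (\<lambda>n. if n > 0 then 1 else 0) n"
    by (rule multiplicative_eqI[OF multiplicative_convol[OF multiplicative_sq_ind multiplicative_rho] M pp n])
  also have "\<dots> = (\<Sum>d | d dvd n. chi d)"
    unfolding convol_def by (rule sum.cong) (use n in \<open>auto simp: div_greater_zero_iff dvd_imp_le\<close>)
  finally show ?thesis .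
qed

end

subsection \<open>The class number of the imaginary field\<close>

context prime_1_mod_4
begin

interpretation Q: quad_order 0 "int p" w_im by (rule quad_order_im)

lemma im_poly_at: "Q.poly_at b = b\<^sup>2 + int p"
  by (simp add: Q.poly_at_def)

lemma im_nrm: "Q.nrm u v = u\<^sup>2 + int p * v\<^sup>2"
  by (simp add: Q.nrm_def)

text \<open>One triple for each ideal of norm \<open>n\<close>: the norm is
  \<open>k\<^sup>2 a\<close>, and reducing \<open>b\<close> modulo \<open>a\<close> makes the normal
  form unique.\<close>

definition norm_triples :: "nat \<Rightarrow> (nat \<times> nat \<times> nat) set" where
  "norm_triples n = {(k, a, b). k > 0 \<and> a > 0 \<and> b < a \<and> a dvd b\<^sup>2 + p \<and> k\<^sup>2 * a = n}"

text \<open>A square divisor \<open>d = k\<^sup>2\<close> leaves \<open>rho (n div d)\<close>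
  choices of \<open>b\<close>, so the count is the convolution of the square indicator with
  \<open>rho\<close>.\<close>

lemma norm_triples_card:
  assumes "n > 0"
  shows "finite (norm_triples n)" "int (card (norm_triples n)) = (\<Sum>d | d dvd n. chi d)"
proof -
  have fin: "finite {d. d dvd n}" using assms by simp
  let ?S = "{d. d dvd n \<and> (\<exists>k. d = k\<^sup>2)}"
  define sr where "sr = (\<lambda>d. SOME k::nat. d = k\<^sup>2)"
  have sr: "sr (k\<^sup>2) = k" for k
  proof -
    have "k\<^sup>2 = (sr (k\<^sup>2))\<^sup>2" unfolding sr_def by (rule someI[of _ k]) simp
    thus ?thesis by (simp add: power2_eq_iff_nonneg)
  qed
  have e: "norm_triples n = (\<lambda>(d, b). (sr d, n div d, b)) ` (SIGMA d:?S. rho_set (n div d))"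
  proof (intro equalityI subsetI)
    fix t assume "t \<in> norm_triples n"
    then obtain k a b where t: "t = (k, a, b)" "k > 0" "a > 0" "b < a" "a dvd b\<^sup>2 + p" "k\<^sup>2 * a = n"
      by (auto simp: norm_triples_def)
    have "n div k\<^sup>2 = a" using t by auto
    moreover have "k\<^sup>2 dvd n" using t(6) by auto
    ultimately have "(k\<^sup>2, b) \<in> (SIGMA d:?S. rho_set (n div d))" "t = (\<lambda>(d, b). (sr d, n div d, b)) (k\<^sup>2, b)"
      using t by (auto simp: rho_set_def sr)
    thus "t \<in> (\<lambda>(d, b). (sr d, n div d, b)) ` (SIGMA d:?S. rho_set (n div d))" by (rule rev_image_eqI)
  next
    fix t assume "t \<in> (\<lambda>(d, b). (sr d, n div d, b)) ` (SIGMA d:?S. rho_set (n div d))"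
    then obtain k b where h: "k\<^sup>2 dvd n" "b \<in> rho_set (n div k\<^sup>2)" "t = (k, n div k\<^sup>2, b)"
      by (auto simp: sr)
    have "k > 0" using h(1) assms by (cases k) auto
    moreover have "k\<^sup>2 * (n div k\<^sup>2) = n" using h(1) by simp
    moreover have "n div k\<^sup>2 > 0" using h(1) assms by (simp add: div_greater_zero_iff dvd_imp_le \<open>k > 0\<close>)
    ultimately show "t \<in> norm_triples n" using h(2,3) by (simp add: norm_triples_def rho_set_def)
  qed
  have finS: "finite ?S" by (rule finite_subset[OF _ fin]) auto
  show "finite (norm_triples n)" unfolding e using finS finite_rho_set by (intro finite_imageI finite_SigmaI)
  have inj: "inj_on (\<lambda>(d, b). (sr d, n div d, b)) (SIGMA d:?S. rho_set (n div d))"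
    by (rule inj_onI) (auto simp: sr)
  have "int (card (norm_triples n)) = (\<Sum>d\<in>?S. rho (n div d))"
    unfolding e card_image[OF inj] using finS finite_rho_set by (subst card_SigmaI) (auto simp: rho_def)
  also have "\<dots> = (\<Sum>d | d dvd n. sq_ind d * rho (n div d))"
  proof -
    have "?S \<subseteq> {d. d dvd n}" by auto
    have "(\<Sum>d | d dvd n. sq_ind d * rho (n div d)) = (\<Sum>d\<in>?S. sq_ind d * rho (n div d))"
      by (rule sum.mono_neutral_right[OF fin]) (auto simp: sq_ind_def)
    also have "\<dots> = (\<Sum>d\<in>?S. rho (n div d))" by (rule sum.cong) (auto simp: sq_ind_def)
    finally show ?thesis by simp
  qed
  also have "\<dots> = (\<Sum>d | d dvd n. chi d)" using convol_sq_rho[OF assms] by (simp add: convol_def)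
  finally show "int (card (norm_triples n)) = (\<Sum>d | d dvd n. chi d)" .
qed

definition bounded_ideals :: "nat \<Rightarrow> complex set set" where
  "bounded_ideals X = (\<lambda>(k, a, b). Q.qid (int k) (int a) (int b)) ` (\<Union>n\<in>{1..X}. norm_triples n)"

lemma dvd_poly_at_nat: "int a dvd Q.poly_at (int b) \<longleftrightarrow> a dvd b\<^sup>2 + p"
proof -
  have "Q.poly_at (int b) = int (b\<^sup>2 + p)" by (simp add: im_poly_at)
  thus ?thesis by (simp only: int_dvd_int_iff)
qed

text \<open>Summing the divisor sums over all norms up to \<open>X\<close> and exchanging the order,
  each \<open>d\<close> occurs once for every multiple of it up to \<open>X\<close>.\<close>

lemma bounded_ideals_card:
  "finite (bounded_ideals X)" "int (card (bounded_ideals X)) = (\<Sum>d\<in>{1..X}. chi d * int (X div d))"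
proof -
  have fin: "finite (\<Union>n\<in>{1..X}. norm_triples n)" using norm_triples_card(1) by auto
  thus "finite (bounded_ideals X)" unfolding bounded_ideals_def by (rule finite_imageI)
  have inj: "inj_on (\<lambda>(k, a, b). Q.qid (int k) (int a) (int b)) (\<Union>n\<in>{1..X}. norm_triples n)"
  proof (rule inj_onI)
    fix s t assume "s \<in> (\<Union>n\<in>{1..X}. norm_triples n)" "t \<in> (\<Union>n\<in>{1..X}. norm_triples n)"
      and eq: "(case s of (k, a, b) \<Rightarrow> Q.qid (int k) (int a) (int b)) = (case t of (k, a, b) \<Rightarrow> Q.qid (int k) (int a) (int b))"
    then obtain k a b k' a' b' where st: "s = (k, a, b)" "t = (k', a', b')" "k > 0" "a > 0" "b < a" "k' > 0" "a' > 0" "b' < a'"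
      by (auto simp: norm_triples_def)
    have "Q.qid (int k) (int a) (int b) = Q.qid (int k') (int a') (int b')" using eq st by simp
    hence h: "int k = int k'" "int a = int a'" "[int b = int b'] (mod int a)"
      using Q.qid_eq_iff[of "int k" "int a" "int k'" "int a'" "int b" "int b'"] st by auto
    have "int b = int b'" by (rule cong_small_imp_eq[OF h(3)]) (use st h in auto)
    thus "s = t" using st h by simp
  qed
  have disj: "norm_triples m \<inter> norm_triples n = {}" if "m \<noteq> n" for m n
    using that by (auto simp: norm_triples_def)
  have "card (bounded_ideals X) = card (\<Union>n\<in>{1..X}. norm_triples n)"
    unfolding bounded_ideals_def by (rule card_image[OF inj])
  also have "\<dots> = (\<Sum>n\<in>{1..X}. card (norm_triples n))"
    by (rule card_UN_disjoint) (use norm_triples_card(1) disj in auto)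
  finally have "int (card (bounded_ideals X)) = (\<Sum>n\<in>{1..X}. int (card (norm_triples n)))" by simp
  also have "\<dots> = (\<Sum>n\<in>{1..X}. \<Sum>d\<in>{1..X}. if d dvd n then chi d else 0)"
  proof (rule sum.cong)
    fix n assume n: "n \<in> {1..X}"
    have "(\<Sum>d | d dvd n. chi d) = (\<Sum>d\<in>{d \<in> {1..X}. d dvd n}. chi d)"
    proof (rule sum.cong)
      show "{d. d dvd n} = {d \<in> {1..X}. d dvd n}"
      proof (intro equalityI subsetI)
        fix d assume "d \<in> {d. d dvd n}"
        hence "d dvd n" by simp
        moreover from this have "d \<le> n" "d > 0" using n by (auto intro: dvd_imp_le dvd_pos_nat)
        ultimately show "d \<in> {d \<in> {1..X}. d dvd n}" using n by auto
      qed auto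
    qed simp
    also have "\<dots> = (\<Sum>d\<in>{1..X}. if d dvd n then chi d else 0)" by (rule sum.inter_filter) simp
    finally show "int (card (norm_triples n)) = (\<Sum>d\<in>{1..X}. if d dvd n then chi d else 0)"
      using norm_triples_card(2)[of n] n by simp
  qed simp
  also have "\<dots> = (\<Sum>d\<in>{1..X}. \<Sum>n\<in>{1..X}. if d dvd n then chi d else 0)" by (rule sum.swap)
  also have "\<dots> = (\<Sum>d\<in>{1..X}. chi d * int (X div d))"
  proof (rule sum.cong)
    fix d assume d: "d \<in> {1..X}"
    have "(\<Sum>n\<in>{1..X}. if d dvd n then chi d else 0) = (\<Sum>n\<in>{n \<in> {1..X}. d dvd n}. chi d)"
      by (rule sum.inter_filter[symmetric]) simp
    also have "\<dots> = chi d * int (card {n \<in> {1..X}. d dvd n})" by simp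
    also have "card {n \<in> {1..X}. d dvd n} = X div d"
    proof -
      have "{n \<in> {1..X}. d dvd n} = (\<lambda>k. d * k) ` {1..X div d}"
      proof (intro equalityI subsetI)
        fix n assume "n \<in> {n \<in> {1..X}. d dvd n}"
        then obtain k where k: "n = d * k" "n \<ge> 1" "n \<le> X" by (auto elim!: dvdE)
        have "k \<ge> 1" using k by (cases k) auto
        moreover have "k \<le> X div d" using k d by (simp add: less_eq_div_iff_mult_less_eq mult.commute)
        ultimately show "n \<in> (\<lambda>k. d * k) ` {1..X div d}" using k by auto
      next
        fix n assume "n \<in> (\<lambda>k. d * k) ` {1..X div d}"
        then obtain k where k': "k \<in> {1..X div d}" and k1: "n = d * k" by blast
        hence k: "n = d * k" "k \<ge> 1" "k \<le> X div d" by auto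
        have "d * k \<le> X" using k d by (simp add: less_eq_div_iff_mult_less_eq mult.commute)
        thus "n \<in> {n \<in> {1..X}. d dvd n}" using k d by (auto intro: Suc_leI)
      qed
      moreover have "inj_on (\<lambda>k. d * k) {1..X div d}" using d by (intro inj_onI) auto
      ultimately show ?thesis by (simp add: card_image)
    qed
    finally show "(\<Sum>n\<in>{1..X}. if d dvd n then chi d else 0) = chi d * int (X div d)" .
  qed simp
  finally show "int (card (bounded_ideals X)) = (\<Sum>d\<in>{1..X}. chi d * int (X div d))" .
qed

lemma qid_bounded_iff:
  assumes "k > 0" "a > 0" "a dvd Q.poly_at b"
  shows "Q.qid k a b \<in> bounded_ideals X \<longleftrightarrow> k * k * a \<le> int X"
proof
  assume "Q.qid k a b \<in> bounded_ideals X"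
  then obtain n k' a' b' where h: "n \<in> {1..X}" "(k', a', b') \<in> norm_triples n"
    "Q.qid k a b = Q.qid (int k') (int a') (int b')"
    by (auto simp: bounded_ideals_def)
  have h2: "k' > 0" "a' > 0" "k'\<^sup>2 * a' = n" using h(2) by (auto simp: norm_triples_def)
  have "k = int k'" "a = int a'" using Q.qid_eq_iff[of k a "int k'" "int a'" b "int b'"] assms h(3) h2 by auto
  hence "k * k * a = int n" using h2(3) by (simp add: power2_eq_square[symmetric] flip: of_nat_power of_nat_mult)
  thus "k * k * a \<le> int X" using h(1) by simp
next
  assume le: "k * k * a \<le> int X"
  define b' where "b' = b mod a"
  have b': "0 \<le> b'" "b' < a" using assms by (auto simp: b'_def)
  have c: "[b = b'] (mod a)" by (simp add: b'_def cong_mod)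
  have eq: "Q.qid k a b = Q.qid k a b'" using Q.qid_eq_iff[of k a k a b b'] assms c by simp
  have "[Q.poly_at b = Q.poly_at b'] (mod a)" unfolding im_poly_at by (intro cong_add cong_pow cong_refl c)
  hence "a dvd Q.poly_at b'" using assms(3) cong_dvd_iff by blast
  hence d: "nat a dvd (nat b')\<^sup>2 + p" using dvd_poly_at_nat[of "nat a" "nat b'"] assms b' by simp
  have n: "int ((nat k)\<^sup>2 * nat a) = k * k * a" using assms by (simp add: power2_eq_square)
  have "(nat k)\<^sup>2 * nat a \<in> {1..X}"
  proof -
    have "int ((nat k)\<^sup>2 * nat a) \<le> int X" using le n by simp
    hence "(nat k)\<^sup>2 * nat a \<le> X" by (simp only: of_nat_le_iff)
    moreover have "(nat k)\<^sup>2 * nat a > 0" using assms by simp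
    ultimately show ?thesis by (simp add: Suc_leI)
  qed
  moreover have "(nat k, nat a, nat b') \<in> norm_triples ((nat k)\<^sup>2 * nat a)"
    using assms b' d by (simp add: norm_triples_def)
  ultimately have "(nat k, nat a, nat b') \<in> (\<Union>n\<in>{1..X}. norm_triples n)" by blast
  moreover have "Q.qid k a b = (\<lambda>(k, a, b). Q.qid (int k) (int a) (int b)) (nat k, nat a, nat b')"
    using assms b' eq by simp
  ultimately show "Q.qid k a b \<in> bounded_ideals X" unfolding bounded_ideals_def by (rule rev_image_eqI)
qed

lemma bounded_sub_nz: "bounded_ideals X \<subseteq> Q.nz_ideals"
proof
  fix I assume "I \<in> bounded_ideals X"
  then obtain n k a b where h: "(k, a, b) \<in> norm_triples n" "I = Q.qid (int k) (int a) (int b)"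
    by (auto simp: bounded_ideals_def)
  hence "k > 0" "a > 0" "a dvd b\<^sup>2 + p" by (auto simp: norm_triples_def)
  thus "I \<in> Q.nz_ideals" unfolding h(2) by (intro Q.qid_in_nz) (simp_all add: dvd_poly_at_nat)
qed

text \<open>
  Dividing by \<open>a\<close> the multiples \<open>z J\<close> of \<open>J = qid 1 a b\<close>, for \<open>z\<close> in the conjugate ideal \<open>qid 1 a (- b)\<close>,
  gives every ideal in the class of \<open>J\<close> exactly twice, from \<open>z\<close> and \<open>- z\<close>.
\<close>

context
  fixes a b :: int
  assumes a0: "a > 0" and ab: "a dvd Q.poly_at b"
begin

definition quot_ideal :: "complex \<Rightarrow> complex set" where
  "quot_ideal z = {x. of_int a * x \<in> (*) z ` Q.qid 1 a b}"

lemma qid_1_neg_mem: "Q.el u v \<in> Q.qid 1 a (- b) \<longleftrightarrow> a dvd u + b * v"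
  by (simp add: Q.qid_mem)

text \<open>The product of the conjugate ideals is contained in the multiples of \<open>a\<close>.
  Of the products of basis elements only
  \<open>(- b + \<omega>) (b + \<omega>) = - (b\<^sup>2 + p)\<close> lacks a visible factor
  \<open>a\<close>, and it is supplied by the divisibility assumption.\<close>

lemma mult_qid_sub:
  assumes "z \<in> Q.qid 1 a (- b)" "x \<in> Q.qid 1 a b"
  shows "\<exists>w\<in>Q.ints. z * x = of_int a * w"
proof -
  obtain u v where z: "z = Q.el u v" using assms(1) Q.qid_sub_ints by (meson Q.intsE subsetD)
  obtain c d where x: "x = Q.el c d" using assms(2) Q.qid_sub_ints by (meson Q.intsE subsetD)
  obtain m where m: "u + b * v = a * m" using assms(1) unfolding z qid_1_neg_mem by (auto simp: dvd_def)
  obtain n where n: "c - b * d = a * n" using assms(2) unfolding x by (auto simp: Q.qid_mem dvd_def)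
  obtain e where e: "b\<^sup>2 + int p = a * e" using ab unfolding im_poly_at by (auto simp: dvd_def)
  have u: "u = a * m - b * v" and c: "c = a * n + b * d" using m n by simp_all
  have ip: "int p = a * e - b\<^sup>2" using e by simp
  have "z * x = Q.el (u * c - int p * v * d) (u * d + v * c)" unfolding z x Q.el_mult by simp
  also have "u * c - int p * v * d = a * (m * c - b * v * n - e * v * d)"
    unfolding ip u c by (simp add: power2_eq_square algebra_simps)
  also have "u * d + v * c = a * (m * d + v * n)" unfolding u c by (simp add: algebra_simps)
  also have "Q.el (a * (m * c - b * v * n - e * v * d)) (a * (m * d + v * n)) =
      of_int a * Q.el (m * c - b * v * n - e * v * d) (m * d + v * n)"
    by (simp add: Q.el_def algebra_simps)
  finally have "z * x = of_int a * Q.el (m * c - b * v * n - e * v * d) (m * d + v * n)" .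
  thus ?thesis by (rule bexI) (rule Q.el_in_ints)
qed

lemma scale_quot_ideal:
  assumes "z \<in> Q.qid 1 a (- b)"
  shows "(*) (of_int a) ` quot_ideal z = (*) z ` Q.qid 1 a b"
proof (intro equalityI subsetI)
  fix y assume "y \<in> (*) z ` Q.qid 1 a b"
  then obtain x where x: "x \<in> Q.qid 1 a b" "y = z * x" by blast
  then obtain w where "y = of_int a * w" using mult_qid_sub[OF assms] by blast
  thus "y \<in> (*) (of_int a) ` quot_ideal z" using x unfolding quot_ideal_def by blast
qed (auto simp: quot_ideal_def)

lemma quot_ideal_nz:
  assumes "z \<in> Q.qid 1 a (- b)" "z \<noteq> 0"
  shows "quot_ideal z \<in> Q.nz_ideals"
proof -
  have zO: "z \<in> Q.ints" using assms(1) Q.qid_sub_ints by blast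
  have J: "Q.qid 1 a b \<in> Q.nz_ideals" using Q.qid_in_nz[of 1 a b] a0 ab by simp
  have zJ: "(*) z ` Q.qid 1 a b \<in> Q.nz_ideals" by (rule Q.nz_ideal_scale[OF J zO assms(2)])
  hence i: "0 \<in> (*) z ` Q.qid 1 a b" "(*) z ` Q.qid 1 a b \<noteq> {0}"
    "\<And>x y. x \<in> (*) z ` Q.qid 1 a b \<Longrightarrow> y \<in> (*) z ` Q.qid 1 a b \<Longrightarrow> x - y \<in> (*) z ` Q.qid 1 a b"
    "\<And>r x. r \<in> Q.ints \<Longrightarrow> x \<in> (*) z ` Q.qid 1 a b \<Longrightarrow> r * x \<in> (*) z ` Q.qid 1 a b"
    by (auto simp: Q.nz_ideals_def Q.is_ideal_def)
  have "Q.is_ideal (quot_ideal z)"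
    unfolding Q.is_ideal_def
  proof (intro conjI ballI)
    show "quot_ideal z \<subseteq> Q.ints"
    proof
      fix x assume "x \<in> quot_ideal z"
      then obtain y where "y \<in> Q.qid 1 a b" "of_int a * x = z * y" by (auto simp: quot_ideal_def)
      then obtain w where "w \<in> Q.ints" "of_int a * x = of_int a * w" using mult_qid_sub[OF assms(1)] by metis
      thus "x \<in> Q.ints" using a0 by simp
    qed
    show "0 \<in> quot_ideal z" using i(1) by (simp add: quot_ideal_def)
  next
    fix x y assume "x \<in> quot_ideal z" "y \<in> quot_ideal z"
    thus "x - y \<in> quot_ideal z" using i(3) unfolding quot_ideal_def by (simp add: right_diff_distrib)
  next
    fix r x assume "r \<in> Q.ints" "x \<in> quot_ideal z"
    hence "r * (of_int a * x) \<in> (*) z ` Q.qid 1 a b" using i(4) unfolding quot_ideal_def by blast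
    thus "r * x \<in> quot_ideal z" unfolding quot_ideal_def by (simp add: mult.left_commute)
  qed
  moreover have "quot_ideal z \<noteq> {0}"
  proof
    assume "quot_ideal z = {0}"
    hence "(*) z ` Q.qid 1 a b = {0}" using scale_quot_ideal[OF assms(1)] by simp
    thus False using i(2) by blast
  qed
  ultimately show ?thesis by (simp add: Q.nz_ideals_def)
qed

lemma quot_ideal_rel:
  assumes "z \<in> Q.qid 1 a (- b)" "z \<noteq> 0"
  shows "(quot_ideal z, Q.qid 1 a b) \<in> Q.class_rel"
  by (rule Q.class_relI[where x = "of_int a" and y = z])
    (use assms a0 ab quot_ideal_nz[OF assms] scale_quot_ideal[OF assms(1)] Q.qid_in_nz[of 1 a b]
      Q.qid_sub_ints[of 1 a "- b"] in auto)

lemma im_Nm_nonneg: "Q.Nm z \<ge> 0"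
  by (simp add: Q.Nm_def im_nrm)

text \<open>Comparing norms in \<open>a * quot_ideal z = z * J\<close> with
  \<open>J = qid 1 a b\<close>: \<open>a\<^sup>2\<close> times the norm of the quotient equals
  \<open>Nm z * a\<close>, so that norm is \<open>Nm z / a\<close>.\<close>

lemma quot_ideal_bounded:
  assumes "z \<in> Q.qid 1 a (- b)" "z \<noteq> 0"
  shows "quot_ideal z \<in> bounded_ideals X \<longleftrightarrow> Q.Nm z \<le> a * int X"
proof -
  obtain k a' b' where h: "k > 0" "a' > 0" "a' dvd Q.poly_at b'" "quot_ideal z = Q.qid k a' b'"
    using quot_ideal_nz[OF assms] by (rule Q.nz_idealE)
  have zO: "z \<in> Q.ints" using assms(1) Q.qid_sub_ints by blast
  have "\<bar>Q.Nm (of_int a) * (k * k * a')\<bar> = \<bar>Q.Nm z * (1 * 1 * a)\<bar>"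
    by (rule Q.scaled_norms[OF Q.of_int_in_ints zO]) (use scale_quot_ideal[OF assms(1)] h(4) in simp)
  hence "a * a * (k * k * a') = Q.Nm z * a"
    using a0 h(1,2) im_Nm_nonneg[of z] by (simp add: Q.Nm_of_int abs_mult power2_eq_square)
  hence "a * (a * (k * k * a')) = a * Q.Nm z" by (simp only: mult_ac)
  hence e: "Q.Nm z = a * (k * k * a')" using a0 by simp
  show ?thesis unfolding h(4) qid_bounded_iff[OF h(1-3)] e mult_le_cancel_left_pos[OF a0] ..
qed

text \<open>From \<open>x I = y J\<close> with \<open>J = qid 1 a b\<close> the candidate is
  \<open>z = a y / x\<close>, which lies in \<open>I\<close>. Since
  \<open>(y / x) (b + \<omega>)\<close> lies in the ring too, the \<open>\<omega>\<close>-coordinate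
  \<open>u + b v\<close> of \<open>z (b + \<omega>)\<close> is divisible by \<open>a\<close>, and
  this is the membership condition for the conjugate ideal.\<close>

lemma quot_ideal_surj:
  assumes "(I, Q.qid 1 a b) \<in> Q.class_rel"
  shows "\<exists>z\<in>Q.qid 1 a (- b) - {0}. I = quot_ideal z"
proof -
  from assms obtain x y where h: "I \<in> Q.nz_ideals" "Q.qid 1 a b \<in> Q.nz_ideals" "x \<in> Q.ints" "x \<noteq> 0" "y \<in> Q.ints" "y \<noteq> 0"
    "(*) x ` I = (*) y ` Q.qid 1 a b" by (rule Q.class_relE)
  have I: "w \<in> I \<longleftrightarrow> x * w \<in> (*) y ` Q.qid 1 a b" for w
    unfolding h(7)[symmetric] using h(4) by auto
  have J: "(y / x) * j \<in> I" if "j \<in> Q.qid 1 a b" for j unfolding I using that h(4) by auto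
  have Isub: "I \<subseteq> Q.ints" using h(1) by (simp add: Q.nz_ideals_def Q.is_ideal_def)
  define z where "z = (y / x) * of_int a"
  have "Q.el a 0 \<in> Q.qid 1 a b" by (simp add: Q.qid_mem)
  hence "z \<in> I" unfolding z_def using J by (simp add: Q.el_of_int)
  then obtain u v where z: "z = Q.el u v" using Isub by (meson Q.intsE subsetD)
  have "Q.el b 1 \<in> Q.qid 1 a b" by (simp add: Q.qid_mem)
  hence "(y / x) * Q.el b 1 \<in> Q.ints" using J Isub by blast
  then obtain c d where cd: "(y / x) * Q.el b 1 = Q.el c d" by (rule Q.intsE)
  have "z * Q.el b 1 = of_int a * ((y / x) * Q.el b 1)" by (simp add: z_def mult_ac)
  hence "Q.el u v * Q.el b 1 = Q.el a 0 * Q.el c d" unfolding cd z by (simp add: Q.el_of_int)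
  hence "u + b * v = a * d" unfolding Q.el_mult Q.el_eq_iff by (simp add: mult.commute)
  hence "z \<in> Q.qid 1 a (- b)" unfolding z qid_1_neg_mem by simp
  moreover have "z \<noteq> 0" using h(4,6) a0 by (simp add: z_def)
  moreover have "I = quot_ideal z"
  proof (rule Set.set_eqI)
    fix w
    have "w \<in> quot_ideal z \<longleftrightarrow> (\<exists>j\<in>Q.qid 1 a b. of_int a * w = (y / x) * of_int a * j)"
      by (auto simp: quot_ideal_def z_def)
    also have "\<dots> \<longleftrightarrow> (\<exists>j\<in>Q.qid 1 a b. x * w = y * j)"
    proof (rule bex_cong[OF refl])
      fix j
      have "of_int a * w = (y / x) * of_int a * j \<longleftrightarrow> of_int a * (x * w) = of_int a * (y * j)"
        using h(4) by (simp add: field_simps)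
      thus "of_int a * w = (y / x) * of_int a * j \<longleftrightarrow> x * w = y * j" using a0 by simp
    qed
    also have "\<dots> \<longleftrightarrow> w \<in> I" unfolding I by auto
    finally show "w \<in> I \<longleftrightarrow> w \<in> quot_ideal z" by simp
  qed
  ultimately show ?thesis by blast
qed

text \<open>The quotient \<open>w = z' / z\<close> maps the lattice \<open>qid 1 a b\<close> to
  itself, so by the Cayley-Hamilton argument it is a root of a monic integral quadratic and lies in
  the ring. Its norm is 1, and \<open>c\<^sup>2 + p d\<^sup>2 = 1\<close> leaves only
  \<open>w = 1\<close> and \<open>w = -1\<close>.\<close>

lemma quot_ideal_eq_iff:
  assumes z: "z \<in> Q.qid 1 a (- b)" "z \<noteq> 0" and z': "z' \<in> Q.qid 1 a (- b)" "z' \<noteq> 0"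
  shows "quot_ideal z = quot_ideal z' \<longleftrightarrow> z' = z \<or> z' = - z"
proof
  assume "quot_ideal z = quot_ideal z'"
  hence zz: "(*) z ` Q.qid 1 a b = (*) z' ` Q.qid 1 a b" using scale_quot_ideal z z' by metis
  have zO: "z \<in> Q.ints" "z' \<in> Q.ints" using z z' Q.qid_sub_ints by blast+
  define w where "w = z' / z"
  have wJ: "w * j \<in> Q.qid 1 a b" if "j \<in> Q.qid 1 a b" for j
  proof -
    have "z' * j \<in> (*) z ` Q.qid 1 a b" unfolding zz using that by blast
    then obtain i where "i \<in> Q.qid 1 a b" "z' * j = z * i" by blast
    thus ?thesis using z(2) by (simp add: w_def)
  qed
  have gen: "\<exists>x y. j = of_int x * of_int a + of_int y * Q.el b 1" if jJ: "j \<in> Q.qid 1 a b" for j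
  proof -
    obtain u v where j: "j = Q.el u v" using jJ Q.qid_sub_ints by (meson Q.intsE subsetD)
    obtain x where "u = a * x + b * v" using jJ unfolding j Q.qid_1_mem by blast
    hence "j = of_int x * of_int a + of_int v * Q.el b 1" unfolding j by (simp add: Q.el_def algebra_simps)
    thus ?thesis by blast
  qed
  have "of_int a \<in> Q.qid 1 a b" using Q.qid_mem[of a 0 1 a b] by (simp add: Q.el_of_int)
  then obtain x1 y1 where 1: "w * of_int a = of_int x1 * of_int a + of_int y1 * Q.el b 1" using gen[OF wJ] by blast
  have "Q.el b 1 \<in> Q.qid 1 a b" by (simp add: Q.qid_mem)
  then obtain x2 y2 where 2: "w * Q.el b 1 = of_int x2 * of_int a + of_int y2 * Q.el b 1" using gen[OF wJ] by blast
  define A where "A = (of_int a :: complex)"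
  define B where "B = Q.el b 1"
  have e1: "(w - of_int x1) * A = of_int y1 * B" and e2: "(w - of_int y2) * B = of_int x2 * A"
    using 1 2 by (simp_all add: A_def B_def algebra_simps)
  \<comment> \<open>Eliminating the basis \<open>A\<close>, \<open>B\<close> from the two linear
    relations: the determinant of the system vanishes.\<close>
  have "((w - of_int x1) * (w - of_int y2) - of_int (y1 * x2)) * (A * B) =
      ((w - of_int x1) * A) * ((w - of_int y2) * B) - (of_int y1 * B) * (of_int x2 * A)"
    by (simp add: algebra_simps)
  also have "\<dots> = 0" unfolding e1 e2 by simp
  finally have "((w - of_int x1) * (w - of_int y2) - of_int (y1 * x2)) * (of_int a * Q.el b 1) = 0"
    by (simp only: A_def B_def)
  moreover have "of_int a * Q.el b 1 \<noteq> 0" using a0 by (simp add: Q.el_0_iff)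
  ultimately have "(w - of_int x1) * (w - of_int y2) - of_int (y1 * x2) = 0" by simp
  hence quad: "w * w = of_int (x1 + y2) * w - of_int (x1 * y2 - y1 * x2)" by (simp add: algebra_simps)
  \<comment> \<open>The denominator \<open>z\<close> is made rational by multiplying with its
    conjugate.\<close>
  have wf: "w \<in> quad_field (- int p)"
  proof -
    obtain u v where e: "z = Q.el u v" using zO(1) by (rule Q.intsE)
    obtain A B where AB: "z' * Q.el u (- v) = Q.el A B"
      using Q.ints_closed(3)[OF zO(2), of "Q.el u (- v)"] by (auto elim: Q.intsE)
    have N: "z * Q.el u (- v) = of_int (Q.nrm u v)" using Q.el_conj[of u v] by (simp add: e)
    have N0: "Q.nrm u v \<noteq> 0" using z(2) e by (simp add: Q.nrm_0_iff Q.el_0_iff)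
    have "w * (z * Q.el u (- v)) = Q.el A B" using z(2) AB by (simp add: w_def)
    hence "w = Q.el A B / of_int (Q.nrm u v)" unfolding N using N0 by (simp add: field_simps)
    hence "w = of_rat (of_int A / of_int (Q.nrm u v)) + of_rat (of_int B / of_int (Q.nrm u v)) * w_im"
      by (simp add: Q.el_def of_rat_divide add_divide_distrib)
    thus ?thesis unfolding quad_field_def w_im_def by blast
  qed
  have "w \<in> Q.ints" by (rule Q.algebraic_int_quadratic_in_ints[OF carrier_im wf quad])
  then obtain c d where w: "w = Q.el c d" by (rule Q.intsE)
  have zw: "z' = w * z" using z(2) by (simp add: w_def)
  have "\<bar>Q.Nm z * (1 * 1 * a)\<bar> = \<bar>Q.Nm z' * (1 * 1 * a)\<bar>" by (rule Q.scaled_norms[OF zO zz])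
  hence "Q.Nm z = Q.Nm z'" using a0 im_Nm_nonneg[of z] im_Nm_nonneg[of z'] by (simp add: abs_mult)
  also have "\<dots> = Q.nrm c d * Q.Nm z" unfolding zw using Q.Nm_mult[of w z] zO by (simp add: w)
  finally have "Q.nrm c d = 1" using Q.Nm_0_iff[OF zO(1)] z(2) by simp
  hence cd: "c\<^sup>2 + int p * d\<^sup>2 = 1" by (simp add: im_nrm)
  have "d = 0"
  proof (rule ccontr)
    assume "d \<noteq> 0"
    hence "d\<^sup>2 \<ge> 1" by (simp add: int_one_le_iff_zero_less)
    hence "int p * d\<^sup>2 \<ge> int p * 1" by (intro mult_left_mono) auto
    moreover have "c\<^sup>2 \<ge> 0" by simp
    ultimately show False using cd p_gt2 by linarith
  qed
  hence "c\<^sup>2 = 1" using cd by simp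
  hence "c = 1 \<or> c = -1" by (simp add: power2_eq_1_iff)
  hence "w = 1 \<or> w = -1" unfolding w \<open>d = 0\<close> by (auto simp: Q.el_of_int)
  thus "z' = z \<or> z' = - z" unfolding zw by auto
next
  have neg: "- j \<in> Q.qid 1 a b" if jJ: "j \<in> Q.qid 1 a b" for j
  proof -
    obtain u v where j: "j = Q.el u v" using jJ Q.qid_sub_ints by (meson Q.intsE subsetD)
    have "a dvd u - b * v" using jJ by (simp add: j Q.qid_mem)
    hence "a dvd - (u - b * v)" by (simp only: dvd_minus_iff)
    moreover have "- (u - b * v) = - u - b * - v" by simp
    ultimately show ?thesis unfolding j Q.el_minus Q.qid_mem by simp
  qed
  have "(*) (- z) ` Q.qid 1 a b = (*) z ` Q.qid 1 a b"
  proof (intro equalityI subsetI)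
    fix x assume "x \<in> (*) (- z) ` Q.qid 1 a b"
    then obtain j where "j \<in> Q.qid 1 a b" "x = - z * j" by blast
    thus "x \<in> (*) z ` Q.qid 1 a b" using neg[of j] by (intro image_eqI[of _ _ "- j"]) auto
  next
    fix x assume "x \<in> (*) z ` Q.qid 1 a b"
    then obtain j where "j \<in> Q.qid 1 a b" "x = z * j" by blast
    thus "x \<in> (*) (- z) ` Q.qid 1 a b" using neg[of j] by (intro image_eqI[of _ _ "- j"]) auto
  qed
  moreover assume "z' = z \<or> z' = - z"
  ultimately show "quot_ideal z = quot_ideal z'" unfolding quot_ideal_def by (elim disjE) (simp_all only:)
qed

text \<open>Each ideal of the class within the bound comes from exactly two elements,
  \<open>z\<close> and \<open>- z\<close>; the additional 1 is the lattice point 0, which gives no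
  ideal.\<close>

lemma class_count:
  "2 * card (bounded_ideals X \<inter> Q.class_rel `` {Q.qid 1 a b}) + 1 = card (ellipse_points a b (int p) (a * int X))"
proof -
  define E where "E = {z \<in> Q.qid 1 a (- b) - {0}. Q.Nm z \<le> a * int X}"
  let ?ell = "ellipse_points a b (int p) (a * int X)"
  let ?el = "\<lambda>(m, t). Q.el (a * m - b * t) t"
  have symr: "(I, J) \<in> Q.class_rel \<longleftrightarrow> (J, I) \<in> Q.class_rel" for I J
    using Q.equiv_class_rel by (meson equivE symD)
  have finell: "finite ?ell"
  proof (cases "a * int X \<ge> int p")
    case True
    thus ?thesis using ellipse_count(1)[of a "int p" "a * int X" b] a0 p_gt2 by simp
  next
    case False
    have "?ell \<subseteq> ellipse_points a b (int p) (int p)" using False by (auto simp: ellipse_points_def)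
    thus ?thesis using ellipse_count(1)[of a "int p" "int p" b] a0 p_gt2 finite_subset by auto
  qed
  have zero: "(0, 0) \<in> ?ell" using a0 by (simp add: ellipse_points_def)
  have inj: "inj_on ?el (?ell - {(0, 0)})"
    using a0 by (auto simp: inj_on_def Q.el_eq_iff)
  have E: "E = ?el ` (?ell - {(0, 0)})"
  proof (intro equalityI subsetI)
    fix z assume "z \<in> E"
    hence z: "z \<in> Q.qid 1 a (- b)" "z \<noteq> 0" "Q.Nm z \<le> a * int X" by (auto simp: E_def)
    obtain u v where e: "z = Q.el u v" using z(1) Q.qid_sub_ints by (meson Q.intsE subsetD)
    obtain m where m: "u + b * v = a * m" using z(1) unfolding e qid_1_neg_mem by (auto simp: dvd_def)
    hence u: "u = a * m - b * v" by simp
    have "(m, v) \<in> ?ell" using z(3) by (simp add: e im_nrm u ellipse_points_def)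
    moreover have "(m, v) \<noteq> (0, 0)" using z(2) by (auto simp: e u Q.el_0_iff)
    moreover have "z = ?el (m, v)" by (simp add: e u)
    ultimately show "z \<in> ?el ` (?ell - {(0, 0)})" by blast
  next
    fix z assume "z \<in> ?el ` (?ell - {(0, 0)})"
    then obtain m t where mt: "(m, t) \<in> ?ell" "(m, t) \<noteq> (0, 0)" "z = Q.el (a * m - b * t) t" by auto
    have "z \<in> Q.qid 1 a (- b)" unfolding mt(3) qid_1_neg_mem by simp
    moreover have "z \<noteq> 0" using mt(2) a0 unfolding mt(3) Q.el_0_iff by auto
    moreover have "Q.Nm z \<le> a * int X" using mt(1) unfolding mt(3) by (simp add: im_nrm ellipse_points_def)
    ultimately show "z \<in> E" by (simp add: E_def)
  qed
  have finE: "finite E" unfolding E using finell by simp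
  have cardE: "card E + 1 = card ?ell"
    unfolding E card_image[OF inj] using card.remove[OF finell zero] by simp
  have img: "quot_ideal ` E = bounded_ideals X \<inter> Q.class_rel `` {Q.qid 1 a b}"
  proof (intro equalityI subsetI)
    fix I assume "I \<in> quot_ideal ` E"
    then obtain z where z: "z \<in> Q.qid 1 a (- b)" "z \<noteq> 0" "Q.Nm z \<le> a * int X" "I = quot_ideal z" by (auto simp: E_def)
    show "I \<in> bounded_ideals X \<inter> Q.class_rel `` {Q.qid 1 a b}"
      using quot_ideal_bounded[OF z(1,2)] quot_ideal_rel[OF z(1,2)] z(3) symr unfolding z(4) by blast
  next
    fix I assume I: "I \<in> bounded_ideals X \<inter> Q.class_rel `` {Q.qid 1 a b}"
    hence "(I, Q.qid 1 a b) \<in> Q.class_rel" using symr by blast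
    then obtain z where z: "z \<in> Q.qid 1 a (- b)" "z \<noteq> 0" "I = quot_ideal z" using quot_ideal_surj by blast
    have "Q.Nm z \<le> a * int X" using quot_ideal_bounded[OF z(1,2)] I z(3) by blast
    hence "z \<in> E" using z by (simp add: E_def)
    thus "I \<in> quot_ideal ` E" using z(3) by blast
  qed
  have fib: "card {z \<in> E. quot_ideal z = I} = 2" if "I \<in> quot_ideal ` E" for I
  proof -
    obtain z where z: "z \<in> E" "I = quot_ideal z" using \<open>I \<in> quot_ideal ` E\<close> by blast
    hence z1: "z \<in> Q.qid 1 a (- b)" "z \<noteq> 0" "Q.Nm z \<le> a * int X" by (auto simp: E_def)
    obtain u v where e: "z = Q.el u v" using z1(1) Q.qid_sub_ints by (meson Q.intsE subsetD)
    have "a dvd - (u + b * v)" using z1(1) unfolding e qid_1_neg_mem by (simp only: dvd_minus_iff)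
    moreover have "- (u + b * v) = - u + b * - v" by simp
    ultimately have "- z \<in> Q.qid 1 a (- b)" unfolding e Q.el_minus qid_1_neg_mem by simp
    moreover have "Q.Nm (- z) = Q.Nm z" unfolding e Q.el_minus by (simp add: im_nrm)
    ultimately have mz: "- z \<in> E" using z1 by (simp add: E_def)
    have "{z' \<in> E. quot_ideal z' = I} = {z, - z}"
    proof (intro equalityI subsetI)
      fix z' assume "z' \<in> {z' \<in> E. quot_ideal z' = I}"
      hence "z' \<in> Q.qid 1 a (- b)" "z' \<noteq> 0" "quot_ideal z = quot_ideal z'" using z(2) by (auto simp: E_def)
      thus "z' \<in> {z, - z}" using quot_ideal_eq_iff[OF z1(1,2)] by blast
    next
      fix z' assume z': "z' \<in> {z, - z}"
      hence "z' \<in> E" using z(1) mz by blast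
      moreover from this have "z' \<in> Q.qid 1 a (- b)" "z' \<noteq> 0" by (auto simp: E_def)
      ultimately show "z' \<in> {z' \<in> E. quot_ideal z' = I}"
        using quot_ideal_eq_iff[OF z1(1,2), of z'] z' z(2) by auto
    qed
    moreover have "z \<noteq> - z" using z1(2) by simp
    ultimately show ?thesis by simp
  qed
  have "card E = (\<Sum>I\<in>quot_ideal ` E. card {z \<in> E. quot_ideal z = I})"
    using sum.image_gen[OF finE, of "\<lambda>_. 1::nat" quot_ideal] by simp
  also have "\<dots> = 2 * card (quot_ideal ` E)" using fib by simp
  finally show ?thesis using cardE unfolding img by simp
qed

lemma class_density:
  "(\<lambda>X. real (card (bounded_ideals X \<inter> Q.class_rel `` {Q.qid 1 a b})) / real X) \<longlonglongrightarrow> pi / (2 * sqrt (real p))"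
proof -
  have A: "(\<lambda>X. real (card (ellipse_points a b (int p) (a * int X))) / real X) \<longlonglongrightarrow> pi / sqrt (real p)"
    using ellipse_count_tendsto[of a "int p" b] a0 p_gt2 by simp
  have B: "(\<lambda>X. 1 / real X) \<longlonglongrightarrow> 0" by real_asymp
  have "(\<lambda>X. (real (card (ellipse_points a b (int p) (a * int X))) / real X - 1 / real X) / 2)
      \<longlonglongrightarrow> (pi / sqrt (real p) - 0) / 2"
    by (rule tendsto_divide[OF tendsto_diff[OF A B] tendsto_const]) simp
  also have "(\<lambda>X. (real (card (ellipse_points a b (int p) (a * int X))) / real X - 1 / real X) / 2) =
      (\<lambda>X. real (card (bounded_ideals X \<inter> Q.class_rel `` {Q.qid 1 a b})) / real X)"
  proof
    fix X
    have "real (card (ellipse_points a b (int p) (a * int X))) =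
        2 * real (card (bounded_ideals X \<inter> Q.class_rel `` {Q.qid 1 a b})) + 1"
      unfolding class_count[symmetric] by simp
    thus "(real (card (ellipse_points a b (int p) (a * int X))) / real X - 1 / real X) / 2 =
      real (card (bounded_ideals X \<inter> Q.class_rel `` {Q.qid 1 a b})) / real X"
      by (simp add: diff_divide_distrib[symmetric])
  qed
  also have "(pi / sqrt (real p) - 0) / 2 = pi / (2 * sqrt (real p))" by simp
  finally show ?thesis .
qed

end

section \<open>Comparison of the two counts of ideals\<close>

lemma chi_partial_sums: "\<exists>C. \<forall>n. \<bar>\<Sum>d<n. real_of_int (chi d)\<bar> \<le> C"
proof -
  define S where "S = (\<lambda>n. \<Sum>d<n. real_of_int (chi d))"
  have oddp: "odd p" using p_eq by simp
  \<comment> \<open>Adding \<open>2 p\<close> keeps the symbol but changes \<open>d div 2\<close> by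
    the odd number \<open>p\<close>. Hence the partial sums have period \<open>4 p\<close>.\<close>
  have shift: "chi (d + 2 * p) = - chi d" for d
  proof -
    have "L (int (d + 2 * p)) = L (int d)" by (rule Legendre_cong) (simp add: cong_iff_dvd_diff)
    moreover have "(d + 2 * p) div 2 = d div 2 + p" by simp
    ultimately show ?thesis using oddp by (simp add: chi_def power_add)
  qed
  have step: "S (n + 2 * p) = S (2 * p) - S n" for n
  proof -
    have "(\<Sum>d<n + m. f d) = (\<Sum>d<m. f d) + (\<Sum>d<n. f (d + m))" for f :: "nat \<Rightarrow> real" and m n
      by (induction n) simp_all
    hence "S (n + 2 * p) = S (2 * p) + (\<Sum>d<n. real_of_int (chi (d + 2 * p)))"
      unfolding S_def .
    thus ?thesis by (simp add: shift S_def sum_negf)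
  qed
  have "S (n + 4 * p) = S n" for n
    using step[of n] step[of "n + 2 * p"] by (simp add: algebra_simps)
  hence per: "S (n + 4 * p * k) = S n" for n k
    by (induction k) (simp_all add: algebra_simps, metis add.assoc add.commute)
  have chi1: "\<bar>chi d\<bar> \<le> 1" for d
    using Legendre_values[of "int d" "int p"] by (auto simp: chi_def abs_mult)
  have "\<bar>S n\<bar> \<le> real (4 * p)" for n
  proof -
    have "S n = S (n mod (4 * p))" using per[of "n mod (4 * p)" "n div (4 * p)"] by simp
    also have "\<bar>\<dots>\<bar> \<le> (\<Sum>d<n mod (4 * p). 1)"
      unfolding S_def by (rule order_trans[OF sum_abs sum_mono]) (use chi1 in \<open>simp flip: of_int_abs\<close>)
    also have "\<dots> = real (n mod (4 * p))" by simp
    also have "\<dots> \<le> real (4 * p)" using p_gt2 by (intro of_nat_mono less_imp_le mod_less_divisor) simp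
    finally show ?thesis .
  qed
  thus ?thesis unfolding S_def by blast
qed

lemma ideal_density:
  "(\<lambda>X. real (card (bounded_ideals X)) / real X) \<longlonglongrightarrow> pi * (real q - 2 * real N4) / sqrt (real p)"
proof -
  obtain C where C: "\<And>n. \<bar>\<Sum>d<n. real_of_int (chi d)\<bar> \<le> C" using chi_partial_sums by blast
  have c1: "\<bar>real_of_int (chi d)\<bar> \<le> 1" for d
    using Legendre_values[of "int d" "int p"] by (auto simp: chi_def abs_mult)
  let ?v = "pi * (real q - 2 * real N4) / sqrt (real p)"
  have "(\<lambda>N. \<Sum>n<N. chi n / real n) \<longlonglongrightarrow> ?v"
  proof -
    \<comment> \<open>For odd \<open>N\<close> the additional last term has even index, where
      \<open>chi\<close> vanishes.\<close>
    have e: "(\<Sum>n<N. chi n / real n) = (\<Sum>n<2 * (N div 2). chi n / real n)" for N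
    proof (cases "even N")
      case False
      then obtain M where "N = 2 * M + 1" by (auto elim: oddE)
      thus ?thesis by (simp add: chi_def)
    qed simp
    have "filterlim (\<lambda>N::nat. N div 2) at_top at_top"
      unfolding filterlim_at_top
    proof
      fix Z :: nat
      show "eventually (\<lambda>N. Z \<le> N div 2) at_top"
        using eventually_ge_at_top[of "2 * Z"] by eventually_elim auto
    qed
    from filterlim_compose[OF chi_series this] show ?thesis
      by (rule Lim_transform_eventually) (rule always_eventually, rule allI, rule e[symmetric])
  qed
  from hyperbola_limit[OF C c1 this]
  have "(\<lambda>X. (\<Sum>d\<in>{1..X}. real_of_int (chi d) * real (X div d)) / real X) \<longlonglongrightarrow> ?v" .
  moreover have "(\<Sum>d\<in>{1..X}. real_of_int (chi d) * real (X div d)) = real (card (bounded_ideals X))" for X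
  proof -
    have "real_of_int (int (card (bounded_ideals X))) = of_int (\<Sum>d\<in>{1..X}. chi d * int (X div d))"
      unfolding bounded_ideals_card(2) ..
    thus ?thesis by simp
  qed
  ultimately show ?thesis by simp
qed

text \<open>Every class has the same density \<open>pi / (2 * sqrt (real p))\<close>, and the
  density of all ideals is known from the L-series, so the number of classes is their quotient.
  Finiteness comes out of the same comparison: finitely many classes never exceed the total density,
  which bounds their number.\<close>

lemma class_number_im: "class_number (- int p) + 4 * N4 = 2 * q"
proof -
  let ?r = Q.class_rel
  let ?X = "Q.nz_ideals // ?r"
  have eq: "equiv Q.nz_ideals ?r" by (rule Q.equiv_class_rel)
  have dens: "(\<lambda>X. real (card (bounded_ideals X \<inter> C)) / real X) \<longlonglongrightarrow> pi / (2 * sqrt (real p))" if CX: "C \<in> ?X" for C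
  proof -
    obtain I where I: "I \<in> Q.nz_ideals" "C = ?r `` {I}" using CX by (rule quotientE)
    obtain k a b where h: "k > 0" "a > 0" "a dvd Q.poly_at b" "I = Q.qid k a b" using I(1) by (rule Q.nz_idealE)
    have "C = ?r `` {Q.qid 1 a b}" unfolding I(2) h(4) by (rule equiv_class_eq[OF eq Q.qid_rel_qid_1[OF h(1-3)]])
    thus ?thesis using class_density[OF h(2,3)] by simp
  qed
  have disj: "C \<inter> D = {}" if "C \<in> ?X" "D \<in> ?X" "C \<noteq> D" for C D
    using quotient_disj[OF eq that(1,2)] that(3) by blast
  have sum: "(\<lambda>X. real (card (bounded_ideals X \<inter> \<Union>F)) / real X) \<longlonglongrightarrow> real (card F) * (pi / (2 * sqrt (real p)))"
    if F: "finite F" "F \<subseteq> ?X" for F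
  proof -
    have "card (bounded_ideals X \<inter> \<Union>F) = (\<Sum>C\<in>F. card (bounded_ideals X \<inter> C))" for X
    proof -
      have "bounded_ideals X \<inter> \<Union>F = (\<Union>C\<in>F. bounded_ideals X \<inter> C)" by blast
      also have "card \<dots> = (\<Sum>C\<in>F. card (bounded_ideals X \<inter> C))"
        by (rule card_UN_disjoint) (use F bounded_ideals_card(1) disj in blast)+
      finally show ?thesis .
    qed
    hence e: "real (card (bounded_ideals X \<inter> \<Union>F)) / real X = (\<Sum>C\<in>F. real (card (bounded_ideals X \<inter> C)) / real X)" for X
      by (simp add: sum_divide_distrib)
    have "(\<lambda>X. \<Sum>C\<in>F. real (card (bounded_ideals X \<inter> C)) / real X) \<longlonglongrightarrow> (\<Sum>C\<in>F. pi / (2 * sqrt (real p)))"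
      by (intro tendsto_sum dens) (use F in blast)
    thus ?thesis unfolding e by simp
  qed
  define v where "v = pi * (real q - 2 * real N4) / sqrt (real p)"
  have le: "real (card F) * (pi / (2 * sqrt (real p))) \<le> v" if F: "finite F" "F \<subseteq> ?X" for F
  proof (rule tendsto_le[OF _ ideal_density[folded v_def] sum[OF F]])
    show "eventually (\<lambda>X. real (card (bounded_ideals X \<inter> \<Union>F)) / real X \<le> real (card (bounded_ideals X)) / real X) sequentially"
      by (intro always_eventually allI divide_right_mono of_nat_mono card_mono bounded_ideals_card(1)) auto
  qed simp
  have pp: "pi / (2 * sqrt (real p)) > 0" using p_gt2 by simp
  have fin: "finite ?X"
  proof (rule ccontr)
    assume inf: "infinite ?X"
    obtain n :: nat where n: "v / (pi / (2 * sqrt (real p))) < real n" using reals_Archimedean2 by blast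
    obtain F where F: "F \<subseteq> ?X" "finite F" "card F = n" using infinite_arbitrarily_large[OF inf] by blast
    have "real n * (pi / (2 * sqrt (real p))) \<le> v" using le[OF F(2,1)] F(3) by simp
    moreover have "v < real n * (pi / (2 * sqrt (real p)))" using n by (simp only: pos_divide_less_eq[OF pp])
    ultimately show False by linarith
  qed
  have "\<Union>?X = Q.nz_ideals" by (rule Union_quotient[OF eq])
  hence "bounded_ideals X \<inter> \<Union>?X = bounded_ideals X" for X using bounded_sub_nz by blast
  hence "(\<lambda>X. real (card (bounded_ideals X)) / real X) \<longlonglongrightarrow> real (card ?X) * (pi / (2 * sqrt (real p)))"
    using sum[OF fin order_refl] by simp
  hence "real (card ?X) * (pi / (2 * sqrt (real p))) = pi * (real q - 2 * real N4) / sqrt (real p)"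
    using ideal_density by (rule LIMSEQ_unique)
  hence "pi * real (card ?X) = pi * (2 * (real q - 2 * real N4))" using p_gt2 by (simp add: field_simps)
  hence "real (card ?X) = 2 * (real q - 2 * real N4)" by simp
  hence "real (card ?X + 4 * N4) = real (2 * q)" by simp
  hence "card ?X + 4 * N4 = 2 * q" by (simp only: of_nat_eq_iff)
  thus ?thesis using Q.class_number_eq[OF carrier_im] by simp
qed

end

theorem theorem1:
  fixes p :: nat and u v :: int
  assumes "prime p" and "[p = 1] (mod 4)"
    and "fundamental_unit (int p) ((of_int u + of_int v * sqrt (of_nat p)) / 2)"
  shows "([p = 1] (mod 8) \<longrightarrow>
            sign (sigma01 p) =
              bal_res p (of_int (s_prod p) * of_int u ^ ((p - 1) div 4)) *
              (-1) ^ (((class_number (int p) + 2) * (p - 1) + 2 * class_number (- int p)) div 8 + r_star p)) \<and>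
         ([p = 5] (mod 8) \<longrightarrow>
            sign (sigma01 p) =
              bal_res p (1 / 2 * of_int (s_prod p) * of_int u ^ ((p + 3) div 4)) *
              (-1) ^ (((class_number (int p) + 2) * (p + 3) + 2 * class_number (- int p) - 4) div 8 + r_star p))"
proof -
  define q where "q = p div 4"
  have "p mod 4 = 1" using assms(2) by (simp add: cong_mod)
  hence pq: "p = 4 * q + 1" unfolding q_def by presburger
  interpret prime_1_mod_4 p q by unfold_locales (fact assms(1), fact pq)
  have norm: "u\<^sup>2 - int p * v\<^sup>2 = -4" by (rule fundamental_unit_norm(1)[OF assms(3)])
  have u: "[u\<^sup>2 = -4] (mod int p)" unfolding cong_iff_dvd_diff
  proof (rule dvdI)
    show "u\<^sup>2 - (-4) = int p * v\<^sup>2" using norm by simp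
  qed
  have h: "odd (class_number (int p))" by (rule odd_class_number[OF fundamental_unit_norm(2)[OF assms(3)]])
  note hm = class_number_im
  show ?thesis
  proof (intro conjI impI)
    assume "[p = 1] (mod 8)"
    hence "p mod 8 = 1" by (simp add: cong_mod)
    hence q2: "q = 2 * (q div 2)" and "(p - 1) div 4 = q" using pq by presburger+
    thus "sign (sigma01 p) =
        bal_res p (of_int (s_prod p) * of_int u ^ ((p - 1) div 4)) *
        (-1) ^ (((class_number (int p) + 2) * (p - 1) + 2 * class_number (- int p)) div 8 + r_star p)"
      using sign_sigma01_1_mod_8[OF q2 u h hm] by (simp only:)
  next
    assume "[p = 5] (mod 8)"
    hence "p mod 8 = 5" by (simp add: cong_mod)
    hence q2: "q = 2 * (q div 2) + 1" and "(p + 3) div 4 = q + 1" using pq by presburger+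
    thus "sign (sigma01 p) =
        bal_res p (1 / 2 * of_int (s_prod p) * of_int u ^ ((p + 3) div 4)) *
        (-1) ^ (((class_number (int p) + 2) * (p + 3) + 2 * class_number (- int p) - 4) div 8 + r_star p)"
      using sign_sigma01_5_mod_8[OF q2 u h hm] by (simp only:)
  qed
qed

end
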